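(* Let $G$ be a finite group and $\mathbb{F}$ a field of characteristic zero. Let $A$ be a $G$-prime $G$-graded $\mathbb{F}$-algebra satisfying an ordinary polynomial identity. Let $S=Z(A)_e\setminus\{0\}$, where $Z(A)_e=Z(A)\cap A_e$. Then $S$ contains no zero divisors of $A$. As a result, $A$ embeds, as a $G$-graded algebra, in $A_1=S^{-1}A$, which is a $G$-graded $\mathbb{K}$-algebra for $\mathbb{K}=S^{-1}Z(A)_e$. Moreover, $A_1$ is a finite dimensional $G$-simple $\mathbb{K}$-algebra.
   Context: A $G$-graded $\mathbb{F}$-algebra is an associative $\mathbb{F}$-algebra $A=\bigoplus_{g\in G}A_g$ with $A_gA_h\subseteq A_{gh}$; $e$ is the identity of $G$, and $Z(A)$ is the center. $A$ is $G$-prime if for any two $G$-graded ideals $I,J$ of $A$ with $IJ=0$ one has $I=0$ or $J=0$. $A$ is $G$-simple if $A^2\neq0$ and its only $G$-graded two-sided ideals are $0$ and $A$. "Ordinary polynomial identity" means that some non-zero polynomial of the free associative algebra $\mathbb{F}\langle x_1,x_2,\dots\rangle$ vanishes under all substitutions from $A$. $S^{-1}A$ is the central localization, graded by $(S^{-1}A)_g=S^{-1}A_g$. *)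

theory Defs
  imports "HOL-Algebra.Module" "HOL-Algebra.Ideal_Product"
begin

text \<open>
  Algebras are associative but not assumed to have a unit: the field \<open>one\<close> of the record \<open>A\<close> is
  left unconstrained, and nothing stated below about \<open>A\<close> depends on its value.
\<close>

locale assoc_algebra = module F A for F (structure) and A (structure) +
  assumes mult_closed: "\<lbrakk>x \<in> carrier A; y \<in> carrier A\<rbrakk> \<Longrightarrow> x \<otimes>\<^bsub>A\<^esub> y \<in> carrier A"
    and mult_assoc: "\<lbrakk>x \<in> carrier A; y \<in> carrier A; z \<in> carrier A\<rbrakk>
      \<Longrightarrow> (x \<otimes>\<^bsub>A\<^esub> y) \<otimes>\<^bsub>A\<^esub> z = x \<otimes>\<^bsub>A\<^esub> (y \<otimes>\<^bsub>A\<^esub> z)"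
    and mult_distrib_right: "\<lbrakk>x \<in> carrier A; y \<in> carrier A; z \<in> carrier A\<rbrakk>
      \<Longrightarrow> (x \<oplus>\<^bsub>A\<^esub> y) \<otimes>\<^bsub>A\<^esub> z = x \<otimes>\<^bsub>A\<^esub> z \<oplus>\<^bsub>A\<^esub> y \<otimes>\<^bsub>A\<^esub> z"
    and mult_distrib_left: "\<lbrakk>x \<in> carrier A; y \<in> carrier A; z \<in> carrier A\<rbrakk>
      \<Longrightarrow> z \<otimes>\<^bsub>A\<^esub> (x \<oplus>\<^bsub>A\<^esub> y) = z \<otimes>\<^bsub>A\<^esub> x \<oplus>\<^bsub>A\<^esub> z \<otimes>\<^bsub>A\<^esub> y"
    and smult_mult_left: "\<lbrakk>c \<in> carrier F; x \<in> carrier A; y \<in> carrier A\<rbrakk>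
      \<Longrightarrow> (c \<odot>\<^bsub>A\<^esub> x) \<otimes>\<^bsub>A\<^esub> y = c \<odot>\<^bsub>A\<^esub> (x \<otimes>\<^bsub>A\<^esub> y)"
    and smult_mult_right: "\<lbrakk>c \<in> carrier F; x \<in> carrier A; y \<in> carrier A\<rbrakk>
      \<Longrightarrow> x \<otimes>\<^bsub>A\<^esub> (c \<odot>\<^bsub>A\<^esub> y) = c \<odot>\<^bsub>A\<^esub> (x \<otimes>\<^bsub>A\<^esub> y)"

definition char_zero :: "('f, 'n) ring_scheme \<Rightarrow> bool"
  where "char_zero F \<longleftrightarrow> (\<forall>n::nat. n > 0 \<longrightarrow> [n] \<cdot>\<^bsub>F\<^esub> \<one>\<^bsub>F\<^esub> \<noteq> \<zero>\<^bsub>F\<^esub>)"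

text \<open>
  \<open>V\<close> is the internal direct sum of the \<open>U i\<close>.  The sum is taken over the support of \<open>f\<close> because
  \<^const>\<open>finsum\<close> is trivial on infinite index sets.
\<close>

definition direct_sum_of :: "('a, 'm) ring_scheme \<Rightarrow> 'i set \<Rightarrow> ('i \<Rightarrow> 'a set) \<Rightarrow> 'a set \<Rightarrow> bool"
  where "direct_sum_of A I U V \<longleftrightarrow>
    (\<forall>i\<in>I. U i \<subseteq> V) \<and>
    (\<forall>x\<in>V. \<exists>!f. f \<in> (\<Pi>\<^sub>E i\<in>I. U i) \<and> finite {i\<in>I. f i \<noteq> \<zero>\<^bsub>A\<^esub>} \<and>
      x = (\<Oplus>\<^bsub>A\<^esub>i\<in>{i\<in>I. f i \<noteq> \<zero>\<^bsub>A\<^esub>}. f i))"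

locale graded_algebra = assoc_algebra F A + G: group G
  for G (structure) and F (structure) and A (structure) +
  fixes gr :: "'g \<Rightarrow> 'a set"
  constrains G :: "('g, 'l) monoid_scheme" and A :: "('f, 'a, 'm) module_scheme"
  assumes gr_submodule: "g \<in> carrier G \<Longrightarrow> submodule (gr g) F A"
    and gr_direct_sum: "direct_sum_of A (carrier G) gr (carrier A)"
    and gr_mult: "\<lbrakk>g \<in> carrier G; h \<in> carrier G; x \<in> gr g; y \<in> gr h\<rbrakk>
      \<Longrightarrow> x \<otimes>\<^bsub>A\<^esub> y \<in> gr (g \<otimes>\<^bsub>G\<^esub> h)"

definition graded_ideal ::
  "('g, 'l) monoid_scheme \<Rightarrow> ('f, 'n) ring_scheme \<Rightarrow> ('f, 'a, 'm) module_scheme \<Rightarrow>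
    ('g \<Rightarrow> 'a set) \<Rightarrow> 'a set \<Rightarrow> bool"
  where "graded_ideal G F A gr I \<longleftrightarrow>
    submodule I F A \<and>
    (\<forall>x\<in>carrier A. \<forall>y\<in>I. x \<otimes>\<^bsub>A\<^esub> y \<in> I \<and> y \<otimes>\<^bsub>A\<^esub> x \<in> I) \<and>
    direct_sum_of A (carrier G) (\<lambda>g. I \<inter> gr g) I"

definition graded_prime ::
  "('g, 'l) monoid_scheme \<Rightarrow> ('f, 'n) ring_scheme \<Rightarrow> ('f, 'a, 'm) module_scheme \<Rightarrow>
    ('g \<Rightarrow> 'a set) \<Rightarrow> bool"
  where "graded_prime G F A gr \<longleftrightarrow>
    (\<forall>I J. graded_ideal G F A gr I \<and> graded_ideal G F A gr J \<and> ideal_prod A I J = {\<zero>\<^bsub>A\<^esub>}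
      \<longrightarrow> I = {\<zero>\<^bsub>A\<^esub>} \<or> J = {\<zero>\<^bsub>A\<^esub>})"

definition graded_simple ::
  "('g, 'l) monoid_scheme \<Rightarrow> ('f, 'n) ring_scheme \<Rightarrow> ('f, 'a, 'm) module_scheme \<Rightarrow>
    ('g \<Rightarrow> 'a set) \<Rightarrow> bool"
  where "graded_simple G F A gr \<longleftrightarrow>
    ideal_prod A (carrier A) (carrier A) \<noteq> {\<zero>\<^bsub>A\<^esub>} \<and>
    (\<forall>I. graded_ideal G F A gr I \<longrightarrow> I = {\<zero>\<^bsub>A\<^esub>} \<or> I = carrier A)"

definition finite_dimensional :: "('f, 'n) ring_scheme \<Rightarrow> ('f, 'a, 'm) module_scheme \<Rightarrow> bool"
  where "finite_dimensional F A \<longleftrightarrow>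
    (\<exists>B. finite B \<and> B \<subseteq> carrier A \<and>
      (\<forall>x\<in>carrier A. \<exists>c\<in>B \<rightarrow> carrier F. x = (\<Oplus>\<^bsub>A\<^esub>b\<in>B. c b \<odot>\<^bsub>A\<^esub> b)))"

text \<open>
  A noncommutative polynomial is the coefficient function of a finite linear combination of words
  in the variables \<open>x\<^sub>0, x\<^sub>1, \<dots>\<close>.  There is no constant term, since constants cannot be evaluated in
  an algebra without unit; if \<open>A\<close> has a unit, the constant term of an identity vanishes anyway
  (substitute zero for all variables).
\<close>

definition nc_polys :: "('f, 'n) ring_scheme \<Rightarrow> (nat list \<Rightarrow> 'f) set"
  where "nc_polys F =
    {p. (\<forall>w. p w \<in> carrier F) \<and> finite {w. p w \<noteq> \<zero>\<^bsub>F\<^esub>} \<and> p [] = \<zero>\<^bsub>F\<^esub>}"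

fun word_value :: "('a, 'm) ring_scheme \<Rightarrow> (nat \<Rightarrow> 'a) \<Rightarrow> nat list \<Rightarrow> 'a"
  where
    "word_value A x [] = \<one>\<^bsub>A\<^esub>"  \<comment> \<open>irrelevant for \<^term>\<open>nc_polys F\<close>\<close>
  | "word_value A x [i] = x i"
  | "word_value A x (i # j # w) = x i \<otimes>\<^bsub>A\<^esub> word_value A x (j # w)"

definition nc_poly_value ::
  "('f, 'n) ring_scheme \<Rightarrow> ('f, 'a, 'm) module_scheme \<Rightarrow> (nat list \<Rightarrow> 'f) \<Rightarrow> (nat \<Rightarrow> 'a) \<Rightarrow> 'a"
  where "nc_poly_value F A p x = (\<Oplus>\<^bsub>A\<^esub>w\<in>{w. p w \<noteq> \<zero>\<^bsub>F\<^esub>}. p w \<odot>\<^bsub>A\<^esub> word_value A x w)"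

definition satisfies_PI :: "('f, 'n) ring_scheme \<Rightarrow> ('f, 'a, 'm) module_scheme \<Rightarrow> bool"
  where "satisfies_PI F A \<longleftrightarrow>
    (\<exists>p\<in>nc_polys F. (\<exists>w. p w \<noteq> \<zero>\<^bsub>F\<^esub>) \<and>
      (\<forall>x. (\<forall>i. x i \<in> carrier A) \<longrightarrow> nc_poly_value F A p x = \<zero>\<^bsub>A\<^esub>))"

definition alg_center :: "('a, 'm) ring_scheme \<Rightarrow> 'a set"
  where "alg_center A = {z \<in> carrier A. \<forall>x\<in>carrier A. z \<otimes>\<^bsub>A\<^esub> x = x \<otimes>\<^bsub>A\<^esub> z}"

definition center_e ::
  "('g, 'l) monoid_scheme \<Rightarrow> ('a, 'm) ring_scheme \<Rightarrow> ('g \<Rightarrow> 'a set) \<Rightarrow> 'a set"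
  where "center_e G A gr = alg_center A \<inter> gr \<one>\<^bsub>G\<^esub>"

definition zero_divisor :: "('a, 'm) ring_scheme \<Rightarrow> 'a \<Rightarrow> bool"
  where "zero_divisor A s \<longleftrightarrow>
    (\<exists>x\<in>carrier A. x \<noteq> \<zero>\<^bsub>A\<^esub> \<and> (s \<otimes>\<^bsub>A\<^esub> x = \<zero>\<^bsub>A\<^esub> \<or> x \<otimes>\<^bsub>A\<^esub> s = \<zero>\<^bsub>A\<^esub>))"

text \<open>
  Localization of \<open>A\<close> at a set \<open>S\<close> of central elements.  The pair \<open>(a, s)\<close> stands for the fraction
  \<open>a/s\<close>; the elements of the localization are the classes of \<open>frac_rel A S\<close>.
\<close>

definition frac_rel :: "('a, 'm) ring_scheme \<Rightarrow> 'a set \<Rightarrow> (('a \<times> 'a) \<times> ('a \<times> 'a)) set"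
  where "frac_rel A S = {((a, s), (b, t)). a \<in> carrier A \<and> s \<in> S \<and> b \<in> carrier A \<and> t \<in> S \<and>
    (\<exists>u\<in>S. u \<otimes>\<^bsub>A\<^esub> (t \<otimes>\<^bsub>A\<^esub> a) = u \<otimes>\<^bsub>A\<^esub> (s \<otimes>\<^bsub>A\<^esub> b))}"

definition frac_add ::
  "('a, 'm) ring_scheme \<Rightarrow> 'a set \<Rightarrow> ('a \<times> 'a) set \<Rightarrow> ('a \<times> 'a) set \<Rightarrow> ('a \<times> 'a) set"
  where "frac_add A S X Y =
    (\<Union>(a, s)\<in>X. \<Union>(b, t)\<in>Y. frac_rel A S `` {(t \<otimes>\<^bsub>A\<^esub> a \<oplus>\<^bsub>A\<^esub> s \<otimes>\<^bsub>A\<^esub> b, s \<otimes>\<^bsub>A\<^esub> t)})"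

definition frac_mult ::
  "('a, 'm) ring_scheme \<Rightarrow> 'a set \<Rightarrow> ('a \<times> 'a) set \<Rightarrow> ('a \<times> 'a) set \<Rightarrow> ('a \<times> 'a) set"
  where "frac_mult A S X Y =
    (\<Union>(a, s)\<in>X. \<Union>(b, t)\<in>Y. frac_rel A S `` {(a \<otimes>\<^bsub>A\<^esub> b, s \<otimes>\<^bsub>A\<^esub> t)})"

text \<open>
  The operation \<open>sm\<close> is the scalar action: the same ring \<open>S\<^sup>-\<^sup>1A\<close> is used both as an \<open>F\<close>-algebra and
  as an algebra over \<open>S\<^sup>-\<^sup>1Z(A)\<^sub>e\<close>.
\<close>

definition frac_algebra ::
  "('a, 'm) ring_scheme \<Rightarrow> 'a set \<Rightarrow> ('c \<Rightarrow> ('a \<times> 'a) set \<Rightarrow> ('a \<times> 'a) set) \<Rightarrow>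
    ('c, ('a \<times> 'a) set) module"
  where "frac_algebra A S sm = \<lparr>
    carrier = (carrier A \<times> S) // frac_rel A S,
    mult = frac_mult A S,
    one = frac_rel A S `` {(s, s) | s. s \<in> S},
    zero = frac_rel A S `` {(\<zero>\<^bsub>A\<^esub>, s) | s. s \<in> S},
    add = frac_add A S,
    smult = sm\<rparr>"

definition localization ::
  "('f, 'a, 'm) module_scheme \<Rightarrow> 'a set \<Rightarrow> ('f, ('a \<times> 'a) set) module"
  where "localization A S =
    frac_algebra A S (\<lambda>c X. \<Union>(a, s)\<in>X. frac_rel A S `` {(c \<odot>\<^bsub>A\<^esub> a, s)})"

text \<open>
  Here the scalars are fractions \<open>z/s\<close> with \<open>z\<close> central.  Such a scalar, as a class of the
  localized center, is a set of pairs \<open>(z, s)\<close>, so the action is given by the formula for the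
  product of fractions.
\<close>

definition localization_central ::
  "('a, 'm) ring_scheme \<Rightarrow> 'a set \<Rightarrow> (('a \<times> 'a) set, ('a \<times> 'a) set) module"
  where "localization_central A S = frac_algebra A S (frac_mult A S)"

definition localization_gr ::
  "('a, 'm) ring_scheme \<Rightarrow> 'a set \<Rightarrow> ('g \<Rightarrow> 'a set) \<Rightarrow> 'g \<Rightarrow> ('a \<times> 'a) set set"
  where "localization_gr A S gr g = (gr g \<times> S) // frac_rel A S"

text \<open>The canonical map, \<open>a \<mapsto> sa/s\<close> for any \<open>s \<in> S\<close> (\<open>a/1\<close> need not make sense without a unit).\<close>

definition localization_map :: "('a, 'm) ring_scheme \<Rightarrow> 'a set \<Rightarrow> 'a \<Rightarrow> ('a \<times> 'a) set"
  where "localization_map A S a = frac_rel A S `` {(s \<otimes>\<^bsub>A\<^esub> a, s) | s. s \<in> S}"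

definition graded_embedding ::
  "('g, 'l) monoid_scheme \<Rightarrow> ('f, 'n) ring_scheme \<Rightarrow>
    ('f, 'a, 'm) module_scheme \<Rightarrow> ('g \<Rightarrow> 'a set) \<Rightarrow>
    ('f, 'b, 'k) module_scheme \<Rightarrow> ('g \<Rightarrow> 'b set) \<Rightarrow> ('a \<Rightarrow> 'b) \<Rightarrow> bool"
  where "graded_embedding G F A grA B grB \<phi> \<longleftrightarrow>
    \<phi> \<in> carrier A \<rightarrow> carrier B \<and> inj_on \<phi> (carrier A) \<and>
    (\<forall>x\<in>carrier A. \<forall>y\<in>carrier A.
      \<phi> (x \<oplus>\<^bsub>A\<^esub> y) = \<phi> x \<oplus>\<^bsub>B\<^esub> \<phi> y \<and> \<phi> (x \<otimes>\<^bsub>A\<^esub> y) = \<phi> x \<otimes>\<^bsub>B\<^esub> \<phi> y) \<and>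
    (\<forall>c\<in>carrier F. \<forall>x\<in>carrier A. \<phi> (c \<odot>\<^bsub>A\<^esub> x) = c \<odot>\<^bsub>B\<^esub> \<phi> x) \<and>
    (\<forall>g\<in>carrier G. \<phi> ` grA g \<subseteq> grB g)"

end

theory Submission
  imports Defs "HOL-Library.Poly_Mapping"
begin

text \<open>
  This is a graded version of Posner's theorem.  The free ring on the homogeneous elements of \<open>A\<close> and
  the scalars acts on \<open>A\<close>; modulo the annihilator \<open>N\<close> of this action one has a graded prime ring.
  No extended centroid is formed.  Instead, linear algebra is done with operators \<open>T\<close> generated by
  left and right multiplications and the projections to the homogeneous components: \<open>x\<close> depends
  on \<open>X\<close> if every \<open>T\<close> that maps \<open>X\<close> into \<open>N\<close> also maps \<open>x\<close> into \<open>N\<close>.  Primeness gives the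
  exchange property and dual systems.

  A maximal ideal \<open>P\<close> among those whose homogeneous elements lie in \<open>N\<close> is prime, and a multilinear
  identity modulo \<open>P\<close> yields an ideal of finite rank (Martindale, Amitsur).  As \<open>P\<close> contains no
  new homogeneous element, the graded ideal generated by some homogeneous element has finite rank modulo
  \<open>N\<close>.  The trace of left multiplication on it, restricted to degree \<open>e\<close>, is nondegenerate in
  characteristic zero, and every operator has an adjoint for it.  The adjoint of the trace takes
  central values of degree \<open>e\<close>.  Hence every nonzero graded ideal of \<open>A\<close> meets \<open>Z(A)\<^sub>e\<close>,
  and \<open>sA\<close> lies in a finitely generated \<open>Z(A)\<^sub>e\<close>-module for some \<open>s\<close>; inverting \<open>Z(A)\<^sub>e - 0\<close> gives
  a graded simple algebra of finite dimension.
\<close>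

section \<open>Linear dependence with respect to operators\<close>

text \<open>In a prime ring the span of a finite X over the extended centroid consists of the x
  killed by every multiplication operator that kills X. Taking this as the definition of the closure
  \<open>opcl\<close> keeps linear algebra inside the ring, but no scalar can be inverted: a dual
  basis exists only up to a common factor \<tau>, and the coordinate formulas carry \<tau>, or a
  \<sigma> of the same kind, as a denominator that primeness cancels at the end. The arguments with
  the identity need primeness for arbitrary elements, while N offers it for homogeneous ones; hence
  the detour through P. Rank returns to N because on homogeneous elements of one fixed degree each
  component of a graded operator is a plain multiplication operator. The adjoint V of the trace has
  central values for this reason: \<open>tr1 (x * V y)\<close> is congruent to
  \<open>tr1 (tr1 x * y)\<close>, so it depends on x only through \<open>tr1 x\<close>. As the trace
  kills commutators, V y is orthogonal to all of them, and nondegeneracy turns this into centrality.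
  Nondegeneracy itself is tested on a graded right ideal of minimal rank.\<close>

inductive_set mops :: "('r::ring_1 \<Rightarrow> 'r) set \<Rightarrow> ('r \<Rightarrow> 'r) set" for Q where
  left: "(\<lambda>x. u * x) \<in> mops Q"
| right: "(\<lambda>x. x * u) \<in> mops Q"
| base: "q \<in> Q \<Longrightarrow> q \<in> mops Q"
| add: "S \<in> mops Q \<Longrightarrow> T \<in> mops Q \<Longrightarrow> (\<lambda>x. S x + T x) \<in> mops Q"
| comp: "S \<in> mops Q \<Longrightarrow> T \<in> mops Q \<Longrightarrow> (\<lambda>x. S (T x)) \<in> mops Q"

lemma mops_id: "(\<lambda>x. x) \<in> mops Q"
  by (rule back_subst[of "\<lambda>f. f \<in> mops Q", OF mops.left[of 1]]) (simp add: fun_eq_iff)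

lemma mops_zero: "(\<lambda>x. 0) \<in> mops Q"
  by (rule back_subst[of "\<lambda>f. f \<in> mops Q", OF mops.left[of 0]]) (simp add: fun_eq_iff)

lemma mops_left_comp: "T \<in> mops Q \<Longrightarrow> (\<lambda>x. u * T x) \<in> mops Q"
  using mops.comp[OF mops.left[of u Q]] by simp

lemma mops_right_comp: "T \<in> mops Q \<Longrightarrow> (\<lambda>x. T x * u) \<in> mops Q"
  using mops.comp[OF mops.right[of u Q]] by simp

lemma mops_diff:
  assumes "S \<in> mops Q" "T \<in> mops Q" shows "(\<lambda>x. S x - T x) \<in> mops Q"
  using mops.add[OF assms(1) mops_left_comp[OF assms(2), of "-1"]] by simp

lemma mops_sum:
  assumes "\<And>i. i \<in> I \<Longrightarrow> T i \<in> mops Q" shows "(\<lambda>x. \<Sum>i\<in>I. T i x) \<in> mops Q"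
  using assms by (induction I rule: infinite_finite_induct) (auto intro: mops_zero mops.add)

lemmas mops_intros = mops_id mops_left_comp mops_right_comp mops_diff mops_sum mops.add mops.left mops.right

definition opcl :: "('r::ring_1 \<Rightarrow> 'r) set \<Rightarrow> 'r set \<Rightarrow> 'r set \<Rightarrow> 'r set" where
  "opcl Q N X = {x. \<forall>T\<in>mops Q. (\<forall>y\<in>X. T y \<in> N) \<longrightarrow> T x \<in> N}"

definition opindep :: "('r::ring_1 \<Rightarrow> 'r) set \<Rightarrow> 'r set \<Rightarrow> 'r set \<Rightarrow> bool" where
  "opindep Q N B \<longleftrightarrow> (\<forall>b\<in>B. b \<notin> opcl Q N (B - {b}))"

locale two_sided_ideal =
  fixes N :: "'r::ring_1 set"
  assumes zero_mem: "0 \<in> N"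
    and add_mem: "x \<in> N \<Longrightarrow> y \<in> N \<Longrightarrow> x + y \<in> N"
    and left_mem: "x \<in> N \<Longrightarrow> u * x \<in> N"
    and right_mem: "x \<in> N \<Longrightarrow> x * u \<in> N"
begin

lemma minus_mem: "x \<in> N \<Longrightarrow> - x \<in> N"
  using left_mem[of x "-1"] by simp

lemma diff_mem: "x \<in> N \<Longrightarrow> y \<in> N \<Longrightarrow> x - y \<in> N"
  using add_mem[OF _ minus_mem, of x y] by simp

lemma sum_mem: "(\<And>i. i \<in> I \<Longrightarrow> f i \<in> N) \<Longrightarrow> sum f I \<in> N"
  by (induction I rule: infinite_finite_induct) (auto intro: zero_mem add_mem)

lemma minus_commute_mem: "x - y \<in> N \<Longrightarrow> y - x \<in> N"
  using minus_mem[of "x - y"] by simp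

lemma mem_cong: "x - y \<in> N \<Longrightarrow> x \<in> N \<longleftrightarrow> y \<in> N"
  using add_mem[of "x - y" y] diff_mem[of x "x - y"] by auto

lemma trans_mem: "x - y \<in> N \<Longrightarrow> y - z \<in> N \<Longrightarrow> x - z \<in> N"
  using add_mem[of "x - y" "y - z"] by simp

lemma sum_diff_mem: "(\<And>i. i \<in> I \<Longrightarrow> f i - g i \<in> N) \<Longrightarrow> sum f I - sum g I \<in> N"
  using sum_mem[of I "\<lambda>i. f i - g i"] by (simp add: sum_subtractf)

end

text \<open>One frame for two cases: Q empty and every element in Hm (a prime ideal), or Q the
  projections and Hm the homogeneous elements (a graded prime ideal). \<open>Q_left\<close> and
  \<open>Q_right\<close> say that annihilators of homogeneous elements are stable under Q; this
  extends primeness from two homogeneous factors to one.\<close>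

locale op_prime = two_sided_ideal N for N :: "'r::ring_1 set" +
  fixes Q :: "('r \<Rightarrow> 'r) set" and Hm :: "'r set"
  assumes Q_add: "q \<in> Q \<Longrightarrow> q (x + y) = q x + q y"
    and Q_mem: "q \<in> Q \<Longrightarrow> x \<in> N \<Longrightarrow> q x \<in> N"
    and hom_op: "x \<notin> N \<Longrightarrow> \<exists>T\<in>mops Q. T x \<in> Hm \<and> T x \<notin> N"
    and prime_hom: "u \<in> Hm \<Longrightarrow> v \<in> Hm \<Longrightarrow> (\<And>x. u * x * v \<in> N) \<Longrightarrow> u \<in> N \<or> v \<in> N"
    and Q_left: "q \<in> Q \<Longrightarrow> y \<in> Hm \<Longrightarrow> (\<And>u. x * u * y \<in> N) \<Longrightarrow> q x * u * y \<in> N"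
    and Q_right: "q \<in> Q \<Longrightarrow> y \<in> Hm \<Longrightarrow> (\<And>u. y * u * x \<in> N) \<Longrightarrow> y * u * q x \<in> N"
begin

abbreviation "E \<equiv> mops Q"
abbreviation "cl \<equiv> opcl Q N"
abbreviation "indep \<equiv> opindep Q N"

lemma op_add: "T \<in> E \<Longrightarrow> T (x + y) = T x + T y"
proof (induction arbitrary: x y rule: mops.induct)
  case (base q)
  then show ?case by (rule Q_add)
qed (simp_all add: algebra_simps)

lemma op_zero: "T \<in> E \<Longrightarrow> T 0 = 0"
  using op_add[of T 0 0] by simp

lemma op_minus: "T \<in> E \<Longrightarrow> T (- x) = - T x"
  using op_add[of T x "- x"] op_zero[of T] by (simp add: add_eq_0_iff)

lemma op_diff: "T \<in> E \<Longrightarrow> T (x - y) = T x - T y"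
  using op_add[of T x "- y"] op_minus[of T y] by simp

lemma op_sum: "T \<in> E \<Longrightarrow> T (sum f I) = (\<Sum>i\<in>I. T (f i))"
  by (induction I rule: infinite_finite_induct) (auto simp: op_zero op_add)

lemma op_mem: "T \<in> E \<Longrightarrow> x \<in> N \<Longrightarrow> T x \<in> N"
  by (induction arbitrary: x rule: mops.induct) (auto intro: left_mem right_mem add_mem Q_mem)

text \<open>The x with \<open>x * u * y\<close> in N for all u form a set stable under all
  operators. An x outside N could therefore be moved to a homogeneous element outside N, where
  \<open>prime_hom\<close> applies.\<close>

lemma prime_left:
  assumes y: "y \<in> Hm" "y \<notin> N" and x: "\<And>u. x * u * y \<in> N" shows "x \<in> N"
proof (rule ccontr)
  have op: "T \<in> E \<Longrightarrow> (\<And>u. x * u * y \<in> N) \<Longrightarrow> T x * u * y \<in> N" for T x u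
  proof (induction arbitrary: x u rule: mops.induct)
    case (left v)
    then show ?case using left_mem[of "x * u * y" v] by (simp add: mult.assoc)
  next
    case (right v)
    then show ?case using right(1)[of "v * u"] by (simp add: mult.assoc)
  next
    case (base q)
    then show ?case using Q_left y(1) by blast
  next
    case (add S T)
    then show ?case by (simp add: distrib_right add_mem)
  qed blast
  assume "x \<notin> N"
  then obtain T where T: "T \<in> E" "T x \<in> Hm" "T x \<notin> N" using hom_op by blast
  have "T x * u * y \<in> N" for u using op[OF T(1)] x by blast
  then show False using prime_hom T y by blast
qed

lemma prime_right:
  assumes y: "y \<in> Hm" "y \<notin> N" and x: "\<And>u. y * u * x \<in> N" shows "x \<in> N"
proof (rule ccontr)
  have op: "T \<in> E \<Longrightarrow> (\<And>u. y * u * x \<in> N) \<Longrightarrow> y * u * T x \<in> N" for T x u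
  proof (induction arbitrary: x u rule: mops.induct)
    case (left v)
    then show ?case using left(1)[of "u * v"] by (simp add: mult.assoc)
  next
    case (right v)
    then show ?case using right_mem[of "y * u * x" v] by (simp add: mult.assoc)
  next
    case (base q)
    then show ?case using Q_right y(1) by blast
  next
    case (add S T)
    then show ?case by (simp add: distrib_left add_mem)
  qed blast
  assume "x \<notin> N"
  then obtain T where T: "T \<in> E" "T x \<in> Hm" "T x \<notin> N" using hom_op by blast
  have "y * u * T x \<in> N" for u using op[OF T(1)] x by blast
  then show False using prime_hom T y by blast
qed

lemma clI: "(\<And>T. T \<in> E \<Longrightarrow> (\<And>y. y \<in> X \<Longrightarrow> T y \<in> N) \<Longrightarrow> T x \<in> N) \<Longrightarrow> x \<in> cl X"
  by (auto simp: opcl_def)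

lemma clD: "x \<in> cl X \<Longrightarrow> T \<in> E \<Longrightarrow> (\<And>y. y \<in> X \<Longrightarrow> T y \<in> N) \<Longrightarrow> T x \<in> N"
  by (auto simp: opcl_def)

lemma cl_superset: "X \<subseteq> cl X"
  by (auto simp: opcl_def)

lemma cl_mono: "X \<subseteq> Y \<Longrightarrow> cl X \<subseteq> cl Y"
  by (auto simp: opcl_def)

lemma cl_least: "X \<subseteq> cl Y \<Longrightarrow> cl X \<subseteq> cl Y"
  by (fastforce simp: opcl_def)

lemma cl_trans: "x \<in> cl Y \<Longrightarrow> Y \<subseteq> cl X \<Longrightarrow> x \<in> cl X"
  using cl_least by blast

lemma cl_N: "N \<subseteq> cl X"
  by (auto simp: opcl_def op_mem)

lemma cl_add: "x \<in> cl X \<Longrightarrow> y \<in> cl X \<Longrightarrow> x + y \<in> cl X"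
  by (auto simp: opcl_def op_add add_mem)

lemma cl_diff: "x \<in> cl X \<Longrightarrow> y \<in> cl X \<Longrightarrow> x - y \<in> cl X"
  by (auto simp: opcl_def op_diff diff_mem)

lemma cl_sum: "(\<And>i. i \<in> I \<Longrightarrow> f i \<in> cl X) \<Longrightarrow> sum f I \<in> cl X"
  by (auto simp: opcl_def op_sum intro!: sum_mem)

lemma cl_cong: "x - y \<in> N \<Longrightarrow> x \<in> cl X \<longleftrightarrow> y \<in> cl X"
  using cl_N[of X] cl_add[of "x - y" X y] cl_diff[of x X "x - y"] by auto

lemma cl_op: "S \<in> E \<Longrightarrow> x \<in> cl X \<Longrightarrow> S x \<in> cl (S ` X)"
  by (rule clI) (use clD[of x X, OF _ mops.comp] in auto)

lemma separate:
  assumes "x \<notin> cl X"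
  obtains T where "T \<in> E" "\<And>y. y \<in> X \<Longrightarrow> T y \<in> N" "T x \<in> Hm" "T x \<notin> N"
proof -
  obtain T where T: "T \<in> E" "\<And>y. y \<in> X \<Longrightarrow> T y \<in> N" "T x \<notin> N"
    using assms by (auto simp: opcl_def)
  obtain S where S: "S \<in> E" "S (T x) \<in> Hm" "S (T x) \<notin> N" using hom_op[OF T(3)] by blast
  have "(\<lambda>x. S (T x)) \<in> E" using S(1) T(1) by (rule mops.comp)
  then show ?thesis using that S T op_mem by blast
qed

text \<open>The operator \<open>\<lambda>y. S y * u * T c - S c * u * T y\<close> is a 2 by 2
  determinant: modulo N it vanishes at c and on X, hence at b. As T kills b, there remains
  \<open>S b * u * T c\<close>, which by primeness is not in N for every u.\<close>

lemma exchange: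
  assumes b: "b \<in> cl (insert c X)" "b \<notin> cl X" shows "c \<in> cl (insert b X)"
proof (rule ccontr)
  assume "c \<notin> cl (insert b X)"
  then obtain T where T: "T \<in> E" "\<And>y. y \<in> insert b X \<Longrightarrow> T y \<in> N" "T c \<in> Hm" "T c \<notin> N"
    by (rule separate) blast
  obtain S where S: "S \<in> E" "\<And>y. y \<in> X \<Longrightarrow> S y \<in> N" "S b \<in> Hm" "S b \<notin> N"
    using separate[OF b(2)] by blast
  have "S b * u * T c \<in> N" for u
  proof -
    have "(\<lambda>y. S y * u * T c - S c * u * T y) \<in> E"
      using S(1) T(1) by (intro mops_intros)
    moreover have "S y * u * T c - S c * u * T y \<in> N" if "y \<in> insert c X" for y
      using that S(2) T(2) by (auto intro: zero_mem diff_mem left_mem right_mem)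
    ultimately have "S b * u * T c - S c * u * T b \<in> N" using clD[OF b(1)] by fast
    moreover have "S c * u * T b \<in> N" using T(2) left_mem by blast
    ultimately show ?thesis using add_mem by fastforce
  qed
  then show False using prime_hom S T by blast
qed

section \<open>Independent sets, bases and rank\<close>

lemma indep_insert:
  assumes B: "indep B" and x: "x \<notin> cl B" shows "indep (insert x B)"
  unfolding opindep_def
proof
  fix b assume b: "b \<in> insert x B"
  have xB: "x \<notin> B" using x cl_superset by auto
  show "b \<notin> cl (insert x B - {b})"
  proof (cases "b = x")
    case True
    then show ?thesis using x xB by simp
  next
    case False
    then have bB: "b \<in> B" and eq: "insert x B - {b} = insert x (B - {b})" using b by auto
    show ?thesis
    proof
      assume "b \<in> cl (insert x B - {b})"
      then have "x \<in> cl (insert b (B - {b}))"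
        using exchange[of b x "B - {b}"] eq B bB by (auto simp: opindep_def)
      then show False using x bB by (simp add: insert_absorb)
    qed
  qed
qed

lemma indep_subset: "indep B \<Longrightarrow> C \<subseteq> B \<Longrightarrow> indep C"
  unfolding opindep_def using cl_mono by (meson Diff_mono order_refl subset_iff)

text \<open>Each round replaces an element of \<open>I - Y\<close> by an element of Y without
  changing the cardinality, until I lies inside Y. A replacement exists because otherwise Y, and
  with it x, would lie in the closure of \<open>I - {x}\<close>.\<close>

lemma steinitz:
  assumes "finite I" "finite Y" "indep I" "I \<subseteq> cl Y" shows "card I \<le> card Y"
  using assms(1,3,4)
proof (induction "card (I - Y)" arbitrary: I)
  case 0
  then have "I \<subseteq> Y" by auto
  then show ?case by (simp add: assms(2) card_mono)
next
  case (Suc n)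
  then obtain x where x: "x \<in> I" "x \<notin> Y" by (metis Diff_eq_empty_iff card.empty nat.distinct(1) subsetI)
  have "x \<notin> cl (I - {x})" using Suc.prems x by (auto simp: opindep_def)
  then have "\<not> Y \<subseteq> cl (I - {x})" using cl_least Suc.prems x by (meson in_mono)
  then obtain y where y: "y \<in> Y" "y \<notin> cl (I - {x})" by auto
  then have yI: "y \<notin> I - {x}" using cl_superset[of "I - {x}"] by auto
  define I' where "I' = insert y (I - {x})"
  have fin: "finite I'" using Suc.prems by (simp add: I'_def)
  have ind: "indep I'" unfolding I'_def by (rule indep_insert[OF indep_subset[OF Suc.prems(2)] y(2)]) auto
  have sub: "I' \<subseteq> cl Y" using Suc.prems y cl_superset by (auto simp: I'_def)
  have "I' - Y = (I - Y) - {x}" using y x by (auto simp: I'_def)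
  then have "n = card (I' - Y)" using Suc.hyps(2) x Suc.prems(1) by simp
  then have "card I' \<le> card Y" using Suc.hyps(1) fin ind sub by blast
  moreover have "card I' = card I"
    using yI x Suc.prems(1) card_Suc_Diff1[of I x] unfolding I'_def by simp
  ultimately show ?case by simp
qed

text \<open>Stated with a bound on independent subsets instead of a finite spanning set, since in
  the graded setting the bound will come from the rank modulo a different ideal.\<close>

lemma basis_bounded:
  assumes n: "\<And>B. finite B \<Longrightarrow> indep B \<Longrightarrow> B \<subseteq> X \<Longrightarrow> card B \<le> n"
    and I: "finite I" "indep I" "I \<subseteq> X"
  obtains B where "finite B" "indep B" "I \<subseteq> B" "B \<subseteq> X" "X \<subseteq> cl B"
proof -
  let ?P = "\<lambda>m. \<exists>B. finite B \<and> indep B \<and> I \<subseteq> B \<and> B \<subseteq> X \<and> card B = m"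
  have "?P (card I)" using I by blast
  moreover have "m \<le> n" if "?P m" for m using that n by blast
  ultimately obtain m where m: "?P m" and max: "\<And>k. ?P k \<Longrightarrow> k \<le> m"
    using GreatestI_nat[of ?P "card I" n] Greatest_le_nat[of ?P _ n] by blast
  then obtain B where B: "finite B" "indep B" "I \<subseteq> B" "B \<subseteq> X" "card B = m" by blast
  have "X \<subseteq> cl B"
  proof
    fix x assume x: "x \<in> X"
    show "x \<in> cl B"
    proof (rule ccontr)
      assume nx: "x \<notin> cl B"
      then have "x \<notin> B" using cl_superset by auto
      then have "?P (Suc m)" using B x indep_insert[OF B(2) nx] by (intro exI[of _ "insert x B"]) auto
      then have "Suc m \<le> m" by (rule max)
      then show False by simp
    qed
  qed
  then show ?thesis using that B by blast
qed

lemma basis_extend: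
  assumes Y: "finite Y" "X \<subseteq> cl Y" and I: "finite I" "indep I" "I \<subseteq> X"
  obtains B where "finite B" "indep B" "I \<subseteq> B" "B \<subseteq> X" "X \<subseteq> cl B"
proof (rule basis_bounded[OF _ I])
  show "card B \<le> card Y" if "finite B" "indep B" "B \<subseteq> X" for B
    using steinitz[OF that(1) Y(1) that(2)] that(3) Y(2) by blast
qed (rule that)

lemma spanning_subset:
  assumes "finite Y" obtains B where "B \<subseteq> Y" "finite B" "indep B" "Y \<subseteq> cl B"
proof (rule basis_extend[OF assms cl_superset finite.emptyI _ empty_subsetI])
  show "indep {}" by (simp add: opindep_def)
qed (rule that)

section \<open>Dual systems with a common denominator \<tau>\<close>

definition dual :: "'r set \<Rightarrow> ('r \<Rightarrow> 'r \<Rightarrow> 'r) \<Rightarrow> 'r \<Rightarrow> bool" where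
  "dual B T \<tau> \<longleftrightarrow> finite B \<and> \<tau> \<in> Hm \<and> \<tau> \<notin> N \<and>
    (\<forall>b\<in>B. T b \<in> E \<and> T b b = \<tau> \<and> (\<forall>c\<in>B. c \<noteq> b \<longrightarrow> T b c \<in> N))"

lemma Hm_nonempty: "x \<notin> N \<Longrightarrow> \<exists>\<tau>\<in>Hm. \<tau> \<notin> N"
  using hom_op by blast

text \<open>Each b is separated from the others by some operator, but the values at the b differ and
  cannot be scaled to 1. They are made equal one b at a time, as fractions are brought to a common
  denominator.\<close>

lemma dual_exists:
  assumes B: "finite B" "indep B" and one: "1 \<notin> N"
  obtains T \<tau> where "dual B T \<tau>"
proof -
  have "\<exists>T \<tau>. \<tau> \<in> Hm \<and> \<tau> \<notin> N \<and> (\<forall>b\<in>C. T b \<in> E \<and> T b b = \<tau> \<and> (\<forall>c\<in>B. c \<noteq> b \<longrightarrow> T b c \<in> N))"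
    if "finite C" "C \<subseteq> B" for C
    using that
  proof (induction C rule: finite_induct)
    case empty
    then show ?case using Hm_nonempty[OF one] by blast
  next
    case (insert b0 C)
    then obtain T \<tau> where IH': "\<tau> \<in> Hm \<and> \<tau> \<notin> N \<and>
      (\<forall>b\<in>C. T b \<in> E \<and> T b b = \<tau> \<and> (\<forall>c\<in>B. c \<noteq> b \<longrightarrow> T b c \<in> N))" by auto
    have IH: "\<tau> \<in> Hm" "\<tau> \<notin> N"
      "\<And>b. b \<in> C \<Longrightarrow> T b \<in> E" "\<And>b. b \<in> C \<Longrightarrow> T b b = \<tau>"
      "\<And>b c. b \<in> C \<Longrightarrow> c \<in> B \<Longrightarrow> c \<noteq> b \<Longrightarrow> T b c \<in> N"
      using IH' by blast+
    have "b0 \<notin> cl (B - {b0})" using insert B by (auto simp: opindep_def)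
    then obtain S where S: "S \<in> E" "\<And>y. y \<in> B - {b0} \<Longrightarrow> S y \<in> N" "S b0 \<in> Hm" "S b0 \<notin> N"
      using separate by blast
    obtain u where u: "\<tau> * u * S b0 \<notin> N"
      using prime_hom[OF IH(1) S(3)] IH(2) S(4) by auto
    obtain R where R: "R \<in> E" "R (\<tau> * u * S b0) \<in> Hm" "R (\<tau> * u * S b0) \<notin> N"
      using hom_op[OF u] by (elim bexE conjE) (rule that)
    \<comment> \<open>The earlier operators get \<open>S b0\<close> as a factor on the right, the
      new one gets \<tau> on the left. Both then take the value \<open>\<tau> * u * S b0\<close> on
      their own basis element, and R makes this value homogeneous.\<close>
    define T' where "T' b = (if b = b0 then (\<lambda>x. R (\<tau> * u * S x)) else (\<lambda>x. R (T b x * u * S b0)))" for b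
    have "\<forall>b\<in>insert b0 C. T' b \<in> E \<and> T' b b = R (\<tau> * u * S b0) \<and> (\<forall>c\<in>B. c \<noteq> b \<longrightarrow> T' b c \<in> N)"
    proof
      fix b assume b: "b \<in> insert b0 C"
      show "T' b \<in> E \<and> T' b b = R (\<tau> * u * S b0) \<and> (\<forall>c\<in>B. c \<noteq> b \<longrightarrow> T' b c \<in> N)"
      proof (cases "b = b0")
        case True
        have "(\<lambda>x. R (\<tau> * u * S x)) \<in> E" using S(1) by (intro mops.comp[OF R(1)] mops_left_comp)
        then show ?thesis using True S by (auto simp: T'_def intro!: op_mem[OF R(1)] left_mem)
      next
        case False
        then have bC: "b \<in> C" using b by simp
        have "(\<lambda>x. R (T b x * u * S b0)) \<in> E"
          using IH(3)[OF bC] by (intro mops.comp[OF R(1)] mops_right_comp)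
        then show ?thesis using False bC IH(4,5) by (auto simp: T'_def intro!: op_mem[OF R(1)] right_mem)
      qed
    qed
    then show ?case using R(2,3) by (intro exI conjI)
  qed
  from this[OF B(1) subset_refl] obtain T \<tau> where "\<tau> \<in> Hm \<and> \<tau> \<notin> N \<and>
      (\<forall>b\<in>B. T b \<in> E \<and> T b b = \<tau> \<and> (\<forall>c\<in>B. c \<noteq> b \<longrightarrow> T b c \<in> N))" by (elim exE)
  then have "dual B T \<tau>" using B(1) by (simp add: dual_def)
  then show ?thesis by (rule that)
qed

context
  fixes B T \<tau> assumes dual: "dual B T \<tau>"
begin

lemma dual_op: "b \<in> B \<Longrightarrow> T b \<in> E" and dual_same: "b \<in> B \<Longrightarrow> T b b = \<tau>"
  and dual_other: "b \<in> B \<Longrightarrow> c \<in> B \<Longrightarrow> c \<noteq> b \<Longrightarrow> T b c \<in> N"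
  and dual_finite: "finite B" and dual_hom: "\<tau> \<in> Hm" and dual_nz: "\<tau> \<notin> N"
  using dual by (auto simp: dual_def)

text \<open>With scalars this is the coordinate expansion of y with coefficients T b y over \<tau>,
  put through U; the arbitrary u records that scalars commute with everything. The difference is an
  operator in y that maps B into N, hence also the closure of B.\<close>

lemma dual_expand_right:
  assumes "y \<in> cl B" "U \<in> E"
  shows "U y * u * \<tau> - (\<Sum>b\<in>B. U b * u * T b y) \<in> N"
proof -
  have "(\<lambda>y. U y * u * \<tau> - (\<Sum>b\<in>B. U b * u * T b y)) \<in> E"
    using assms(2) dual_op by (intro mops_intros) auto
  moreover have "U c * u * \<tau> - (\<Sum>b\<in>B. U b * u * T b c) \<in> N" if c: "c \<in> B" for c
  proof -
    have "(\<Sum>b\<in>B. U b * u * T b c) = U c * u * \<tau> + (\<Sum>b\<in>B - {c}. U b * u * T b c)"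
      using c by (simp add: sum.remove[OF dual_finite c] dual_same)
    moreover have "(\<Sum>b\<in>B - {c}. U b * u * T b c) \<in> N"
      using c by (intro sum_mem left_mem dual_other) auto
    ultimately show ?thesis by (simp add: minus_mem)
  qed
  ultimately show ?thesis using clD[OF assms(1)] by fast
qed

lemma dual_expand_left:
  assumes "y \<in> cl B" "U \<in> E"
  shows "\<tau> * u * U y - (\<Sum>b\<in>B. T b y * u * U b) \<in> N"
proof -
  have "(\<lambda>y. \<tau> * u * U y - (\<Sum>b\<in>B. T b y * u * U b)) \<in> E"
    using assms(2) dual_op by (intro mops_intros) auto
  moreover have "\<tau> * u * U c - (\<Sum>b\<in>B. T b c * u * U b) \<in> N" if c: "c \<in> B" for c
  proof -
    have "(\<Sum>b\<in>B. T b c * u * U b) = \<tau> * u * U c + (\<Sum>b\<in>B - {c}. T b c * u * U b)"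
      using c by (simp add: sum.remove[OF dual_finite c] dual_same)
    moreover have "(\<Sum>b\<in>B - {c}. T b c * u * U b) \<in> N"
      using c by (intro sum_mem right_mem dual_other) auto
    ultimately show ?thesis by (simp add: minus_mem)
  qed
  ultimately show ?thesis using clD[OF assms(1)] by fast
qed

text \<open>Coordinates are scalar multiples of \<tau>: an operator that kills \<tau> kills
  \<open>T b c\<close> for every basis element c.\<close>

lemma dual_cl:
  assumes y: "y \<in> cl B" and b: "b \<in> B" shows "T b y \<in> cl {\<tau>}"
proof (rule clI)
  fix S assume S: "S \<in> E" and "\<And>y. y \<in> {\<tau>} \<Longrightarrow> S y \<in> N"
  then have St: "S \<tau> \<in> N" by blast
  have "(\<lambda>y. S (T b y)) \<in> E" using S dual_op[OF b] by (rule mops.comp)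
  moreover have "S (T b c) \<in> N" if "c \<in> B" for c
    using that b St dual_same dual_other op_mem[OF S] by (cases "c = b") auto
  ultimately show "S (T b y) \<in> N" using clD[OF y] by fast
qed

end

text \<open>Scalar multiples of one \<tau> can be interchanged around any u. The expression
  \<open>x * u * \<tau> - \<tau> * u * x\<close> vanishes at x = \<tau>, hence at s; the remaining
  \<tau> is then replaced by t in the same way.\<close>

lemma cl_commute:
  assumes "s \<in> cl {\<tau>}" "t \<in> cl {\<tau>}" shows "s * u * t - t * u * s \<in> N"
proof -
  have 1: "s * u * \<tau> - \<tau> * u * s \<in> N"
  proof -
    have "(\<lambda>x. x * u * \<tau> - \<tau> * u * x) \<in> E" by (intro mops_intros)
    from clD[OF assms(1) this] show ?thesis using zero_mem by simp
  qed
  have "(\<lambda>x. s * u * x - x * u * s) \<in> E" by (intro mops_intros)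
  from clD[OF assms(2) this] show ?thesis using 1 by simp
qed

end

section \<open>Prime rings with a multilinear identity\<close>

definition perms :: "nat \<Rightarrow> nat list set" where
  "perms d = {w. distinct w \<and> set w = {..<d}}"

lemma finite_perms: "finite (perms d)"
  by (rule finite_subset[OF _ finite_subset_distinct[of "{..<d}"]]) (auto simp: perms_def)

text \<open>In the application M consists of the elements of a free ring that act like elements of
  the algebra; the polynomial identity is available there and need not hold on the whole ring. d is
  the degree, and the coefficients are ring elements that are central modulo P.\<close>

locale prime_pi = two_sided_ideal P for P :: "'r::ring_1 set" +
  fixes M :: "'r set" and \<alpha> :: "nat list \<Rightarrow> 'r" and d :: nat
  assumes prime: "(\<And>y. u * y * v \<in> P) \<Longrightarrow> u \<in> P \<or> v \<in> P"
    and M_left: "y \<in> M \<Longrightarrow> u * y \<in> M"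
    and M_right: "y \<in> M \<Longrightarrow> y * u \<in> M"
    and M_nontriv: "\<exists>m\<in>M. m \<notin> P"
    and identity: "(\<And>i. x i \<in> M) \<Longrightarrow> (\<Sum>w\<in>perms d. \<alpha> w * prod_list (map x w)) \<in> P"
    and coeff: "\<alpha> [0..<d] \<notin> P"
    and coeff_central: "\<alpha> w * y - y * \<alpha> w \<in> P"
begin

sublocale op_prime P "{}" UNIV
proof
  show "\<exists>T\<in>mops {}. T x \<in> UNIV \<and> T x \<notin> P" if "x \<notin> P" for x
    using that by (intro bexI[of _ "\<lambda>x. x"] mops_id) auto
  show "u \<in> P \<or> v \<in> P" if "\<And>x. u * x * v \<in> P" for u v
    using that by (rule prime)
qed auto

lemma one_notin: "1 \<notin> P"
  using M_nontriv left_mem[of 1] by auto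

lemma prime_M:
  assumes "\<And>x. x \<in> M \<Longrightarrow> u * x * v \<in> P" shows "u \<in> P \<or> v \<in> P"
proof (rule ccontr)
  assume nP: "\<not> (u \<in> P \<or> v \<in> P)"
  obtain m where m: "m \<in> M" "m \<notin> P" using M_nontriv by blast
  obtain s where s: "u * s * m \<notin> P" using prime[of u m] nP m(2) by auto
  obtain t where "u * s * m * t * v \<notin> P" using prime[of "u * s * m" v] nP s by auto
  moreover have "s * m * t \<in> M" using M_left M_right m(1) by blast
  ultimately show False using assms[of "s * m * t"] by (simp add: mult.assoc)
qed

text \<open>A relation linear in x survives operators applied to the coefficients on one side of x:
  a left multiplication multiplies the whole sum, and a right multiplication is absorbed by
  substituting \<open>u * x\<close> for x.\<close>

lemma slot_left:
  assumes "S \<in> E" "\<And>x. x \<in> M \<Longrightarrow> (\<Sum>k\<in>K. a k * x * b k) \<in> P" "x \<in> M"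
  shows "(\<Sum>k\<in>K. S (a k) * x * b k) \<in> P"
  using assms
proof (induction arbitrary: a x rule: mops.induct)
  case (left u)
  have "(\<Sum>k\<in>K. u * a k * x * b k) = u * (\<Sum>k\<in>K. a k * x * b k)"
    by (simp add: sum_distrib_left mult.assoc)
  then show ?case using left left_mem by simp
next
  case (right u)
  have "(\<Sum>k\<in>K. a k * u * x * b k) = (\<Sum>k\<in>K. a k * (u * x) * b k)"
    by (simp add: mult.assoc)
  then show ?case using right M_left by simp
next
  case (add S T)
  then show ?case by (simp add: distrib_right sum.distrib add_mem)
next
  case (comp S T)
  show ?case by (rule comp.IH(1)[OF comp.IH(2)[OF comp.prems(1)]]) (use comp.prems in auto)
qed auto

lemma slot_right:
  assumes "S \<in> E" "\<And>x. x \<in> M \<Longrightarrow> (\<Sum>k\<in>K. a k * x * b k) \<in> P" "x \<in> M"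
  shows "(\<Sum>k\<in>K. a k * x * S (b k)) \<in> P"
  using assms
proof (induction arbitrary: b x rule: mops.induct)
  case (left u)
  have "(\<Sum>k\<in>K. a k * x * (u * b k)) = (\<Sum>k\<in>K. a k * (x * u) * b k)"
    by (simp add: mult.assoc)
  then show ?case using left M_right by simp
next
  case (right u)
  have "(\<Sum>k\<in>K. a k * x * (b k * u)) = (\<Sum>k\<in>K. a k * x * b k) * u"
    by (simp add: sum_distrib_right mult.assoc)
  then show ?case using right right_mem by simp
next
  case (add S T)
  then show ?case by (simp add: distrib_left sum.distrib add_mem)
next
  case (comp S T)
  show ?case by (rule comp.IH(1)[OF comp.IH(2)[OF comp.prems(1)]]) (use comp.prems in auto)
qed auto

text \<open>The hypothesis to be refuted: a generalized linear map whose values lie in the closure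
  of a finite set vanishes. The index sets consist of words because the maps arise from sums over
  monomials.\<close>

definition no_finite_rank :: bool where
  "no_finite_rank \<longleftrightarrow> (\<forall>(K :: nat list set) a b X. finite K \<longrightarrow> finite X \<longrightarrow>
    (\<forall>y. (\<Sum>k\<in>K. a k * y * b k) \<in> cl X) \<longrightarrow> (\<forall>y. (\<Sum>k\<in>K. a k * y * b k) \<in> P))"

text \<open>The terms in which \<open>x\<close> precedes \<open>y\<close> can be separated from the others: otherwise a
  functional in the slots before \<open>x\<close> produces an operator in \<open>y\<close> whose values lie in the closure of
  multiples of the coefficients \<open>r'\<close>.\<close>

lemma separate_order:
  fixes p q r p' q' r' :: "nat list \<Rightarrow> 'r"
  assumes nf: no_finite_rank and fin: "finite W" "finite W'"
    and rel: "\<And>x y. x \<in> M \<Longrightarrow> y \<in> M \<Longrightarrow>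
      (\<Sum>m\<in>W. p m * x * q m * y * r m) + (\<Sum>m\<in>W'. p' m * y * q' m * x * r' m) \<in> P"
    and xy: "x \<in> M" "y \<in> M"
  shows "(\<Sum>m\<in>W. p m * x * q m * y * r m) \<in> P"
proof -
  obtain B where B: "B \<subseteq> p ` W" "finite B" "indep B" "p ` W \<subseteq> cl B"
    using spanning_subset[of "p ` W"] fin by auto
  obtain T \<tau> where T: "dual B T \<tau>" using dual_exists[OF B(2,3) one_notin] by blast
  have pB: "p m \<in> cl B" if "m \<in> W" for m using B(4) that by auto
  \<comment> \<open>A coordinate functional turns the coefficients before x into scalar multiples of
    \<tau>, which can be moved past x. What is left is a map in y alone, and it has finite
    rank.\<close>
  have h: "(\<Sum>m\<in>W. T i (p m) * z * q m * y * r m) \<in> P" if i: "i \<in> B" and y: "y \<in> M" for i z y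
  proof -
    define X where "X = (\<lambda>m. \<tau> * z * r' m) ` W'"
    have Ti: "T i \<in> E" using dual_op[OF T i] .
    have *: "(\<Sum>m\<in>W. T i (p m) * z * q m * y * r m) \<in> cl X" if y: "y \<in> M" for y
    proof (rule clI)
      fix R assume R: "R \<in> E" and RX: "\<And>v. v \<in> X \<Longrightarrow> R v \<in> P"
      have Rt: "(\<lambda>v. R (\<tau> * z * v)) \<in> E" by (rule mops.comp[OF R mops.left])
      have "\<tau> * x * R (\<Sum>m\<in>W. T i (p m) * z * q m * y * r m) \<in> P" if x: "x \<in> M" for x
      proof -
        define a where "a k = (case k of Inl m \<Rightarrow> p m | Inr m \<Rightarrow> p' m * y * q' m)" for k
        define b where "b k = (case k of Inl m \<Rightarrow> q m * y * r m | Inr m \<Rightarrow> r' m)" for k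
        have "(\<Sum>k\<in>W <+> W'. a k * x * b k) \<in> P" if "x \<in> M" for x
          using rel[OF that y] fin by (simp add: sum.Plus a_def b_def mult.assoc)
        from slot_right[OF Rt slot_left[OF Ti this] x]
        have 1: "(\<Sum>k\<in>W <+> W'. T i (a k) * x * R (\<tau> * z * b k)) \<in> P" by simp
        \<comment> \<open>The terms in which y precedes x vanish because R kills X.\<close>
        have "(\<Sum>m\<in>W'. T i (p' m * y * q' m) * x * R (\<tau> * z * r' m)) \<in> P"
          by (intro sum_mem left_mem RX) (auto simp: X_def)
        then have 2: "(\<Sum>m\<in>W. T i (p m) * x * R (\<tau> * z * (q m * y * r m))) \<in> P"
          using 1 fin diff_mem by (fastforce simp: sum.Plus a_def b_def)
        \<comment> \<open>\<open>T i (p m)\<close> and \<tau> trade places around x and R, the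
          former being a scalar multiple of the latter.\<close>
        have "(\<Sum>m\<in>W. T i (p m) * x * R (\<tau> * z * (q m * y * r m))) -
            (\<Sum>m\<in>W. \<tau> * x * R (T i (p m) * z * (q m * y * r m))) \<in> P"
        proof (rule sum_diff_mem)
          fix m assume m: "m \<in> W"
          let ?c = "q m * y * r m"
          have "(\<lambda>v. R (v * (z * ?c))) \<in> E" by (rule mops.comp[OF R mops.right])
          then have "(\<lambda>v. v * (x * R (\<tau> * z * ?c)) - \<tau> * x * R (v * (z * ?c))) \<in> E"
            by (intro mops_diff mops.right mops_left_comp)
          from clD[OF dual_cl[OF T pB[OF m] i] this]
          show "T i (p m) * x * R (\<tau> * z * ?c) - \<tau> * x * R (T i (p m) * z * ?c) \<in> P"
            by (simp add: mult.assoc zero_mem)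
        qed
        then have "(\<Sum>m\<in>W. \<tau> * x * R (T i (p m) * z * (q m * y * r m))) \<in> P"
          using 2 mem_cong by blast
        then show ?thesis by (simp add: op_sum[OF R] sum_distrib_left mult.assoc)
      qed
      then show "R (\<Sum>m\<in>W. T i (p m) * z * q m * y * r m) \<in> P"
        using prime_M dual_nz[OF T] by blast
    qed
    \<comment> \<open>With \<open>v * y\<close> in place of y this becomes a linear map in an
      arbitrary ring element v, as \<open>no_finite_rank\<close> requires; v = 1 gives the
      claim.\<close>
    have fr: "(\<Sum>m\<in>W. (T i (p m) * z * q m) * v * (y * r m)) \<in> cl X" for v
      using *[OF M_left[OF y, of v]] by (simp add: mult.assoc)
    have "finite X" using fin by (simp add: X_def)
    then have "(\<Sum>m\<in>W. (T i (p m) * z * q m) * 1 * (y * r m)) \<in> P"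
      by (rule nf[unfolded no_finite_rank_def, rule_format, OF fin(1) _ fr])
    then show ?thesis by (simp add: mult.assoc)
  qed
  let ?F = "\<Sum>m\<in>W. p m * x * q m * y * r m"
  \<comment> \<open>The coefficients p m are reassembled from their coordinates, at the cost of a
    factor \<tau>.\<close>
  have "\<tau> * u * ?F \<in> P" for u
  proof -
    have "(\<Sum>m\<in>W. \<tau> * u * (p m * x * q m * y * r m)) -
        (\<Sum>m\<in>W. \<Sum>b\<in>B. T b (p m) * (u * b * x) * q m * y * r m) \<in> P"
    proof (rule sum_diff_mem)
      fix m assume m: "m \<in> W"
      have "\<tau> * u * p m - (\<Sum>b\<in>B. T b (p m) * u * b) \<in> P"
        using dual_expand_left[OF T pB[OF m] mops_id] by simp
      from right_mem[OF this, of "x * q m * y * r m"]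
      show "\<tau> * u * (p m * x * q m * y * r m) -
          (\<Sum>b\<in>B. T b (p m) * (u * b * x) * q m * y * r m) \<in> P"
        by (simp add: left_diff_distrib sum_distrib_right mult.assoc)
    qed
    moreover have "(\<Sum>m\<in>W. \<Sum>b\<in>B. T b (p m) * (u * b * x) * q m * y * r m) \<in> P"
      by (subst sum.swap) (intro sum_mem h xy)
    ultimately show ?thesis using mem_cong by (simp add: sum_distrib_left)
  qed
  then show ?thesis using prime_right[of \<tau>] dual_nz[OF T] by blast
qed

section \<open>Ordering the letters of the monomials\<close>

definition before :: "nat \<Rightarrow> nat \<Rightarrow> nat list \<Rightarrow> bool" where
  "before i j w \<longleftrightarrow> (\<exists>u v t. w = u @ i # v @ j # t)"

lemma before_cases:
  assumes "i \<in> set w" "j \<in> set w" "i \<noteq> j" shows "before i j w \<or> before j i w"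
proof -
  obtain u t where w: "w = u @ i # t" using assms(1) by (meson split_list)
  consider "j \<in> set u" | "j \<in> set t" using w assms by auto
  then show ?thesis
  proof cases
    case 1
    then obtain a b where "u = a @ j # b" by (meson split_list)
    then have "w = a @ j # b @ i # t" using w by simp
    then show ?thesis unfolding before_def by blast
  next
    case 2
    then obtain a b where "t = a @ j # b" by (meson split_list)
    then have "w = u @ i # a @ j # b" using w by simp
    then show ?thesis unfolding before_def by blast
  qed
qed

lemma before_asym:
  assumes "distinct w" "before i j w" shows "\<not> before j i w"
proof
  assume "before j i w"
  then obtain u v t where w: "w = u @ j # v @ i # t" by (auto simp: before_def)
  obtain u' v' t' where w': "w = u' @ i # v' @ j # t'" using assms by (auto simp: before_def)
  have "w ! length u = j" "w ! (length u + Suc (length v)) = i"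
    "length u + Suc (length v) < length w" by (simp_all add: w nth_append)
  moreover have "w ! length u' = i" "w ! (length u' + Suc (length v')) = j"
    "length u' + Suc (length v') < length w" by (simp_all add: w' nth_append)
  ultimately have "length u = length u' + Suc (length v')" "length u' = length u + Suc (length v)"
    using assms(1) by (metis add_lessD1 nth_eq_iff_index_eq)+
  then show False by simp
qed

text \<open>A permutation without inversions is sorted. So once all order conditions are imposed on
  the identity, a single monomial is left.\<close>

lemma before_all:
  "{w \<in> perms d. \<forall>(i, j)\<in>{(i, j). i < j \<and> j < d}. before i j w} = {[0..<d]}"
proof (intro equalityI subsetI)
  fix w assume w: "w \<in> {w \<in> perms d. \<forall>(i, j)\<in>{(i, j). i < j \<and> j < d}. before i j w}"
  then have d: "distinct w" "set w = {..<d}" by (auto simp: perms_def)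
  have "sorted w"
  proof (rule ccontr)
    assume "\<not> sorted w"
    then obtain a b where ab: "a < b" "b < length w" "w ! b < w ! a"
      by (auto simp: sorted_iff_nth_mono_less not_le)
    then have "w ! a < d" using d(2) nth_mem[of a w] by auto
    then have bf: "before (w ! b) (w ! a) w" using w ab by auto
    have "w = take a w @ w ! a # take (b - Suc a) (drop (Suc a) w) @ w ! b # drop (Suc b) w"
      using ab id_take_nth_drop[of a w] id_take_nth_drop[of "b - Suc a" "drop (Suc a) w"]
      by (simp add: Suc_diff_Suc)
    then have "before (w ! a) (w ! b) w" unfolding before_def by blast
    then show False using before_asym d(1) bf by blast
  qed
  then have "w = [0..<d]"
    using d sorted_distinct_set_unique[of w "[0..<d]"] by (simp add: atLeast0LessThan)
  then show "w \<in> {[0..<d]}" by simp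
next
  fix w assume "w \<in> {[0..<d]}"
  moreover have "before i j [0..<d]" if "i < j" "j < d" for i j
  proof -
    have "[0..<d] = [0..<i] @ i # [Suc i..<j] @ j # [Suc j..<d]"
      using that upt_add_eq_append[of 0 i "d - i"] upt_conv_Cons[of i d]
        upt_add_eq_append[of "Suc i" j "d - j"] upt_conv_Cons[of j d] by simp
    then show ?thesis unfolding before_def by blast
  qed
  ultimately show "w \<in> {w \<in> perms d. \<forall>(i, j)\<in>{(i, j). i < j \<and> j < d}. before i j w}"
    by (auto simp: perms_def)
qed

lemma map_upd_notin: "i \<notin> set u \<Longrightarrow> map (x(i := a)) u = map x u"
  by (induction u) auto

text \<open>One pair is treated at a time. Of the monomials left so far, those with i before j and
  those with j before i form the two sums of \<open>separate_order\<close>; x i and x j are its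
  variables, and all other letters are frozen into the coefficients.\<close>

lemma identity_ordered:
  assumes nf: no_finite_rank and R: "finite R" "R \<subseteq> {(i, j). i < j \<and> j < d}" and x: "\<And>i. x i \<in> M"
  shows "(\<Sum>w\<in>{w \<in> perms d. \<forall>(i, j)\<in>R. before i j w}. \<alpha> w * prod_list (map x w)) \<in> P"
  using R x
proof (induction R arbitrary: x rule: finite_induct)
  case empty
  then show ?case using identity by simp
next
  case (insert ij R)
  obtain i j where ij: "ij = (i, j)" by force
  then have lt: "i < j" "j < d" using insert.prems by auto
  define S where "S = {w \<in> perms d. \<forall>(i, j)\<in>R. before i j w}"
  define W where "W = {w \<in> S. before i j w}"
  define W' where "W' = {w \<in> S. before j i w}"
  have finS: "finite S" using finite_perms by (simp add: S_def)
  have ijw: "i \<in> set w" "j \<in> set w" "distinct w" if "w \<in> S" for w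
    using that lt by (auto simp: S_def perms_def)
  have SW: "S = W \<union> W'" "W \<inter> W' = {}"
    using before_cases before_asym ijw lt unfolding W_def W'_def by blast+
  have fin: "finite W" "finite W'" using finS SW by auto
  have "\<forall>w\<in>W. \<exists>u v t. w = u @ i # v @ j # t" by (auto simp: W_def before_def)
  then obtain u v t where uvt: "\<And>w. w \<in> W \<Longrightarrow> w = u w @ i # v w @ j # t w" by metis
  have "\<forall>w\<in>W'. \<exists>u v t. w = u @ j # v @ i # t" by (auto simp: W'_def before_def)
  then obtain u' v' t' where uvt': "\<And>w. w \<in> W' \<Longrightarrow> w = u' w @ j # v' w @ i # t' w" by metis
  define p where "p w = \<alpha> w * prod_list (map x (u w))" for w
  define p' where "p' w = \<alpha> w * prod_list (map x (u' w))" for w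
  have val: "\<alpha> w * prod_list (map (x(i := a, j := b)) w) =
      p w * a * prod_list (map x (v w)) * b * prod_list (map x (t w))" if w: "w \<in> W" for w a b
  proof -
    have "distinct w" using ijw[of w] w SW(1) by blast
    then have "distinct (u w @ i # v w @ j # t w)" by (subst (asm) uvt[OF w])
    then have "prod_list (map (x(i := a, j := b)) (u w @ i # v w @ j # t w)) =
        prod_list (map x (u w)) * a * prod_list (map x (v w)) * b * prod_list (map x (t w))"
      using lt by (simp add: map_upd_notin mult.assoc)
    then show ?thesis by (simp add: p_def mult.assoc flip: uvt[OF w])
  qed
  have val': "\<alpha> w * prod_list (map (x(i := a, j := b)) w) =
      p' w * b * prod_list (map x (v' w)) * a * prod_list (map x (t' w))" if w: "w \<in> W'" for w a b
  proof -
    have "distinct w" using ijw[of w] w SW(1) by blast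
    then have "distinct (u' w @ j # v' w @ i # t' w)" by (subst (asm) uvt'[OF w])
    then have "prod_list (map (x(i := a, j := b)) (u' w @ j # v' w @ i # t' w)) =
        prod_list (map x (u' w)) * b * prod_list (map x (v' w)) * a * prod_list (map x (t' w))"
      using lt by (simp add: map_upd_notin mult.assoc)
    then show ?thesis by (simp add: p'_def mult.assoc flip: uvt'[OF w])
  qed
  have "(\<Sum>w\<in>W. p w * a * prod_list (map x (v w)) * b * prod_list (map x (t w))) +
      (\<Sum>w\<in>W'. p' w * b * prod_list (map x (v' w)) * a * prod_list (map x (t' w))) \<in> P"
    if ab: "a \<in> M" "b \<in> M" for a b
  proof -
    have "(\<Sum>w\<in>S. \<alpha> w * prod_list (map (x(i := a, j := b)) w)) \<in> P"
      unfolding S_def using insert.prems ab by (intro insert.IH) auto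
    then show ?thesis by (simp add: SW(1) sum.union_disjoint[OF fin SW(2)] val val')
  qed
  from separate_order[OF nf fin this, of "x i" "x j"]
  have "(\<Sum>w\<in>W. p w * x i * prod_list (map x (v w)) * x j * prod_list (map x (t w))) \<in> P"
    using insert.prems by simp
  moreover have "\<alpha> w * prod_list (map x w) =
      p w * x i * prod_list (map x (v w)) * x j * prod_list (map x (t w))" if "w \<in> W" for w
    using val[OF that, of "x i" "x j"] by simp
  ultimately have "(\<Sum>w\<in>W. \<alpha> w * prod_list (map x w)) \<in> P" by simp
  moreover have "W = {w \<in> perms d. \<forall>(i, j)\<in>insert ij R. before i j w}"
    by (auto simp: W_def S_def ij)
  ultimately show ?case by simp
qed

section \<open>Maps of finite rank and an ideal of finite rank\<close>

lemma prod_notin: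
  assumes "c \<notin> P" shows "\<exists>x. (\<forall>i. x i \<in> M) \<and> c * prod_list (map x [0..<n]) \<notin> P"
proof (induction n)
  case 0
  obtain m where "m \<in> M" using M_nontriv by blast
  then show ?case using assms by (intro exI[of _ "\<lambda>_. m"]) auto
next
  case (Suc n)
  then obtain x where x: "\<And>i. x i \<in> M" "c * prod_list (map x [0..<n]) \<notin> P" by blast
  obtain y where y: "y \<in> M" "c * prod_list (map x [0..<n]) * y * 1 \<notin> P"
    using prime_M[of _ 1] x(2) one_notin by blast
  have "prod_list (map (x(n := y)) [0..<Suc n]) = prod_list (map x [0..<n]) * y"
    by (simp add: map_upd_notin del: fun_upd_apply) simp
  then have "c * prod_list (map (x(n := y)) [0..<Suc n]) \<notin> P"
    using y(2) by (simp only: mult_1_right mult.assoc not_False_eq_True)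
  moreover have "\<forall>i. (x(n := y)) i \<in> M" using x(1) y(1) by simp
  ultimately show ?case by blast
qed

text \<open>Otherwise all order conditions can be imposed, so the single monomial with coefficient
  \<open>\<alpha> [0..<d]\<close> has all its values on M in P, which primeness excludes.\<close>

lemma ex_finite_rank: "\<not> no_finite_rank"
proof
  assume nf: no_finite_rank
  have fin: "finite {(i, j). i < j \<and> j < d}"
    by (rule finite_subset[of _ "{..<d} \<times> {..<d}"]) auto
  have "\<alpha> [0..<d] * prod_list (map x [0..<d]) \<in> P" if "\<And>i. x i \<in> M" for x
    using identity_ordered[OF nf fin subset_refl that] unfolding before_all by simp
  then show False using prod_notin[OF coeff] by blast
qed

text \<open>A left multiplication of the b k only changes the parameter y, a right multiplication
  acts on the values, and sums unite the spanning sets; finite rank is kept in each case.\<close>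

lemma finite_rank_slot:
  assumes "S \<in> E" "finite X" "\<And>y. (\<Sum>k\<in>K. a k * y * b k) \<in> cl X"
  shows "\<exists>X'. finite X' \<and> (\<forall>y. (\<Sum>k\<in>K. a k * y * S (b k)) \<in> cl X')"
  using assms
proof (induction arbitrary: b X rule: mops.induct)
  case (left u)
  have "(\<Sum>k\<in>K. a k * y * (u * b k)) \<in> cl X" for y
    using left(2)[of "y * u"] by (simp add: mult.assoc)
  then show ?case using left(1) by blast
next
  case (right u)
  have "(\<Sum>k\<in>K. a k * y * (b k * u)) \<in> cl ((\<lambda>x. x * u) ` X)" for y
    using cl_op[OF mops.right right(2)[of y], of u] by (simp add: sum_distrib_right mult.assoc)
  then show ?case using right(1) by blast
next
  case (add S T)
  obtain X1 where X1: "finite X1 \<and> (\<forall>y. (\<Sum>k\<in>K. a k * y * S (b k)) \<in> cl X1)"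
    using add.IH(1)[OF add.prems] by (rule exE)
  obtain X2 where X2: "finite X2 \<and> (\<forall>y. (\<Sum>k\<in>K. a k * y * T (b k)) \<in> cl X2)"
    using add.IH(2)[OF add.prems] by (rule exE)
  have "(\<Sum>k\<in>K. a k * y * (S (b k) + T (b k))) \<in> cl (X1 \<union> X2)" for y
  proof -
    have "(\<Sum>k\<in>K. a k * y * S (b k)) + (\<Sum>k\<in>K. a k * y * T (b k)) \<in> cl (X1 \<union> X2)"
      using X1 X2 by (intro cl_add) (auto intro: subsetD[OF cl_mono, rotated])
    then show ?thesis by (simp add: distrib_left sum.distrib)
  qed
  then show ?case using X1 X2 by (intro exI[of _ "X1 \<union> X2"]) simp
next
  case (comp S T)
  obtain X1 where X1: "finite X1 \<and> (\<forall>y. (\<Sum>k\<in>K. a k * y * T (b k)) \<in> cl X1)"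
    using comp.IH(2)[OF comp.prems] by (rule exE)
  show ?case by (rule comp.IH(1)[of X1]) (use X1 in auto)
qed auto

text \<open>A coordinate functional replaces the b k by scalar multiples of one \<tau>. These can be
  moved across x, which merges the whole sum into a single product.\<close>

lemma finite_rank_product:
  obtains a b X where "a \<notin> P" "b \<notin> P" "finite X" "\<And>x. a * x * b \<in> cl X"
proof -
  obtain K :: "nat list set" and a b X where K: "finite K" and X: "finite X"
    and fr: "\<forall>y. (\<Sum>k\<in>K. a k * y * b k) \<in> cl X" and "\<exists>y. (\<Sum>k\<in>K. a k * y * b k) \<notin> P"
    using ex_finite_rank unfolding no_finite_rank_def not_all not_imp by (elim exE conjE) (rule that, (assumption | erule exI)+)
  then obtain y0 where nz: "(\<Sum>k\<in>K. a k * y0 * b k) \<notin> P" by blast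
  obtain B where B: "B \<subseteq> b ` K" "finite B" "indep B" "b ` K \<subseteq> cl B"
    using spanning_subset[of "b ` K"] K by auto
  obtain T \<tau> where T: "dual B T \<tau>" using dual_exists[OF B(2,3) one_notin] by blast
  have bB: "b k \<in> cl B" if "k \<in> K" for k using B(4) that by auto
  \<comment> \<open>If all coordinate maps vanished, expanding the b k in the basis B would make the
    given map vanish at y0.\<close>
  have "\<exists>i\<in>B. \<exists>y. (\<Sum>k\<in>K. a k * y * T i (b k)) \<notin> P"
  proof (rule ccontr)
    assume "\<not> ?thesis"
    then have all: "(\<Sum>k\<in>K. a k * y * T i (b k)) \<in> P" if "i \<in> B" for i y using that by blast
    have "(\<Sum>k\<in>K. a k * y0 * b k) * u * \<tau> \<in> P" for u
    proof -
      have "(\<Sum>k\<in>K. a k * y0 * (b k * u * \<tau>)) - (\<Sum>k\<in>K. \<Sum>i\<in>B. a k * (y0 * i * u) * T i (b k)) \<in> P"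
      proof (rule sum_diff_mem)
        fix k assume k: "k \<in> K"
        have "b k * u * \<tau> - (\<Sum>i\<in>B. i * u * T i (b k)) \<in> P"
          using dual_expand_right[OF T bB[OF k] mops_id] by simp
        from left_mem[OF this, of "a k * y0"]
        show "a k * y0 * (b k * u * \<tau>) - (\<Sum>i\<in>B. a k * (y0 * i * u) * T i (b k)) \<in> P"
          by (simp add: right_diff_distrib sum_distrib_left mult.assoc)
      qed
      moreover have "(\<Sum>k\<in>K. \<Sum>i\<in>B. a k * (y0 * i * u) * T i (b k)) \<in> P"
        by (subst sum.swap) (intro sum_mem all)
      ultimately show ?thesis using mem_cong by (simp add: sum_distrib_right mult.assoc)
    qed
    then show False using prime_left[of \<tau>] dual_nz[OF T] nz by blast
  qed
  then obtain i y where i: "i \<in> B" and y: "(\<Sum>k\<in>K. a k * y * T i (b k)) \<notin> P" by blast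
  obtain X' where X': "finite X' \<and> (\<forall>y. (\<Sum>k\<in>K. a k * y * T i (b k)) \<in> cl X')"
    using finite_rank_slot[OF dual_op[OF T i] X fr[rule_format]] by (rule exE)
  \<comment> \<open>The sum on the left becomes the factor a of the claim and \<tau> the factor b;
    up to P the product is the value of the coordinate map at \<open>y * \<tau> * x\<close>.\<close>
  have "(\<Sum>k\<in>K. a k * y * T i (b k)) * x * \<tau> \<in> cl X'" for x
  proof -
    have "(\<Sum>k\<in>K. a k * y * (T i (b k) * x * \<tau>)) - (\<Sum>k\<in>K. a k * y * (\<tau> * x * T i (b k))) \<in> P"
    proof (rule sum_diff_mem)
      fix k assume k: "k \<in> K"
      have "\<tau> \<in> cl {\<tau>}" using cl_superset by blast
      then have "T i (b k) * x * \<tau> - \<tau> * x * T i (b k) \<in> P"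
        by (rule cl_commute[OF dual_cl[OF T bB[OF k] i]])
      from left_mem[OF this, of "a k * y"]
      show "a k * y * (T i (b k) * x * \<tau>) - a k * y * (\<tau> * x * T i (b k)) \<in> P"
        by (simp add: right_diff_distrib)
    qed
    from cl_cong[OF this, of X'] conjunct2[OF X', rule_format, of "y * \<tau> * x"] show ?thesis
      by (simp add: sum_distrib_right mult.assoc)
  qed
  then show ?thesis by (rule that[OF y dual_nz[OF T] conjunct1[OF X']])
qed

text \<open>The product and the opposite product are treated at once.\<close>

context
  fixes mu :: "'r \<Rightarrow> 'r \<Rightarrow> 'r"
  assumes mu: "mu = (\<lambda>x y. x * y) \<or> mu = (\<lambda>x y. y * x)"
begin

lemma mu_assoc: "mu (mu x y) z = mu x (mu y z)"
  and mu_one: "mu x 1 = x" "mu 1 x = x"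
  and mu_sum: "mu (sum f A) x = (\<Sum>a\<in>A. mu (f a) x)"
  and mu_mem: "x \<in> P \<Longrightarrow> mu u x \<in> P" and mu_M: "x \<in> M \<Longrightarrow> mu x u \<in> M"
  using mu by (auto simp: mult.assoc sum_distrib_left sum_distrib_right left_mem right_mem M_left M_right)

lemma mu_prime: "(\<And>x. x \<in> M \<Longrightarrow> mu (mu u x) v \<in> P) \<Longrightarrow> u \<in> P \<or> v \<in> P"
  using mu prime_M[of u v] prime_M[of v u] by (auto simp: mult.assoc)

lemma mu_slot:
  assumes "S \<in> E" "\<And>x. x \<in> M \<Longrightarrow> (\<Sum>k\<in>K. mu (mu (a k) x) (b k)) \<in> P" "x \<in> M"
  shows "(\<Sum>k\<in>K. mu (mu (a k) x) (S (b k))) \<in> P"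
  using mu
proof
  assume "mu = (\<lambda>x y. x * y)"
  then show ?thesis using slot_right[OF assms(1), where K = K and a = a and b = b and x = x] assms by simp
next
  assume "mu = (\<lambda>x y. y * x)"
  then show ?thesis using slot_left[OF assms(1), where K = K and a = b and b = a and x = x] assms by (simp add: mult.assoc)
qed

definition muprod :: "'r list \<Rightarrow> 'r" where "muprod xs = foldr mu xs 1"

lemma muprod_simps: "muprod [] = 1" "muprod (x # xs) = mu x (muprod xs)"
  by (simp_all add: muprod_def)

lemma muprod_append: "muprod (xs @ ys) = mu (muprod xs) (muprod ys)"
  by (induction xs) (simp_all add: muprod_simps mu_assoc mu_one)

text \<open>The opposite product reverses every monomial. Relabelling the variables by i to d - 1 -
  i as well fixes the word \<open>[0..<d]\<close>, so the distinguished coefficient is still outside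
  P.\<close>

lemma mu_identity:
  obtains \<beta> where "\<beta> [0..<d] \<notin> P"
    "\<And>x. (\<And>i. x i \<in> M) \<Longrightarrow> (\<Sum>w\<in>perms d. mu (\<beta> w) (muprod (map x w))) \<in> P"
  using mu
proof
  assume m: "mu = (\<lambda>x y. x * y)"
  then have mu_eq: "mu x y = x * y" for x y by simp
  have mp: "muprod xs = prod_list xs" for xs
  proof (induction xs)
    case (Cons x xs)
    have "muprod (x # xs) = x * muprod xs" unfolding muprod_simps by (rule mu_eq)
    then show ?case using Cons by simp
  qed (simp add: muprod_simps)
  have "(\<Sum>w\<in>perms d. mu (\<alpha> w) (muprod (map x w))) \<in> P" if x: "\<And>i. x i \<in> M" for x
    using identity[of x, OF x] unfolding mp mu_eq .
  then show ?thesis by (rule that[of \<alpha>, OF coeff])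
next
  assume m: "mu = (\<lambda>x y. y * x)"
  then have mu_eq: "mu x y = y * x" for x y by simp
  have mp: "muprod xs = prod_list (rev xs)" for xs
  proof (induction xs)
    case (Cons x xs)
    have "muprod (x # xs) = muprod xs * x" unfolding muprod_simps by (rule mu_eq)
    then show ?case using Cons by simp
  qed (simp add: muprod_simps)
  define \<pi> where "\<pi> i = d - 1 - i" for i
  define f where "f w = map \<pi> (rev w)" for w
  have inj: "inj_on \<pi> {..<d}" by (rule inj_onI) (simp add: \<pi>_def)
  have "\<pi> ` {..<d} \<subseteq> {..<d}" by (simp add: \<pi>_def image_subset_iff)
  then have im: "\<pi> ` {..<d} = {..<d}" by (rule endo_inj_surj[OF finite_lessThan _ inj])
  have ff: "f (f w) = w" if "w \<in> perms d" for w
  proof -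
    have "map (\<pi> \<circ> \<pi>) w = w"
      using that by (intro map_idI) (simp add: \<pi>_def perms_def)
    then show ?thesis by (simp add: f_def rev_map)
  qed
  have fp: "f w \<in> perms d" if "w \<in> perms d" for w
    using that inj im by (simp add: f_def perms_def distinct_map)
  have f0: "f [0..<d] = [0..<d]"
    by (rule nth_equalityI) (auto simp: f_def \<pi>_def rev_nth)
  have "(\<Sum>w\<in>perms d. mu (\<alpha> (f w)) (muprod (map x w))) \<in> P" if x: "\<And>i. x i \<in> M" for x
  proof -
    have "(\<Sum>w\<in>perms d. mu (\<alpha> (f w)) (muprod (map x w))) =
        (\<Sum>w\<in>perms d. mu (\<alpha> w) (muprod (map x (f w))))"
      by (rule sum.reindex_bij_witness[of _ f f]) (auto simp: ff fp)
    also have "\<dots> = (\<Sum>w\<in>perms d. prod_list (map (\<lambda>i. x (\<pi> i)) w) * \<alpha> w)"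
      unfolding mp mu_eq by (simp add: f_def rev_map comp_def)
    finally have "(\<Sum>w\<in>perms d. mu (\<alpha> (f w)) (muprod (map x w))) =
      (\<Sum>w\<in>perms d. prod_list (map (\<lambda>i. x (\<pi> i)) w) * \<alpha> w)" .
    moreover have "(\<Sum>w\<in>perms d. \<alpha> w * prod_list (map (\<lambda>i. x (\<pi> i)) w)) -
        (\<Sum>w\<in>perms d. prod_list (map (\<lambda>i. x (\<pi> i)) w) * \<alpha> w) \<in> P"
      by (intro sum_diff_mem coeff_central)
    ultimately show ?thesis using identity[of "\<lambda>i. x (\<pi> i)"] x mem_cong by auto
  qed
  moreover have "\<alpha> (f [0..<d]) \<notin> P" unfolding f0 by (rule coeff)
  ultimately show ?thesis using that[of "\<lambda>w. \<alpha> (f w)"] by blast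
qed

lemma muprod_last: "u \<noteq> [] \<Longrightarrow> \<exists>l. mu z (muprod (map (\<lambda>i. mu (r i) (j i)) u)) = mu l (j (last u))"
  by (induction u rule: rev_induct) (auto simp: muprod_append muprod_simps mu_one simp flip: mu_assoc)

text \<open>Multiples of the j i are substituted into the identity, and the largest index k is
  eliminated first: T k, applied to the part of a monomial that starts with j k, kills it unless k
  is the last letter. Hence only monomials ending in k survive, and primeness cancels their last
  factor.\<close>

lemma no_long_chain:
  assumes T: "\<And>k. k < d \<Longrightarrow> T k \<in> E" "\<And>k i l. k < d \<Longrightarrow> i < k \<Longrightarrow> T k (mu l (j i)) \<in> P"
    "\<And>k. k < d \<Longrightarrow> T k (j k) \<notin> P"
  shows False
proof -
  obtain \<beta> where \<beta>: "\<beta> [0..<d] \<notin> P"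
    and id: "\<And>x. (\<And>i. x i \<in> M) \<Longrightarrow> (\<Sum>w\<in>perms d. mu (\<beta> w) (muprod (map x w))) \<in> P"
    using mu_identity by blast
  define X where "X r i = mu (r i) (j i)" for r i
  \<comment> \<open>The identity restricted to the monomials in which the letters k, ..., d - 1 come
    last in increasing order, with their factors already cancelled; \<open>Qp 0\<close> puts the
    distinguished coefficient into P.\<close>
  define Qp where "Qp k \<longleftrightarrow> (\<forall>r. (\<forall>i. r i \<in> M) \<longrightarrow>
      (\<Sum>u\<in>perms k. mu (\<beta> (u @ [k..<d])) (muprod (map (X r) u))) \<in> P)" for k
  have step: "Qp k" if Qs: "Qp (Suc k)" and k: "k < d" for k
    unfolding Qp_def
  proof (intro allI impI)
    fix r :: "nat \<Rightarrow> 'r" assume r: "\<forall>i. r i \<in> M"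
    define f where "f w = takeWhile (\<lambda>x. x \<noteq> k) w" for w :: "nat list"
    define g where "g w = tl (dropWhile (\<lambda>x. x \<noteq> k) w)" for w :: "nat list"
    have split: "w = f w @ k # g w" if "w \<in> perms (Suc k)" for w
    proof -
      have "dropWhile (\<lambda>x. x \<noteq> k) w \<noteq> []" using that by (auto simp: perms_def dropWhile_eq_Nil_conv)
      then have "dropWhile (\<lambda>x. x \<noteq> k) w = k # g w"
        using hd_dropWhile[of "\<lambda>x. x \<noteq> k" w] by (cases "dropWhile (\<lambda>x. x \<noteq> k) w") (auto simp: g_def)
      then show ?thesis unfolding f_def by (metis takeWhile_dropWhile_id)
    qed
    have parts: "k \<notin> set (f w)" "k \<notin> set (g w)" "set (f w) \<subseteq> {..<k}" "set (g w) \<subseteq> {..<k}" "distinct (f w)"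
      if w: "w \<in> perms (Suc k)" for w
    proof -
      have "distinct w" "set w = {..<Suc k}" using w by (auto simp: perms_def)
      then have "distinct (f w @ k # g w)" "set (f w @ k # g w) = {..<Suc k}"
        by (simp_all only: split[OF w, symmetric])
      then show "k \<notin> set (f w)" "k \<notin> set (g w)" "set (f w) \<subseteq> {..<k}" "set (g w) \<subseteq> {..<k}" "distinct (f w)"
        by (auto simp: less_Suc_eq)
    qed
    \<comment> \<open>With r k as free variable a monomial reads A w, then r k, then B w; the part B
      w starts with j k and ends with some j i, i < k, unless k is the last letter.\<close>
    define A where "A w = mu (\<beta> (w @ [Suc k..<d])) (muprod (map (X r) (f w)))" for w
    define B where "B w = mu (j k) (muprod (map (X r) (g w)))" for w
    have "(\<Sum>w\<in>perms (Suc k). mu (mu (A w) y) (B w)) \<in> P" if y: "y \<in> M" for y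
    proof -
      have "(\<Sum>w\<in>perms (Suc k). mu (\<beta> (w @ [Suc k..<d])) (muprod (map (X (r(k := y))) w))) \<in> P"
        using Qs r y unfolding Qp_def by simp
      moreover have "mu (\<beta> (w @ [Suc k..<d])) (muprod (map (X (r(k := y))) w)) = mu (mu (A w) y) (B w)"
        if w: "w \<in> perms (Suc k)" for w
      proof -
        have 1: "map (X (r(k := y))) (f w) = map (X r) (f w)" "map (X (r(k := y))) (g w) = map (X r) (g w)"
          using parts[OF w] by (auto simp: X_def)
        have "map (X (r(k := y))) w = map (X r) (f w) @ mu y (j k) # map (X r) (g w)"
          by (subst split[OF w]) (simp add: 1 del: fun_upd_apply, simp add: X_def)
        then show ?thesis by (simp add: A_def B_def muprod_append muprod_simps mu_assoc)
      qed
      ultimately show ?thesis by simp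
    qed
    from mu_slot[OF T(1)[OF k] this]
    have *: "(\<Sum>w\<in>perms (Suc k). mu (mu (A w) y) (T k (B w))) \<in> P" if "y \<in> M" for y using that by simp
    define W where "W = {w \<in> perms (Suc k). g w = []}"
    have "mu (mu (\<Sum>w\<in>W. A w) y) (T k (j k)) \<in> P" if y: "y \<in> M" for y
    proof -
      have rest: "(\<Sum>w\<in>perms (Suc k) - W. mu (mu (A w) y) (T k (B w))) \<in> P"
      proof (intro sum_mem mu_mem)
        fix w assume w: "w \<in> perms (Suc k) - W"
        then have ne: "g w \<noteq> []" by (auto simp: W_def)
        obtain l where "B w = mu l (j (last (g w)))"
          using muprod_last[OF ne, of "j k" r j] unfolding B_def X_def by auto
        moreover have "last (g w) < k" using parts(4)[of w] w ne last_in_set by blast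
        ultimately show "T k (B w) \<in> P" using T(2)[OF k] by simp
      qed
      have total: "(\<Sum>w\<in>perms (Suc k). mu (mu (A w) y) (T k (B w))) =
          (\<Sum>w\<in>perms (Suc k) - W. mu (mu (A w) y) (T k (B w))) + (\<Sum>w\<in>W. mu (mu (A w) y) (T k (B w)))"
        by (rule sum.subset_diff[OF _ finite_perms]) (auto simp: W_def)
      have main: "(\<Sum>w\<in>W. mu (mu (A w) y) (T k (B w))) = mu (mu (\<Sum>w\<in>W. A w) y) (T k (j k))"
      proof -
        have "B w = j k" if "w \<in> W" for w
          using that unfolding B_def W_def by (simp add: muprod_simps mu_one)
        then have "(\<Sum>w\<in>W. mu (mu (A w) y) (T k (B w))) = (\<Sum>w\<in>W. mu (mu (A w) y) (T k (j k)))"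
          by (intro sum.cong) simp_all
        then show ?thesis by (simp only: mu_sum)
      qed
      from diff_mem[OF *[OF y, unfolded total] rest] show ?thesis by (simp only: main add_diff_cancel_left')
    qed
    then have AP: "(\<Sum>w\<in>W. A w) \<in> P" using mu_prime T(3)[OF k] by blast
    have "(\<Sum>w\<in>W. A w) = (\<Sum>u\<in>perms k. A (u @ [k]))"
    proof (rule sum.reindex_bij_witness[of _ "\<lambda>u. u @ [k]" f])
      fix w assume w: "w \<in> W"
      then have wp: "w \<in> perms (Suc k)" and g: "g w = []" by (auto simp: W_def)
      have eq: "w = f w @ [k]" using split[OF wp] g by simp
      then show "f w @ [k] = w" by simp
      have "set (f w @ [k]) = {..<Suc k}" using wp eq by (auto simp: perms_def)
      then have "set (f w) = {..<k}" using parts[OF wp] by auto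
      then show "f w \<in> perms k" using parts[OF wp] by (simp add: perms_def)
      show "A (f w @ [k]) = A w" using eq by simp
    next
      fix u assume u: "u \<in> perms k"
      then have ku: "k \<notin> set u" by (auto simp: perms_def)
      have ap: "\<And>x. x \<in> set u \<Longrightarrow> x \<noteq> k" using ku by auto
      show fu: "f (u @ [k]) = u" unfolding f_def by (subst takeWhile_append2) (use ap in auto)
      have "dropWhile (\<lambda>x. x \<noteq> k) (u @ [k]) = dropWhile (\<lambda>x. x \<noteq> k) [k]"
        by (rule dropWhile_append2) (rule ap)
      also have "\<dots> = [k]" by simp
      finally have "g (u @ [k]) = []" unfolding g_def by (simp only: list.sel)
      moreover have "u @ [k] \<in> perms (Suc k)"
        using u by (simp add: perms_def lessThan_Suc)
      ultimately show "u @ [k] \<in> W" by (simp add: W_def)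
    qed
    also have "\<dots> = (\<Sum>u\<in>perms k. mu (\<beta> (u @ [k..<d])) (muprod (map (X r) u)))"
    proof (rule sum.cong[OF refl])
      fix u assume u: "u \<in> perms k"
      then have ap: "\<And>x. x \<in> set u \<Longrightarrow> x \<noteq> k" by (auto simp: perms_def)
      have "f (u @ [k]) = u" unfolding f_def by (subst takeWhile_append2) (use ap in auto)
      then show "A (u @ [k]) = mu (\<beta> (u @ [k..<d])) (muprod (map (X r) u))"
        using upt_conv_Cons[OF k] by (simp add: A_def)
    qed
    finally show "(\<Sum>u\<in>perms k. mu (\<beta> (u @ [k..<d])) (muprod (map (X r) u))) \<in> P" using AP by simp
  qed
  have Qd: "Qp d" using id M_left mu_M by (simp add: Qp_def X_def)
  have "k \<le> d \<Longrightarrow> Qp (d - k)" for k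
  proof (induction k)
    case (Suc k)
    then show ?case using step[of "d - Suc k"] by (simp add: Suc_diff_Suc)
  qed (use Qd in simp)
  from this[of d] have Q0: "Qp 0" by simp
  obtain m where "m \<in> M" using M_nontriv by blast
  then have "(\<Sum>u\<in>perms 0. mu (\<beta> (u @ [0..<d])) (muprod (map (X (\<lambda>_. m)) u))) \<in> P"
    using Q0[unfolded Qp_def, rule_format, of "\<lambda>_. m"] by simp
  moreover have "perms 0 = {[]}" by (auto simp: perms_def)
  ultimately show False using \<beta> by (simp add: muprod_simps mu_one)
qed

text \<open>Up to closure the one-sided ideal generated by any set is finitely generated: otherwise
  d elements of Z could be chosen, each outside the closure of the multiples of its
  predecessors.\<close>

lemma finite_generation:
  obtains S where "finite S" "S \<subseteq> Z" "Z \<subseteq> cl {mu l s | l s. s \<in> S}"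
proof (rule ccontr)
  assume "\<not> thesis"
  then have nex: "\<exists>z\<in>Z. z \<notin> cl {mu l s | l s. s \<in> S}" if "finite S" "S \<subseteq> Z" for S
    using that(1,2) \<open>(\<And>S. finite S \<Longrightarrow> S \<subseteq> Z \<Longrightarrow> Z \<subseteq> cl {mu l s |l s. s \<in> S} \<Longrightarrow> thesis)\<close> by blast
  have "\<exists>js. length js = n \<and> set js \<subseteq> Z \<and>
      (\<forall>i<n. js ! i \<notin> cl {mu l s | l s. s \<in> set (take i js)})" for n
  proof (induction n)
    case (Suc n)
    then obtain js where js: "length js = n" "set js \<subseteq> Z"
      "\<And>i. i < n \<Longrightarrow> js ! i \<notin> cl {mu l s | l s. s \<in> set (take i js)}" by blast
    obtain z where z: "z \<in> Z" "z \<notin> cl {mu l s | l s. s \<in> set js}" using nex[of "set js"] js by auto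
    show ?case
      using js z by (intro exI[of _ "js @ [z]"]) (auto simp: nth_append less_Suc_eq)
  qed auto
  then obtain js where js: "length js = d" "set js \<subseteq> Z"
    "\<And>i. i < d \<Longrightarrow> js ! i \<notin> cl {mu l s | l s. s \<in> set (take i js)}" by blast
  have "\<exists>T. T \<in> E \<and> (\<forall>i<k. \<forall>l. T (mu l (js ! i)) \<in> P) \<and> T (js ! k) \<notin> P" if k: "k < d" for k
  proof -
    obtain T where T: "T \<in> E" "\<And>y. y \<in> {mu l s | l s. s \<in> set (take k js)} \<Longrightarrow> T y \<in> P"
      "T (js ! k) \<in> UNIV" "T (js ! k) \<notin> P" by (rule separate[OF js(3)[OF k]]) (rule that)
    have "T (mu l (js ! i)) \<in> P" if "i < k" for i l
    proof (rule T(2))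
      have "js ! i \<in> set (take k js)"
        unfolding in_set_conv_nth using that k js(1) by (intro exI[of _ i]) simp
      then show "mu l (js ! i) \<in> {mu l s | l s. s \<in> set (take k js)}" by blast
    qed
    then show ?thesis using T(1,4) by (intro exI[of _ T] conjI allI impI)
  qed
  then obtain T where "\<And>k. k < d \<Longrightarrow> T k \<in> E" "\<And>k i l. k < d \<Longrightarrow> i < k \<Longrightarrow> T k (mu l (js ! i)) \<in> P"
    "\<And>k. k < d \<Longrightarrow> T k (js ! k) \<notin> P" by metis
  then show False by (rule no_long_chain)
qed

end

text \<open>All a x b lie in a finite closure, and outer factors have to be added. The right ideal
  of b is covered by left multiples of finitely many \<open>b * \<sigma> s\<close>, the left ideal
  of a by right multiples of finitely many \<open>\<rho> s * a\<close>; the multipliers on the inner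
  side are absorbed into x, and finitely many outer ones remain.\<close>

lemma finite_rank_ideal:
  obtains h X where "h \<notin> P" "finite X" "\<And>T. T \<in> E \<Longrightarrow> T h \<in> cl X"
proof -
  obtain a b X where ab: "a \<notin> P" "b \<notin> P" "finite X" and abX: "\<And>x. a * x * b \<in> cl X"
    by (rule finite_rank_product) blast
  obtain S where S: "finite S" "S \<subseteq> range (\<lambda>s. b * s)" "range (\<lambda>s. b * s) \<subseteq> cl {l * s | l s. s \<in> S}"
    by (rule finite_generation[OF disjI1[OF refl]]) (rule that)
  have "\<forall>s\<in>S. \<exists>t. s = b * t" using S(2) by auto
  from bchoice[OF this] obtain \<sigma> where \<sigma>: "\<forall>s\<in>S. s = b * \<sigma> s" by (rule exE)
  define X1 where "X1 = (\<Union>s\<in>S. (\<lambda>x. x * \<sigma> s) ` X)"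
  have fin1: "finite X1" using S(1) ab(3) by (simp add: X1_def)
  have ab1: "a * x * b * s \<in> cl X1" for x s
  proof -
    have "b * s \<in> cl {l * s | l s. s \<in> S}" using S(3) by blast
    from cl_op[OF mops.left this, of "a * x"]
    have "a * x * (b * s) \<in> cl ((\<lambda>y. a * x * y) ` {l * s | l s. s \<in> S})" by simp
    moreover have "(\<lambda>y. a * x * y) ` {l * s | l s. s \<in> S} \<subseteq> cl X1"
    proof clarify
      fix l s assume s: "s \<in> S"
      then have sb: "s = b * \<sigma> s" by (rule bspec[OF \<sigma>])
      have "a * (x * l) * b * \<sigma> s \<in> cl ((\<lambda>x. x * \<sigma> s) ` X)"
        using cl_op[OF mops.right abX, of "x * l" "\<sigma> s"] by simp
      moreover have "(\<lambda>x. x * \<sigma> s) ` X \<subseteq> X1" using s by (auto simp: X1_def)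
      ultimately have "a * (x * l) * b * \<sigma> s \<in> cl X1" using cl_mono by blast
      moreover have "a * (x * l) * b * \<sigma> s = a * x * (l * (b * \<sigma> s))"
        by (simp add: mult.assoc)
      ultimately show "a * x * (l * s) \<in> cl X1" by (simp flip: sb)
    qed
    ultimately have "a * x * (b * s) \<in> cl X1" by (rule cl_trans)
    then show ?thesis by (simp add: mult.assoc)
  qed
  obtain S' where S': "finite S'" "S' \<subseteq> range (\<lambda>t. t * a)" "range (\<lambda>t. t * a) \<subseteq> cl {s * l | l s. s \<in> S'}"
    by (rule finite_generation[OF disjI2[OF refl]]) (rule that)
  have "\<forall>s\<in>S'. \<exists>t. s = t * a" using S'(2) by auto
  from bchoice[OF this] obtain \<rho> where \<rho>: "\<forall>s\<in>S'. s = \<rho> s * a" by (rule exE)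
  define X2 where "X2 = (\<Union>s\<in>S'. (\<lambda>x. \<rho> s * x) ` X1)"
  have fin2: "finite X2" using S'(1) fin1 by (simp add: X2_def)
  have ab2: "t * (a * x * b) * s \<in> cl X2" for t x s
  proof -
    have "t * a \<in> cl {s * l | l s. s \<in> S'}" using S'(3) by blast
    from cl_op[OF mops.right this, of "x * b * s"]
    have "t * a * (x * b * s) \<in> cl ((\<lambda>y. y * (x * b * s)) ` {s * l | l s. s \<in> S'})" by simp
    moreover have "(\<lambda>y. y * (x * b * s)) ` {s * l | l s. s \<in> S'} \<subseteq> cl X2"
    proof clarify
      fix l s' assume s: "s' \<in> S'"
      then have sb: "s' = \<rho> s' * a" by (rule bspec[OF \<rho>])
      have "\<rho> s' * (a * (l * x) * b * s) \<in> cl ((\<lambda>x. \<rho> s' * x) ` X1)"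
        using cl_op[OF mops.left ab1, of "\<rho> s'" "l * x" s] by simp
      moreover have "(\<lambda>x. \<rho> s' * x) ` X1 \<subseteq> X2" using s by (auto simp: X2_def)
      ultimately have "\<rho> s' * (a * (l * x) * b * s) \<in> cl X2" using cl_mono by blast
      moreover have "\<rho> s' * (a * (l * x) * b * s) = \<rho> s' * a * l * (x * b * s)"
        by (simp add: mult.assoc)
      ultimately show "s' * l * (x * b * s) \<in> cl X2" by (simp flip: sb)
    qed
    ultimately have "t * a * (x * b * s) \<in> cl X2" by (rule cl_trans)
    then show ?thesis by (simp add: mult.assoc)
  qed
  obtain x where x: "a * x * b \<notin> P" using prime ab by blast
  have "T z \<in> cl X2" if "T \<in> E" "\<And>t s. t * z * s \<in> cl X2" for T z
  proof -
    have "t * T z * s \<in> cl X2" for t s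
      using that
    proof (induction arbitrary: z t s rule: mops.induct)
      case (left u)
      then show ?case using left(1)[of "t * u" s] by (simp add: mult.assoc)
    next
      case (right u)
      then show ?case using right(1)[of t "u * s"] by (simp add: mult.assoc)
    next
      case (add S T)
      then show ?case by (simp add: distrib_left distrib_right cl_add)
    qed auto
    from this[of 1 1] show ?thesis by simp
  qed
  then show ?thesis using that[OF x fin2] ab2 by blast
qed

end

section \<open>Graded prime rings with a multilinear identity\<close>

text \<open>\<open>coeff\<close> asks for a coefficient that is invertible modulo N, because it has
  to stay outside the larger ideal in which the identity will be used. Homogeneity of degree g is
  expressed as \<open>Pr g x = x\<close>.\<close>

locale graded_prime_pi = two_sided_ideal N + G: group G
  for N :: "'r::ring_1 set" and G :: "('g, 'l) monoid_scheme" (structure) +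
  fixes Pr :: "'g \<Rightarrow> 'r \<Rightarrow> 'r" and M :: "'r set" and \<alpha> :: "nat list \<Rightarrow> 'r" and d :: nat
  assumes fin_G: "finite (carrier G)"
    and Pr_add: "g \<in> carrier G \<Longrightarrow> Pr g (x + y) = Pr g x + Pr g y"
    and Pr_Pr: "g \<in> carrier G \<Longrightarrow> h \<in> carrier G \<Longrightarrow> Pr g (Pr h x) = (if g = h then Pr h x else 0)"
    and Pr_sum: "(\<Sum>g\<in>carrier G. Pr g x) = x"
    and Pr_mult: "g \<in> carrier G \<Longrightarrow> h \<in> carrier G \<Longrightarrow> Pr g x = x \<Longrightarrow> Pr h y = y \<Longrightarrow>
      Pr (g \<otimes> h) (x * y) = x * y"
    and Pr_one: "Pr \<one> 1 = 1"
    and Pr_mem: "g \<in> carrier G \<Longrightarrow> x \<in> N \<Longrightarrow> Pr g x \<in> N"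
    and prime_graded: "g \<in> carrier G \<Longrightarrow> h \<in> carrier G \<Longrightarrow> Pr g x = x \<Longrightarrow> Pr h y = y \<Longrightarrow>
      (\<And>u. x * u * y \<in> N) \<Longrightarrow> x \<in> N \<or> y \<in> N"
    and torsion_free: "0 < n \<Longrightarrow> of_nat n * x \<in> N \<Longrightarrow> x \<in> N"
    and M_left: "x \<in> M \<Longrightarrow> u * x \<in> M"
    and M_right: "x \<in> M \<Longrightarrow> x * u \<in> M"
    and M_nontriv: "\<exists>m\<in>M. \<exists>g\<in>carrier G. Pr g m = m \<and> m \<notin> N"
    and identity: "(\<And>i. f i \<in> M) \<Longrightarrow> (\<Sum>w\<in>perms d. \<alpha> w * prod_list (map f w)) \<in> N"
    and coeff: "\<exists>\<beta>. \<beta> * \<alpha> [0..<d] - 1 \<in> N"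
    and coeff_central: "\<alpha> w * x - x * \<alpha> w \<in> N"
begin

section \<open>Components of products and operators in a graded ring\<close>

definition Hm :: "'r set" where "Hm = {x. \<exists>g\<in>carrier G. Pr g x = x}"

lemma Pr_zero: "g \<in> carrier G \<Longrightarrow> Pr g 0 = 0"
  using Pr_add[of g 0 0] by simp

lemma Pr_setsum: "g \<in> carrier G \<Longrightarrow> Pr g (sum f I) = (\<Sum>i\<in>I. Pr g (f i))"
  by (induction I rule: infinite_finite_induct) (auto simp: Pr_zero Pr_add)

lemma Pr_hom: "g \<in> carrier G \<Longrightarrow> h \<in> carrier G \<Longrightarrow> Pr h x = x \<Longrightarrow> Pr g x = (if g = h then x else 0)"
  using Pr_Pr[of g h x] by simp

lemma Pr_in_Hm: "g \<in> carrier G \<Longrightarrow> Pr g x \<in> Hm"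
  unfolding Hm_def using Pr_Pr[of g g x] by auto

text \<open>Multiplication by an element of degree k shifts all degrees by the bijection g to
  \<open>g \<otimes> k\<close>, so the components of the product are the shifted components of
  x.\<close>

lemma Pr_mult_right:
  assumes "g \<in> carrier G" "k \<in> carrier G" "Pr k u = u"
  shows "Pr (g \<otimes> k) (x * u) = Pr g x * u"
proof -
  have "Pr (g \<otimes> k) (x * u) = Pr (g \<otimes> k) (\<Sum>l\<in>carrier G. Pr l x * u)"
    by (simp add: Pr_sum flip: sum_distrib_right)
  also have "\<dots> = (\<Sum>l\<in>carrier G. Pr (g \<otimes> k) (Pr l x * u))" using assms by (intro Pr_setsum) simp
  also have "\<dots> = (\<Sum>l\<in>carrier G. if l = g then Pr g x * u else 0)"
  proof (rule sum.cong[OF refl])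
    fix l assume l: "l \<in> carrier G"
    have "Pr (l \<otimes> k) (Pr l x * u) = Pr l x * u" using l assms Pr_mult Pr_Pr by simp
    then have "Pr (g \<otimes> k) (Pr l x * u) = (if g \<otimes> k = l \<otimes> k then Pr l x * u else 0)"
      using l assms by (intro Pr_hom) simp_all
    then show "Pr (g \<otimes> k) (Pr l x * u) = (if l = g then Pr g x * u else 0)"
      using l assms by auto
  qed
  finally show ?thesis using assms fin_G by simp
qed

lemma Pr_mult_left:
  assumes "g \<in> carrier G" "k \<in> carrier G" "Pr k u = u"
  shows "Pr (k \<otimes> g) (u * x) = u * Pr g x"
proof -
  have "Pr (k \<otimes> g) (u * x) = Pr (k \<otimes> g) (\<Sum>l\<in>carrier G. u * Pr l x)"
    by (simp add: Pr_sum flip: sum_distrib_left)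
  also have "\<dots> = (\<Sum>l\<in>carrier G. Pr (k \<otimes> g) (u * Pr l x))" using assms by (intro Pr_setsum) simp
  also have "\<dots> = (\<Sum>l\<in>carrier G. if l = g then u * Pr g x else 0)"
  proof (rule sum.cong[OF refl])
    fix l assume l: "l \<in> carrier G"
    have "Pr (k \<otimes> l) (u * Pr l x) = u * Pr l x" using l assms Pr_mult Pr_Pr by simp
    then have "Pr (k \<otimes> g) (u * Pr l x) = (if k \<otimes> g = k \<otimes> l then u * Pr l x else 0)"
      using l assms by (intro Pr_hom) simp_all
    then show "Pr (k \<otimes> g) (u * Pr l x) = (if l = g then u * Pr g x else 0)"
      using l assms by auto
  qed
  finally show ?thesis using assms fin_G by simp
qed

lemma Pr_one_mult: "Pr \<one> (x * y) = (\<Sum>g\<in>carrier G. Pr g x * Pr (inv g) y)"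
proof -
  have "Pr \<one> (x * y) = Pr \<one> (\<Sum>g\<in>carrier G. Pr g x * y)"
    by (simp add: Pr_sum flip: sum_distrib_right)
  also have "\<dots> = (\<Sum>g\<in>carrier G. Pr (g \<otimes> inv g) (Pr g x * y))" by (subst Pr_setsum) simp_all
  also have "\<dots> = (\<Sum>g\<in>carrier G. Pr g x * Pr (inv g) y)"
    by (intro sum.cong[OF refl] Pr_mult_left) (simp_all add: Pr_Pr)
  finally show ?thesis .
qed

lemma mem_if_Pr_mem: "(\<And>g. g \<in> carrier G \<Longrightarrow> Pr g x \<in> N) \<Longrightarrow> x \<in> N"
  using sum_mem[of "carrier G" "\<lambda>g. Pr g x"] by (simp add: Pr_sum)

sublocale op_prime N "Pr ` carrier G" Hm
proof
  show "q (x + y) = q x + q y" if "q \<in> Pr ` carrier G" for q x y using that Pr_add by auto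
  show "q x \<in> N" if "q \<in> Pr ` carrier G" "x \<in> N" for q x using that Pr_mem by auto
  show "\<exists>T\<in>mops (Pr ` carrier G). T x \<in> Hm \<and> T x \<notin> N" if x: "x \<notin> N" for x
  proof -
    obtain g where "g \<in> carrier G" "Pr g x \<notin> N" using x mem_if_Pr_mem by blast
    then show ?thesis by (intro bexI[of _ "Pr g"]) (auto intro: Pr_in_Hm mops.base)
  qed
  show "u \<in> N \<or> v \<in> N" if "u \<in> Hm" "v \<in> Hm" "\<And>x. u * x * v \<in> N" for u v
    using that prime_graded[of _ _ u v] unfolding Hm_def by blast
  show "q x * u * y \<in> N" if q: "q \<in> Pr ` carrier G" and y: "y \<in> Hm" and x: "\<And>u. x * u * y \<in> N" for q x u y
  proof -
    obtain g where g: "g \<in> carrier G" "q = Pr g" using q by blast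
    obtain h where h: "h \<in> carrier G" "Pr h y = y" using y by (auto simp: Hm_def)
    \<comment> \<open>This is the component of \<open>x * Pr k u * y\<close> in degree
      \<open>g \<otimes> (k \<otimes> h)\<close>, and N is closed under components; summing over k
      restores u.\<close>
    have "Pr g x * Pr k u * y \<in> N" if k: "k \<in> carrier G" for k
    proof -
      have "Pr (k \<otimes> h) (Pr k u * y) = Pr k u * y" using k h Pr_mult Pr_Pr by simp
      then have "Pr (g \<otimes> (k \<otimes> h)) (x * (Pr k u * y)) = Pr g x * (Pr k u * y)"
        using k h g by (intro Pr_mult_right) simp_all
      moreover have "Pr (g \<otimes> (k \<otimes> h)) (x * (Pr k u * y)) \<in> N"
        using x[of "Pr k u"] k h g by (intro Pr_mem) (simp_all add: mult.assoc)
      ultimately show ?thesis by (simp add: mult.assoc)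
    qed
    then have "(\<Sum>k\<in>carrier G. Pr g x * Pr k u * y) \<in> N" by (rule sum_mem)
    then show ?thesis by (simp add: g Pr_sum flip: sum_distrib_left sum_distrib_right)
  qed
  show "y * u * q x \<in> N" if q: "q \<in> Pr ` carrier G" and y: "y \<in> Hm" and x: "\<And>u. y * u * x \<in> N" for q x u y
  proof -
    obtain g where g: "g \<in> carrier G" "q = Pr g" using q by blast
    obtain h where h: "h \<in> carrier G" "Pr h y = y" using y by (auto simp: Hm_def)
    have "y * Pr k u * Pr g x \<in> N" if k: "k \<in> carrier G" for k
    proof -
      have "Pr (h \<otimes> k) (y * Pr k u) = y * Pr k u" using k h Pr_mult Pr_Pr by simp
      then have "Pr ((h \<otimes> k) \<otimes> g) (y * Pr k u * x) = y * Pr k u * Pr g x"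
        using k h g by (intro Pr_mult_left) simp_all
      moreover have "Pr ((h \<otimes> k) \<otimes> g) (y * Pr k u * x) \<in> N"
        using x[of "Pr k u"] k h g by (intro Pr_mem) simp_all
      ultimately show ?thesis by simp
    qed
    then have "(\<Sum>k\<in>carrier G. y * Pr k u * Pr g x) \<in> N" by (rule sum_mem)
    then show ?thesis by (simp add: g Pr_sum flip: sum_distrib_left sum_distrib_right)
  qed
qed

lemma Pr_op: "g \<in> carrier G \<Longrightarrow> Pr g \<in> E"
  by (rule mops.base) simp

lemma Pr_op_comp: "g \<in> carrier G \<Longrightarrow> T \<in> E \<Longrightarrow> (\<lambda>x. Pr g (T x)) \<in> E"
  by (rule mops.comp[OF Pr_op])

lemma prime_hom_ex:
  assumes "u \<in> Hm" "u \<notin> N" "v \<in> Hm" "v \<notin> N"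
  obtains x k where "k \<in> carrier G" "Pr k x = x" "u * x * v \<notin> N" "u * x * v \<in> Hm"
proof -
  obtain g h where gh: "g \<in> carrier G" "Pr g u = u" "h \<in> carrier G" "Pr h v = v"
    using assms by (auto simp: Hm_def)
  obtain x where x: "u * x * v \<notin> N" using prime_hom[OF assms(1,3)] assms(2,4) by auto
  have "\<exists>k\<in>carrier G. u * Pr k x * v \<notin> N"
  proof (rule ccontr)
    assume "\<not> ?thesis"
    then have "(\<Sum>k\<in>carrier G. u * Pr k x * v) \<in> N" by (intro sum_mem) blast
    then show False using x by (simp add: Pr_sum flip: sum_distrib_left sum_distrib_right)
  qed
  then obtain k where k: "k \<in> carrier G" "u * Pr k x * v \<notin> N" by blast
  have "Pr (g \<otimes> k \<otimes> h) (u * Pr k x * v) = u * Pr k x * v"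
    using gh k Pr_mult Pr_Pr by simp
  then have "u * Pr k x * v \<in> Hm" using gh k unfolding Hm_def by blast
  then show ?thesis using that[OF k(1) _ k(2)] k Pr_Pr by simp
qed

text \<open>Between two fixed degrees the projections disappear: a multiplication is replaced by the
  one component of its factor that leads from g to h, and a composition is summed over the
  intermediate degrees. This makes graded operators usable modulo an ideal that is not
  graded.\<close>

lemma hom_op_base:
  assumes "T \<in> E" "g \<in> carrier G" "h \<in> carrier G"
  shows "\<exists>S\<in>mops {}. \<forall>x. Pr g x = x \<longrightarrow> Pr h (T x) = S x"
  using assms
proof (induction arbitrary: g h rule: mops.induct)
  case (left u)
  have "Pr h (u * x) = Pr (h \<otimes> inv g) u * x" if "Pr g x = x" for x
    using Pr_mult_right[of "h \<otimes> inv g" g x u] left that by (simp add: G.m_assoc)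
  then show ?case by (intro bexI[of _ "\<lambda>x. Pr (h \<otimes> inv g) u * x"] mops.left) simp
next
  case (right u)
  have "Pr h (x * u) = x * Pr (inv g \<otimes> h) u" if "Pr g x = x" for x
    using Pr_mult_left[of "inv g \<otimes> h" g x u] right that by (simp flip: G.m_assoc)
  then show ?case by (intro bexI[of _ "\<lambda>x. x * Pr (inv g \<otimes> h) u"] mops.right) simp
next
  case (base q)
  then obtain k where k: "k \<in> carrier G" "q = Pr k" by blast
  show ?case
  proof (cases "h = k \<and> k = g")
    case True
    then show ?thesis using k by (intro bexI[of _ "\<lambda>x. x"] mops_id) simp
  next
    case False
    then have "Pr h (q x) = 0" if "Pr g x = x" for x
      using that k base Pr_Pr[of h k x] Pr_hom[of k g x] by (auto simp: Pr_zero)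
    then show ?thesis by (intro bexI[of _ "\<lambda>x. 0"] mops_zero) simp
  qed
next
  case (add S T)
  obtain S' where S': "S' \<in> mops {}" "\<forall>x. Pr g x = x \<longrightarrow> Pr h (S x) = S' x"
    using add.IH(1)[OF add.prems] by (rule bexE)
  obtain T' where T': "T' \<in> mops {}" "\<forall>x. Pr g x = x \<longrightarrow> Pr h (T x) = T' x"
    using add.IH(2)[OF add.prems] by (rule bexE)
  show ?case using S' T' add.prems
    by (intro bexI[of _ "\<lambda>x. S' x + T' x"] mops.add) (simp_all add: Pr_add)
next
  case (comp S T)
  have "\<forall>k\<in>carrier G. \<exists>R. R \<in> mops {} \<and> (\<forall>x. Pr g x = x \<longrightarrow> Pr h (S (Pr k (T x))) = R x)"
  proof
    fix k assume k: "k \<in> carrier G"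
    obtain T' where T': "T' \<in> mops {}" "\<forall>x. Pr g x = x \<longrightarrow> Pr k (T x) = T' x"
      using comp.IH(2)[OF comp.prems(1) k] by (rule bexE)
    obtain S' where S': "S' \<in> mops {}" "\<forall>x. Pr k x = x \<longrightarrow> Pr h (S x) = S' x"
      using comp.IH(1)[OF k comp.prems(2)] by (rule bexE)
    have "Pr h (S (Pr k (T x))) = S' (T' x)" if "Pr g x = x" for x
    proof -
      have "Pr h (S (Pr k (T x))) = S' (Pr k (T x))" using S'(2) k Pr_Pr by simp
      then show ?thesis using T'(2) that by simp
    qed
    then show "\<exists>R. R \<in> mops {} \<and> (\<forall>x. Pr g x = x \<longrightarrow> Pr h (S (Pr k (T x))) = R x)"
      using mops.comp[OF S'(1) T'(1)] by (intro exI[of _ "\<lambda>x. S' (T' x)"]) simp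
  qed
  from bchoice[OF this] obtain R where R: "\<forall>k\<in>carrier G. R k \<in> mops {} \<and>
      (\<forall>x. Pr g x = x \<longrightarrow> Pr h (S (Pr k (T x))) = R k x)" by (rule exE)
  have "Pr h (S (T x)) = (\<Sum>k\<in>carrier G. R k x)" if "Pr g x = x" for x
  proof -
    have "S (T x) = (\<Sum>k\<in>carrier G. S (Pr k (T x)))"
      by (simp add: Pr_sum flip: op_sum[OF comp.hyps(1)])
    then have "Pr h (S (T x)) = (\<Sum>k\<in>carrier G. Pr h (S (Pr k (T x))))"
      using Pr_setsum comp.prems by simp
    also have "\<dots> = (\<Sum>k\<in>carrier G. R k x)" using R that by (intro sum.cong) simp_all
    finally show ?thesis .
  qed
  moreover have "(\<lambda>x. \<Sum>k\<in>carrier G. R k x) \<in> mops {}" using R by (intro mops_sum) blast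
  ultimately show ?case by (intro bexI[of _ "\<lambda>x. \<Sum>k\<in>carrier G. R k x"]) simp_all
qed

text \<open>Zorn: an ideal that is maximal among those containing no homogeneous element outside \<open>N\<close>
  is prime in the ungraded sense.\<close>

lemma ex_maximal:
  obtains P where "two_sided_ideal P" "N \<subseteq> P" "P \<inter> Hm \<subseteq> N"
    "\<And>I. two_sided_ideal I \<Longrightarrow> P \<subseteq> I \<Longrightarrow> I \<noteq> P \<Longrightarrow> \<exists>u\<in>I. u \<in> Hm \<and> u \<notin> N"
proof -
  define \<A> where "\<A> = {I. two_sided_ideal I \<and> N \<subseteq> I \<and> I \<inter> Hm \<subseteq> N}"
  have "N \<in> \<A>" using two_sided_ideal_axioms by (auto simp: \<A>_def)
  moreover have "\<Union>\<C> \<in> \<A>" if ne: "\<C> \<noteq> {}" and ch: "subset.chain \<A> \<C>" for \<C>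
  proof -
    have sub: "\<C> \<subseteq> \<A>" and lin: "\<And>X Y. X \<in> \<C> \<Longrightarrow> Y \<in> \<C> \<Longrightarrow> X \<subseteq> Y \<or> Y \<subseteq> X"
      using ch by (auto simp: subset.chain_def)
    have id: "two_sided_ideal X" if "X \<in> \<C>" for X using sub that by (auto simp: \<A>_def)
    have "two_sided_ideal (\<Union>\<C>)"
    proof
      show "0 \<in> \<Union>\<C>" using ne two_sided_ideal.zero_mem[OF id] by blast
      show "x + y \<in> \<Union>\<C>" if "x \<in> \<Union>\<C>" "y \<in> \<Union>\<C>" for x y
      proof -
        obtain X Y where XY: "X \<in> \<C>" "Y \<in> \<C>" "x \<in> X" "y \<in> Y" using \<open>x \<in> \<Union>\<C>\<close> \<open>y \<in> \<Union>\<C>\<close> by blast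
        then consider "x \<in> Y" | "y \<in> X" using lin by blast
        then show ?thesis
        proof cases
          case 1
          then show ?thesis using two_sided_ideal.add_mem[OF id[OF XY(2)] _ XY(4)] XY(2) by blast
        next
          case 2
          then show ?thesis using two_sided_ideal.add_mem[OF id[OF XY(1)] XY(3)] XY(1) by blast
        qed
      qed
      show "u * x \<in> \<Union>\<C>" if "x \<in> \<Union>\<C>" for u x using that two_sided_ideal.left_mem[OF id] by blast
      show "x * u \<in> \<Union>\<C>" if "x \<in> \<Union>\<C>" for u x using that two_sided_ideal.right_mem[OF id] by blast
    qed
    moreover have "N \<subseteq> \<Union>\<C>" "\<Union>\<C> \<inter> Hm \<subseteq> N" using ne sub by (auto simp: \<A>_def)
    ultimately show ?thesis by (simp add: \<A>_def)
  qed
  ultimately obtain P where P: "P \<in> \<A>" and max: "\<forall>X\<in>\<A>. P \<subseteq> X \<longrightarrow> X = P"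
    using subset_Zorn_nonempty[of \<A>] by blast
  show ?thesis
  proof (rule that)
    show "two_sided_ideal P" "N \<subseteq> P" "P \<inter> Hm \<subseteq> N" using P by (auto simp: \<A>_def)
    show "\<exists>u\<in>I. u \<in> Hm \<and> u \<notin> N" if "two_sided_ideal I" "P \<subseteq> I" "I \<noteq> P" for I
    proof (rule ccontr)
      assume "\<not> ?thesis"
      then have "I \<in> \<A>" using that P by (auto simp: \<A>_def)
      then show False using max that by blast
    qed
  qed
qed

section \<open>A graded ideal of finite rank\<close>

definition idl :: "'r \<Rightarrow> 'r set" where "idl u = {T u | T. T \<in> E}"

lemma idl_self: "u \<in> idl u"
  unfolding idl_def by (intro CollectI exI[of _ "\<lambda>x. x"]) (simp add: mops_id)

lemma idl_op:
  assumes "T \<in> E" "x \<in> idl u" shows "T x \<in> idl u"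
proof -
  obtain S where S: "x = S u" "S \<in> E" using assms(2) unfolding idl_def by blast
  show ?thesis
    unfolding idl_def S(1)
    by (intro CollectI exI[of _ "\<lambda>x. T (S x)"]) (simp add: mops.comp[OF assms(1) S(2)])
qed

lemma idl_add:
  assumes "x \<in> idl u" "y \<in> idl u" shows "x + y \<in> idl u"
proof -
  obtain S T where S: "x = S u" "S \<in> E" "y = T u" "T \<in> E" using assms unfolding idl_def by blast
  show ?thesis
    unfolding idl_def S(1,3)
    by (intro CollectI exI[of _ "\<lambda>x. S x + T x"]) (simp add: mops.add[OF S(2,4)])
qed

lemma idl_left: "x \<in> idl u \<Longrightarrow> v * x \<in> idl u"
  by (rule idl_op[OF mops.left])

lemma idl_right: "x \<in> idl u \<Longrightarrow> x * v \<in> idl u"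
  by (rule idl_op[OF mops.right])

lemma idl_Pr: "g \<in> carrier G \<Longrightarrow> x \<in> idl u \<Longrightarrow> Pr g x \<in> idl u"
  by (rule idl_op[OF Pr_op])

text \<open>The elements whose images under all multiplication operators lie in one finite closure
  modulo P form an ideal larger than P. By maximality of P it contains a homogeneous element outside
  N.\<close>

lemma finite_rank_graded_ideal:
  obtains u Y where "u \<in> Hm" "u \<notin> N" "u \<in> M" "finite Y" "idl u \<subseteq> cl Y"
proof -
  obtain P where P: "two_sided_ideal P" "N \<subseteq> P" "P \<inter> Hm \<subseteq> N"
    and max: "\<And>I. two_sided_ideal I \<Longrightarrow> P \<subseteq> I \<Longrightarrow> I \<noteq> P \<Longrightarrow> \<exists>u\<in>I. u \<in> Hm \<and> u \<notin> N"
    by (rule ex_maximal) blast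
  interpret P: two_sided_ideal P by (rule P(1))
  interpret P: prime_pi P M \<alpha> d
  proof
    show "u \<in> P \<or> v \<in> P" if uv: "\<And>y. u * y * v \<in> P" for u v
    proof (rule ccontr)
      assume n: "\<not> (u \<in> P \<or> v \<in> P)"
      \<comment> \<open>If u and v are outside P, then I and the annihilator K of I modulo P are
        both larger than P, so each contains a homogeneous element outside N. Graded primeness
        yields a homogeneous product of the two outside N, although it lies in P.\<close>
      define I where "I = {x. \<forall>y. x * y * v \<in> P}"
      have "two_sided_ideal I"
      proof
        show "s * x \<in> I" if "x \<in> I" for s x using that P.left_mem by (simp add: I_def mult.assoc)
        show "x * s \<in> I" if "x \<in> I" for s x
          unfolding I_def
        proof (intro CollectI allI)
          fix y
          have "x * (s * y) * v \<in> P" using that by (simp add: I_def)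
          then show "x * s * y * v \<in> P" by (simp add: mult.assoc)
        qed
      qed (use P.zero_mem P.add_mem in \<open>simp_all add: I_def distrib_right\<close>)
      moreover have "P \<subseteq> I" using P.right_mem by (auto simp: I_def)
      moreover have "u \<in> I" using uv by (simp add: I_def)
      ultimately obtain a where a: "a \<in> I" "a \<in> Hm" "a \<notin> N" using max[of I] n by blast
      define K where "K = {x. \<forall>z\<in>I. \<forall>y. z * y * x \<in> P}"
      have "two_sided_ideal K"
      proof
        show "s * x \<in> K" if "x \<in> K" for s x
          unfolding K_def
        proof (intro CollectI ballI allI)
          fix z y assume "z \<in> I"
          then have "z * (y * s) * x \<in> P" using that by (simp add: K_def)
          then show "z * y * (s * x) \<in> P" by (simp add: mult.assoc)
        qed
        show "x * s \<in> K" if "x \<in> K" for s x using that P.right_mem by (simp add: K_def flip: mult.assoc)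
      qed (use P.zero_mem P.add_mem in \<open>simp_all add: K_def distrib_left\<close>)
      moreover have "P \<subseteq> K" using P.left_mem by (auto simp: K_def)
      moreover have "v \<in> K" by (auto simp: K_def I_def)
      ultimately obtain b where b: "b \<in> K" "b \<in> Hm" "b \<notin> N" using max[of K] n by blast
      obtain x k where "a * x * b \<notin> N" "a * x * b \<in> Hm" using prime_hom_ex[OF a(2,3) b(2,3)] by blast
      moreover have "a * x * b \<in> P" using a(1) b(1) by (simp add: K_def)
      ultimately show False using P(3) by blast
    qed
    show "\<exists>m\<in>M. m \<notin> P" using M_nontriv P(3) unfolding Hm_def by blast
    show "(\<Sum>w\<in>perms d. \<alpha> w * prod_list (map x w)) \<in> P" if "\<And>i. x i \<in> M" for x
      by (rule subsetD[OF P(2) identity[OF that]])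
    show "\<alpha> w * y - y * \<alpha> w \<in> P" for w y by (rule subsetD[OF P(2) coeff_central])
    show "\<alpha> [0..<d] \<notin> P"
    proof
      assume "\<alpha> [0..<d] \<in> P"
      moreover obtain \<beta> where "\<beta> * \<alpha> [0..<d] - 1 \<in> P" using coeff P(2) by blast
      ultimately have "1 \<in> P" using P.left_mem P.mem_cong by blast
      moreover have "1 \<in> Hm" using Pr_one by (auto simp: Hm_def)
      ultimately have "1 \<in> N" using P(3) by blast
      then show False using M_nontriv left_mem[of 1] by auto
    qed
  qed (auto intro: M_left M_right)
  obtain h X where h: "h \<notin> P" "finite X" "\<And>T. T \<in> mops {} \<Longrightarrow> T h \<in> P.cl X"
    by (rule P.finite_rank_ideal) (rule that)
  define I where "I = {z. \<forall>T\<in>mops {}. T z \<in> P.cl X}"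
  have "two_sided_ideal I"
  proof
    show "0 \<in> I" using subsetD[OF P.cl_N P.op_mem] P.zero_mem by (simp add: I_def)
    show "x + y \<in> I" if "x \<in> I" "y \<in> I" for x y using that by (simp add: I_def P.op_add P.cl_add)
    show "u * x \<in> I" if "x \<in> I" for u x
      unfolding I_def
    proof (intro CollectI ballI)
      fix T :: "'r \<Rightarrow> 'r" assume "T \<in> mops {}"
      from mops.comp[OF this mops.left, of u] have "(\<lambda>x. T (u * x)) \<in> mops {}" .
      from bspec[OF that[unfolded I_def, THEN CollectD] this] show "T (u * x) \<in> P.cl X" .
    qed
    show "x * u \<in> I" if "x \<in> I" for u x
      unfolding I_def
    proof (intro CollectI ballI)
      fix T :: "'r \<Rightarrow> 'r" assume "T \<in> mops {}"
      from mops.comp[OF this mops.right, of u] have "(\<lambda>x. T (x * u)) \<in> mops {}" .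
      from bspec[OF that[unfolded I_def, THEN CollectD] this] show "T (x * u) \<in> P.cl X" .
    qed
  qed
  then interpret I: two_sided_ideal I .
  have "P \<subseteq> I"
  proof
    fix x assume "x \<in> P"
    then show "x \<in> I" unfolding I_def using subsetD[OF P.cl_N P.op_mem] by simp
  qed
  moreover have "h \<in> I" using h(3) by (simp add: I_def)
  ultimately obtain a where a: "a \<in> I" "a \<in> Hm" "a \<notin> N" using max[OF I.two_sided_ideal_axioms] h(1) by blast
  obtain m where m: "m \<in> M" "m \<in> Hm" "m \<notin> N" using M_nontriv unfolding Hm_def by blast
  obtain x k where x: "a * x * m \<notin> N" "a * x * m \<in> Hm" using prime_hom_ex[OF a(2,3) m(2,3)] by blast
  \<comment> \<open>The factor m from M carries the element of I into M without leaving I.\<close>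
  define u where "u = a * x * m"
  have u: "u \<in> Hm" "u \<notin> N" "u \<in> M" "u \<in> I"
    using x m(1) a(1) M_left I.right_mem by (auto simp: u_def mult.assoc)
  obtain gu where gu: "gu \<in> carrier G" "Pr gu u = u" using u(1) by (auto simp: Hm_def)
  \<comment> \<open>Within one degree, independence modulo N passes to P: the separating operator
    can be replaced by a multiplication operator there, and its homogeneous value outside N is also
    outside P.\<close>
  have bound: "card B \<le> card X"
    if g: "g \<in> carrier G" and B: "finite B" "indep B" "B \<subseteq> {x \<in> idl u. Pr g x = x}" for g B
  proof (rule P.steinitz[OF B(1) h(2)])
    show "P.indep B"
      unfolding opindep_def
    proof
      fix b assume b: "b \<in> B"
      then have nb: "b \<notin> cl (B - {b})" using B(2) by (auto simp: opindep_def)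
      obtain T where T: "T \<in> E" "\<And>y. y \<in> B - {b} \<Longrightarrow> T y \<in> N" "T b \<in> Hm" "T b \<notin> N"
        by (rule separate[OF nb]) (rule that)
      obtain k where k: "k \<in> carrier G" "Pr k (T b) = T b" using T(3) by (auto simp: Hm_def)
      obtain S where S: "S \<in> mops {}" "\<forall>x. Pr g x = x \<longrightarrow> Pr k (T x) = S x"
        using hom_op_base[OF T(1) g k(1)] by (rule bexE)
      have gB: "Pr g y = y" if "y \<in> B" for y using that B(3) by auto
      have Sb: "S b = T b" using S(2)[rule_format, OF gB[OF b]] k(2) by simp
      have "S y \<in> P" if y: "y \<in> B - {b}" for y
      proof -
        have "S y = Pr k (T y)" using S(2)[rule_format, OF gB[of y]] y by simp
        then show ?thesis using Pr_mem[OF k(1) T(2)[OF y]] P(2) by auto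
      qed
      then have "S b \<in> P" if "b \<in> P.cl (B - {b})" using P.clD[OF that S(1)] by simp
      then show "b \<notin> P.cl (B - {b})" using Sb T(3,4) P(3) by auto
    qed
    show "B \<subseteq> P.cl X"
    proof
      fix b assume "b \<in> B"
      then obtain T where T: "T \<in> E" "b = T u" "Pr g b = b" using B(3) by (auto simp: idl_def)
      obtain S where "S \<in> mops {}" "\<forall>x. Pr gu x = x \<longrightarrow> Pr g (T x) = S x"
        using hom_op_base[OF T(1) gu(1) g] by (rule bexE)
      then have "S \<in> mops {}" "b = S u" using T gu by auto
      then show "b \<in> P.cl X" using u(4) by (auto simp: I_def)
    qed
  qed
  have "\<forall>g\<in>carrier G. \<exists>B. finite B \<and> {x \<in> idl u. Pr g x = x} \<subseteq> cl B"
  proof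
    fix g assume g: "g \<in> carrier G"
    have ind: "indep {}" by (simp add: opindep_def)
    show "\<exists>B. finite B \<and> {x \<in> idl u. Pr g x = x} \<subseteq> cl B"
    proof (rule basis_bounded[OF _ finite.emptyI ind empty_subsetI])
      show "card B \<le> card X" if "finite B" "indep B" "B \<subseteq> {x \<in> idl u. Pr g x = x}" for B
        using that by (rule bound[OF g])
    qed blast
  qed
  from bchoice[OF this] obtain B where B: "\<forall>g\<in>carrier G. finite (B g) \<and> {x \<in> idl u. Pr g x = x} \<subseteq> cl (B g)"
    by (rule exE)
  have "idl u \<subseteq> cl (\<Union>g\<in>carrier G. B g)"
  proof
    fix x assume x: "x \<in> idl u"
    have "(\<Sum>g\<in>carrier G. Pr g x) \<in> cl (\<Union>g\<in>carrier G. B g)"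
    proof (rule cl_sum)
      fix g assume g: "g \<in> carrier G"
      then have "Pr g x \<in> {x \<in> idl u. Pr g x = x}" using idl_Pr x Pr_Pr by simp
      then have "Pr g x \<in> cl (B g)" using B g by blast
      then show "Pr g x \<in> cl (\<Union>g\<in>carrier G. B g)" using cl_mono[of "B g" "\<Union>g\<in>carrier G. B g"] g by blast
    qed
    then show "x \<in> cl (\<Union>g\<in>carrier G. B g)" by (simp add: Pr_sum)
  qed
  moreover have "finite (\<Union>g\<in>carrier G. B g)" using B fin_G by blast
  ultimately show ?thesis using that u by blast
qed

section \<open>The trace form and central elements\<close>

definition gr_right :: "'r set \<Rightarrow> bool" where
  "gr_right J \<longleftrightarrow> 0 \<in> J \<and> (\<forall>x\<in>J. \<forall>y\<in>J. x + y \<in> J) \<and> (\<forall>x\<in>J. \<forall>v. x * v \<in> J) \<and>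
    (\<forall>x\<in>J. \<forall>g\<in>carrier G. Pr g x \<in> J)"

lemma gr_rightD:
  assumes "gr_right J"
  shows "0 \<in> J" "x \<in> J \<Longrightarrow> y \<in> J \<Longrightarrow> x + y \<in> J" "x \<in> J \<Longrightarrow> x * v \<in> J"
    "x \<in> J \<Longrightarrow> g \<in> carrier G \<Longrightarrow> Pr g x \<in> J"
  using assms by (auto simp: gr_right_def)

lemma gr_right_diff: "gr_right J \<Longrightarrow> x \<in> J \<Longrightarrow> y \<in> J \<Longrightarrow> x - y \<in> J"
  using gr_rightD(2)[of J x "- y"] gr_rightD(3)[of J y "-1"] by simp

lemma gr_right_sum: "gr_right J \<Longrightarrow> (\<And>i. i \<in> I \<Longrightarrow> f i \<in> J) \<Longrightarrow> sum f I \<in> J"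
  by (induction I rule: infinite_finite_induct) (auto intro: gr_rightD)

lemma gr_right_hom_ex:
  assumes "gr_right J" "\<not> J \<subseteq> N" obtains j where "j \<in> J" "j \<in> Hm" "j \<notin> N"
proof -
  obtain x where x: "x \<in> J" "x \<notin> N" using assms by blast
  obtain g where "g \<in> carrier G" "Pr g x \<notin> N" using mem_if_Pr_mem x(2) by blast
  then show ?thesis using that[of "Pr g x"] gr_rightD(4)[OF assms(1) x(1)] Pr_in_Hm by blast
qed

lemma gr_right_idl: "gr_right (idl u)"
proof -
  have "0 \<in> idl u" using idl_left[OF idl_self, of 0 u] by simp
  then show ?thesis unfolding gr_right_def using idl_add idl_right idl_Pr by blast
qed

lemma indep_empty: "indep {}"
  by (simp add: opindep_def)

text \<open>Minimality is meant in terms of rank. A graded right ideal inside J that is not inside N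
  has at least the rank of J, so a basis of it already spans J up to closure.\<close>

lemma ex_minimal_right:
  assumes u: "u \<in> Hm" "u \<notin> N" and Y: "finite Y" "idl u \<subseteq> cl Y"
  obtains J BJ where "gr_right J" "J \<subseteq> idl u" "\<not> J \<subseteq> N" "finite BJ" "indep BJ" "BJ \<subseteq> J" "J \<subseteq> cl BJ"
    "\<And>J'. gr_right J' \<Longrightarrow> J' \<subseteq> J \<Longrightarrow> \<not> J' \<subseteq> N \<Longrightarrow> J \<subseteq> cl J'"
proof -
  let ?P = "\<lambda>n. \<exists>J B. gr_right J \<and> J \<subseteq> idl u \<and> \<not> J \<subseteq> N \<and> finite B \<and> indep B \<and> B \<subseteq> J \<and>
    J \<subseteq> cl B \<and> card B = n"
  obtain B0 where B0: "finite B0" "indep B0" "{} \<subseteq> B0" "B0 \<subseteq> idl u" "idl u \<subseteq> cl B0"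
    by (rule basis_extend[OF Y finite.emptyI indep_empty empty_subsetI]) (rule that)
  have "\<not> idl u \<subseteq> N" using idl_self u(2) by blast
  then have "?P (card B0)" using B0 gr_right_idl by blast
  then have "?P (LEAST n. ?P n)" by (rule LeastI)
  then obtain J BJ where J: "gr_right J" "J \<subseteq> idl u" "\<not> J \<subseteq> N" and BJ: "finite BJ" "indep BJ" "BJ \<subseteq> J"
    "J \<subseteq> cl BJ" and card: "card BJ = (LEAST n. ?P n)" by (elim exE conjE) (rule that)
  have "J \<subseteq> cl J'" if J': "gr_right J'" "J' \<subseteq> J" "\<not> J' \<subseteq> N" for J'
  proof -
    have J'Y: "J' \<subseteq> cl BJ" using J'(2) BJ(4) by blast
    obtain B' where B': "finite B'" "indep B'" "{} \<subseteq> B'" "B' \<subseteq> J'" "J' \<subseteq> cl B'"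
      by (rule basis_extend[OF BJ(1) J'Y finite.emptyI indep_empty empty_subsetI]) (rule that)
    have "?P (card B')" using B' J' J(2) by blast
    then have le: "card BJ \<le> card B'" unfolding card by (rule Least_le)
    have "J \<subseteq> cl B'"
    proof
      fix x assume x: "x \<in> J"
      show "x \<in> cl B'"
      proof (rule ccontr)
        assume nx: "x \<notin> cl B'"
        then have xB: "x \<notin> B'" using cl_superset[of B'] by blast
        have "card (insert x B') \<le> card BJ"
          using B'(1,4) J'(2) BJ x by (intro steinitz indep_insert[OF B'(2) nx]) auto
        then show False using xB le B'(1) by simp
      qed
    qed
    then show ?thesis using cl_mono[OF B'(4)] by blast
  qed
  then show ?thesis using that J BJ by blast
qed

context
  fixes u J BJ B T \<tau>
  assumes J: "gr_right J" "J \<subseteq> idl u" "\<not> J \<subseteq> N"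
    and BJ: "finite BJ" "BJ \<subseteq> J" "J \<subseteq> cl BJ"
    and J_min: "\<And>J'. gr_right J' \<Longrightarrow> J' \<subseteq> J \<Longrightarrow> \<not> J' \<subseteq> N \<Longrightarrow> J \<subseteq> cl J'"
    and B: "BJ \<subseteq> B" "B \<subseteq> idl u" "idl u \<subseteq> cl B"
    and dual: "dual B T \<tau>"
begin

text \<open>\<tau> times the trace of left multiplication by x on the ideal of u, computed in the
  basis B.\<close>

definition tr :: "'r \<Rightarrow> 'r" where "tr x = (\<Sum>b\<in>B. T b (x * b))"

text \<open>Restricting to degree \<open>\<one>\<close> makes \<open>Pr g\<close> and
  \<open>Pr (inv g)\<close> adjoint to each other, and later forces the values of the adjoint of the
  trace into degree \<open>\<one>\<close>.\<close>

definition tr1 :: "'r \<Rightarrow> 'r" where "tr1 x = tr (Pr \<one> x)"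

lemma tr_op: "tr \<in> E"
  unfolding tr_def[abs_def] by (intro mops_sum mops.comp[OF dual_op[OF dual] mops.right])

lemma tr1_op: "tr1 \<in> E"
  unfolding tr1_def[abs_def] by (intro mops.comp[OF tr_op Pr_op]) simp

lemma mem_cl_B: "x * b \<in> cl B" if "b \<in> B"
  using that B idl_left by blast

text \<open>The trace of a product of matrices: the entries of r and s are
  \<open>T i (r * j)\<close> and \<open>T j (s * i)\<close>. Each entry carries a factor \<tau>,
  hence the additional \<tau> on the left.\<close>

lemma tr_mult: "tr (r * s) * v * \<tau> - (\<Sum>i\<in>B. \<Sum>j\<in>B. T i (r * j) * v * T j (s * i)) \<in> N"
proof -
  have "T i (r * (s * i)) * v * \<tau> - (\<Sum>j\<in>B. T i (r * j) * v * T j (s * i)) \<in> N" if i: "i \<in> B" for i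
  proof -
    have "(\<lambda>y. T i (r * y)) \<in> E" by (rule mops.comp[OF dual_op[OF dual i] mops.left])
    from dual_expand_right[OF dual mem_cl_B[OF i] this] show ?thesis .
  qed
  then have "(\<Sum>i\<in>B. T i (r * (s * i)) * v * \<tau>) - (\<Sum>i\<in>B. \<Sum>j\<in>B. T i (r * j) * v * T j (s * i)) \<in> N"
    by (rule sum_diff_mem)
  then show ?thesis by (simp add: tr_def sum_distrib_right mult.assoc)
qed

text \<open>The matrix entries are scalar multiples of \<tau> and commute around v, so the double
  sum of \<open>tr_mult\<close> is symmetric in r and s.\<close>

lemma tr_commute: "tr (r * s) - tr (s * r) \<in> N"
proof (rule prime_left[OF dual_hom[OF dual] dual_nz[OF dual]])
  fix v
  have "(\<Sum>i\<in>B. \<Sum>j\<in>B. T i (r * j) * v * T j (s * i)) - (\<Sum>i\<in>B. \<Sum>j\<in>B. T j (s * i) * v * T i (r * j)) \<in> N"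
    by (intro sum_diff_mem cl_commute[of _ \<tau>] dual_cl[OF dual] mem_cl_B)
  moreover have "(\<Sum>i\<in>B. \<Sum>j\<in>B. T j (s * i) * v * T i (r * j)) =
      (\<Sum>i\<in>B. \<Sum>j\<in>B. T i (s * j) * v * T j (r * i))" by (rule sum.swap)
  ultimately have "(\<Sum>i\<in>B. \<Sum>j\<in>B. T i (r * j) * v * T j (s * i)) -
      (\<Sum>i\<in>B. \<Sum>j\<in>B. T i (s * j) * v * T j (r * i)) \<in> N" by simp
  from trans_mem[OF trans_mem[OF tr_mult this] minus_commute_mem[OF tr_mult]]
  show "(tr (r * s) - tr (s * r)) * v * \<tau> \<in> N" by (simp add: left_diff_distrib)
qed

lemma tr1_commute: "tr1 (r * s) - tr1 (s * r) \<in> N"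
proof -
  have "tr1 (r * s) = (\<Sum>g\<in>carrier G. tr (Pr g r * Pr (inv g) s))"
    by (simp add: tr1_def Pr_one_mult op_sum[OF tr_op])
  moreover have "tr1 (s * r) = (\<Sum>g\<in>carrier G. tr (Pr (inv g) s * Pr g r))"
    unfolding tr1_def Pr_one_mult op_sum[OF tr_op]
    by (rule sum.reindex_bij_witness[of _ "\<lambda>g. inv g" "\<lambda>g. inv g"]) simp_all
  moreover have "(\<Sum>g\<in>carrier G. tr (Pr g r * Pr (inv g) s)) - (\<Sum>g\<in>carrier G. tr (Pr (inv g) s * Pr g r)) \<in> N"
    by (intro sum_diff_mem tr_commute)
  ultimately show ?thesis by simp
qed

lemma tr1_Pr:
  assumes g: "g \<in> carrier G" shows "tr1 (Pr g x * y) = tr1 (x * Pr (inv g) y)"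
proof -
  have "Pr (g \<otimes> inv g) (Pr g x * y) = Pr g x * Pr (inv g) y"
    using g by (intro Pr_mult_left) (simp_all add: Pr_Pr)
  moreover have "Pr (g \<otimes> inv g) (x * Pr (inv g) y) = Pr g x * Pr (inv g) y"
    using g by (intro Pr_mult_right) (simp_all add: Pr_Pr)
  ultimately show ?thesis using g by (simp add: tr1_def)
qed

text \<open>A right multiplication moves to the other argument by associativity, a left
  multiplication by the symmetry of the form; \<open>Pr g\<close> becomes \<open>Pr (inv g)\<close>,
  and compositions change their order.\<close>

lemma tr1_adjoint:
  assumes "U \<in> E" shows "\<exists>V\<in>E. \<forall>x y. tr1 (U x * y) - tr1 (x * V y) \<in> N"
  using assms
proof (induction rule: mops.induct)
  case (left v)
  show ?case
  proof (intro bexI[of _ "\<lambda>y. y * v"] allI mops.right)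
    show "tr1 (v * x * y) - tr1 (x * (y * v)) \<in> N" for x y
      using tr1_commute[of v "x * y"] by (simp add: mult.assoc)
  qed
next
  case (right v)
  show ?case
    by (intro bexI[of _ "\<lambda>y. v * y"] allI mops.left) (simp add: mult.assoc zero_mem)
next
  case (base q)
  then obtain g where g: "g \<in> carrier G" "q = Pr g" by blast
  then show ?case
    by (intro bexI[of _ "Pr (inv g)"] allI Pr_op) (simp_all add: tr1_Pr zero_mem)
next
  case (add S R)
  obtain S' where S': "S' \<in> E" "\<forall>x y. tr1 (S x * y) - tr1 (x * S' y) \<in> N" using add.IH(1) by (rule bexE)
  obtain R' where R': "R' \<in> E" "\<forall>x y. tr1 (R x * y) - tr1 (x * R' y) \<in> N" using add.IH(2) by (rule bexE)
  have "tr1 ((S x + R x) * y) - tr1 (x * (S' y + R' y)) \<in> N" for x y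
    using add_mem[OF S'(2)[rule_format, of x y] R'(2)[rule_format, of x y]]
    by (simp add: distrib_left distrib_right op_add[OF tr1_op] algebra_simps)
  then show ?case by (intro bexI[of _ "\<lambda>y. S' y + R' y"] allI mops.add S'(1) R'(1))
next
  case (comp S R)
  obtain S' where S': "S' \<in> E" "\<forall>x y. tr1 (S x * y) - tr1 (x * S' y) \<in> N" using comp.IH(1) by (rule bexE)
  obtain R' where R': "R' \<in> E" "\<forall>x y. tr1 (R x * y) - tr1 (x * R' y) \<in> N" using comp.IH(2) by (rule bexE)
  have "tr1 (S (R x) * y) - tr1 (x * R' (S' y)) \<in> N" for x y
    by (rule trans_mem[OF S'(2)[rule_format] R'(2)[rule_format]])
  then show ?case by (intro bexI[of _ "\<lambda>y. R' (S' y)"] allI mops.comp[OF R'(1) S'(1)])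
qed

lemma tr_one: "tr 1 = of_nat (card B) * \<tau>"
  by (simp add: tr_def dual_same[OF dual])

lemma BJ_nonempty: "BJ \<noteq> {}"
proof
  assume e: "BJ = {}"
  have "x \<in> N" if "x \<in> J" for x
    using clD[OF subsetD[OF BJ(3) that] mops_id] e by simp
  then show False using J(3) by blast
qed

lemma multiple_notin: "0 < n \<Longrightarrow> of_nat n * \<tau> \<notin> N"
  using torsion_free dual_nz[OF dual] by blast

text \<open>The trace of the identity is \<tau> times the rank of the ideal, and the rank is a
  positive integer; torsion-freeness modulo N is used here.\<close>

lemma tr1_one_notin: "tr1 1 \<notin> N"
proof -
  have "0 < card B" using BJ_nonempty B(1) dual_finite[OF dual] by (auto simp: card_gt_0_iff)
  then show ?thesis using multiple_notin by (simp add: tr1_def Pr_one tr_one)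
qed

definition Rad :: "'r set" where "Rad = {x. \<forall>y. tr1 (x * y) \<in> N}"

lemma gr_right_Rad: "gr_right Rad"
  unfolding gr_right_def Rad_def
  by (auto simp: op_zero[OF tr1_op] zero_mem distrib_right op_add[OF tr1_op] add_mem mult.assoc tr1_Pr)

lemma Rad_left: "x \<in> Rad \<Longrightarrow> v * x \<in> Rad"
proof -
  assume "x \<in> Rad"
  then have "tr1 (x * (y * v)) \<in> N" for y by (simp add: Rad_def)
  then have "tr1 (v * (x * y)) \<in> N" for y
    using mem_cong[OF tr1_commute[of v "x * y"]] by (simp add: mult.assoc)
  then show "v * x \<in> Rad" by (simp add: Rad_def mult.assoc)
qed

text \<open>The algebraic content is that the trace of a left identity of the minimal right ideal \<open>J\<close> is
  the rank of \<open>J\<close>, which is not zero; the left identity exists only after extending scalars, and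
  appears here through the relation \<open>j \<sigma> = \<Sum>c. y c j (s c)\<close> modulo \<open>N\<close>.\<close>

lemma left_identity:
  obtains C :: "'r set" and y \<sigma> s where "finite C" "\<sigma> \<in> Hm" "\<sigma> \<notin> N" "\<And>c. c \<in> C \<Longrightarrow> y c \<in> J" "\<And>c. c \<in> C \<Longrightarrow> Pr \<one> (y c) = y c"
    "\<And>U j z. U \<in> E \<Longrightarrow> j \<in> J \<Longrightarrow> U j * z * \<sigma> - (\<Sum>c\<in>C. U (y c * j) * z * s c) \<in> N"
proof -
  note JD = gr_rightD[OF J(1)]
  obtain j where j: "j \<in> J" "j \<in> Hm" "j \<notin> N" by (rule gr_right_hom_ex[OF J(1,3)])
  obtain x k where x: "k \<in> carrier G" "Pr k x = x" "j * x * j \<notin> N" using prime_hom_ex[OF j(2,3) j(2,3)] by blast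
  define a where "a = j * x"
  obtain gj where gj: "gj \<in> carrier G" "Pr gj j = j" using j by (auto simp: Hm_def)
  define ga where "ga = gj \<otimes> k"
  have ga: "ga \<in> carrier G" "Pr ga a = a" using gj x Pr_mult by (simp_all add: a_def ga_def)
  have aJ: "a \<in> J" using j(1) JD by (simp add: a_def)
  have Pr_a: "Pr (ga \<otimes> g) (a * x) = a * Pr g x" if "g \<in> carrier G" for g x
    using ga that by (intro Pr_mult_left)
  \<comment> \<open>The kernel K of left multiplication by a on J, taken modulo N, is a graded right
    ideal. If it were not inside N, its closure would contain j, but \<open>a * j\<close> is outside
    N.\<close>
  have a_inj: "x \<in> N" if "x \<in> J" "a * x \<in> N" for x
  proof (rule ccontr)
    assume "x \<notin> N"
    define K where "K = {x \<in> J. a * x \<in> N}"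
    have "gr_right K"
      unfolding gr_right_def
    proof (intro conjI ballI allI)
      show "0 \<in> K" using JD zero_mem by (simp add: K_def)
      show "x + y \<in> K" if "x \<in> K" "y \<in> K" for x y using that JD add_mem by (simp add: K_def distrib_left)
      show "x * v \<in> K" if "x \<in> K" for x v using that JD right_mem[of "a * x" v] by (simp add: K_def mult.assoc)
      show "Pr g x \<in> K" if "x \<in> K" "g \<in> carrier G" for x g
        using that JD Pr_mem[of "ga \<otimes> g" "a * x"] ga by (simp add: K_def Pr_a)
    qed
    moreover have "\<not> K \<subseteq> N" using that \<open>x \<notin> N\<close> by (auto simp: K_def)
    ultimately have JK: "J \<subseteq> cl K" by (intro J_min) (auto simp: K_def)
    have "a * j \<in> N" by (rule clD[OF subsetD[OF JK j(1)] mops.left]) (simp add: K_def)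
    then show False using x(3) by (simp add: a_def)
  qed
  define Je where "Je = {x \<in> J. Pr \<one> x = x}"
  \<comment> \<open>The right ideal a J is not inside N, so by minimality its closure contains a.
    Passing to components of degree ga leaves only the multiples of a by elements of degree
    \<open>\<one>\<close>: up to scalars, a equals a times an element of Je.\<close>
  have "a \<in> cl ((\<lambda>x. a * x) ` Je)"
  proof (rule clI)
    fix S assume S: "S \<in> E" and kill: "\<And>y. y \<in> (\<lambda>x. a * x) ` Je \<Longrightarrow> S y \<in> N"
    define aJ where "aJ = (\<lambda>x. a * x) ` J"
    have "gr_right aJ"
      unfolding gr_right_def
    proof (intro conjI ballI allI)
      show "0 \<in> aJ" using JD(1) by (auto simp: aJ_def intro: image_eqI[of _ _ 0])
      show "x + y \<in> aJ" if "x \<in> aJ" "y \<in> aJ" for x y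
        using that JD(2) by (auto simp: aJ_def simp flip: distrib_left)
      show "x * v \<in> aJ" if "x \<in> aJ" for x v using that JD(3) by (auto simp: aJ_def mult.assoc)
      show "Pr g x \<in> aJ" if x: "x \<in> aJ" and g: "g \<in> carrier G" for x g
      proof -
        obtain y where y: "y \<in> J" "x = a * y" using x by (auto simp: aJ_def)
        have "Pr (ga \<otimes> (inv ga \<otimes> g)) (a * y) = a * Pr (inv ga \<otimes> g) y" using ga g by (intro Pr_a) simp
        then have "Pr g x = a * Pr (inv ga \<otimes> g) y" using ga g y by (simp flip: G.m_assoc)
        then show ?thesis using JD(4)[OF y(1)] ga g by (auto simp: aJ_def)
      qed
    qed
    moreover have "\<not> aJ \<subseteq> N" using x(3) j(1) by (auto simp: aJ_def a_def)
    moreover have "aJ \<subseteq> J" using JD(3)[OF \<open>a \<in> J\<close>] by (auto simp: aJ_def)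
    ultimately have "a \<in> cl aJ" using J_min \<open>a \<in> J\<close> by blast
    moreover have "(\<lambda>x. S (Pr ga x)) \<in> E" by (rule mops.comp[OF S Pr_op[OF ga(1)]])
    moreover have "S (Pr ga y) \<in> N" if y: "y \<in> aJ" for y
    proof -
      obtain x where x: "x \<in> J" "y = a * x" using y by (auto simp: aJ_def)
      then have "Pr ga y = a * Pr \<one> x" using Pr_a[of \<one> x] ga by simp
      moreover have "Pr \<one> x \<in> Je" using JD(4)[OF x(1)] Pr_Pr by (simp add: Je_def)
      ultimately show ?thesis using kill by blast
    qed
    ultimately have "S (Pr ga a) \<in> N" by (rule clD)
    then show "S a \<in> N" by (simp add: ga)
  qed
  moreover have "(\<lambda>x. a * x) ` Je \<subseteq> cl BJ" using JD(3)[OF aJ] BJ(3) by blast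
  then obtain C where C: "finite C" "indep C" "{} \<subseteq> C" "C \<subseteq> (\<lambda>x. a * x) ` Je" "(\<lambda>x. a * x) ` Je \<subseteq> cl C"
    by (rule basis_extend[OF BJ(1) _ finite.emptyI indep_empty empty_subsetI]) (rule that)
  ultimately have aC: "a \<in> cl C" using cl_trans by blast
  have "\<forall>c\<in>C. \<exists>y. y \<in> Je \<and> c = a * y" using C(4) by auto
  from bchoice[OF this] obtain y where y: "\<forall>c\<in>C. y c \<in> Je \<and> c = a * y c" by (rule exE)
  have "1 \<notin> N" using tr1_one_notin op_mem[OF tr1_op] by blast
  then obtain S \<sigma> where S: "dual C S \<sigma>" using dual_exists[OF C(1,2)] by blast
  obtain k where k: "k \<in> carrier G" "Pr k \<sigma> = \<sigma>" using dual_hom[OF S] by (auto simp: Hm_def)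
  \<comment> \<open>Projecting to the degree k of \<sigma> makes all coordinates s c homogeneous of
    this degree, which the case of a projection in \<open>rel\<close> depends on.\<close>
  define S' where "S' c x = Pr k (S c x)" for c x
  have S': "dual C S' \<sigma>"
    unfolding dual_def
  proof (intro conjI ballI impI)
    show "S' c \<in> E" if "c \<in> C" for c
      unfolding S'_def[abs_def] by (rule mops.comp[OF Pr_op[OF k(1)] dual_op[OF S that]])
    show "S' c c = \<sigma>" if "c \<in> C" for c using dual_same[OF S that] k by (simp add: S'_def)
    show "S' c c' \<in> N" if "c \<in> C" "c' \<in> C" "c' \<noteq> c" for c c'
      unfolding S'_def by (rule Pr_mem[OF k(1) dual_other[OF S that]])
  qed (use dual_finite[OF S] dual_hom[OF S] dual_nz[OF S] in auto)
  define s where "s c = S' c a" for c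
  have s: "Pr k (s c) = s c" for c using k Pr_Pr by (simp add: s_def S'_def)
  \<comment> \<open>After left multiplication by a this is the expansion of a in the basis C. Both
    terms lie in J, where a can be cancelled.\<close>
  have base: "j * \<sigma> - (\<Sum>c\<in>C. y c * j * s c) \<in> N" if j: "j \<in> J" for j
  proof (rule a_inj)
    have "y c * j * s c \<in> J" if "c \<in> C" for c using y that JD(3) by (auto simp: Je_def)
    then show "j * \<sigma> - (\<Sum>c\<in>C. y c * j * s c) \<in> J"
      using JD(3) j by (intro gr_right_diff[OF J(1)] gr_right_sum[OF J(1)]) auto
    have "a * j * \<sigma> - (\<Sum>c\<in>C. c * j * s c) \<in> N"
      using dual_expand_right[OF S' aC mops_id] by (simp add: s_def)
    moreover have "(\<Sum>c\<in>C. c * j * s c) = (\<Sum>c\<in>C. a * (y c * j * s c))"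
    proof (rule sum.cong[OF refl])
      fix c assume "c \<in> C"
      then have "c = a * y c" using y by blast
      from arg_cong[OF this, of "\<lambda>v. v * (j * s c)"]
      show "c * j * s c = a * (y c * j * s c)" by (simp only: mult.assoc)
    qed
    ultimately show "a * (j * \<sigma> - (\<Sum>c\<in>C. y c * j * s c)) \<in> N"
      by (simp add: right_diff_distrib sum_distrib_left mult.assoc)
  qed
  have rel: "\<forall>z. U x0 * z * \<sigma> - (\<Sum>c\<in>C. U (f c) * z * s c) \<in> N"
    if "U \<in> E" "\<forall>z. x0 * z * \<sigma> - (\<Sum>c\<in>C. f c * z * s c) \<in> N" for U x0 f
    using that
  proof (induction arbitrary: x0 f rule: mops.induct)
    case (left v)
    show ?case
    proof
      fix z
      from left_mem[OF left[rule_format, of z], of v]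
      show "v * x0 * z * \<sigma> - (\<Sum>c\<in>C. v * f c * z * s c) \<in> N"
        by (simp add: right_diff_distrib sum_distrib_left mult.assoc)
    qed
  next
    case (right v)
    show ?case
    proof
      fix z
      from right[rule_format, of "v * z"]
      show "x0 * v * z * \<sigma> - (\<Sum>c\<in>C. f c * v * z * s c) \<in> N" by (simp add: mult.assoc)
    qed
  next
    case (base q)
    then obtain g where g: "g \<in> carrier G" "q = Pr g" by blast
    have hom: "Pr g x0 * Pr l z * \<sigma> - (\<Sum>c\<in>C. Pr g (f c) * Pr l z * s c) \<in> N" if l: "l \<in> carrier G" for l z
    proof -
      have *: "Pr (g \<otimes> (l \<otimes> k)) (x * Pr l z * t) = Pr g x * Pr l z * t" if "Pr k t = t" for x t
      proof -
        have "Pr (l \<otimes> k) (Pr l z * t) = Pr l z * t" using l k that Pr_mult Pr_Pr by simp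
        then have "Pr (g \<otimes> (l \<otimes> k)) (x * (Pr l z * t)) = Pr g x * (Pr l z * t)"
          using l k g by (intro Pr_mult_right) simp_all
        then show ?thesis by (simp add: mult.assoc)
      qed
      have glk: "g \<otimes> (l \<otimes> k) \<in> carrier G" using g l k by simp
      from op_mem[OF Pr_op[OF glk] base.prems[rule_format, of "Pr l z"]]
      show ?thesis by (simp add: op_diff[OF Pr_op[OF glk]] op_sum[OF Pr_op[OF glk]] *[OF k(2)] *[OF s])
    qed
    show ?case
    proof
      fix z
      have "(\<Sum>l\<in>carrier G. Pr g x0 * Pr l z * \<sigma> - (\<Sum>c\<in>C. Pr g (f c) * Pr l z * s c)) \<in> N"
        by (intro sum_mem hom)
      moreover have "(\<Sum>l\<in>carrier G. Pr g x0 * Pr l z * \<sigma>) = Pr g x0 * z * \<sigma>"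
        by (simp add: Pr_sum flip: sum_distrib_left sum_distrib_right)
      moreover have "(\<Sum>l\<in>carrier G. \<Sum>c\<in>C. Pr g (f c) * Pr l z * s c) = (\<Sum>c\<in>C. Pr g (f c) * z * s c)"
        by (subst sum.swap) (simp add: Pr_sum flip: sum_distrib_left sum_distrib_right)
      ultimately show "q x0 * z * \<sigma> - (\<Sum>c\<in>C. q (f c) * z * s c) \<in> N"
        by (simp add: g(2) sum_subtractf)
    qed
  next
    case (add V W)
    show ?case
    proof
      fix z
      from add_mem[OF add.IH(1)[OF add.prems, rule_format, of z] add.IH(2)[OF add.prems, rule_format, of z]]
      show "(V x0 + W x0) * z * \<sigma> - (\<Sum>c\<in>C. (V (f c) + W (f c)) * z * s c) \<in> N"
        by (simp add: distrib_right sum.distrib algebra_simps)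
    qed
  next
    case (comp V W)
    show ?case by (rule comp.IH(1)[OF comp.IH(2)[OF comp.prems]])
  qed
  show ?thesis
  proof (rule that[OF C(1) dual_hom[OF S] dual_nz[OF S]])
    show "y c \<in> J" "Pr \<one> (y c) = y c" if "c \<in> C" for c using y that by (auto simp: Je_def)
    show "U j * z * \<sigma> - (\<Sum>c\<in>C. U (y c * j) * z * s c) \<in> N" if U: "U \<in> E" and j: "j \<in> J" for U j z
    proof -
      have "\<forall>z. j * z * \<sigma> - (\<Sum>c\<in>C. y c * j * z * s c) \<in> N"
        using base[OF JD(3)[OF j]] by (simp add: mult.assoc)
      from rel[OF U this] show ?thesis by blast
    qed
  qed
qed

text \<open>If the radical is not inside N, it meets J outside N, and by minimality the trace
  vanishes on all of J, in particular at the y c. Their combination with the coefficients s c acts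
  on J as \<sigma>, so the same traces also compute the rank of J, which is not zero.\<close>

lemma Rad_subset: "Rad \<subseteq> N"
proof (rule ccontr)
  assume nR: "\<not> Rad \<subseteq> N"
  obtain r where r: "r \<in> Rad" "r \<in> Hm" "r \<notin> N" by (rule gr_right_hom_ex[OF gr_right_Rad nR])
  obtain j where j: "j \<in> J" "j \<in> Hm" "j \<notin> N" by (rule gr_right_hom_ex[OF J(1,3)])
  obtain x where x: "j * x * r \<notin> N" using prime_hom_ex[OF j(2,3) r(2,3)] by blast
  have "j * x * r \<in> J \<inter> Rad" using j(1) r(1) gr_rightD(3)[OF J(1)] Rad_left by (simp add: mult.assoc)
  then have "\<not> J \<inter> Rad \<subseteq> N" using x by blast
  moreover have "gr_right (J \<inter> Rad)" using J(1) gr_right_Rad unfolding gr_right_def by blast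
  ultimately have JR: "J \<subseteq> cl (J \<inter> Rad)" by (intro J_min) auto
  have trJ: "tr1 y \<in> N" if "y \<in> J" for y
  proof (rule clD[OF subsetD[OF JR that] tr1_op])
    fix z assume "z \<in> J \<inter> Rad"
    then have "\<forall>y. tr1 (z * y) \<in> N" by (simp add: Rad_def)
    from spec[OF this, of 1] show "tr1 z \<in> N" by simp
  qed
  obtain C :: "'r set" and y \<sigma> s where C: "finite C" and \<sigma>: "\<sigma> \<in> Hm" "\<sigma> \<notin> N"
    and y: "\<And>c. c \<in> C \<Longrightarrow> y c \<in> J" "\<And>c. c \<in> C \<Longrightarrow> Pr \<one> (y c) = y c"
    and rel: "\<And>U j z. U \<in> E \<Longrightarrow> j \<in> J \<Longrightarrow> U j * z * \<sigma> - (\<Sum>c\<in>C. U (y c * j) * z * s c) \<in> N"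
    by (rule left_identity) (rule that)
  have BJB: "b \<in> B" if "b \<in> BJ" for b using B(1) that by blast
  \<comment> \<open>Left multiplication by y c maps the whole ideal into J, so the basis elements
    outside BJ contribute nothing to its trace.\<close>
  have sumBJ: "(\<Sum>b\<in>BJ. T b (y c * b)) \<in> N" if c: "c \<in> C" for c
  proof -
    have "tr (y c) \<in> N" using trJ[OF y(1)[OF c]] y(2)[OF c] by (simp add: tr1_def)
    moreover have "tr (y c) = (\<Sum>b\<in>B - BJ. T b (y c * b)) + (\<Sum>b\<in>BJ. T b (y c * b))"
      unfolding tr_def by (rule sum.subset_diff[OF B(1) dual_finite[OF dual]])
    moreover have "(\<Sum>b\<in>B - BJ. T b (y c * b)) \<in> N"
    proof (rule sum_mem)
      fix b assume b: "b \<in> B - BJ"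
      have "y c * b \<in> cl BJ" using gr_rightD(3)[OF J(1) y(1)[OF c]] BJ(3) by blast
      then show "T b (y c * b) \<in> N"
      proof (rule clD)
        show "T b \<in> E" using b dual_op[OF dual] by blast
        show "T b y \<in> N" if "y \<in> BJ" for y using b that BJB by (intro dual_other[OF dual]) auto
      qed
    qed
    ultimately show ?thesis using diff_mem[of "tr (y c)"] by fastforce
  qed
  have "of_nat (card BJ) * \<tau> * z * \<sigma> \<in> N" for z
  proof -
    have "(\<Sum>b\<in>BJ. T b b * z * \<sigma>) - (\<Sum>b\<in>BJ. \<Sum>c\<in>C. T b (y c * b) * z * s c) \<in> N"
      using BJ(2) by (intro sum_diff_mem rel dual_op[OF dual] BJB) auto
    moreover have "(\<Sum>b\<in>BJ. \<Sum>c\<in>C. T b (y c * b) * z * s c) = (\<Sum>c\<in>C. (\<Sum>b\<in>BJ. T b (y c * b)) * z * s c)"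
      by (subst sum.swap) (simp add: sum_distrib_right)
    moreover have "(\<Sum>c\<in>C. (\<Sum>b\<in>BJ. T b (y c * b)) * z * s c) \<in> N"
      by (intro sum_mem right_mem sumBJ)
    ultimately have "(\<Sum>b\<in>BJ. T b b * z * \<sigma>) \<in> N" using mem_cong by simp
    moreover have "(\<Sum>b\<in>BJ. T b b * z * \<sigma>) = (\<Sum>b\<in>BJ. \<tau> * z * \<sigma>)"
      using dual_same[OF dual BJB] by (intro sum.cong) auto
    ultimately show ?thesis by (simp add: mult.assoc)
  qed
  then have "of_nat (card BJ) * \<tau> \<in> N" by (rule prime_left[OF \<sigma>])
  then show False using multiple_notin BJ_nonempty BJ(1) by (simp add: card_gt_0_iff)
qed

text \<open>z is the component of degree \<open>\<one>\<close> of V y, where V is the adjoint of the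
  trace and y an element of the ideal of w at which V is not in N.\<close>

lemma central_element:
  assumes w: "w \<in> Hm" "w \<notin> N"
  obtains z where "z \<in> idl w" "Pr \<one> z = z" "z \<notin> N" "\<And>x. z * x - x * z \<in> N"
proof -
  obtain V where V: "V \<in> E" "\<forall>x y. tr1 (tr1 x * y) - tr1 (x * V y) \<in> N"
    using tr1_adjoint[OF tr1_op] by (rule bexE)
  have zero: "tr1 (x * V y) \<in> N" if "tr1 x \<in> N" for x y
    using mem_cong[OF V(2)[rule_format, of x y]] op_mem[OF tr1_op right_mem[OF that]] by blast
  have central: "V y * s - s * V y \<in> N" for y s
  proof -
    have "tr1 ((V y * s - s * V y) * r) \<in> N" for r
    proof -
      have 1: "tr1 (V y * s * r) - tr1 (s * r * V y) \<in> N" using tr1_commute[of "V y" "s * r"] by (simp add: mult.assoc)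
      have 2: "tr1 (s * V y * r) - tr1 (r * s * V y) \<in> N" using tr1_commute[of "s * V y" r] by (simp add: mult.assoc)
      have "tr1 ((s * r - r * s) * V y) \<in> N"
        by (rule zero) (use tr1_commute in \<open>simp add: op_diff[OF tr1_op]\<close>)
      then have 3: "tr1 (s * r * V y) - tr1 (r * s * V y) \<in> N"
        by (simp add: left_diff_distrib op_diff[OF tr1_op])
      from trans_mem[OF trans_mem[OF 1 3] minus_commute_mem[OF 2]]
      show ?thesis by (simp add: left_diff_distrib op_diff[OF tr1_op])
    qed
    then have "V y * s - s * V y \<in> Rad" by (simp add: Rad_def)
    then show ?thesis using Rad_subset by blast
  qed
  \<comment> \<open>Elements of degree other than \<open>\<one>\<close> have trace zero, and so do
    their products with V y; hence the other components of V y are in the radical.\<close>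
  have deg: "Pr g (V y) \<in> N" if g: "g \<in> carrier G" "g \<noteq> \<one>" for g y
  proof -
    have "tr1 (Pr g (V y) * r) \<in> N" for r
    proof -
      have "\<one> \<noteq> inv g" using g G.inv_eq_1_iff by metis
      then have "Pr \<one> (Pr (inv g) r) = 0"
        by (rule trans[OF Pr_Pr[OF G.one_closed G.inv_closed[OF g(1)]] if_not_P])
      then have "tr1 (Pr (inv g) r * V y) \<in> N" by (intro zero) (simp add: tr1_def op_zero[OF tr_op] zero_mem)
      then show ?thesis using tr1_Pr[OF g(1)] mem_cong[OF tr1_commute] by simp
    qed
    then have "Pr g (V y) \<in> Rad" by (simp add: Rad_def)
    then show ?thesis using Rad_subset by blast
  qed
  have cong: "V y - Pr \<one> (V y) \<in> N" for y
  proof -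
    have "V y = Pr \<one> (V y) + (\<Sum>g\<in>carrier G - {\<one>}. Pr g (V y))"
      using Pr_sum[of "V y"] sum.remove[OF fin_G, of \<one> "\<lambda>g. Pr g (V y)"] by simp
    moreover have "(\<Sum>g\<in>carrier G - {\<one>}. Pr g (V y)) \<in> N" using deg by (intro sum_mem) auto
    ultimately show ?thesis by (metis add_diff_cancel_left')
  qed
  \<comment> \<open>If V mapped the ideal of w into N, then by adjunction
    \<open>tr1 1 * s * w\<close> would be in the radical for all s, and primeness would put
    \<open>tr1 1\<close> into N.\<close>
  have "\<exists>y\<in>idl w. V y \<notin> N"
  proof (rule ccontr)
    assume "\<not> ?thesis"
    then have VN: "V y \<in> N" if "y \<in> idl w" for y using that by blast
    have "tr1 1 * s * w \<in> N" for s
    proof -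
      have "tr1 (tr1 1 * s * w * r) \<in> N" for r
      proof -
        have "V (s * w * r) \<in> N" by (intro VN idl_right idl_left idl_self)
        then have "tr1 (1 * V (s * w * r)) \<in> N" by (intro op_mem[OF tr1_op] left_mem)
        then show ?thesis using mem_cong[OF V(2)[rule_format, of 1 "s * w * r"]] by (simp add: mult.assoc)
      qed
      then have "tr1 1 * s * w \<in> Rad" by (simp add: Rad_def)
      then show ?thesis using Rad_subset by blast
    qed
    then have "tr1 1 \<in> N" by (rule prime_left[OF w])
    then show False using tr1_one_notin by blast
  qed
  then obtain y where y: "y \<in> idl w" "V y \<notin> N" by blast
  show ?thesis
  proof (rule that[of "Pr \<one> (V y)"])
    show "Pr \<one> (V y) \<in> idl w" by (intro idl_Pr idl_op[OF V(1) y(1)]) simp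
    show "Pr \<one> (Pr \<one> (V y)) = Pr \<one> (V y)" by (simp add: Pr_Pr)
    show "Pr \<one> (V y) \<notin> N" using y(2) mem_cong[OF cong] by blast
    show "Pr \<one> (V y) * x - x * Pr \<one> (V y) \<in> N" for x
    proof -
      have 1: "Pr \<one> (V y) * x - V y * x \<in> N"
        using right_mem[OF minus_commute_mem[OF cong[of y]], of x] by (simp add: left_diff_distrib)
      have 2: "x * V y - x * Pr \<one> (V y) \<in> N"
        using left_mem[OF cong[of y], of x] by (simp add: right_diff_distrib)
      show ?thesis by (rule trans_mem[OF trans_mem[OF 1 central] 2])
    qed
  qed
qed

end

definition central_e :: "'r \<Rightarrow> bool" where
  "central_e z \<longleftrightarrow> Pr \<one> z = z \<and> (\<forall>x. z * x - x * z \<in> N)"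

lemma one_notin: "1 \<notin> N"
  using M_nontriv left_mem[of 1] by auto

lemma central_e_mult: "central_e y \<Longrightarrow> central_e z \<Longrightarrow> central_e (y * z)"
proof -
  assume y: "central_e y" and z: "central_e z"
  have "Pr (\<one> \<otimes> \<one>) (y * z) = y * z" by (rule Pr_mult) (use y z in \<open>auto simp: central_e_def\<close>)
  moreover have "y * z * x - x * (y * z) \<in> N" for x
  proof (rule trans_mem)
    show "y * z * x - y * x * z \<in> N"
      using left_mem[of "z * x - x * z" y] z by (simp add: central_e_def right_diff_distrib mult.assoc)
    show "y * x * z - x * (y * z) \<in> N"
      using right_mem[of "y * x - x * y" z] y by (simp add: central_e_def left_diff_distrib mult.assoc)
  qed
  ultimately show ?thesis by (simp add: central_e_def)
qed

lemma central_e_mult_notin: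
  assumes "central_e y" "y \<notin> N" "z \<in> Hm" "z \<notin> N" shows "y * z \<notin> N"
proof
  assume yz: "y * z \<in> N"
  have "y * s * z \<in> N" for s
  proof -
    have "y * s - s * y \<in> N" using assms(1) by (simp add: central_e_def)
    from right_mem[OF this, of z] have "y * s * z - s * (y * z) \<in> N"
      by (simp add: left_diff_distrib mult.assoc)
    then show ?thesis using mem_cong left_mem[OF yz] by blast
  qed
  then show False using prime_left[OF assms(3,4)] assms(2) by blast
qed

lemma central_e_Hm: "central_e z \<Longrightarrow> z \<in> Hm"
  by (auto simp: central_e_def Hm_def)

text \<open>For the second claim an operator moves the common value \<tau> of a dual system to a
  central element c0. All coordinates are then central of degree \<open>\<one>\<close> modulo N,
  since this can be tested on the basis, where the values are c0 or in N.\<close>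

lemma graded_posner:
  shows central_in_ideal: "w \<in> Hm \<Longrightarrow> w \<notin> N \<Longrightarrow> \<exists>z\<in>idl w. central_e z \<and> z \<notin> N"
    and finite_over_center: "\<exists>u B c. u \<in> M \<and> finite B \<and> B \<subseteq> idl u \<and>
      (\<forall>b\<in>B. \<forall>b'\<in>B. b - b' \<in> N \<longrightarrow> b = b') \<and> c \<in> idl u \<and> central_e c \<and> c \<notin> N \<and>
      (\<forall>x. \<exists>\<zeta>. (\<forall>b\<in>B. \<zeta> b \<in> idl u \<and> central_e (\<zeta> b)) \<and> c * x - (\<Sum>b\<in>B. \<zeta> b * b) \<in> N)"
proof -
  obtain u Y where u: "u \<in> Hm" "u \<notin> N" "u \<in> M" and Y: "finite Y" "idl u \<subseteq> cl Y"
    by (rule finite_rank_graded_ideal)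
  obtain J BJ where J: "gr_right J" "J \<subseteq> idl u" "\<not> J \<subseteq> N" and BJ: "finite BJ" "indep BJ" "BJ \<subseteq> J" "J \<subseteq> cl BJ"
    and J_min: "\<And>J'. gr_right J' \<Longrightarrow> J' \<subseteq> J \<Longrightarrow> \<not> J' \<subseteq> N \<Longrightarrow> J \<subseteq> cl J'"
    by (rule ex_minimal_right[OF u(1,2) Y]) (rule that)
  have BJu: "BJ \<subseteq> idl u" using BJ J by blast
  obtain B where B: "finite B" "indep B" "BJ \<subseteq> B" "B \<subseteq> idl u" "idl u \<subseteq> cl B"
    by (rule basis_extend[OF Y BJ(1,2) BJu]) (rule that)
  obtain T \<tau> where T: "dual B T \<tau>" by (rule dual_exists[OF B(1,2) one_notin])
  have central: "\<exists>z\<in>idl w. central_e z \<and> z \<notin> N" if w: "w \<in> Hm" "w \<notin> N" for w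
  proof -
    obtain z where "z \<in> idl w" "Pr \<one> z = z" "z \<notin> N" "\<And>x. z * x - x * z \<in> N"
      by (rule central_element[OF J BJ(1,3,4) _ B(3-5) T w]) (erule (2) J_min, rule that)
    then show ?thesis unfolding central_e_def by blast
  qed
  then show "w \<in> Hm \<Longrightarrow> w \<notin> N \<Longrightarrow> \<exists>z\<in>idl w. central_e z \<and> z \<notin> N" for w .
  obtain z0 where z0: "z0 \<in> idl u" "central_e z0" "z0 \<notin> N" using central[OF u(1,2)] by blast
  obtain c0 where c0: "c0 \<in> idl \<tau>" "central_e c0" "c0 \<notin> N" using central[OF dual_hom[OF T] dual_nz[OF T]] by blast
  obtain W where W: "W \<in> E" "c0 = W \<tau>" using c0(1) unfolding idl_def by blast
  define S where "S b x = W (T b x)" for b x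
  have S: "dual B S c0"
    unfolding dual_def
  proof (intro conjI ballI impI)
    show "S b \<in> E" if "b \<in> B" for b
      unfolding S_def[abs_def] by (rule mops.comp[OF W(1) dual_op[OF T that]])
    show "S b b = c0" if "b \<in> B" for b using dual_same[OF T that] W(2) by (simp add: S_def)
    show "S b b' \<in> N" if "b \<in> B" "b' \<in> B" "b' \<noteq> b" for b b'
      unfolding S_def by (rule op_mem[OF W(1) dual_other[OF T that]])
  qed (use B(1) central_e_Hm[OF c0(2)] c0(3) in auto)
  have S_central: "S b y * x - x * S b y \<in> N" "S b y - Pr \<one> (S b y) \<in> N" if b: "b \<in> B" and y: "y \<in> idl u" for b x y
  proof -
    have ycl: "y \<in> cl B" using y B(5) by blast
    have Sb: "S b \<in> E" by (rule dual_op[OF S b])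
    have val: "S b b' = c0 \<or> S b b' \<in> N" if "b' \<in> B" for b'
      using dual_same[OF S b] dual_other[OF S b that] by (cases "b' = b") auto
    have op1: "(\<lambda>v. S b v * x - x * S b v) \<in> E" using Sb by (intro mops_diff mops_left_comp mops_right_comp)
    show "S b y * x - x * S b y \<in> N"
    proof (rule clD[OF ycl op1])
      show "S b v * x - x * S b v \<in> N" if "v \<in> B" for v
        using val[OF that] c0(2) diff_mem left_mem right_mem by (auto simp: central_e_def)
    qed
    have op2: "(\<lambda>v. S b v - Pr \<one> (S b v)) \<in> E" using Sb by (intro mops_diff Pr_op_comp) simp_all
    show "S b y - Pr \<one> (S b y) \<in> N"
    proof (rule clD[OF ycl op2])
      show "S b v - Pr \<one> (S b v) \<in> N" if "v \<in> B" for v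
        using val[OF that] c0(2) diff_mem Pr_mem[of \<one>] by (auto simp: central_e_def zero_mem)
    qed
  qed
  have PrS: "central_e (Pr \<one> (S b y))" if b: "b \<in> B" and y: "y \<in> idl u" for b y
    unfolding central_e_def
  proof (intro conjI allI)
    show "Pr \<one> (Pr \<one> (S b y)) = Pr \<one> (S b y)" by (simp add: Pr_Pr)
    show "Pr \<one> (S b y) * x - x * Pr \<one> (S b y) \<in> N" for x
    proof -
      have 1: "Pr \<one> (S b y) * x - S b y * x \<in> N"
        using right_mem[OF minus_commute_mem[OF S_central(2)[OF b y]], of x] by (simp add: left_diff_distrib)
      have 2: "x * S b y - x * Pr \<one> (S b y) \<in> N"
        using left_mem[OF S_central(2)[OF b y], of x] by (simp add: right_diff_distrib)
      show ?thesis by (rule trans_mem[OF trans_mem[OF 1 S_central(1)[OF b y]] 2])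
    qed
  qed
  \<comment> \<open>The right factor z0 carries x into the ideal of u, where the basis expands it;
    c0 is the denominator of the expansion; the left factor z0 carries the coefficients into the
    ideal of u, so that in the application they come from elements of the algebra.\<close>
  define c where "c = z0 * (c0 * z0)"
  have c0z0: "central_e (c0 * z0)" by (rule central_e_mult[OF c0(2) z0(2)])
  have "\<exists>\<zeta>. (\<forall>b\<in>B. \<zeta> b \<in> idl u \<and> central_e (\<zeta> b)) \<and> c * x - (\<Sum>b\<in>B. \<zeta> b * b) \<in> N" for x
  proof (intro exI conjI ballI)
    have y: "z0 * x \<in> idl u" by (rule idl_right[OF z0(1)])
    let ?\<zeta> = "\<lambda>b. z0 * Pr \<one> (S b (z0 * x))"
    show "?\<zeta> b \<in> idl u" for b by (rule idl_right[OF z0(1)])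
    show "central_e (?\<zeta> b)" if "b \<in> B" for b by (rule central_e_mult[OF z0(2) PrS[OF that y]])
    have ycl: "z0 * x \<in> cl B" using y B(5) by blast
    have 1: "z0 * x * c0 - (\<Sum>b\<in>B. b * S b (z0 * x)) \<in> N"
      using dual_expand_right[OF S ycl mops_id, of 1] by simp
    have 2: "(\<Sum>b\<in>B. b * S b (z0 * x)) - (\<Sum>b\<in>B. Pr \<one> (S b (z0 * x)) * b) \<in> N"
    proof (rule sum_diff_mem)
      fix b assume b: "b \<in> B"
      have "b * S b (z0 * x) - S b (z0 * x) * b \<in> N" by (rule minus_commute_mem[OF S_central(1)[OF b y]])
      moreover have "S b (z0 * x) * b - Pr \<one> (S b (z0 * x)) * b \<in> N"
        using right_mem[OF S_central(2)[OF b y], of b] by (simp add: left_diff_distrib)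
      ultimately show "b * S b (z0 * x) - Pr \<one> (S b (z0 * x)) * b \<in> N" by (rule trans_mem)
    qed
    have 3: "c0 * (z0 * x) - z0 * x * c0 \<in> N" using c0(2) by (simp add: central_e_def)
    from left_mem[OF trans_mem[OF 3 trans_mem[OF 1 2]], of z0]
    show "c * x - (\<Sum>b\<in>B. ?\<zeta> b * b) \<in> N"
      by (simp add: c_def right_diff_distrib sum_distrib_left mult.assoc)
  qed
  moreover have "c \<in> idl u" unfolding c_def by (rule idl_right[OF z0(1)])
  moreover have "central_e c" unfolding c_def by (rule central_e_mult[OF z0(2) c0z0])
  moreover have "c \<notin> N"
    unfolding c_def
    by (intro central_e_mult_notin z0 c0 central_e_Hm[OF c0z0] central_e_Hm[OF z0(2)])
  moreover have "b = b'" if "b \<in> B" "b' \<in> B" "b - b' \<in> N" for b b'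
  proof (rule ccontr)
    assume "b \<noteq> b'"
    then have "b' \<in> cl (B - {b})" using cl_superset[of "B - {b}"] that(2) by blast
    then have "b \<in> cl (B - {b})" using cl_cong[OF that(3)] by blast
    then show False using B(2) that(1) by (simp add: opindep_def)
  qed
  ultimately show "\<exists>u B c. u \<in> M \<and> finite B \<and> B \<subseteq> idl u \<and>
      (\<forall>b\<in>B. \<forall>b'\<in>B. b - b' \<in> N \<longrightarrow> b = b') \<and> c \<in> idl u \<and> central_e c \<and> c \<notin> N \<and>
      (\<forall>x. \<exists>\<zeta>. (\<forall>b\<in>B. \<zeta> b \<in> idl u \<and> central_e (\<zeta> b)) \<and> c * x - (\<Sum>b\<in>B. \<zeta> b * b) \<in> N)"
    using u(3) B(1,4) by (intro exI[of _ u] exI[of _ B] exI[of _ c] conjI ballI impI allI) blast+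
qed

end

section \<open>Multilinearization\<close>

lemma prod_list_zero_mem: "0 \<in> set xs \<Longrightarrow> prod_list xs = (0 :: 'r::semiring_1)"
  by (induction xs) auto

text \<open>Distributivity, with \<kappa> listing the summands chosen at the letters of w. The map v
  sends a new variable to the old variable that it refines.\<close>

lemma prod_list_sum_expand:
  fixes y :: "nat \<Rightarrow> 'r::semiring_1"
  shows "prod_list (map (\<lambda>i. \<Sum>k\<in>{k. k < d \<and> v k = i}. y k) w) =
    (\<Sum>\<kappa>\<in>{\<kappa>. set \<kappa> \<subseteq> {..<d} \<and> map v \<kappa> = w}. prod_list (map y \<kappa>))"
proof (induction w)
  case Nil
  have "{\<kappa>. set \<kappa> \<subseteq> {..<d} \<and> map v \<kappa> = []} = {[]}" by auto
  then show ?case by simp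
next
  case (Cons i w)
  have "(\<Sum>k\<in>{k. k < d \<and> v k = i}. y k) *
      (\<Sum>\<kappa>\<in>{\<kappa>. set \<kappa> \<subseteq> {..<d} \<and> map v \<kappa> = w}. prod_list (map y \<kappa>)) =
      (\<Sum>(k, \<kappa>)\<in>{k. k < d \<and> v k = i} \<times> {\<kappa>. set \<kappa> \<subseteq> {..<d} \<and> map v \<kappa> = w}. y k * prod_list (map y \<kappa>))"
    by (simp add: sum_product sum.cartesian_product)
  also have "\<dots> = (\<Sum>\<kappa>\<in>{\<kappa>. set \<kappa> \<subseteq> {..<d} \<and> map v \<kappa> = i # w}. prod_list (map y \<kappa>))"
    by (rule sum.reindex_bij_witness[of _ "\<lambda>\<kappa>. (hd \<kappa>, tl \<kappa>)" "\<lambda>(k, \<kappa>). k # \<kappa>"]) auto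
  finally show ?case using Cons by simp
qed

text \<open>Polarization along a longest word w0 of length d: each variable is replaced by the sum
  of the y k over its positions k in w0, and the terms containing all d new variables are extracted.
  By the length bound each of them occurs exactly once, and the word \<open>[0..<d]\<close> gets the
  coefficient of w0.\<close>

lemma multilinear_part:
  fixes c :: "nat list \<Rightarrow> 'r::ring_1"
  assumes N: "two_sided_ideal N" and W: "finite W" "\<And>w. w \<in> W \<Longrightarrow> length w \<le> length w0"
    and M: "0 \<in> M" "\<And>x y. x \<in> M \<Longrightarrow> y \<in> M \<Longrightarrow> x + y \<in> M"
    and id: "\<And>\<xi>. (\<And>i. \<xi> i \<in> M) \<Longrightarrow> (\<Sum>w\<in>W. c w * prod_list (map \<xi> w)) \<in> N"
    and y: "\<And>i. y i \<in> M"
  shows "(\<Sum>\<kappa>\<in>perms (length w0).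
    (if map (nth w0) \<kappa> \<in> W then c (map (nth w0) \<kappa>) else 0) * prod_list (map y \<kappa>)) \<in> N"
proof -
  interpret two_sided_ideal N by (rule N)
  let ?d = "length w0"
  define v where "v = nth w0"
  define K where "K = {\<kappa>. set \<kappa> \<subseteq> {..<?d} \<and> map v \<kappa> \<in> W}"
  have "K \<subseteq> {\<kappa>. set \<kappa> \<subseteq> {..<?d} \<and> length \<kappa> \<le> ?d}"
    using W(2) by (force simp: K_def)
  then have finK: "finite K" using finite_lists_length_le[of "{..<?d}" ?d] by (rule finite_subset) simp
  have full: "(\<Sum>\<kappa>\<in>K. c (map v \<kappa>) * prod_list (map y \<kappa>)) \<in> N" if y: "\<And>i. y i \<in> M" for y
  proof -
    define \<xi> where "\<xi> i = (\<Sum>k\<in>{k. k < ?d \<and> v k = i}. y k)" for i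
    have "sum y A \<in> M" for A
      by (induction A rule: infinite_finite_induct) (simp_all add: M y)
    then have "(\<Sum>w\<in>W. c w * prod_list (map \<xi> w)) \<in> N" by (intro id) (simp add: \<xi>_def)
    moreover have "(\<Sum>w\<in>W. c w * prod_list (map \<xi> w)) =
        (\<Sum>w\<in>W. \<Sum>\<kappa>\<in>{\<kappa> \<in> K. map v \<kappa> = w}. c (map v \<kappa>) * prod_list (map y \<kappa>))"
    proof (rule sum.cong[OF refl])
      fix w assume w: "w \<in> W"
      then have eq: "{\<kappa> \<in> K. map v \<kappa> = w} = {\<kappa>. set \<kappa> \<subseteq> {..<?d} \<and> map v \<kappa> = w}" by (auto simp: K_def)
      show "c w * prod_list (map \<xi> w) = (\<Sum>\<kappa>\<in>{\<kappa> \<in> K. map v \<kappa> = w}. c (map v \<kappa>) * prod_list (map y \<kappa>))"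
        unfolding eq \<xi>_def[abs_def] prod_list_sum_expand by (simp add: sum_distrib_left)
    qed
    moreover have "(\<Sum>w\<in>W. \<Sum>\<kappa>\<in>{\<kappa> \<in> K. map v \<kappa> = w}. c (map v \<kappa>) * prod_list (map y \<kappa>)) =
        (\<Sum>\<kappa>\<in>K. c (map v \<kappa>) * prod_list (map y \<kappa>))"
      by (rule sum.group[OF finK W(1)]) (auto simp: K_def)
    ultimately show ?thesis by simp
  qed
  \<comment> \<open>The terms without y m are removed by subtracting the value of the sum at
    \<open>y m = 0\<close>, for one m after the other.\<close>
  have step: "(\<Sum>\<kappa>\<in>{\<kappa> \<in> K. {..<m} \<subseteq> set \<kappa>}. c (map v \<kappa>) * prod_list (map y \<kappa>)) \<in> N"
    if y: "\<And>i. y i \<in> M" for m y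
    using y
  proof (induction m arbitrary: y)
    case 0
    then show ?case using full by simp
  next
    case (Suc m)
    let ?t = "\<lambda>y \<kappa>. c (map v \<kappa>) * prod_list (map y \<kappa>)"
    let ?K = "{\<kappa> \<in> K. {..<m} \<subseteq> set \<kappa>}"
    define y0 where "y0 = y(m := 0)"
    have y0: "y0 i \<in> M" for i using Suc.prems M(1) by (simp add: y0_def)
    have zero: "?t y0 \<kappa> = 0" if "m \<in> set \<kappa>" for \<kappa>
    proof -
      have "y0 m \<in> set (map y0 \<kappa>)" using that by simp
      then have "prod_list (map y0 \<kappa>) = 0" by (intro prod_list_zero_mem) (simp add: y0_def)
      then show ?thesis by simp
    qed
    have same: "?t y0 \<kappa> = ?t y \<kappa>" if "m \<notin> set \<kappa>" for \<kappa>
    proof -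
      have "map y0 \<kappa> = map y \<kappa>" using that by (auto simp: y0_def)
      then show ?thesis by (simp only:)
    qed
    have part: "?K = {\<kappa> \<in> K. {..<Suc m} \<subseteq> set \<kappa>} \<union> {\<kappa> \<in> ?K. m \<notin> set \<kappa>}"
      by (auto simp: lessThan_Suc)
    have split: "sum f ?K = sum f {\<kappa> \<in> K. {..<Suc m} \<subseteq> set \<kappa>} + sum f {\<kappa> \<in> ?K. m \<notin> set \<kappa>}" for f :: "nat list \<Rightarrow> 'r"
      by (subst part, rule sum.union_disjoint) (use finK in \<open>auto simp: lessThan_Suc\<close>)
    have "sum (?t y0) {\<kappa> \<in> K. {..<Suc m} \<subseteq> set \<kappa>} = 0"
      by (intro sum.neutral ballI zero) (auto simp: lessThan_Suc)
    moreover have "sum (?t y0) {\<kappa> \<in> ?K. m \<notin> set \<kappa>} = sum (?t y) {\<kappa> \<in> ?K. m \<notin> set \<kappa>}"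
      by (intro sum.cong[OF refl] same) simp
    ultimately have "sum (?t y) {\<kappa> \<in> K. {..<Suc m} \<subseteq> set \<kappa>} = sum (?t y) ?K - sum (?t y0) ?K"
      by (simp only: split[of "?t y"] split[of "?t y0"] add_0 add_diff_cancel_right')
    then show ?case using diff_mem[OF Suc.IH[OF Suc.prems] Suc.IH[of y0, OF y0]] by (simp only:)
  qed
  have eq: "{\<kappa> \<in> K. {..<?d} \<subseteq> set \<kappa>} = {\<kappa> \<in> perms ?d. map v \<kappa> \<in> W}"
  proof (intro equalityI subsetI)
    fix \<kappa> assume k: "\<kappa> \<in> {\<kappa> \<in> K. {..<?d} \<subseteq> set \<kappa>}"
    then have s: "set \<kappa> = {..<?d}" and w: "map v \<kappa> \<in> W" by (auto simp: K_def)
    have "length \<kappa> \<le> card (set \<kappa>)" using W(2)[OF w] s by simp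
    then have "distinct \<kappa>" using card_length[of \<kappa>] by (intro card_distinct) simp
    then show "\<kappa> \<in> {\<kappa> \<in> perms ?d. map v \<kappa> \<in> W}" using s w by (simp add: perms_def)
  qed (auto simp: K_def perms_def)
  have "(\<Sum>\<kappa>\<in>perms ?d. (if map v \<kappa> \<in> W then c (map v \<kappa>) else 0) * prod_list (map y \<kappa>)) =
      (\<Sum>\<kappa>\<in>{\<kappa> \<in> perms ?d. map v \<kappa> \<in> W}. c (map v \<kappa>) * prod_list (map y \<kappa>))"
    by (rule sum.mono_neutral_cong_right[OF finite_perms]) auto
  then show ?thesis using step[where m = ?d and y = y, OF y] unfolding eq v_def by simp
qed

text \<open>Concatenation is made the addition of a monoid, so that finitely supported integer
  functions on words get the convolution product and form the free ring.\<close>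

datatype 'x word = Word (letters: "'x list")

instantiation word :: (type) monoid_add
begin

definition "0 = Word []"
definition "v + w = Word (letters v @ letters w)"

instance by standard (simp_all add: zero_word_def plus_word_def)

end

lift_definition restrict_keys :: "('x \<Rightarrow> bool) \<Rightarrow> ('x \<Rightarrow>\<^sub>0 'b::zero) \<Rightarrow> ('x \<Rightarrow>\<^sub>0 'b)"
  is "\<lambda>P f x. if P x then f x else 0"
  by (rule finite_subset[rotated]) auto

lemma restrict_keys_id_iff: "restrict_keys P f = f \<longleftrightarrow> (\<forall>x\<in>Poly_Mapping.keys f. P x)"
  by (auto simp: poly_mapping_eq_iff fun_eq_iff restrict_keys.rep_eq in_keys_iff)

text \<open>Single words generate the free abelian group under subtraction, so statements additive
  in the ring element reduce to words.\<close>

lemma int_mapping_induct [case_names zero one diff]: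
  fixes f :: "'x \<Rightarrow>\<^sub>0 int"
  assumes "P 0" "\<And>x. P (frag_of x)" "\<And>f g. P f \<Longrightarrow> P g \<Longrightarrow> P (f - g)"
  shows "P f"
  by (rule frag_induction[OF subset_UNIV[of "Poly_Mapping.keys f"]]) (use assms in auto)

section \<open>Graded algebras\<close>

lemma (in abelian_group) finsum_support:
  assumes "finite I" "f \<in> I \<rightarrow> carrier G"
  shows "(\<Oplus>i\<in>{i\<in>I. f i \<noteq> \<zero>}. f i) = (\<Oplus>i\<in>I. f i)"
  by (rule add.finprod_mono_neutral_cong_left) (use assms in auto)

text \<open>For a finite index set the restriction to the support and the extensionality of the
  families can both be dropped; uniqueness becomes a statement about values.\<close>

lemma (in abelian_group) direct_sum_ofI:
  assumes I: "finite I" and UV: "\<And>i. i \<in> I \<Longrightarrow> U i \<subseteq> V" and V: "V \<subseteq> carrier G"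
    and ex: "\<And>x. x \<in> V \<Longrightarrow> \<exists>f\<in>(\<Pi> i\<in>I. U i). x = (\<Oplus>i\<in>I. f i)"
    and unique: "\<And>f h i. f \<in> (\<Pi> i\<in>I. U i) \<Longrightarrow> h \<in> (\<Pi> i\<in>I. U i) \<Longrightarrow>
      (\<Oplus>i\<in>I. f i) = (\<Oplus>i\<in>I. h i) \<Longrightarrow> i \<in> I \<Longrightarrow> f i = h i"
  shows "direct_sum_of G I U V"
proof -
  have sup: "(\<Oplus>i\<in>{i\<in>I. f i \<noteq> \<zero>}. f i) = (\<Oplus>i\<in>I. f i)" if "f \<in> (\<Pi> i\<in>I. U i)" for f
    using that UV V by (intro finsum_support I) blast
  show ?thesis
    unfolding direct_sum_of_def
  proof (intro conjI ballI)
    fix x assume x: "x \<in> V"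
    obtain f where f: "f \<in> (\<Pi> i\<in>I. U i)" "x = (\<Oplus>i\<in>I. f i)" using ex[OF x] by blast
    define f' where "f' = restrict f I"
    have eq: "(\<Oplus>i\<in>I. f' i) = (\<Oplus>i\<in>I. f i)"
      by (rule add.finprod_cong') (use f(1) UV V in \<open>auto simp: f'_def\<close>)
    have f'U: "f' \<in> (\<Pi>\<^sub>E i\<in>I. U i)" using f(1) by (simp add: f'_def)
    then have f'P: "f' \<in> (\<Pi> i\<in>I. U i)" by blast
    show "\<exists>!f. f \<in> (\<Pi>\<^sub>E i\<in>I. U i) \<and> finite {i \<in> I. f i \<noteq> \<zero>} \<and> x = (\<Oplus>i\<in>{i \<in> I. f i \<noteq> \<zero>}. f i)"
    proof (rule ex1I[of _ f'])
      show "f' \<in> (\<Pi>\<^sub>E i\<in>I. U i) \<and> finite {i \<in> I. f' i \<noteq> \<zero>} \<and> x = (\<Oplus>i\<in>{i \<in> I. f' i \<noteq> \<zero>}. f' i)"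
        using f'U I sup[OF f'P] eq f(2) by simp
    next
      fix h assume h: "h \<in> (\<Pi>\<^sub>E i\<in>I. U i) \<and> finite {i \<in> I. h i \<noteq> \<zero>} \<and> x = (\<Oplus>i\<in>{i \<in> I. h i \<noteq> \<zero>}. h i)"
      then have hP: "h \<in> (\<Pi> i\<in>I. U i)" by blast
      have "(\<Oplus>i\<in>I. h i) = (\<Oplus>i\<in>I. f' i)" using h sup[OF hP] eq f(2) by simp
      then have "h i = f' i" if "i \<in> I" for i using unique[OF hP f'P] that by blast
      then show "h = f'" using h f'U by (intro PiE_ext[of h I U f']) auto
    qed
  qed (use UV in blast)
qed

lemma (in abelian_group) direct_sum_ofD:
  assumes I: "finite I" and ds: "direct_sum_of G I U V" and V: "V \<subseteq> carrier G"
  shows direct_sum_subset: "i \<in> I \<Longrightarrow> U i \<subseteq> V"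
    and direct_sum_ex: "x \<in> V \<Longrightarrow> \<exists>f\<in>(\<Pi> i\<in>I. U i). x = (\<Oplus>i\<in>I. f i)"
    and direct_sum_unique: "f \<in> (\<Pi> i\<in>I. U i) \<Longrightarrow> h \<in> (\<Pi> i\<in>I. U i) \<Longrightarrow>
      (\<Oplus>i\<in>I. f i) \<in> V \<Longrightarrow> (\<Oplus>i\<in>I. f i) = (\<Oplus>i\<in>I. h i) \<Longrightarrow> i \<in> I \<Longrightarrow> f i = h i"
proof -
  have UV: "\<And>i. i \<in> I \<Longrightarrow> U i \<subseteq> V" using ds by (auto simp: direct_sum_of_def)
  have sup: "(\<Oplus>i\<in>{i\<in>I. f i \<noteq> \<zero>}. f i) = (\<Oplus>i\<in>I. f i)" if "f \<in> (\<Pi> i\<in>I. U i)" for f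
    using that UV V by (intro finsum_support I) blast
  have ex1: "\<exists>!f. f \<in> (\<Pi>\<^sub>E i\<in>I. U i) \<and> finite {i \<in> I. f i \<noteq> \<zero>} \<and> x = (\<Oplus>i\<in>{i \<in> I. f i \<noteq> \<zero>}. f i)"
    if "x \<in> V" for x using ds that by (auto simp: direct_sum_of_def)
  show "U i \<subseteq> V" if "i \<in> I" using UV that .
  show "\<exists>f\<in>(\<Pi> i\<in>I. U i). x = (\<Oplus>i\<in>I. f i)" if x: "x \<in> V"
  proof -
    obtain f where f: "f \<in> (\<Pi>\<^sub>E i\<in>I. U i)" "x = (\<Oplus>i\<in>{i \<in> I. f i \<noteq> \<zero>}. f i)" using ex1[OF x] by blast
    then have fP: "f \<in> (\<Pi> i\<in>I. U i)" by blast
    show ?thesis using fP f(2) sup[OF fP] by auto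
  qed
  show "f i = h i" if f: "f \<in> (\<Pi> i\<in>I. U i)" and h: "h \<in> (\<Pi> i\<in>I. U i)" and V': "(\<Oplus>i\<in>I. f i) \<in> V"
    and eq: "(\<Oplus>i\<in>I. f i) = (\<Oplus>i\<in>I. h i)" and i: "i \<in> I"
  proof -
    have r: "restrict f I \<in> (\<Pi>\<^sub>E i\<in>I. U i) \<and> finite {i \<in> I. restrict f I i \<noteq> \<zero>} \<and>
        (\<Oplus>i\<in>I. f i) = (\<Oplus>i\<in>{i \<in> I. restrict f I i \<noteq> \<zero>}. restrict f I i)"
      if f: "f \<in> (\<Pi> i\<in>I. U i)" for f
    proof -
      have P: "restrict f I \<in> (\<Pi> i\<in>I. U i)" using f by auto
      have "(\<Oplus>i\<in>I. restrict f I i) = (\<Oplus>i\<in>I. f i)"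
        by (rule add.finprod_cong') (use f UV V in auto)
      then show ?thesis using sup[OF P] f I by simp
    qed
    from ex1[OF V'] obtain k where k: "\<And>y. y \<in> (\<Pi>\<^sub>E i\<in>I. U i) \<and> finite {i \<in> I. y i \<noteq> \<zero>} \<and>
        (\<Oplus>i\<in>I. f i) = (\<Oplus>i\<in>{i \<in> I. y i \<noteq> \<zero>}. y i) \<Longrightarrow> y = k" by (elim ex1E) blast
    have "restrict f I = restrict h I"
      using k[OF r[OF f]] k[OF r[OF h, folded eq]] by (rule trans[OF _ sym])
    then show ?thesis using i by (metis restrict_apply')
  qed
qed

context assoc_algebra
begin

definition additive_map where
  "additive_map f \<longleftrightarrow> f \<in> carrier A \<rightarrow> carrier A \<and>
    (\<forall>x\<in>carrier A. \<forall>y\<in>carrier A. f (x \<oplus>\<^bsub>A\<^esub> y) = f x \<oplus>\<^bsub>A\<^esub> f y)"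

lemma additive_mapI:
  "(\<And>x. x \<in> carrier A \<Longrightarrow> f x \<in> carrier A) \<Longrightarrow>
    (\<And>x y. x \<in> carrier A \<Longrightarrow> y \<in> carrier A \<Longrightarrow> f (x \<oplus>\<^bsub>A\<^esub> y) = f x \<oplus>\<^bsub>A\<^esub> f y) \<Longrightarrow> additive_map f"
  by (simp add: additive_map_def)

lemma additive_closed: "additive_map f \<Longrightarrow> x \<in> carrier A \<Longrightarrow> f x \<in> carrier A"
  and additive_add: "additive_map f \<Longrightarrow> x \<in> carrier A \<Longrightarrow> y \<in> carrier A \<Longrightarrow> f (x \<oplus>\<^bsub>A\<^esub> y) = f x \<oplus>\<^bsub>A\<^esub> f y"
  by (auto simp: additive_map_def)

lemma additive_zero: "additive_map f \<Longrightarrow> f \<zero>\<^bsub>A\<^esub> = \<zero>\<^bsub>A\<^esub>"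
  using additive_add[of f "\<zero>\<^bsub>A\<^esub>" "\<zero>\<^bsub>A\<^esub>"] additive_closed[of f "\<zero>\<^bsub>A\<^esub>"] M.add.r_cancel_one'
  by simp

lemma additive_minus:
  assumes f: "additive_map f" and x: "x \<in> carrier A" shows "f (\<ominus>\<^bsub>A\<^esub> x) = \<ominus>\<^bsub>A\<^esub> f x"
proof -
  have "f (\<ominus>\<^bsub>A\<^esub> x) \<oplus>\<^bsub>A\<^esub> f x = \<zero>\<^bsub>A\<^esub>"
    using additive_add[OF f, of "\<ominus>\<^bsub>A\<^esub> x" x] additive_zero[OF f] x by (simp add: M.l_neg)
  then show ?thesis using additive_closed[OF f] x by (intro M.minus_equality[symmetric]) auto
qed

lemma additive_diff:
  assumes f: "additive_map f" and x: "x \<in> carrier A" and y: "y \<in> carrier A"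
  shows "f (x \<ominus>\<^bsub>A\<^esub> y) = f x \<ominus>\<^bsub>A\<^esub> f y"
  unfolding a_minus_def using additive_add[OF f x, of "\<ominus>\<^bsub>A\<^esub> y"] additive_minus[OF f y] y by simp

lemma additive_finsum:
  assumes f: "additive_map f" and g: "g \<in> I \<rightarrow> carrier A"
  shows "f (\<Oplus>\<^bsub>A\<^esub>i\<in>I. g i) = (\<Oplus>\<^bsub>A\<^esub>i\<in>I. f (g i))"
  using g
proof (induction I rule: infinite_finite_induct)
  case (insert i I)
  have "(\<lambda>i. f (g i)) \<in> insert i I \<rightarrow> carrier A" using insert.prems additive_closed[OF f] by auto
  then have "(\<Oplus>\<^bsub>A\<^esub>i\<in>insert i I. f (g i)) = f (g i) \<oplus>\<^bsub>A\<^esub> (\<Oplus>\<^bsub>A\<^esub>i\<in>I. f (g i))"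
    using insert.hyps by (intro M.finsum_insert) auto
  moreover have "f (\<Oplus>\<^bsub>A\<^esub>i\<in>insert i I. g i) = f (g i \<oplus>\<^bsub>A\<^esub> (\<Oplus>\<^bsub>A\<^esub>i\<in>I. g i))"
    using insert by (subst M.finsum_insert) auto
  ultimately show ?case using insert additive_add[OF f] by (simp add: Pi_iff)
qed (simp_all add: additive_zero[OF f])

lemma additive_comp: "additive_map f \<Longrightarrow> additive_map h \<Longrightarrow> additive_map (\<lambda>x. f (h x))"
  by (auto simp: additive_map_def Pi_iff)

lemma additive_left: "a \<in> carrier A \<Longrightarrow> additive_map (\<lambda>x. a \<otimes>\<^bsub>A\<^esub> x)"
  by (intro additive_mapI mult_closed mult_distrib_left)

lemma additive_right: "a \<in> carrier A \<Longrightarrow> additive_map (\<lambda>x. x \<otimes>\<^bsub>A\<^esub> a)"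
  by (intro additive_mapI mult_closed mult_distrib_right)

lemma additive_smult: "c \<in> carrier F \<Longrightarrow> additive_map (\<lambda>x. c \<odot>\<^bsub>A\<^esub> x)"
  by (intro additive_mapI smult_closed smult_r_distr)

lemma mult_zero_left: "x \<in> carrier A \<Longrightarrow> \<zero>\<^bsub>A\<^esub> \<otimes>\<^bsub>A\<^esub> x = \<zero>\<^bsub>A\<^esub>"
  and mult_zero_right: "x \<in> carrier A \<Longrightarrow> x \<otimes>\<^bsub>A\<^esub> \<zero>\<^bsub>A\<^esub> = \<zero>\<^bsub>A\<^esub>"
  using additive_zero[OF additive_right[of x]] additive_zero[OF additive_left[of x]] by auto

lemma diff_zero_iff:
  assumes "x \<in> carrier A" "y \<in> carrier A" shows "x \<ominus>\<^bsub>A\<^esub> y = \<zero>\<^bsub>A\<^esub> \<longleftrightarrow> x = y"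
proof
  assume "x \<ominus>\<^bsub>A\<^esub> y = \<zero>\<^bsub>A\<^esub>"
  then have "x \<oplus>\<^bsub>A\<^esub> \<ominus>\<^bsub>A\<^esub> y \<oplus>\<^bsub>A\<^esub> y = y" using assms by (simp add: a_minus_def)
  then show "x = y" using assms by (simp add: M.a_assoc M.l_neg)
qed (use assms in \<open>simp add: a_minus_def M.r_neg\<close>)

end

section \<open>Homogeneous components and graded ideals of an algebra\<close>

locale finite_graded_algebra = graded_algebra G F A gr
  for G :: "('g, 'l) monoid_scheme" and F :: "('f, 'n) ring_scheme" and A :: "('f, 'a, 'm) module_scheme"
    and gr :: "'g \<Rightarrow> 'a set" +
  assumes fin_G: "finite (carrier G)"
begin

lemma gr_subset: "g \<in> carrier G \<Longrightarrow> gr g \<subseteq> carrier A"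
  by (rule M.direct_sum_subset[OF fin_G gr_direct_sum subset_refl])

lemma gr_carrier: "g \<in> carrier G \<Longrightarrow> x \<in> gr g \<Longrightarrow> x \<in> carrier A"
  using gr_subset by blast

lemma gr_add: "g \<in> carrier G \<Longrightarrow> x \<in> gr g \<Longrightarrow> y \<in> gr g \<Longrightarrow> x \<oplus>\<^bsub>A\<^esub> y \<in> gr g"
  and gr_minus: "g \<in> carrier G \<Longrightarrow> x \<in> gr g \<Longrightarrow> \<ominus>\<^bsub>A\<^esub> x \<in> gr g"
  and gr_smult: "g \<in> carrier G \<Longrightarrow> c \<in> carrier F \<Longrightarrow> x \<in> gr g \<Longrightarrow> c \<odot>\<^bsub>A\<^esub> x \<in> gr g"
  by (rule submoduleE(5)[OF gr_submodule] submoduleE(3)[OF gr_submodule] submoduleE(4)[OF gr_submodule];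
    assumption)+

lemma submodule_zero: "submodule I F A \<Longrightarrow> \<zero>\<^bsub>A\<^esub> \<in> I"
  using subgroup.one_closed[OF submodule.axioms(1)] by fastforce

lemma gr_zero: "g \<in> carrier G \<Longrightarrow> \<zero>\<^bsub>A\<^esub> \<in> gr g"
  using gr_submodule submodule_zero by blast

text \<open>The whole family of components is chosen at once, so that membership and the sum formula
  refer to the same choice.\<close>

definition comp :: "'g \<Rightarrow> 'a \<Rightarrow> 'a" where
  "comp g x = (SOME f. f \<in> (\<Pi> g\<in>carrier G. gr g) \<and> x = (\<Oplus>\<^bsub>A\<^esub>g\<in>carrier G. f g)) g"

lemma comp_props:
  assumes "x \<in> carrier A"
  shows comp_gr: "g \<in> carrier G \<Longrightarrow> comp g x \<in> gr g" and comp_sum: "(\<Oplus>\<^bsub>A\<^esub>g\<in>carrier G. comp g x) = x"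
proof -
  let ?P = "\<lambda>f. f \<in> (\<Pi> g\<in>carrier G. gr g) \<and> x = (\<Oplus>\<^bsub>A\<^esub>g\<in>carrier G. f g)"
  have "\<exists>f. ?P f" using M.direct_sum_ex[OF fin_G gr_direct_sum subset_refl assms] by blast
  then have *: "?P (SOME f. ?P f)" by (rule someI_ex)
  have eq: "(\<lambda>g. comp g x) = (SOME f. ?P f)" by (simp add: fun_eq_iff comp_def)
  show "g \<in> carrier G \<Longrightarrow> comp g x \<in> gr g" "(\<Oplus>\<^bsub>A\<^esub>g\<in>carrier G. comp g x) = x"
    using * unfolding eq[symmetric] by auto
qed

lemma comp_carrier: "x \<in> carrier A \<Longrightarrow> g \<in> carrier G \<Longrightarrow> comp g x \<in> carrier A"
  using comp_gr gr_carrier by blast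

lemma gr_unique:
  assumes "\<And>g. g \<in> carrier G \<Longrightarrow> f g \<in> gr g" "\<And>g. g \<in> carrier G \<Longrightarrow> h g \<in> gr g"
    and "(\<Oplus>\<^bsub>A\<^esub>g\<in>carrier G. f g) = (\<Oplus>\<^bsub>A\<^esub>g\<in>carrier G. h g)" "g \<in> carrier G"
  shows "f g = h g"
proof (rule M.direct_sum_unique[OF fin_G gr_direct_sum subset_refl _ _ _ assms(3,4)])
  show "(\<Oplus>\<^bsub>A\<^esub>g\<in>carrier G. f g) \<in> carrier A" using assms(1) gr_carrier by (intro M.finsum_closed) blast
qed (use assms in auto)

lemma comp_unique:
  assumes "\<And>g. g \<in> carrier G \<Longrightarrow> f g \<in> gr g" "(\<Oplus>\<^bsub>A\<^esub>g\<in>carrier G. f g) = x" "x \<in> carrier A" "g \<in> carrier G"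
  shows "comp g x = f g"
  by (rule gr_unique) (use assms comp_gr comp_sum in auto)

lemma comp_hom:
  assumes "h \<in> carrier G" "x \<in> gr h" "g \<in> carrier G"
  shows "comp g x = (if g = h then x else \<zero>\<^bsub>A\<^esub>)"
proof (rule comp_unique[where f = "\<lambda>g. if g = h then x else \<zero>\<^bsub>A\<^esub>"])
  have "(\<Oplus>\<^bsub>A\<^esub>g\<in>carrier G. if g = h then x else \<zero>\<^bsub>A\<^esub>) = (\<Oplus>\<^bsub>A\<^esub>g\<in>carrier G. if h = g then x else \<zero>\<^bsub>A\<^esub>)"
    by (rule M.add.finprod_cong') (use assms gr_carrier in auto)
  also have "\<dots> = x"
    using M.finsum_singleton[OF assms(1) fin_G, of "\<lambda>_. x"] assms gr_carrier by auto
  finally show "(\<Oplus>\<^bsub>A\<^esub>g\<in>carrier G. if g = h then x else \<zero>\<^bsub>A\<^esub>) = x" .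
qed (use assms gr_zero gr_carrier in auto)

lemma comp_zero_imp_zero: "x \<in> carrier A \<Longrightarrow> (\<And>g. g \<in> carrier G \<Longrightarrow> comp g x = \<zero>\<^bsub>A\<^esub>) \<Longrightarrow> x = \<zero>\<^bsub>A\<^esub>"
  using comp_sum[of x] M.add.finprod_one_eqI[of "carrier G" "\<lambda>g. comp g x"] by simp

lemma comp_mult_right:
  assumes x: "x \<in> carrier A" and h: "h \<in> carrier G" "b \<in> gr h" and g: "g \<in> carrier G"
  shows "comp (g \<otimes>\<^bsub>G\<^esub> h) (x \<otimes>\<^bsub>A\<^esub> b) = comp g x \<otimes>\<^bsub>A\<^esub> b"
proof -
  have b: "b \<in> carrier A" using h gr_carrier by blast
  have "comp (g \<otimes>\<^bsub>G\<^esub> h) (x \<otimes>\<^bsub>A\<^esub> b) = comp ((g \<otimes>\<^bsub>G\<^esub> h) \<otimes>\<^bsub>G\<^esub> inv\<^bsub>G\<^esub> h) x \<otimes>\<^bsub>A\<^esub> b"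
  proof (rule comp_unique[where f = "\<lambda>k. comp (k \<otimes>\<^bsub>G\<^esub> inv\<^bsub>G\<^esub> h) x \<otimes>\<^bsub>A\<^esub> b"])
    show "comp (k \<otimes>\<^bsub>G\<^esub> inv\<^bsub>G\<^esub> h) x \<otimes>\<^bsub>A\<^esub> b \<in> gr k" if "k \<in> carrier G" for k
      using gr_mult[of "k \<otimes>\<^bsub>G\<^esub> inv\<^bsub>G\<^esub> h" h "comp (k \<otimes>\<^bsub>G\<^esub> inv\<^bsub>G\<^esub> h) x" b] that h comp_gr[OF x]
      by (simp add: G.m_assoc)
    have "(\<Oplus>\<^bsub>A\<^esub>k\<in>carrier G. comp (k \<otimes>\<^bsub>G\<^esub> inv\<^bsub>G\<^esub> h) x \<otimes>\<^bsub>A\<^esub> b) =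
        (\<Oplus>\<^bsub>A\<^esub>k\<in>(\<lambda>k. k \<otimes>\<^bsub>G\<^esub> h) ` carrier G. comp (k \<otimes>\<^bsub>G\<^esub> inv\<^bsub>G\<^esub> h) x \<otimes>\<^bsub>A\<^esub> b)"
    proof -
      have "x \<in> (\<lambda>k. k \<otimes>\<^bsub>G\<^esub> h) ` carrier G" if "x \<in> carrier G" for x
        by (rule image_eqI[of _ _ "x \<otimes>\<^bsub>G\<^esub> inv\<^bsub>G\<^esub> h"]) (use h that in \<open>simp_all add: G.m_assoc\<close>)
      then have "(\<lambda>k. k \<otimes>\<^bsub>G\<^esub> h) ` carrier G = carrier G" using h by auto
      then show ?thesis by simp
    qed
    also have "\<dots> = (\<Oplus>\<^bsub>A\<^esub>k\<in>carrier G. comp (k \<otimes>\<^bsub>G\<^esub> h \<otimes>\<^bsub>G\<^esub> inv\<^bsub>G\<^esub> h) x \<otimes>\<^bsub>A\<^esub> b)"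
      using h comp_carrier[OF x] b mult_closed
      by (intro M.finsum_reindex) (auto simp: inj_on_def)
    also have "\<dots> = (\<Oplus>\<^bsub>A\<^esub>k\<in>carrier G. comp k x \<otimes>\<^bsub>A\<^esub> b)"
      by (rule M.add.finprod_cong') (use h comp_carrier[OF x] b mult_closed in \<open>auto simp: G.m_assoc\<close>)
    also have "\<dots> = x \<otimes>\<^bsub>A\<^esub> b"
      using additive_finsum[OF additive_right[OF b], of "\<lambda>k. comp k x" "carrier G"] comp_carrier[OF x]
        comp_sum[OF x] by auto
    finally show "(\<Oplus>\<^bsub>A\<^esub>k\<in>carrier G. comp (k \<otimes>\<^bsub>G\<^esub> inv\<^bsub>G\<^esub> h) x \<otimes>\<^bsub>A\<^esub> b) = x \<otimes>\<^bsub>A\<^esub> b" .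
  qed (use x b g h mult_closed in auto)
  then show ?thesis using g h by (simp add: G.m_assoc)
qed

lemma comp_mult_left:
  assumes x: "x \<in> carrier A" and h: "h \<in> carrier G" "b \<in> gr h" and g: "g \<in> carrier G"
  shows "comp (h \<otimes>\<^bsub>G\<^esub> g) (b \<otimes>\<^bsub>A\<^esub> x) = b \<otimes>\<^bsub>A\<^esub> comp g x"
proof -
  have b: "b \<in> carrier A" using h gr_carrier by blast
  have "comp (h \<otimes>\<^bsub>G\<^esub> g) (b \<otimes>\<^bsub>A\<^esub> x) = b \<otimes>\<^bsub>A\<^esub> comp (inv\<^bsub>G\<^esub> h \<otimes>\<^bsub>G\<^esub> (h \<otimes>\<^bsub>G\<^esub> g)) x"
  proof (rule comp_unique[where f = "\<lambda>k. b \<otimes>\<^bsub>A\<^esub> comp (inv\<^bsub>G\<^esub> h \<otimes>\<^bsub>G\<^esub> k) x"])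
    show "b \<otimes>\<^bsub>A\<^esub> comp (inv\<^bsub>G\<^esub> h \<otimes>\<^bsub>G\<^esub> k) x \<in> gr k" if "k \<in> carrier G" for k
      using gr_mult[of h "inv\<^bsub>G\<^esub> h \<otimes>\<^bsub>G\<^esub> k" b "comp (inv\<^bsub>G\<^esub> h \<otimes>\<^bsub>G\<^esub> k) x"] that h comp_gr[OF x]
      by (simp flip: G.m_assoc)
    have "(\<Oplus>\<^bsub>A\<^esub>k\<in>carrier G. b \<otimes>\<^bsub>A\<^esub> comp (inv\<^bsub>G\<^esub> h \<otimes>\<^bsub>G\<^esub> k) x) =
        (\<Oplus>\<^bsub>A\<^esub>k\<in>(\<lambda>k. h \<otimes>\<^bsub>G\<^esub> k) ` carrier G. b \<otimes>\<^bsub>A\<^esub> comp (inv\<^bsub>G\<^esub> h \<otimes>\<^bsub>G\<^esub> k) x)"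
      using h by (simp add: G.surj_const_mult)
    also have "\<dots> = (\<Oplus>\<^bsub>A\<^esub>k\<in>carrier G. b \<otimes>\<^bsub>A\<^esub> comp (inv\<^bsub>G\<^esub> h \<otimes>\<^bsub>G\<^esub> (h \<otimes>\<^bsub>G\<^esub> k)) x)"
      using h comp_carrier[OF x] b mult_closed
      by (intro M.finsum_reindex) (auto simp: inj_on_def)
    also have "\<dots> = (\<Oplus>\<^bsub>A\<^esub>k\<in>carrier G. b \<otimes>\<^bsub>A\<^esub> comp k x)"
      by (rule M.add.finprod_cong') (use h comp_carrier[OF x] b mult_closed in \<open>auto simp flip: G.m_assoc\<close>)
    also have "\<dots> = b \<otimes>\<^bsub>A\<^esub> x"
      using additive_finsum[OF additive_left[OF b], of "\<lambda>k. comp k x" "carrier G"] comp_carrier[OF x]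
        comp_sum[OF x] by auto
    finally show "(\<Oplus>\<^bsub>A\<^esub>k\<in>carrier G. b \<otimes>\<^bsub>A\<^esub> comp (inv\<^bsub>G\<^esub> h \<otimes>\<^bsub>G\<^esub> k) x) = b \<otimes>\<^bsub>A\<^esub> x" .
  qed (use x b g h mult_closed in auto)
  then show ?thesis using g h by (simp flip: G.m_assoc)
qed

lemma mult_zero_hom:
  assumes x: "x \<in> carrier A" "\<And>h b. h \<in> carrier G \<Longrightarrow> b \<in> gr h \<Longrightarrow> x \<otimes>\<^bsub>A\<^esub> b = \<zero>\<^bsub>A\<^esub>" and y: "y \<in> carrier A"
  shows "x \<otimes>\<^bsub>A\<^esub> y = \<zero>\<^bsub>A\<^esub>"
proof -
  have "x \<otimes>\<^bsub>A\<^esub> y = (\<Oplus>\<^bsub>A\<^esub>g\<in>carrier G. x \<otimes>\<^bsub>A\<^esub> comp g y)"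
    using additive_finsum[OF additive_left[OF x(1)], of "\<lambda>g. comp g y" "carrier G"] comp_carrier[OF y]
      comp_sum[OF y] by auto
  then show ?thesis using x(2) comp_gr[OF y] by (simp add: M.add.finprod_one_eqI)
qed

lemma comp_add:
  assumes "x \<in> carrier A" "y \<in> carrier A" "g \<in> carrier G"
  shows "comp g (x \<oplus>\<^bsub>A\<^esub> y) = comp g x \<oplus>\<^bsub>A\<^esub> comp g y"
proof (rule comp_unique[where f = "\<lambda>g. comp g x \<oplus>\<^bsub>A\<^esub> comp g y"])
  show "(\<Oplus>\<^bsub>A\<^esub>g\<in>carrier G. comp g x \<oplus>\<^bsub>A\<^esub> comp g y) = x \<oplus>\<^bsub>A\<^esub> y"
    using M.finsum_addf[of "\<lambda>g. comp g x" "carrier G" "\<lambda>g. comp g y"] assms comp_carrier comp_sum by auto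
qed (use assms gr_add comp_gr in auto)

lemma additive_comp_g: "g \<in> carrier G \<Longrightarrow> additive_map (comp g)"
  by (intro additive_mapI comp_carrier comp_add)

lemma graded_idealI:
  assumes sub: "I \<subseteq> carrier A" and zero: "\<zero>\<^bsub>A\<^esub> \<in> I"
    and add: "\<And>x y. x \<in> I \<Longrightarrow> y \<in> I \<Longrightarrow> x \<oplus>\<^bsub>A\<^esub> y \<in> I"
    and smult: "\<And>c x. c \<in> carrier F \<Longrightarrow> x \<in> I \<Longrightarrow> c \<odot>\<^bsub>A\<^esub> x \<in> I"
    and left: "\<And>x y. x \<in> carrier A \<Longrightarrow> y \<in> I \<Longrightarrow> x \<otimes>\<^bsub>A\<^esub> y \<in> I"
    and right: "\<And>x y. x \<in> carrier A \<Longrightarrow> y \<in> I \<Longrightarrow> y \<otimes>\<^bsub>A\<^esub> x \<in> I"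
    and comp: "\<And>x g. x \<in> I \<Longrightarrow> g \<in> carrier G \<Longrightarrow> comp g x \<in> I"
  shows "graded_ideal G F A gr I"
proof -
  have "submodule I F A"
  proof (rule submoduleI[OF sub zero])
    show "\<ominus>\<^bsub>A\<^esub> x \<in> I" if "x \<in> I" for x
      using smult[of "\<ominus>\<^bsub>F\<^esub> \<one>\<^bsub>F\<^esub>" x] that sub smult_l_minus[of "\<one>\<^bsub>F\<^esub>" x] by auto
  qed (use add smult in auto)
  moreover have "direct_sum_of A (carrier G) (\<lambda>g. I \<inter> gr g) I"
  proof (rule M.direct_sum_ofI[OF fin_G _ sub])
    show "\<exists>f\<in>(\<Pi> g\<in>carrier G. I \<inter> gr g). x = (\<Oplus>\<^bsub>A\<^esub>g\<in>carrier G. f g)" if "x \<in> I" for x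
      using that sub comp comp_gr comp_sum by (intro bexI[of _ "\<lambda>g. comp g x"]) auto
    show "f g = h g" if "f \<in> (\<Pi> g\<in>carrier G. I \<inter> gr g)" "h \<in> (\<Pi> g\<in>carrier G. I \<inter> gr g)"
      "(\<Oplus>\<^bsub>A\<^esub>g\<in>carrier G. f g) = (\<Oplus>\<^bsub>A\<^esub>g\<in>carrier G. h g)" "g \<in> carrier G" for f h g
      by (rule gr_unique[of f h]) (use that in auto)
  qed blast
  ultimately show ?thesis using left right by (auto simp: graded_ideal_def)
qed

lemma graded_idealD:
  assumes I: "graded_ideal G F A gr I"
  shows "I \<subseteq> carrier A" "\<zero>\<^bsub>A\<^esub> \<in> I" "x \<in> I \<Longrightarrow> y \<in> I \<Longrightarrow> x \<oplus>\<^bsub>A\<^esub> y \<in> I" "x \<in> I \<Longrightarrow> \<ominus>\<^bsub>A\<^esub> x \<in> I"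
    "c \<in> carrier F \<Longrightarrow> x \<in> I \<Longrightarrow> c \<odot>\<^bsub>A\<^esub> x \<in> I"
    "x \<in> carrier A \<Longrightarrow> y \<in> I \<Longrightarrow> x \<otimes>\<^bsub>A\<^esub> y \<in> I" "x \<in> carrier A \<Longrightarrow> y \<in> I \<Longrightarrow> y \<otimes>\<^bsub>A\<^esub> x \<in> I"
    "x \<in> I \<Longrightarrow> g \<in> carrier G \<Longrightarrow> comp g x \<in> I"
proof -
  have sm: "submodule I F A" and ds: "direct_sum_of A (carrier G) (\<lambda>g. I \<inter> gr g) I"
    using I by (auto simp: graded_ideal_def)
  show sub: "I \<subseteq> carrier A" by (rule submoduleE(1)[OF sm])
  show "\<zero>\<^bsub>A\<^esub> \<in> I" by (rule submodule_zero[OF sm])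
  show "x \<in> I \<Longrightarrow> y \<in> I \<Longrightarrow> x \<oplus>\<^bsub>A\<^esub> y \<in> I" "x \<in> I \<Longrightarrow> \<ominus>\<^bsub>A\<^esub> x \<in> I"
    "c \<in> carrier F \<Longrightarrow> x \<in> I \<Longrightarrow> c \<odot>\<^bsub>A\<^esub> x \<in> I"
    by (rule submoduleE(5)[OF sm] submoduleE(3)[OF sm] submoduleE(4)[OF sm]; assumption)+
  show "x \<in> carrier A \<Longrightarrow> y \<in> I \<Longrightarrow> x \<otimes>\<^bsub>A\<^esub> y \<in> I" "x \<in> carrier A \<Longrightarrow> y \<in> I \<Longrightarrow> y \<otimes>\<^bsub>A\<^esub> x \<in> I"
    using I by (auto simp: graded_ideal_def)
  show "comp g x \<in> I" if x: "x \<in> I" and g: "g \<in> carrier G"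
  proof -
    obtain f where f: "f \<in> (\<Pi> g\<in>carrier G. I \<inter> gr g)" "x = (\<Oplus>\<^bsub>A\<^esub>g\<in>carrier G. f g)"
      using M.direct_sum_ex[OF fin_G ds sub x] by blast
    have "comp g x = f g" by (rule comp_unique) (use f x sub g in auto)
    then show ?thesis using f(1) g by auto
  qed
qed

section \<open>The action of a free ring\<close>

text \<open>The free ring on the homogeneous elements of \<open>A\<close> and the scalars acts on \<open>A\<close>; it is a type, so
  that the results for ideals of a ring type apply to the annihilator of this action.  Letters that
  do not denote a homogeneous element or a scalar act as zero.\<close>

definition letter_act :: "('g \<times> 'a) + 'f \<Rightarrow> 'a \<Rightarrow> 'a" where
  "letter_act l b = (case l of
     Inl (g, a) \<Rightarrow> if g \<in> carrier G \<and> a \<in> gr g then a \<otimes>\<^bsub>A\<^esub> b else \<zero>\<^bsub>A\<^esub>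
   | Inr c \<Rightarrow> if c \<in> carrier F then c \<odot>\<^bsub>A\<^esub> b else \<zero>\<^bsub>A\<^esub>)"

text \<open>Letters that act as zero also need a degree in the group; \<open>\<one>\<close> is a
  harmless value, as zero lies in every component.\<close>

definition letter_deg :: "('g \<times> 'a) + 'f \<Rightarrow> 'g" where
  "letter_deg l = (case l of
     Inl (g, a) \<Rightarrow> if g \<in> carrier G \<and> a \<in> gr g then g else \<one>\<^bsub>G\<^esub>
   | Inr c \<Rightarrow> \<one>\<^bsub>G\<^esub>)"

definition word_act :: "(('g \<times> 'a) + 'f) word \<Rightarrow> 'a \<Rightarrow> 'a" where
  "word_act w b = foldr letter_act (letters w) b"

definition deg :: "(('g \<times> 'a) + 'f) word \<Rightarrow> 'g" where
  "deg w = foldr (\<lambda>l h. letter_deg l \<otimes>\<^bsub>G\<^esub> h) (letters w) \<one>\<^bsub>G\<^esub>"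

definition act :: "((('g \<times> 'a) + 'f) word \<Rightarrow>\<^sub>0 int) \<Rightarrow> 'a \<Rightarrow> 'a" where
  "act \<phi> b = (\<Oplus>\<^bsub>A\<^esub>w\<in>Poly_Mapping.keys \<phi>. [Poly_Mapping.lookup \<phi> w] \<cdot>\<^bsub>A\<^esub> word_act w b)"

definition Pr :: "'g \<Rightarrow> ((('g \<times> 'a) + 'f) word \<Rightarrow>\<^sub>0 int) \<Rightarrow> ((('g \<times> 'a) + 'f) word \<Rightarrow>\<^sub>0 int)" where
  "Pr g \<phi> = restrict_keys (\<lambda>w. deg w = g) \<phi>"

definition ann :: "((('g \<times> 'a) + 'f) word \<Rightarrow>\<^sub>0 int) set" where
  "ann = {\<phi>. \<forall>b\<in>carrier A. act \<phi> b = \<zero>\<^bsub>A\<^esub>}"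

text \<open>The ring elements that act as left multiplication by an element of I; for I the whole
  algebra this plays the role of M. Such an element is identified through its action, since without
  a unit it cannot be read off from a value at 1.\<close>

definition rep :: "'a set \<Rightarrow> ((('g \<times> 'a) + 'f) word \<Rightarrow>\<^sub>0 int) set" where
  "rep I = {\<phi>. \<exists>i\<in>I. \<forall>b\<in>carrier A. act \<phi> b = i \<otimes>\<^bsub>A\<^esub> b}"

lemma letter_deg_closed: "letter_deg l \<in> carrier G"
  by (auto simp: letter_deg_def split: sum.splits)

lemma deg_closed: "deg w \<in> carrier G"
proof -
  have "foldr (\<lambda>l h. letter_deg l \<otimes>\<^bsub>G\<^esub> h) ls \<one>\<^bsub>G\<^esub> \<in> carrier G" for ls
    by (induction ls) (auto intro: letter_deg_closed)
  then show ?thesis by (simp add: deg_def)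
qed

lemma deg_add: "deg (v + w) = deg v \<otimes>\<^bsub>G\<^esub> deg w"
proof -
  have cl: "foldr (\<lambda>l h. letter_deg l \<otimes>\<^bsub>G\<^esub> h) ls \<one>\<^bsub>G\<^esub> \<in> carrier G" for ls
    by (induction ls) (auto intro: letter_deg_closed)
  have "foldr (\<lambda>l h. letter_deg l \<otimes>\<^bsub>G\<^esub> h) (ls @ ms) \<one>\<^bsub>G\<^esub> =
      foldr (\<lambda>l h. letter_deg l \<otimes>\<^bsub>G\<^esub> h) ls \<one>\<^bsub>G\<^esub> \<otimes>\<^bsub>G\<^esub> foldr (\<lambda>l h. letter_deg l \<otimes>\<^bsub>G\<^esub> h) ms \<one>\<^bsub>G\<^esub>" for ls ms
    using cl letter_deg_closed by (induction ls) (simp_all add: G.m_assoc)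
  then show ?thesis by (simp add: deg_def plus_word_def)
qed

lemma deg_zero: "deg 0 = \<one>\<^bsub>G\<^esub>"
  by (simp add: deg_def zero_word_def)

lemma letter_act_additive: "additive_map (letter_act l)"
proof (cases l)
  case (Inl ga)
  obtain g a where ga: "ga = (g, a)" by force
  show ?thesis
  proof (cases "g \<in> carrier G \<and> a \<in> gr g")
    case True
    then have "letter_act l = (\<lambda>b. a \<otimes>\<^bsub>A\<^esub> b)" by (simp add: fun_eq_iff letter_act_def Inl ga)
    then show ?thesis using additive_left[of a] gr_carrier True by auto
  next
    case False
    then have "letter_act l = (\<lambda>b. \<zero>\<^bsub>A\<^esub>)" by (auto simp: fun_eq_iff letter_act_def Inl ga)
    then show ?thesis by (simp add: additive_map_def)
  qed
next
  case (Inr c)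
  show ?thesis
  proof (cases "c \<in> carrier F")
    case True
    then have "letter_act l = (\<lambda>b. c \<odot>\<^bsub>A\<^esub> b)" by (simp add: fun_eq_iff letter_act_def Inr)
    then show ?thesis using additive_smult[OF True] by simp
  next
    case False
    then have "letter_act l = (\<lambda>b. \<zero>\<^bsub>A\<^esub>)" by (auto simp: fun_eq_iff letter_act_def Inr)
    then show ?thesis by (simp add: additive_map_def)
  qed
qed

lemma word_act_additive: "additive_map (word_act w)"
proof -
  have "additive_map (\<lambda>b. foldr letter_act ls b)" for ls
  proof (induction ls)
    case Nil
    then show ?case by (simp add: additive_map_def)
  next
    case (Cons l ls)
    then show ?case using additive_comp[OF letter_act_additive[of l]] by simp
  qed
  then show ?thesis unfolding word_act_def[abs_def] .
qed

lemma word_act_add: "word_act (v + w) b = word_act v (word_act w b)"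
  by (simp add: word_act_def plus_word_def)

lemma act_superset:
  assumes "finite S" "Poly_Mapping.keys \<phi> \<subseteq> S" "b \<in> carrier A"
  shows "act \<phi> b = (\<Oplus>\<^bsub>A\<^esub>w\<in>S. [Poly_Mapping.lookup \<phi> w] \<cdot>\<^bsub>A\<^esub> word_act w b)"
  unfolding act_def
proof (rule M.add.finprod_mono_neutral_cong_left[OF assms(1,2)])
  show "[Poly_Mapping.lookup \<phi> w] \<cdot>\<^bsub>A\<^esub> word_act w b = \<zero>\<^bsub>A\<^esub>" if "w \<in> S - Poly_Mapping.keys \<phi>" for w
    using that by (simp add: in_keys_iff add_pow_def)
qed (use assms additive_closed[OF word_act_additive] in auto)

lemma act_closed: "b \<in> carrier A \<Longrightarrow> act \<phi> b \<in> carrier A"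
  unfolding act_def using additive_closed[OF word_act_additive] by (intro M.finsum_closed) auto

lemma act_plus:
  assumes b: "b \<in> carrier A" shows "act (\<phi> + \<mu>) b = act \<phi> b \<oplus>\<^bsub>A\<^esub> act \<mu> b"
proof -
  let ?S = "Poly_Mapping.keys \<phi> \<union> Poly_Mapping.keys \<mu>"
  have wc: "word_act w b \<in> carrier A" for w using additive_closed[OF word_act_additive b] .
  have "act (\<phi> + \<mu>) b = (\<Oplus>\<^bsub>A\<^esub>w\<in>?S. [Poly_Mapping.lookup (\<phi> + \<mu>) w] \<cdot>\<^bsub>A\<^esub> word_act w b)"
    using b Poly_Mapping.keys_add[of \<phi> \<mu>] by (intro act_superset) auto
  also have "\<dots> = (\<Oplus>\<^bsub>A\<^esub>w\<in>?S. [Poly_Mapping.lookup \<phi> w] \<cdot>\<^bsub>A\<^esub> word_act w b \<oplus>\<^bsub>A\<^esub>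
      [Poly_Mapping.lookup \<mu> w] \<cdot>\<^bsub>A\<^esub> word_act w b)"
    by (simp add: lookup_add M.add.int_pow_mult[OF wc])
  also have "\<dots> = (\<Oplus>\<^bsub>A\<^esub>w\<in>?S. [Poly_Mapping.lookup \<phi> w] \<cdot>\<^bsub>A\<^esub> word_act w b) \<oplus>\<^bsub>A\<^esub>
      (\<Oplus>\<^bsub>A\<^esub>w\<in>?S. [Poly_Mapping.lookup \<mu> w] \<cdot>\<^bsub>A\<^esub> word_act w b)"
    using wc by (intro M.finsum_addf) auto
  also have "\<dots> = act \<phi> b \<oplus>\<^bsub>A\<^esub> act \<mu> b" using act_superset[of ?S _ b] b by simp
  finally show ?thesis .
qed

lemma act_zero: "act 0 b = \<zero>\<^bsub>A\<^esub>"
  by (simp add: act_def)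

lemma act_diff:
  assumes b: "b \<in> carrier A" shows "act (\<phi> - \<mu>) b = act \<phi> b \<ominus>\<^bsub>A\<^esub> act \<mu> b"
proof -
  have "act \<phi> b = act (\<phi> - \<mu>) b \<oplus>\<^bsub>A\<^esub> act \<mu> b" using act_plus[OF b, of "\<phi> - \<mu>" \<mu>] by simp
  then show ?thesis using act_closed[OF b] by (simp add: a_minus_def M.a_assoc M.r_neg)
qed

lemma act_frag_of: "b \<in> carrier A \<Longrightarrow> act (frag_of w) b = word_act w b"
  using additive_closed[OF word_act_additive] by (simp add: act_def)

lemma act_additive: "additive_map (act \<phi>)"
proof (induction \<phi> rule: int_mapping_induct)
  case (one w)
  show ?case
    using additive_add[OF word_act_additive] additive_closed[OF word_act_additive]
    by (intro additive_mapI) (simp_all add: act_frag_of)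
next
  case (diff \<phi> \<mu>)
  show ?case
  proof (rule additive_mapI)
    fix x y assume xy: "x \<in> carrier A" "y \<in> carrier A"
    then have c: "act \<phi> x \<in> carrier A" "act \<mu> x \<in> carrier A" "act \<phi> y \<in> carrier A" "act \<mu> y \<in> carrier A"
      by (simp_all add: act_closed)
    have "act (\<phi> - \<mu>) (x \<oplus>\<^bsub>A\<^esub> y) = act \<phi> x \<oplus>\<^bsub>A\<^esub> act \<phi> y \<oplus>\<^bsub>A\<^esub> (\<ominus>\<^bsub>A\<^esub> act \<mu> x \<oplus>\<^bsub>A\<^esub> \<ominus>\<^bsub>A\<^esub> act \<mu> y)"
      using xy c diff by (simp add: act_diff additive_add a_minus_def M.minus_add)
    also have "\<dots> = act (\<phi> - \<mu>) x \<oplus>\<^bsub>A\<^esub> act (\<phi> - \<mu>) y"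
      using xy c by (simp add: act_diff a_minus_def M.a_ac)
    finally show "act (\<phi> - \<mu>) (x \<oplus>\<^bsub>A\<^esub> y) = act (\<phi> - \<mu>) x \<oplus>\<^bsub>A\<^esub> act (\<phi> - \<mu>) y" .
  qed (simp add: act_closed)
qed (auto simp: act_zero additive_map_def)

lemma act_one: "b \<in> carrier A \<Longrightarrow> act 1 b = b"
  using act_frag_of[of b 0, unfolded single_one] by (simp add: word_act_def zero_word_def)

lemma act_mult: "b \<in> carrier A \<Longrightarrow> act (\<phi> * \<mu>) b = act \<phi> (act \<mu> b)"
proof (induction \<phi> rule: int_mapping_induct)
  case zero
  then show ?case by (simp add: act_zero)
next
  case (one v)
  from one show ?case
  proof (induction \<mu> rule: int_mapping_induct)
    case zero
    then show ?case by (simp add: act_zero additive_zero[OF act_additive])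
  next
    case (one w)
    then have "word_act w b \<in> carrier A" by (simp add: additive_closed[OF word_act_additive])
    moreover have "frag_of v * frag_of w = (frag_of (v + w) :: _ word \<Rightarrow>\<^sub>0 int)"
      by (simp add: mult_single)
    ultimately show ?case using one by (simp add: act_frag_of word_act_add)
  next
    case (diff \<phi> \<mu>)
    then show ?case by (simp add: right_diff_distrib act_diff act_closed additive_diff[OF act_additive])
  qed
next
  case (diff \<phi> \<nu>)
  then show ?case by (simp add: left_diff_distrib act_diff act_closed)
qed

lemma act_right:
  assumes x: "x \<in> carrier A" and y: "y \<in> carrier A" shows "act \<phi> (x \<otimes>\<^bsub>A\<^esub> y) = act \<phi> x \<otimes>\<^bsub>A\<^esub> y"
proof (induction \<phi> rule: int_mapping_induct)
  case zero
  then show ?case using y by (simp add: act_zero mult_zero_left)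
next
  case (one w)
  have 1: "letter_act l (x \<otimes>\<^bsub>A\<^esub> y) = letter_act l x \<otimes>\<^bsub>A\<^esub> y" if "x \<in> carrier A" for l x
    using that y gr_carrier by (auto simp: letter_act_def mult_assoc smult_mult_left mult_zero_left split: sum.splits)
  have "foldr letter_act ls (x \<otimes>\<^bsub>A\<^esub> y) = foldr letter_act ls x \<otimes>\<^bsub>A\<^esub> y \<and> foldr letter_act ls x \<in> carrier A" for ls
    using x 1 additive_closed[OF letter_act_additive] by (induction ls) simp_all
  then show ?case using x y by (simp add: act_frag_of word_act_def mult_closed)
next
  case (diff \<phi> \<mu>)
  then show ?case using x y by (simp add: act_diff mult_closed act_closed additive_diff[OF additive_right])
qed

lemma act_smult:
  assumes x: "x \<in> carrier A" and c: "c \<in> carrier F" shows "act \<phi> (c \<odot>\<^bsub>A\<^esub> x) = c \<odot>\<^bsub>A\<^esub> act \<phi> x"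
proof (induction \<phi> rule: int_mapping_induct)
  case zero
  then show ?case using c by (simp add: act_zero)
next
  case (one w)
  have 1: "letter_act l (c \<odot>\<^bsub>A\<^esub> x) = c \<odot>\<^bsub>A\<^esub> letter_act l x" if "x \<in> carrier A" for l x
    using that c gr_carrier
    by (auto simp: letter_act_def smult_mult_right R.m_comm simp flip: smult_assoc1 split: sum.splits)
  have "foldr letter_act ls (c \<odot>\<^bsub>A\<^esub> x) = c \<odot>\<^bsub>A\<^esub> foldr letter_act ls x \<and> foldr letter_act ls x \<in> carrier A" for ls
    using x 1 additive_closed[OF letter_act_additive] by (induction ls) simp_all
  then show ?case using x c by (simp add: act_frag_of word_act_def)
next
  case (diff \<phi> \<mu>)
  then show ?case using x c by (simp add: act_diff act_closed additive_diff[OF additive_smult])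
qed

lemma act_sum:
  assumes b: "b \<in> carrier A" shows "act (sum f I) b = (\<Oplus>\<^bsub>A\<^esub>i\<in>I. act (f i) b)"
proof (induction I rule: infinite_finite_induct)
  case (insert i I)
  then show ?case using act_plus[OF b] act_closed[OF b] by (simp add: M.finsum_insert Pi_iff)
qed (simp_all add: act_zero)

lemma Pr_plus: "Pr g (\<phi> + \<mu>) = Pr g \<phi> + Pr g \<mu>" and Pr_diff: "Pr g (\<phi> - \<mu>) = Pr g \<phi> - Pr g \<mu>"
  by (auto simp: Pr_def poly_mapping_eq_iff fun_eq_iff restrict_keys.rep_eq lookup_add lookup_minus)

lemma Pr_frag_of: "Pr g (frag_of w) = (if deg w = g then frag_of w else 0)"
  by (auto simp: Pr_def poly_mapping_eq_iff fun_eq_iff restrict_keys.rep_eq lookup_single when_def)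

lemma word_act_gr: "h \<in> carrier G \<Longrightarrow> b \<in> gr h \<Longrightarrow> word_act w b \<in> gr (deg w \<otimes>\<^bsub>G\<^esub> h)"
proof -
  assume h: "h \<in> carrier G" and b: "b \<in> gr h"
  have dcl: "foldr (\<lambda>l h. letter_deg l \<otimes>\<^bsub>G\<^esub> h) ls \<one>\<^bsub>G\<^esub> \<in> carrier G" for ls
    by (induction ls) (auto intro: letter_deg_closed)
  have 1: "letter_act l c \<in> gr (letter_deg l \<otimes>\<^bsub>G\<^esub> k)" if "k \<in> carrier G" "c \<in> gr k" for l c k
    using that gr_mult gr_smult gr_zero by (auto simp: letter_act_def letter_deg_def split: sum.splits)
  have "foldr letter_act ls b \<in> gr (foldr (\<lambda>l h. letter_deg l \<otimes>\<^bsub>G\<^esub> h) ls \<one>\<^bsub>G\<^esub> \<otimes>\<^bsub>G\<^esub> h)" for ls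
  proof (induction ls)
    case Nil
    then show ?case using h b by simp
  next
    case (Cons l ls)
    then show ?case using 1[OF _ Cons] dcl h letter_deg_closed by (simp add: G.m_assoc)
  qed
  then show ?thesis by (simp add: word_act_def deg_def)
qed

text \<open>Discarding the words of degree other than g amounts to taking a component as long as b
  is homogeneous; a general b has to be decomposed first.\<close>

lemma act_Pr_hom:
  assumes g: "g \<in> carrier G" and h: "h \<in> carrier G" and b: "b \<in> gr h"
  shows "act (Pr g \<phi>) b = comp (g \<otimes>\<^bsub>G\<^esub> h) (act \<phi> b)"
proof (induction \<phi> rule: int_mapping_induct)
  case zero
  have "Pr g 0 = 0" using Pr_diff[of g 0 0] by simp
  then show ?case using additive_zero[OF additive_comp_g] g h by (simp add: act_zero)
next
  case (one w)
  have bA: "b \<in> carrier A" using gr_carrier h b by blast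
  have "comp (g \<otimes>\<^bsub>G\<^esub> h) (word_act w b) = (if g \<otimes>\<^bsub>G\<^esub> h = deg w \<otimes>\<^bsub>G\<^esub> h then word_act w b else \<zero>\<^bsub>A\<^esub>)"
    using word_act_gr[OF h b] g h deg_closed by (intro comp_hom) auto
  then show ?case using g h deg_closed bA by (auto simp: Pr_frag_of act_frag_of act_zero)
next
  case (diff \<phi> \<mu>)
  have "b \<in> carrier A" using gr_carrier h b by blast
  then show ?case using diff g h by (simp add: Pr_diff act_diff act_closed additive_diff[OF additive_comp_g])
qed

lemma annI: "(\<And>b. b \<in> carrier A \<Longrightarrow> act \<phi> b = \<zero>\<^bsub>A\<^esub>) \<Longrightarrow> \<phi> \<in> ann"
  by (simp add: ann_def)

lemma annI_hom:
  assumes "\<And>h b. h \<in> carrier G \<Longrightarrow> b \<in> gr h \<Longrightarrow> act \<phi> b = \<zero>\<^bsub>A\<^esub>" shows "\<phi> \<in> ann"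
proof (rule annI)
  fix b assume b: "b \<in> carrier A"
  have "act \<phi> b = (\<Oplus>\<^bsub>A\<^esub>g\<in>carrier G. act \<phi> (comp g b))"
    using additive_finsum[OF act_additive, of "\<lambda>g. comp g b" "carrier G"] comp_carrier[OF b] comp_sum[OF b] by auto
  then show "act \<phi> b = \<zero>\<^bsub>A\<^esub>" using assms comp_gr[OF b] by (simp add: M.add.finprod_one_eqI)
qed

lemma ann_ideal: "two_sided_ideal ann"
  by standard (auto simp: ann_def act_zero act_plus act_mult act_closed additive_zero[OF act_additive])

lemma ann_diff: "\<phi> - \<mu> \<in> ann \<longleftrightarrow> (\<forall>b\<in>carrier A. act \<phi> b = act \<mu> b)"
  using act_closed by (auto simp: ann_def act_diff diff_zero_iff)

lemma Pr_ann: "g \<in> carrier G \<Longrightarrow> \<phi> \<in> ann \<Longrightarrow> Pr g \<phi> \<in> ann"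
proof (rule annI_hom)
  fix h b assume "g \<in> carrier G" "\<phi> \<in> ann" "h \<in> carrier G" "b \<in> gr h"
  then show "act (Pr g \<phi>) b = \<zero>\<^bsub>A\<^esub>"
    using gr_carrier additive_zero[OF additive_comp_g] by (simp add: act_Pr_hom ann_def)
qed

lemma rep_frag_of: "g \<in> carrier G \<Longrightarrow> a \<in> gr g \<Longrightarrow> a \<in> I \<Longrightarrow> frag_of (Word [Inl (g, a)]) \<in> rep I"
  using gr_carrier by (auto simp: rep_def act_frag_of word_act_def letter_act_def intro!: bexI[of _ a])

lemma act_ideal: "graded_ideal G F A gr I \<Longrightarrow> i \<in> I \<Longrightarrow> act \<phi> i \<in> I"
proof (induction \<phi> rule: int_mapping_induct)
  case zero
  then show ?case using graded_idealD(2) by (simp add: act_zero)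
next
  case (one w)
  note D = graded_idealD[OF one(1)]
  have 1: "letter_act l i \<in> I" if "i \<in> I" for l i
    using that D(2,5,6) gr_carrier by (auto simp: letter_act_def split: sum.splits)
  have "foldr letter_act ls i \<in> I" for ls using one(2) 1 by (induction ls) auto
  then show ?case using one(2) D(1) by (auto simp: act_frag_of word_act_def)
next
  case (diff \<phi> \<mu>)
  note D = graded_idealD[OF diff(3)]
  have "i \<in> carrier A" using D(1) diff by blast
  then show ?case using diff D(3,4) by (simp add: act_diff a_minus_def)
qed

lemma rep_closed:
  assumes I: "graded_ideal G F A gr I"
  shows rep_zero: "0 \<in> rep I"
    and rep_plus: "\<phi> \<in> rep I \<Longrightarrow> \<mu> \<in> rep I \<Longrightarrow> \<phi> + \<mu> \<in> rep I"
    and rep_left: "\<phi> \<in> rep I \<Longrightarrow> \<mu> * \<phi> \<in> rep I"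
    and rep_right: "\<phi> \<in> rep I \<Longrightarrow> \<phi> * \<mu> \<in> rep I"
    and rep_Pr: "g \<in> carrier G \<Longrightarrow> \<phi> \<in> rep I \<Longrightarrow> Pr g \<phi> \<in> rep I"
proof -
  note D = graded_idealD[OF I]
  have IA: "i \<in> carrier A" if "i \<in> I" for i using D(1) that by blast
  show "0 \<in> rep I" using D(2) by (auto simp: rep_def act_zero mult_zero_left intro!: bexI[of _ "\<zero>\<^bsub>A\<^esub>"])
  show "\<phi> + \<mu> \<in> rep I" if "\<phi> \<in> rep I" "\<mu> \<in> rep I"
  proof -
    obtain i j where "i \<in> I" "j \<in> I" "\<forall>b\<in>carrier A. act \<phi> b = i \<otimes>\<^bsub>A\<^esub> b" "\<forall>b\<in>carrier A. act \<mu> b = j \<otimes>\<^bsub>A\<^esub> b"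
      using \<open>\<phi> \<in> rep I\<close> \<open>\<mu> \<in> rep I\<close> by (auto simp: rep_def)
    then show ?thesis unfolding rep_def using D(3) IA
      by (intro CollectI bexI[of _ "i \<oplus>\<^bsub>A\<^esub> j"]) (simp_all add: act_plus mult_distrib_right)
  qed
  show "\<mu> * \<phi> \<in> rep I" if "\<phi> \<in> rep I"
  proof -
    obtain i where "i \<in> I" "\<forall>b\<in>carrier A. act \<phi> b = i \<otimes>\<^bsub>A\<^esub> b" using \<open>\<phi> \<in> rep I\<close> by (auto simp: rep_def)
    then show ?thesis unfolding rep_def using act_ideal[OF I] IA
      by (intro CollectI bexI[of _ "act \<mu> i"]) (simp_all add: act_mult act_right)
  qed
  \<comment> \<open>For the right ideal property the letters of \<mu> are pushed one by one into i,
    which is multiplied by an element or a scalar each time and stays in I.\<close>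
  have "\<exists>j\<in>I. \<forall>b\<in>carrier A. i \<otimes>\<^bsub>A\<^esub> act \<mu> b = j \<otimes>\<^bsub>A\<^esub> b" if i: "i \<in> I" for i
  proof (induction \<mu> rule: int_mapping_induct)
    case zero
    then show ?case using D(2) IA i
      by (intro bexI[of _ "\<zero>\<^bsub>A\<^esub>"]) (simp_all add: act_zero mult_zero_right mult_zero_left)
  next
    case (one w)
    have 1: "\<exists>j\<in>I. \<forall>b\<in>carrier A. i \<otimes>\<^bsub>A\<^esub> letter_act l b = j \<otimes>\<^bsub>A\<^esub> b" if i: "i \<in> I" for i l
    proof -
      consider g a where "l = Inl (g, a)" "g \<in> carrier G" "a \<in> gr g" | c where "l = Inr c" "c \<in> carrier F"
        | "\<forall>b. letter_act l b = \<zero>\<^bsub>A\<^esub>"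
        by (cases l) (fastforce simp: letter_act_def)+
      then show ?thesis
      proof cases
        case 1
        then have "a \<in> carrier A" using gr_carrier by blast
        then show ?thesis using 1 i IA[OF i] D(7)
          by (intro bexI[of _ "i \<otimes>\<^bsub>A\<^esub> a"]) (simp_all add: letter_act_def mult_assoc)
      next
        case 2
        then show ?thesis using i IA[OF i] D(5)
          by (intro bexI[of _ "c \<odot>\<^bsub>A\<^esub> i"]) (simp_all add: letter_act_def smult_mult_left smult_mult_right)
      next
        case 3
        then show ?thesis using i IA[OF i] D(2)
          by (intro bexI[of _ "\<zero>\<^bsub>A\<^esub>"]) (simp_all add: mult_zero_right mult_zero_left)
      qed
    qed
    have "\<exists>j\<in>I. \<forall>b\<in>carrier A. i \<otimes>\<^bsub>A\<^esub> foldr letter_act ls b = j \<otimes>\<^bsub>A\<^esub> b" for ls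
      using i
    proof (induction ls arbitrary: i)
      case (Cons l ls)
      obtain j where j: "j \<in> I" "\<forall>b\<in>carrier A. i \<otimes>\<^bsub>A\<^esub> letter_act l b = j \<otimes>\<^bsub>A\<^esub> b" using 1[OF Cons.prems] by blast
      obtain k where k: "k \<in> I" "\<forall>b\<in>carrier A. j \<otimes>\<^bsub>A\<^esub> foldr letter_act ls b = k \<otimes>\<^bsub>A\<^esub> b" using Cons.IH[OF j(1)] by blast
      have "foldr letter_act ls b \<in> carrier A" if "b \<in> carrier A" for b
        using additive_closed[OF word_act_additive[of "Word ls"] that] by (simp add: word_act_def)
      then show ?case using j k by (intro bexI[of _ k]) simp_all
    qed auto
    then show ?case by (simp add: act_frag_of word_act_def)
  next
    case (diff \<mu> \<nu>)
    obtain j where j: "j \<in> I" "\<forall>b\<in>carrier A. i \<otimes>\<^bsub>A\<^esub> act \<mu> b = j \<otimes>\<^bsub>A\<^esub> b" using diff.IH(1) by blast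
    obtain k where k: "k \<in> I" "\<forall>b\<in>carrier A. i \<otimes>\<^bsub>A\<^esub> act \<nu> b = k \<otimes>\<^bsub>A\<^esub> b" using diff.IH(2) by blast
    have "i \<otimes>\<^bsub>A\<^esub> act (\<mu> - \<nu>) b = (j \<ominus>\<^bsub>A\<^esub> k) \<otimes>\<^bsub>A\<^esub> b" if b: "b \<in> carrier A" for b
      using additive_diff[OF additive_left[OF IA[OF i]] act_closed[OF b] act_closed[OF b], of \<mu> \<nu>]
        additive_diff[OF additive_right[OF b] IA[OF j(1)] IA[OF k(1)]] j(2) k(2) b
      by (simp add: act_diff)
    moreover have "j \<ominus>\<^bsub>A\<^esub> k \<in> I" using j(1) k(1) D(3,4) by (simp add: a_minus_def)
    ultimately show ?case by blast
  qed
  then show "\<phi> * \<mu> \<in> rep I" if "\<phi> \<in> rep I"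
    using that by (auto simp: rep_def act_mult act_closed)
  show "Pr g \<phi> \<in> rep I" if g: "g \<in> carrier G" and \<phi>: "\<phi> \<in> rep I"
  proof -
    obtain i where i: "i \<in> I" "\<forall>b\<in>carrier A. act \<phi> b = i \<otimes>\<^bsub>A\<^esub> b" using \<phi> by (auto simp: rep_def)
    have c: "comp g i \<in> carrier A" using comp_carrier IA[OF i(1)] g by blast
    have "act (Pr g \<phi>) b = comp g i \<otimes>\<^bsub>A\<^esub> b" if b: "b \<in> carrier A" for b
    proof -
      have "act (Pr g \<phi>) (comp h b) = comp g i \<otimes>\<^bsub>A\<^esub> comp h b" if h: "h \<in> carrier G" for h
        using act_Pr_hom[OF g h comp_gr[OF b h]] comp_mult_right[OF IA[OF i(1)] h comp_gr[OF b h] g]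
          i(2) comp_carrier[OF b h] by simp
      then have "(\<Oplus>\<^bsub>A\<^esub>h\<in>carrier G. act (Pr g \<phi>) (comp h b)) = (\<Oplus>\<^bsub>A\<^esub>h\<in>carrier G. comp g i \<otimes>\<^bsub>A\<^esub> comp h b)"
        by (intro M.add.finprod_cong') (use comp_carrier[OF b] mult_closed[OF c] in auto)
      then show ?thesis
        using additive_finsum[OF act_additive[of "Pr g \<phi>"], of "\<lambda>h. comp h b" "carrier G"]
          additive_finsum[OF additive_left[OF c], of "\<lambda>h. comp h b" "carrier G"]
          comp_carrier[OF b] comp_sum[OF b] by auto
    qed
    then show ?thesis unfolding rep_def using D(8)[OF i(1) g] by blast
  qed
qed

end

section \<open>Consequences of graded primeness for elements\<close>

lemma ideal_prod_eq_zero: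
  assumes "abelian_monoid R" "I \<noteq> {}" "J \<noteq> {}" "\<And>i j. i \<in> I \<Longrightarrow> j \<in> J \<Longrightarrow> i \<otimes>\<^bsub>R\<^esub> j = \<zero>\<^bsub>R\<^esub>"
  shows "ideal_prod R I J = {\<zero>\<^bsub>R\<^esub>}"
proof -
  interpret abelian_monoid R by (rule assms(1))
  have "x = \<zero>\<^bsub>R\<^esub>" if "x \<in> ideal_prod R I J" for x
    using that by (induction rule: ideal_prod.induct) (simp_all add: assms(4))
  moreover obtain i j where "i \<in> I" "j \<in> J" using assms(2,3) by blast
  then have "\<zero>\<^bsub>R\<^esub> \<in> ideal_prod R I J" using ideal_prod.prod[of i I j J R] assms(4) by simp
  ultimately show ?thesis by blast
qed

locale prime_graded_PI_algebra = finite_graded_algebra G F A gr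
  for G :: "('g, 'l) monoid_scheme" and F :: "('f, 'n) ring_scheme" and A :: "('f, 'a, 'm) module_scheme"
    and gr :: "'g \<Rightarrow> 'a set" +
  assumes field_F: "field F" and char_F: "char_zero F" and nontrivial: "carrier A \<noteq> {\<zero>\<^bsub>A\<^esub>}"
    and gprime: "graded_prime G F A gr" and PI: "satisfies_PI F A"
begin

lemma graded_ideal_carrier: "graded_ideal G F A gr (carrier A)"
  by (rule graded_idealI) (auto intro: mult_closed comp_carrier)

lemma graded_primeD:
  assumes "graded_ideal G F A gr I" "graded_ideal G F A gr J" "\<And>i j. i \<in> I \<Longrightarrow> j \<in> J \<Longrightarrow> i \<otimes>\<^bsub>A\<^esub> j = \<zero>\<^bsub>A\<^esub>"
  shows "I = {\<zero>\<^bsub>A\<^esub>} \<or> J = {\<zero>\<^bsub>A\<^esub>}"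
proof -
  have "ideal_prod A I J = {\<zero>\<^bsub>A\<^esub>}"
  proof (rule ideal_prod_eq_zero[OF M.abelian_monoid_axioms _ _ assms(3)])
    show "I \<noteq> {}" "J \<noteq> {}" using graded_idealD(2)[OF assms(1)] graded_idealD(2)[OF assms(2)] by blast+
  qed
  then show ?thesis using gprime assms(1,2) unfolding graded_prime_def by blast
qed

text \<open>The left annihilator of the algebra is a graded ideal whose product with the whole
  algebra is zero.\<close>

lemma left_ann:
  assumes x: "x \<in> carrier A" "\<And>y. y \<in> carrier A \<Longrightarrow> x \<otimes>\<^bsub>A\<^esub> y = \<zero>\<^bsub>A\<^esub>" shows "x = \<zero>\<^bsub>A\<^esub>"
proof -
  define X where "X = {x \<in> carrier A. \<forall>y\<in>carrier A. x \<otimes>\<^bsub>A\<^esub> y = \<zero>\<^bsub>A\<^esub>}"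
  have X: "graded_ideal G F A gr X"
  proof (rule graded_idealI)
    show "comp g x \<in> X" if x: "x \<in> X" and g: "g \<in> carrier G" for x g
    proof -
      have xA: "x \<in> carrier A" using x by (simp add: X_def)
      have "comp g x \<otimes>\<^bsub>A\<^esub> b = \<zero>\<^bsub>A\<^esub>" if "h \<in> carrier G" "b \<in> gr h" for h b
        using comp_mult_right[OF xA that g] x that gr_carrier additive_zero[OF additive_comp_g] g
        by (simp add: X_def)
      then show ?thesis using mult_zero_hom[OF comp_carrier[OF xA g]] comp_carrier[OF xA g] by (simp add: X_def)
    qed
  qed (auto simp: X_def mult_zero_left mult_distrib_right smult_mult_left mult_assoc mult_closed mult_zero_right)
  have "X = {\<zero>\<^bsub>A\<^esub>} \<or> carrier A = {\<zero>\<^bsub>A\<^esub>}"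
    by (rule graded_primeD[OF X graded_ideal_carrier]) (simp add: X_def)
  then show ?thesis using x nontrivial by (auto simp: X_def)
qed

lemma right_ann:
  assumes x: "x \<in> carrier A" "\<And>y. y \<in> carrier A \<Longrightarrow> y \<otimes>\<^bsub>A\<^esub> x = \<zero>\<^bsub>A\<^esub>" shows "x = \<zero>\<^bsub>A\<^esub>"
proof -
  define X where "X = {x \<in> carrier A. \<forall>y\<in>carrier A. y \<otimes>\<^bsub>A\<^esub> x = \<zero>\<^bsub>A\<^esub>}"
  have X: "graded_ideal G F A gr X"
  proof (rule graded_idealI)
    show "comp g x \<in> X" if x: "x \<in> X" and g: "g \<in> carrier G" for x g
    proof -
      have xA: "x \<in> carrier A" using x by (simp add: X_def)
      have hom: "b \<otimes>\<^bsub>A\<^esub> comp g x = \<zero>\<^bsub>A\<^esub>" if "h \<in> carrier G" "b \<in> gr h" for h b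
        using comp_mult_left[OF xA that g] x that gr_carrier additive_zero[OF additive_comp_g] g
        by (simp add: X_def)
      have c: "comp g x \<in> carrier A" by (rule comp_carrier[OF xA g])
      have "y \<otimes>\<^bsub>A\<^esub> comp g x = \<zero>\<^bsub>A\<^esub>" if y: "y \<in> carrier A" for y
      proof -
        have "y \<otimes>\<^bsub>A\<^esub> comp g x = (\<Oplus>\<^bsub>A\<^esub>h\<in>carrier G. comp h y \<otimes>\<^bsub>A\<^esub> comp g x)"
          using additive_finsum[OF additive_right[OF c], of "\<lambda>h. comp h y" "carrier G"] comp_carrier[OF y]
            comp_sum[OF y] by auto
        then show ?thesis using hom comp_gr[OF y] by (simp add: M.add.finprod_one_eqI)
      qed
      then show ?thesis using c by (simp add: X_def)
    qed
  qed (auto simp: X_def mult_zero_left mult_distrib_left smult_mult_right mult_closed mult_zero_right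
        simp flip: mult_assoc)
  have "carrier A = {\<zero>\<^bsub>A\<^esub>} \<or> X = {\<zero>\<^bsub>A\<^esub>}"
    by (rule graded_primeD[OF graded_ideal_carrier X]) (simp add: X_def)
  then show ?thesis using x nontrivial by (auto simp: X_def)
qed

text \<open>The set X of all x with x A y = 0 is a graded ideal, because y is homogeneous, and its
  right annihilator Y contains A y. Since X Y = 0, either X vanishes and with it x, or A y vanishes
  and with it y.\<close>

lemma prime_elements:
  assumes g: "g \<in> carrier G" "x \<in> gr g" and h: "h \<in> carrier G" "y \<in> gr h"
    and zero: "\<And>k z. k \<in> carrier G \<Longrightarrow> z \<in> gr k \<Longrightarrow> (x \<otimes>\<^bsub>A\<^esub> z) \<otimes>\<^bsub>A\<^esub> y = \<zero>\<^bsub>A\<^esub>"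
  shows "x = \<zero>\<^bsub>A\<^esub> \<or> y = \<zero>\<^bsub>A\<^esub>"
proof -
  have xA: "x \<in> carrier A" and yA: "y \<in> carrier A" using g h gr_carrier by auto
  define X where "X = {x \<in> carrier A. \<forall>z\<in>carrier A. (x \<otimes>\<^bsub>A\<^esub> z) \<otimes>\<^bsub>A\<^esub> y = \<zero>\<^bsub>A\<^esub>}"
  have homX: "x \<in> X" if x: "x \<in> carrier A" and "\<And>k z. k \<in> carrier G \<Longrightarrow> z \<in> gr k \<Longrightarrow> (x \<otimes>\<^bsub>A\<^esub> z) \<otimes>\<^bsub>A\<^esub> y = \<zero>\<^bsub>A\<^esub>" for x
  proof -
    have "(x \<otimes>\<^bsub>A\<^esub> z) \<otimes>\<^bsub>A\<^esub> y = \<zero>\<^bsub>A\<^esub>" if z: "z \<in> carrier A" for z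
    proof -
      have "(x \<otimes>\<^bsub>A\<^esub> z) \<otimes>\<^bsub>A\<^esub> y = (\<Oplus>\<^bsub>A\<^esub>k\<in>carrier G. (x \<otimes>\<^bsub>A\<^esub> comp k z) \<otimes>\<^bsub>A\<^esub> y)"
        using additive_finsum[OF additive_comp[OF additive_right[OF yA] additive_left[OF x]], of "\<lambda>k. comp k z" "carrier G"]
          comp_carrier[OF z] comp_sum[OF z] by auto
      then show ?thesis using \<open>\<And>k z. k \<in> carrier G \<Longrightarrow> z \<in> gr k \<Longrightarrow> (x \<otimes>\<^bsub>A\<^esub> z) \<otimes>\<^bsub>A\<^esub> y = \<zero>\<^bsub>A\<^esub>\<close> comp_gr[OF z]
        by (simp add: M.add.finprod_one_eqI)
    qed
    then show ?thesis using x by (simp add: X_def)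
  qed
  have X: "graded_ideal G F A gr X"
  proof (rule graded_idealI)
    show "comp k x \<in> X" if x: "x \<in> X" and k: "k \<in> carrier G" for x k
    proof (rule homX)
      have xA: "x \<in> carrier A" using x by (simp add: X_def)
      then show "comp k x \<in> carrier A" using k comp_carrier by blast
      show "(comp k x \<otimes>\<^bsub>A\<^esub> z) \<otimes>\<^bsub>A\<^esub> y = \<zero>\<^bsub>A\<^esub>" if l: "l \<in> carrier G" "z \<in> gr l" for l z
      proof -
        have zA: "z \<in> carrier A" using l gr_carrier by blast
        have zy: "z \<otimes>\<^bsub>A\<^esub> y \<in> gr (l \<otimes>\<^bsub>G\<^esub> h)" "l \<otimes>\<^bsub>G\<^esub> h \<in> carrier G" using l h gr_mult by auto
        have "x \<otimes>\<^bsub>A\<^esub> (z \<otimes>\<^bsub>A\<^esub> y) = \<zero>\<^bsub>A\<^esub>" using x zA yA xA by (simp add: X_def mult_assoc)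
        then show ?thesis
          using comp_mult_right[OF xA zy(2,1) k] additive_zero[OF additive_comp_g] zy(2) k comp_carrier[OF xA k] zA yA
          by (simp add: mult_assoc)
      qed
    qed
    show "x \<otimes>\<^bsub>A\<^esub> r \<in> X" if x: "x \<in> X" and r: "r \<in> carrier A" for x r
    proof -
      have xA: "x \<in> carrier A" using x by (simp add: X_def)
      have "((x \<otimes>\<^bsub>A\<^esub> r) \<otimes>\<^bsub>A\<^esub> z) \<otimes>\<^bsub>A\<^esub> y = (x \<otimes>\<^bsub>A\<^esub> (r \<otimes>\<^bsub>A\<^esub> z)) \<otimes>\<^bsub>A\<^esub> y" if "z \<in> carrier A" for z
        using that xA r by (simp add: mult_assoc)
      then show ?thesis using x xA r mult_closed by (simp add: X_def)
    qed
  qed (auto simp: X_def yA mult_zero_left mult_distrib_right smult_mult_left mult_assoc mult_closed mult_zero_right)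
  define Y where "Y = {z \<in> carrier A. \<forall>x\<in>X. x \<otimes>\<^bsub>A\<^esub> z = \<zero>\<^bsub>A\<^esub>}"
  note XD = graded_idealD[OF X]
  have Y: "graded_ideal G F A gr Y"
  proof (rule graded_idealI)
    show "comp k z \<in> Y" if z: "z \<in> Y" and k: "k \<in> carrier G" for z k
    proof -
      have zA: "z \<in> carrier A" using z by (simp add: Y_def)
      have c: "comp k z \<in> carrier A" by (rule comp_carrier[OF zA k])
      have "x \<otimes>\<^bsub>A\<^esub> comp k z = \<zero>\<^bsub>A\<^esub>" if x: "x \<in> X" for x
      proof -
        have xA: "x \<in> carrier A" using x XD(1) by blast
        have "comp l x \<otimes>\<^bsub>A\<^esub> comp k z = \<zero>\<^bsub>A\<^esub>" if l: "l \<in> carrier G" for l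
        proof -
          have "comp l x \<otimes>\<^bsub>A\<^esub> z = \<zero>\<^bsub>A\<^esub>" using z XD(8)[OF x l] by (simp add: Y_def)
          then show ?thesis
            using comp_mult_left[OF zA l comp_gr[OF xA l] k] additive_zero[OF additive_comp_g] l k by simp
        qed
        moreover have "x \<otimes>\<^bsub>A\<^esub> comp k z = (\<Oplus>\<^bsub>A\<^esub>l\<in>carrier G. comp l x \<otimes>\<^bsub>A\<^esub> comp k z)"
          using additive_finsum[OF additive_right[OF c], of "\<lambda>l. comp l x" "carrier G"] comp_carrier[OF xA]
            comp_sum[OF xA] by auto
        ultimately show ?thesis by (simp add: M.add.finprod_one_eqI)
      qed
      then show ?thesis using c by (simp add: Y_def)
    qed
    show "r \<otimes>\<^bsub>A\<^esub> z \<in> Y" if "r \<in> carrier A" "z \<in> Y" for r z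
    proof -
      have "x \<otimes>\<^bsub>A\<^esub> (r \<otimes>\<^bsub>A\<^esub> z) = \<zero>\<^bsub>A\<^esub>" if x: "x \<in> X" for x
      proof -
        have "(x \<otimes>\<^bsub>A\<^esub> r) \<otimes>\<^bsub>A\<^esub> z = \<zero>\<^bsub>A\<^esub>" using XD(7)[OF \<open>r \<in> carrier A\<close> x] \<open>z \<in> Y\<close> by (simp add: Y_def)
        then show ?thesis using x XD(1) that \<open>r \<in> carrier A\<close> \<open>z \<in> Y\<close> by (auto simp: Y_def mult_assoc)
      qed
      then show ?thesis using that by (simp add: Y_def mult_closed)
    qed
    show "z \<otimes>\<^bsub>A\<^esub> r \<in> Y" if r: "r \<in> carrier A" and z: "z \<in> Y" for r z
    proof -
      have "x \<otimes>\<^bsub>A\<^esub> (z \<otimes>\<^bsub>A\<^esub> r) = \<zero>\<^bsub>A\<^esub>" if x: "x \<in> X" for x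
      proof -
        have "x \<otimes>\<^bsub>A\<^esub> (z \<otimes>\<^bsub>A\<^esub> r) = (x \<otimes>\<^bsub>A\<^esub> z) \<otimes>\<^bsub>A\<^esub> r"
          using x XD(1) r z by (intro mult_assoc[symmetric]) (auto simp: Y_def)
        then show ?thesis using x r z by (simp add: Y_def mult_zero_left)
      qed
      then show ?thesis using r z by (simp add: Y_def mult_closed)
    qed
  qed (use XD(1) in \<open>auto simp: Y_def mult_zero_right mult_distrib_left smult_mult_right subset_iff\<close>)
  have "X = {\<zero>\<^bsub>A\<^esub>} \<or> Y = {\<zero>\<^bsub>A\<^esub>}" by (rule graded_primeD[OF X Y]) (simp add: Y_def)
  then show ?thesis
  proof
    assume "X = {\<zero>\<^bsub>A\<^esub>}"
    then show ?thesis using homX[OF xA zero] by auto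
  next
    assume Y0: "Y = {\<zero>\<^bsub>A\<^esub>}"
    have "r \<otimes>\<^bsub>A\<^esub> y \<in> Y" if r: "r \<in> carrier A" for r
      using r yA mult_closed by (auto simp: Y_def X_def simp flip: mult_assoc)
    then have "r \<otimes>\<^bsub>A\<^esub> y = \<zero>\<^bsub>A\<^esub>" if "r \<in> carrier A" for r using Y0 that by blast
    then show ?thesis using right_ann[OF yA] by blast
  qed
qed

end

context finite_graded_algebra
begin

lemma act_hom_letter:
  "g \<in> carrier G \<Longrightarrow> a \<in> gr g \<Longrightarrow> b \<in> carrier A \<Longrightarrow> act (frag_of (Word [Inl (g, a)])) b = a \<otimes>\<^bsub>A\<^esub> b"
  by (simp add: act_frag_of word_act_def letter_act_def)

lemma act_scalar:
  "c \<in> carrier F \<Longrightarrow> b \<in> carrier A \<Longrightarrow> act (frag_of (Word [Inr c])) b = c \<odot>\<^bsub>A\<^esub> b"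
  by (simp add: act_frag_of word_act_def letter_act_def)

lemma Pr_Pr: "Pr g (Pr h \<phi>) = (if g = h then Pr h \<phi> else 0)"
  by (auto simp: Pr_def poly_mapping_eq_iff fun_eq_iff restrict_keys.rep_eq)

lemma Pr_sum: "(\<Sum>g\<in>carrier G. Pr g \<phi>) = \<phi>"
  using fin_G deg_closed
  by (auto simp: Pr_def poly_mapping_eq_iff fun_eq_iff restrict_keys.rep_eq lookup_sum)

lemma Pr_mult:
  assumes "Pr g \<phi> = \<phi>" "Pr h \<mu> = \<mu>" shows "Pr (g \<otimes>\<^bsub>G\<^esub> h) (\<phi> * \<mu>) = \<phi> * \<mu>"
  using assms keys_mult[of \<phi> \<mu>] by (fastforce simp: Pr_def restrict_keys_id_iff deg_add)

lemma Pr_one: "Pr \<one>\<^bsub>G\<^esub> 1 = 1"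
  by (simp add: Pr_def restrict_keys_id_iff deg_zero)

lemma act_of_nat: "b \<in> carrier A \<Longrightarrow> act (of_nat n * \<phi>) b = ([n] \<cdot>\<^bsub>F\<^esub> \<one>\<^bsub>F\<^esub>) \<odot>\<^bsub>A\<^esub> act \<phi> b"
proof (induction n)
  case 0
  then show ?case using act_closed by (simp add: act_zero)
next
  case (Suc n)
  then show ?case using act_closed[OF Suc.prems]
    by (simp add: distrib_right act_plus smult_l_distr M.a_comm)
qed

lemma left_mult_ex:
  assumes a: "a \<in> carrier A" shows "\<exists>\<phi>. \<forall>b\<in>carrier A. act \<phi> b = a \<otimes>\<^bsub>A\<^esub> b"
proof (intro exI ballI)
  let ?\<phi> = "\<Sum>g\<in>carrier G. frag_of (Word [Inl (g, comp g a)])"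
  fix b assume b: "b \<in> carrier A"
  have "act ?\<phi> b = (\<Oplus>\<^bsub>A\<^esub>g\<in>carrier G. act (frag_of (Word [Inl (g, comp g a)])) b)"
    by (rule act_sum[OF b])
  also have "\<dots> = (\<Oplus>\<^bsub>A\<^esub>g\<in>carrier G. comp g a \<otimes>\<^bsub>A\<^esub> b)"
    by (rule M.add.finprod_cong') (use a b comp_carrier comp_gr mult_closed in \<open>auto simp: act_hom_letter\<close>)
  also have "\<dots> = a \<otimes>\<^bsub>A\<^esub> b"
    using additive_finsum[OF additive_right[OF b], of "\<lambda>g. comp g a" "carrier G"] comp_carrier[OF a]
      comp_sum[OF a] by auto
  finally show "act ?\<phi> b = a \<otimes>\<^bsub>A\<^esub> b" .
qed

lemma act_prod_list:
  assumes x: "\<And>i. x i \<in> carrier A" "\<And>i b. b \<in> carrier A \<Longrightarrow> act (\<xi> i) b = x i \<otimes>\<^bsub>A\<^esub> b"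
  shows "w \<noteq> [] \<Longrightarrow> word_value A x w \<in> carrier A \<and>
    (\<forall>b\<in>carrier A. act (prod_list (map \<xi> w)) b = word_value A x w \<otimes>\<^bsub>A\<^esub> b)"
proof (induction w)
  case (Cons i w)
  show ?case
  proof (cases w)
    case (Cons j v)
    then show ?thesis using Cons.IH x mult_closed by (simp add: act_mult mult_assoc)
  qed (use x in simp)
qed simp

end

section \<open>Transfer between the algebra and the free ring\<close>

context prime_graded_PI_algebra
begin

lemma left_mult_inject:
  assumes "x \<in> carrier A" "y \<in> carrier A" "\<And>b. b \<in> carrier A \<Longrightarrow> x \<otimes>\<^bsub>A\<^esub> b = y \<otimes>\<^bsub>A\<^esub> b"
  shows "x = y"
proof -
  have "(x \<ominus>\<^bsub>A\<^esub> y) \<otimes>\<^bsub>A\<^esub> b = \<zero>\<^bsub>A\<^esub>" if "b \<in> carrier A" for b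
    using additive_diff[OF additive_right[OF that] assms(1,2)] assms(3)[OF that] mult_closed that assms(1,2)
    by (simp add: diff_zero_iff)
  then show ?thesis using left_ann[of "x \<ominus>\<^bsub>A\<^esub> y"] assms(1,2) by (simp add: diff_zero_iff)
qed

text \<open>If x and y act nontrivially on homogeneous b and b', take for u the product of the
  letters b and z: then \<open>x * u * y\<close> sends b' to the product of \<open>act x b\<close>,
  z and \<open>act y b'\<close>, and primeness for homogeneous elements applies.\<close>

lemma ann_prime:
  assumes g: "g \<in> carrier G" and h: "h \<in> carrier G" and x: "Pr g x = x" and y: "Pr h y = y"
    and xy: "\<And>u. x * u * y \<in> ann"
  shows "x \<in> ann \<or> y \<in> ann"
proof (rule ccontr)
  assume "\<not> ?thesis"
  then obtain k b l b' where k: "k \<in> carrier G" "b \<in> gr k" "act x b \<noteq> \<zero>\<^bsub>A\<^esub>"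
    and l: "l \<in> carrier G" "b' \<in> gr l" "act y b' \<noteq> \<zero>\<^bsub>A\<^esub>"
    using annI_hom[of x] annI_hom[of y] by blast
  have bA: "b \<in> carrier A" "b' \<in> carrier A" using k l gr_carrier by blast+
  have "comp (g \<otimes>\<^bsub>G\<^esub> k) (act x b) = act x b" "comp (h \<otimes>\<^bsub>G\<^esub> l) (act y b') = act y b'"
    using act_Pr_hom[OF g k(1,2), of x] act_Pr_hom[OF h l(1,2), of y] x y by simp_all
  then have gr: "act x b \<in> gr (g \<otimes>\<^bsub>G\<^esub> k)" "act y b' \<in> gr (h \<otimes>\<^bsub>G\<^esub> l)"
    using comp_gr[OF act_closed[OF bA(1)], of "g \<otimes>\<^bsub>G\<^esub> k" x]
      comp_gr[OF act_closed[OF bA(2)], of "h \<otimes>\<^bsub>G\<^esub> l" y] g h k(1) l(1) by simp_all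
  have "(act x b \<otimes>\<^bsub>A\<^esub> z) \<otimes>\<^bsub>A\<^esub> act y b' = \<zero>\<^bsub>A\<^esub>" if j: "j \<in> carrier G" "z \<in> gr j" for j z
  proof -
    have zA: "z \<in> carrier A" using j gr_carrier by blast
    have yA: "act y b' \<in> carrier A" by (rule act_closed[OF bA(2)])
    let ?u = "frag_of (Word [Inl (k, b)]) * frag_of (Word [Inl (j, z)])"
    have "act (x * ?u * y) b' = act x (b \<otimes>\<^bsub>A\<^esub> (z \<otimes>\<^bsub>A\<^esub> act y b'))"
      using act_mult act_hom_letter[OF k(1,2)] act_hom_letter[OF j] act_closed bA zA yA mult_closed
      by simp
    also have "\<dots> = (act x b \<otimes>\<^bsub>A\<^esub> z) \<otimes>\<^bsub>A\<^esub> act y b'"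
      using bA zA yA mult_closed act_closed by (simp add: act_right mult_assoc)
    finally show ?thesis using xy[of ?u] bA(2) by (simp add: ann_def)
  qed
  then have "act x b = \<zero>\<^bsub>A\<^esub> \<or> act y b' = \<zero>\<^bsub>A\<^esub>"
    by (intro prime_elements[OF _ gr(1) _ gr(2)]) (use g h k l in auto)
  then show False using k(3) l(3) by blast
qed

lemma smult_cancel:
  assumes c: "c \<in> carrier F" "c \<noteq> \<zero>\<^bsub>F\<^esub>" and x: "x \<in> carrier A" "c \<odot>\<^bsub>A\<^esub> x = \<zero>\<^bsub>A\<^esub>"
  shows "x = \<zero>\<^bsub>A\<^esub>"
proof -
  have u: "c \<in> Units F" using field.field_Units[OF field_F] c by simp
  have "x = (inv\<^bsub>F\<^esub> c \<otimes>\<^bsub>F\<^esub> c) \<odot>\<^bsub>A\<^esub> x" using u x(1) by simp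
  also have "\<dots> = inv\<^bsub>F\<^esub> c \<odot>\<^bsub>A\<^esub> (c \<odot>\<^bsub>A\<^esub> x)" using u c x(1) by (intro smult_assoc1) auto
  finally show ?thesis using x(2) u by simp
qed

lemma ann_torsion_free:
  assumes n: "0 < n" and \<phi>: "of_nat n * \<phi> \<in> ann" shows "\<phi> \<in> ann"
proof (rule annI)
  fix b assume b: "b \<in> carrier A"
  have "act (of_nat n * \<phi>) b = \<zero>\<^bsub>A\<^esub>" using \<phi> b by (auto simp only: ann_def mem_Collect_eq)
  then have "([n] \<cdot>\<^bsub>F\<^esub> \<one>\<^bsub>F\<^esub>) \<odot>\<^bsub>A\<^esub> act \<phi> b = \<zero>\<^bsub>A\<^esub>" by (simp only: act_of_nat[OF b])
  moreover have "[n] \<cdot>\<^bsub>F\<^esub> \<one>\<^bsub>F\<^esub> \<noteq> \<zero>\<^bsub>F\<^esub>" using char_F n unfolding char_zero_def by blast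
  ultimately show "act \<phi> b = \<zero>\<^bsub>A\<^esub>" using act_closed[OF b] R.add.nat_pow_closed[OF R.one_closed]
    by (intro smult_cancel[of "[n] \<cdot>\<^bsub>F\<^esub> \<one>\<^bsub>F\<^esub>" "act \<phi> b"])
qed

lemma rep_nontriv: "\<exists>m\<in>rep (carrier A). \<exists>g\<in>carrier G. Pr g m = m \<and> m \<notin> ann"
  and graded_ideal_nontriv: "graded_ideal G F A gr I \<Longrightarrow> I \<noteq> {\<zero>\<^bsub>A\<^esub>} \<Longrightarrow>
    \<exists>m\<in>rep I. \<exists>g\<in>carrier G. Pr g m = m \<and> m \<notin> ann"
proof -
  show *: "\<exists>m\<in>rep I. \<exists>g\<in>carrier G. Pr g m = m \<and> m \<notin> ann"
    if I: "graded_ideal G F A gr I" "I \<noteq> {\<zero>\<^bsub>A\<^esub>}" for I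
  proof -
    note D = graded_idealD[OF I(1)]
    obtain i where i: "i \<in> I" "i \<noteq> \<zero>\<^bsub>A\<^esub>" using I(2) D(2) by blast
    then have iA: "i \<in> carrier A" using D(1) by blast
    obtain g where g: "g \<in> carrier G" "comp g i \<noteq> \<zero>\<^bsub>A\<^esub>" using comp_zero_imp_zero[OF iA] i(2) by blast
    have a: "comp g i \<in> gr g" "comp g i \<in> I" "comp g i \<in> carrier A"
      using comp_gr[OF iA g(1)] D(8)[OF i(1) g(1)] comp_carrier[OF iA g(1)] by blast+
    let ?m = "frag_of (Word [Inl (g, comp g i)])"
    have "?m \<notin> ann"
    proof
      assume "?m \<in> ann"
      then have "comp g i \<otimes>\<^bsub>A\<^esub> b = \<zero>\<^bsub>A\<^esub>" if "b \<in> carrier A" for b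
        using that act_hom_letter[OF g(1) a(1) that] by (simp add: ann_def)
      then show False using left_ann[OF a(3)] g(2) by blast
    qed
    moreover have "Pr g ?m = ?m" using g(1) a(1) by (simp add: Pr_frag_of deg_def letter_deg_def)
    ultimately show ?thesis using rep_frag_of[OF g(1) a(1,2)] g(1) by blast
  qed
  show "\<exists>m\<in>rep (carrier A). \<exists>g\<in>carrier G. Pr g m = m \<and> m \<notin> ann"
    by (rule *[OF graded_ideal_carrier nontrivial])
qed

text \<open>The coefficients of the polynomial identity become scalar letters. Modulo the
  annihilator these commute with the free ring, because all actions are linear over F, and a nonzero
  one is invertible because F is a field.\<close>

lemma ann_graded_prime_pi: "\<exists>\<alpha> d. graded_prime_pi ann G Pr (rep (carrier A)) \<alpha> d"
proof -
  interpret N: two_sided_ideal ann by (rule ann_ideal)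
  obtain p where p: "p \<in> nc_polys F" "\<exists>w. p w \<noteq> \<zero>\<^bsub>F\<^esub>"
    "\<And>x. (\<forall>i. x i \<in> carrier A) \<Longrightarrow> nc_poly_value F A p x = \<zero>\<^bsub>A\<^esub>"
    using PI unfolding satisfies_PI_def by blast
  define W where "W = {w. p w \<noteq> \<zero>\<^bsub>F\<^esub>}"
  have pF: "p w \<in> carrier F" for w using p(1) by (simp add: nc_polys_def)
  have W: "finite W" "W \<noteq> {}" "[] \<notin> W" using p(1,2) by (auto simp: nc_polys_def W_def)
  \<comment> \<open>A longest word of the support: its length becomes the degree, and polarization
    along it makes p w0 the distinguished coefficient.\<close>
  define w0 where "w0 = (ARG_MAX length w. w \<in> W)"
  obtain w1 where w1: "w1 \<in> W" using W(2) by blast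
  have "length w < Suc (Max (length ` W))" if "w \<in> W" for w
    using that W(1) by (simp add: less_Suc_eq_le)
  then have w0: "w0 \<in> W \<and> (\<forall>w. w \<in> W \<longrightarrow> length w \<le> length w0)"
    unfolding w0_def by (intro arg_max_nat_lemma[of "\<lambda>w. w \<in> W" w1 length]) (use w1 in blast)+
  define c :: "nat list \<Rightarrow> ('g \<times> 'a + 'f) word \<Rightarrow>\<^sub>0 int" where "c w = frag_of (Word [Inr (p w)])" for w
  have act_c: "act (c w) b = p w \<odot>\<^bsub>A\<^esub> b" if "b \<in> carrier A" for w b
    using act_scalar[OF pF that] by (simp add: c_def)
  have c_central: "c w * x - x * c w \<in> ann" for w x
    by (simp add: ann_diff act_mult act_c act_closed act_smult pF)
  have id: "(\<Sum>w\<in>W. c w * prod_list (map \<xi> w)) \<in> ann" if \<xi>: "\<And>i. \<xi> i \<in> rep (carrier A)" for \<xi>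
  proof (rule annI)
    fix b assume b: "b \<in> carrier A"
    have "\<forall>i. \<exists>x. x \<in> carrier A \<and> (\<forall>b\<in>carrier A. act (\<xi> i) b = x \<otimes>\<^bsub>A\<^esub> b)"
      using \<xi> by (auto simp: rep_def)
    from choice[OF this] obtain x where x: "\<And>i. x i \<in> carrier A"
      "\<And>i b. b \<in> carrier A \<Longrightarrow> act (\<xi> i) b = x i \<otimes>\<^bsub>A\<^esub> b" by blast
    have val: "word_value A x w \<in> carrier A" "act (prod_list (map \<xi> w)) b = word_value A x w \<otimes>\<^bsub>A\<^esub> b"
      if "w \<in> W" for w
      using act_prod_list[of x \<xi> w, OF x] that W(3) b by auto
    have "act (\<Sum>w\<in>W. c w * prod_list (map \<xi> w)) b = (\<Oplus>\<^bsub>A\<^esub>w\<in>W. act (c w * prod_list (map \<xi> w)) b)"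
      by (rule act_sum[OF b])
    also have "\<dots> = (\<Oplus>\<^bsub>A\<^esub>w\<in>W. (p w \<odot>\<^bsub>A\<^esub> word_value A x w) \<otimes>\<^bsub>A\<^esub> b)"
      by (rule M.add.finprod_cong')
        (use val b pF mult_closed in \<open>auto simp: act_mult act_c act_closed smult_mult_left\<close>)
    also have "\<dots> = nc_poly_value F A p x \<otimes>\<^bsub>A\<^esub> b"
      unfolding nc_poly_value_def W_def[symmetric]
      by (rule additive_finsum[OF additive_right[OF b], symmetric]) (use val pF in auto)
    also have "\<dots> = \<zero>\<^bsub>A\<^esub>" using p(3)[of x] x(1) b by (simp add: mult_zero_left)
    finally show "act (\<Sum>w\<in>W. c w * prod_list (map \<xi> w)) b = \<zero>\<^bsub>A\<^esub>" .
  qed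
  define \<alpha> where "\<alpha> \<kappa> = (if map (nth w0) \<kappa> \<in> W then c (map (nth w0) \<kappa>) else 0)" for \<kappa>
  have "graded_prime_pi ann G Pr (rep (carrier A)) \<alpha> (length w0)"
  proof (unfold_locales, goal_cases)
    case (8 g h x y)
    then show ?case by (rule ann_prime)
  next
    case (13 f)
    have "(\<Sum>\<kappa>\<in>perms (length w0).
        (if map (nth w0) \<kappa> \<in> W then c (map (nth w0) \<kappa>) else 0) * prod_list (map f \<kappa>)) \<in> ann"
      by (rule multilinear_part[OF ann_ideal W(1)])
        (use w0 rep_zero[OF graded_ideal_carrier] rep_plus[OF graded_ideal_carrier] id 13 in auto)
    then show ?case by (simp add: \<alpha>_def)
  next
    case 14
    have u: "p w0 \<in> Units F" using w0 pF field.field_Units[OF field_F] by (auto simp: W_def)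
    have "act (frag_of (Word [Inr (inv\<^bsub>F\<^esub> (p w0))]) * c w0) b = act 1 b" if b: "b \<in> carrier A" for b
      using b u pF by (simp add: act_mult act_c act_scalar act_one flip: smult_assoc1)
    then have "frag_of (Word [Inr (inv\<^bsub>F\<^esub> (p w0))]) * c w0 - 1 \<in> ann" by (simp add: ann_diff)
    moreover have "\<alpha> [0..<length w0] = c w0" using w0 by (simp add: \<alpha>_def map_nth)
    ultimately show ?case by auto
  next
    case (15 w x)
    then show ?case using c_central by (auto simp: \<alpha>_def N.zero_mem)
  qed (use fin_G Pr_plus Pr_Pr Pr_sum Pr_mult Pr_one Pr_ann ann_torsion_free rep_left[OF graded_ideal_carrier]
      rep_right[OF graded_ideal_carrier] rep_nontriv in auto)
  then show ?thesis by blast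
qed

text \<open>Being central and of degree \<open>\<one>\<close> modulo the annihilator translates into
  equations between left multiplications by elements of the algebra, and these determine the
  elements.\<close>

lemma center_eI:
  assumes z: "graded_prime_pi.central_e ann G Pr z" and i: "i \<in> carrier A"
    and act: "\<And>b. b \<in> carrier A \<Longrightarrow> act z b = i \<otimes>\<^bsub>A\<^esub> b"
  shows "i \<in> center_e G A gr"
proof -
  obtain \<alpha> d where "graded_prime_pi ann G Pr (rep (carrier A)) \<alpha> d" using ann_graded_prime_pi by blast
  then interpret P: graded_prime_pi ann G Pr "rep (carrier A)" \<alpha> d .
  have z1: "Pr \<one>\<^bsub>G\<^esub> z = z" and z2: "z * x - x * z \<in> ann" for x
    using z by (auto simp: P.central_e_def)
  have "i \<otimes>\<^bsub>A\<^esub> y = y \<otimes>\<^bsub>A\<^esub> i" if y: "y \<in> carrier A" for y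
  proof (rule left_mult_inject)
    obtain x where x: "\<forall>b\<in>carrier A. act x b = y \<otimes>\<^bsub>A\<^esub> b" using left_mult_ex[OF y] by blast
    fix b assume b: "b \<in> carrier A"
    have "act (z * x) b = act (x * z) b" using z2[of x] b by (simp add: ann_diff)
    then show "(i \<otimes>\<^bsub>A\<^esub> y) \<otimes>\<^bsub>A\<^esub> b = (y \<otimes>\<^bsub>A\<^esub> i) \<otimes>\<^bsub>A\<^esub> b"
      using b x act y i mult_closed by (simp add: act_mult mult_assoc)
  qed (use i y mult_closed in auto)
  moreover have "comp \<one>\<^bsub>G\<^esub> i = i"
  proof (rule left_mult_inject)
    fix b assume b: "b \<in> carrier A"
    have hom: "comp \<one>\<^bsub>G\<^esub> i \<otimes>\<^bsub>A\<^esub> c = i \<otimes>\<^bsub>A\<^esub> c" if h: "h \<in> carrier G" "c \<in> gr h" for h c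
    proof -
      have c: "c \<in> carrier A" using h gr_carrier by blast
      have "comp (\<one>\<^bsub>G\<^esub> \<otimes>\<^bsub>G\<^esub> h) (i \<otimes>\<^bsub>A\<^esub> c) = i \<otimes>\<^bsub>A\<^esub> c"
        using act_Pr_hom[OF _ h, of "\<one>\<^bsub>G\<^esub>" z] z1 act[OF c] by simp
      then show ?thesis using comp_mult_right[OF i h, of "\<one>\<^bsub>G\<^esub>"] by simp
    qed
    have ci: "comp \<one>\<^bsub>G\<^esub> i \<in> carrier A" using comp_carrier[OF i] by simp
    have "(\<Oplus>\<^bsub>A\<^esub>h\<in>carrier G. comp \<one>\<^bsub>G\<^esub> i \<otimes>\<^bsub>A\<^esub> comp h b) = (\<Oplus>\<^bsub>A\<^esub>h\<in>carrier G. i \<otimes>\<^bsub>A\<^esub> comp h b)"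
      by (rule M.add.finprod_cong') (use hom comp_gr[OF b] comp_carrier[OF b] mult_closed i in auto)
    then show "comp \<one>\<^bsub>G\<^esub> i \<otimes>\<^bsub>A\<^esub> b = i \<otimes>\<^bsub>A\<^esub> b"
      using additive_finsum[OF additive_left[OF ci], of "\<lambda>h. comp h b" "carrier G"]
        additive_finsum[OF additive_left[OF i], of "\<lambda>h. comp h b" "carrier G"]
        comp_carrier[OF b] comp_sum[OF b] by auto
  qed (use i comp_carrier[OF i] in auto)
  then have "i \<in> gr \<one>\<^bsub>G\<^esub>" using comp_gr[OF i, of "\<one>\<^bsub>G\<^esub>"] by simp
  ultimately show ?thesis using i by (auto simp: center_e_def alg_center_def)
qed

lemma idl_rep:
  assumes I: "graded_ideal G F A gr I" and w: "w \<in> rep I"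
  shows "graded_prime_pi.idl G Pr w \<subseteq> rep I"
proof -
  obtain \<alpha> d where "graded_prime_pi ann G Pr (rep (carrier A)) \<alpha> d" using ann_graded_prime_pi by blast
  then interpret P: graded_prime_pi ann G Pr "rep (carrier A)" \<alpha> d .
  have "T x \<in> rep I" if "T \<in> mops (Pr ` carrier G)" "x \<in> rep I" for T x
    using that
  proof (induction arbitrary: x rule: mops.induct)
    case (base q)
    then show ?case using rep_Pr[OF I] by blast
  qed (simp_all add: rep_left[OF I] rep_right[OF I] rep_plus[OF I])
  then show ?thesis using w unfolding P.idl_def by blast
qed

lemma not_ann_iff:
  assumes "i \<in> carrier A" "\<And>b. b \<in> carrier A \<Longrightarrow> act z b = i \<otimes>\<^bsub>A\<^esub> b"
  shows "z \<in> ann \<longleftrightarrow> i = \<zero>\<^bsub>A\<^esub>"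
  using assms left_ann[OF assms(1)] by (auto simp: ann_def mult_zero_left)

text \<open>A nonzero component of an element of I, read as a letter, is a homogeneous element of
  the free ring. The central element found in its ideal again acts as left multiplication by an
  element of I.\<close>

lemma central_in_graded_ideal:
  assumes I: "graded_ideal G F A gr I" "I \<noteq> {\<zero>\<^bsub>A\<^esub>}"
  shows "\<exists>z\<in>I. z \<in> center_e G A gr \<and> z \<noteq> \<zero>\<^bsub>A\<^esub>"
proof -
  obtain \<alpha> d where "graded_prime_pi ann G Pr (rep (carrier A)) \<alpha> d" using ann_graded_prime_pi by blast
  then interpret P: graded_prime_pi ann G Pr "rep (carrier A)" \<alpha> d .
  obtain m g where m: "m \<in> rep I" "g \<in> carrier G" "Pr g m = m" "m \<notin> ann"
    using graded_ideal_nontriv[OF I] by blast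
  have "m \<in> P.Hm" using m(2,3) by (auto simp: P.Hm_def)
  then obtain z where z: "z \<in> P.idl m" "P.central_e z" "z \<notin> ann" using P.central_in_ideal m(4) by blast
  then obtain i where i: "i \<in> I" "\<forall>b\<in>carrier A. act z b = i \<otimes>\<^bsub>A\<^esub> b"
    using idl_rep[OF I(1) m(1)] unfolding rep_def by blast
  have iA: "i \<in> carrier A" using graded_idealD(1)[OF I(1)] i(1) by blast
  then show ?thesis using i center_eI[OF z(2) iA] not_ann_iff[OF iA, of z] z(3) by blast
qed

text \<open>\<rho> translates elements of the ideal of u into the elements of A by which they act.
  The spanning set, the coefficients and c all lie in that ideal, so the relation in the free ring
  becomes one in A, with s as the image of c.\<close>

lemma finite_over_center_e:
  "\<exists>s\<in>center_e G A gr. s \<noteq> \<zero>\<^bsub>A\<^esub> \<and> (\<exists>B. finite B \<and> B \<subseteq> carrier A \<and>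
    (\<forall>a\<in>carrier A. \<exists>\<zeta>\<in>B \<rightarrow> center_e G A gr. s \<otimes>\<^bsub>A\<^esub> a = (\<Oplus>\<^bsub>A\<^esub>b\<in>B. \<zeta> b \<otimes>\<^bsub>A\<^esub> b)))"
proof -
  obtain \<alpha> d where "graded_prime_pi ann G Pr (rep (carrier A)) \<alpha> d" using ann_graded_prime_pi by blast
  then interpret P: graded_prime_pi ann G Pr "rep (carrier A)" \<alpha> d .
  obtain u B c where H: "u \<in> rep (carrier A) \<and> finite B \<and> B \<subseteq> P.idl u \<and>
      (\<forall>b\<in>B. \<forall>b'\<in>B. b - b' \<in> ann \<longrightarrow> b = b') \<and> c \<in> P.idl u \<and> P.central_e c \<and> c \<notin> ann \<and>
      (\<forall>x. \<exists>\<zeta>. (\<forall>b\<in>B. \<zeta> b \<in> P.idl u \<and> P.central_e (\<zeta> b)) \<and> c * x - (\<Sum>b\<in>B. \<zeta> b * b) \<in> ann)"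
    using P.finite_over_center by (elim exE)
  have u: "u \<in> rep (carrier A)" and B: "finite B" "B \<subseteq> P.idl u"
    and B_dist: "\<forall>b\<in>B. \<forall>b'\<in>B. b - b' \<in> ann \<longrightarrow> b = b'"
    and c: "c \<in> P.idl u" "P.central_e c" "c \<notin> ann"
    and ex: "\<forall>x. \<exists>\<zeta>. (\<forall>b\<in>B. \<zeta> b \<in> P.idl u \<and> P.central_e (\<zeta> b)) \<and> c * x - (\<Sum>b\<in>B. \<zeta> b * b) \<in> ann"
    using H by - (elim conjE, assumption)+
  have "\<forall>x. \<exists>i. x \<in> P.idl u \<longrightarrow> i \<in> carrier A \<and> (\<forall>b\<in>carrier A. act x b = i \<otimes>\<^bsub>A\<^esub> b)"
    using idl_rep[OF graded_ideal_carrier u] unfolding rep_def by blast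
  from choice[OF this] obtain \<rho> where \<rho>: "\<And>x. x \<in> P.idl u \<Longrightarrow> \<rho> x \<in> carrier A"
    "\<And>x b. x \<in> P.idl u \<Longrightarrow> b \<in> carrier A \<Longrightarrow> act x b = \<rho> x \<otimes>\<^bsub>A\<^esub> b" by blast
  have \<rho>Z: "\<rho> x \<in> center_e G A gr" if "x \<in> P.idl u" "P.central_e x" for x
    using center_eI[OF that(2) \<rho>(1)[OF that(1)]] \<rho>(2)[OF that(1)] by blast
  \<comment> \<open>Elements of B are distinct even modulo the annihilator, so the sum over B can be
    reindexed by the image of B.\<close>
  have inj: "inj_on \<rho> B"
  proof (rule inj_onI)
    fix b b' assume b: "b \<in> B" "b' \<in> B" "\<rho> b = \<rho> b'"
    then have "b - b' \<in> ann" using \<rho>(2) B(2) by (auto simp: ann_diff subset_iff)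
    then show "b = b'" by (rule B_dist[rule_format, OF b(1,2)])
  qed
  have "\<exists>\<zeta>\<in>\<rho> ` B \<rightarrow> center_e G A gr. \<rho> c \<otimes>\<^bsub>A\<^esub> a = (\<Oplus>\<^bsub>A\<^esub>b\<in>\<rho> ` B. \<zeta> b \<otimes>\<^bsub>A\<^esub> b)" if a: "a \<in> carrier A" for a
  proof -
    obtain x where x: "\<forall>b\<in>carrier A. act x b = a \<otimes>\<^bsub>A\<^esub> b" using left_mult_ex[OF a] by blast
    obtain \<zeta> where "(\<forall>b\<in>B. \<zeta> b \<in> P.idl u \<and> P.central_e (\<zeta> b)) \<and> c * x - (\<Sum>b\<in>B. \<zeta> b * b) \<in> ann"
      using ex[rule_format, of x] by (elim exE)
    then have \<zeta>: "\<And>b. b \<in> B \<Longrightarrow> \<zeta> b \<in> P.idl u" "\<And>b. b \<in> B \<Longrightarrow> P.central_e (\<zeta> b)"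
      "c * x - (\<Sum>b\<in>B. \<zeta> b * b) \<in> ann" by simp_all
    define \<zeta>' where "\<zeta>' b = \<rho> (\<zeta> (inv_into B \<rho> b))" for b
    have \<zeta>': "\<zeta>' (\<rho> b) = \<rho> (\<zeta> b)" if "b \<in> B" for b using inj that by (simp add: \<zeta>'_def)
    have BA: "b \<in> P.idl u" "\<rho> b \<in> carrier A" "\<rho> (\<zeta> b) \<in> carrier A" if "b \<in> B" for b
      using that \<rho>(1) B(2) \<zeta>(1) by blast+
    have cA: "\<rho> c \<in> carrier A" by (rule \<rho>(1)[OF c(1)])
    let ?r = "\<Oplus>\<^bsub>A\<^esub>b\<in>B. \<rho> (\<zeta> b) \<otimes>\<^bsub>A\<^esub> \<rho> b"
    have "\<rho> c \<otimes>\<^bsub>A\<^esub> a = ?r"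
    proof (rule left_mult_inject)
      show "\<rho> c \<otimes>\<^bsub>A\<^esub> a \<in> carrier A" by (rule mult_closed[OF cA a])
      show "?r \<in> carrier A" using BA mult_closed by (intro M.finsum_closed) auto
      fix y assume y: "y \<in> carrier A"
      have "(\<rho> c \<otimes>\<^bsub>A\<^esub> a) \<otimes>\<^bsub>A\<^esub> y = act (c * x) y"
        using \<rho>(2)[OF c(1)] cA a y x mult_closed by (simp add: act_mult mult_assoc)
      also have "\<dots> = act (\<Sum>b\<in>B. \<zeta> b * b) y" using \<zeta>(3) y by (simp add: ann_diff)
      also have "\<dots> = (\<Oplus>\<^bsub>A\<^esub>b\<in>B. act (\<zeta> b * b) y)" by (rule act_sum[OF y])
      also have "\<dots> = (\<Oplus>\<^bsub>A\<^esub>b\<in>B. (\<rho> (\<zeta> b) \<otimes>\<^bsub>A\<^esub> \<rho> b) \<otimes>\<^bsub>A\<^esub> y)"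
        by (rule M.add.finprod_cong')
          (use BA y \<rho>(2) \<zeta>(1) mult_closed in \<open>auto simp: act_mult act_closed mult_assoc\<close>)
      also have "\<dots> = ?r \<otimes>\<^bsub>A\<^esub> y"
        by (rule additive_finsum[OF additive_right[OF y], symmetric]) (use BA mult_closed in auto)
      finally show "(\<rho> c \<otimes>\<^bsub>A\<^esub> a) \<otimes>\<^bsub>A\<^esub> y = ?r \<otimes>\<^bsub>A\<^esub> y" .
    qed
    also have "?r = (\<Oplus>\<^bsub>A\<^esub>b\<in>B. \<zeta>' (\<rho> b) \<otimes>\<^bsub>A\<^esub> \<rho> b)"
      by (rule M.add.finprod_cong') (use BA mult_closed \<zeta>' in auto)
    also have "\<dots> = (\<Oplus>\<^bsub>A\<^esub>b\<in>\<rho> ` B. \<zeta>' b \<otimes>\<^bsub>A\<^esub> b)"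
      by (rule M.finsum_reindex[symmetric]) (use BA mult_closed \<zeta>' inj in auto)
    finally show ?thesis using \<zeta>' \<rho>Z \<zeta>(1,2) by (intro bexI[of _ \<zeta>']) auto
  qed
  moreover have "\<rho> c \<noteq> \<zero>\<^bsub>A\<^esub>" using not_ann_iff[OF \<rho>(1)[OF c(1)], of c] \<rho>(2)[OF c(1)] c(3) by blast
  moreover have "\<rho> ` B \<subseteq> carrier A" using \<rho>(1) B(2) by blast
  ultimately show ?thesis using B(1) \<rho>Z[OF c(1,2)] by blast
qed

section \<open>Central elements of degree e\<close>

lemma center_e_closed:
  shows center_e_carrier: "z \<in> center_e G A gr \<Longrightarrow> z \<in> carrier A"
    and center_e_gr: "z \<in> center_e G A gr \<Longrightarrow> z \<in> gr \<one>\<^bsub>G\<^esub>"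
    and center_e_commute: "z \<in> center_e G A gr \<Longrightarrow> x \<in> carrier A \<Longrightarrow> z \<otimes>\<^bsub>A\<^esub> x = x \<otimes>\<^bsub>A\<^esub> z"
    and center_e_zero: "\<zero>\<^bsub>A\<^esub> \<in> center_e G A gr"
    and center_e_add: "z \<in> center_e G A gr \<Longrightarrow> y \<in> center_e G A gr \<Longrightarrow> z \<oplus>\<^bsub>A\<^esub> y \<in> center_e G A gr"
    and center_e_minus: "z \<in> center_e G A gr \<Longrightarrow> \<ominus>\<^bsub>A\<^esub> z \<in> center_e G A gr"
    and center_e_mult: "z \<in> center_e G A gr \<Longrightarrow> y \<in> center_e G A gr \<Longrightarrow> z \<otimes>\<^bsub>A\<^esub> y \<in> center_e G A gr"
    and center_e_smult: "c \<in> carrier F \<Longrightarrow> z \<in> center_e G A gr \<Longrightarrow> c \<odot>\<^bsub>A\<^esub> z \<in> center_e G A gr"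
proof -
  show *: "z \<in> carrier A" "z \<in> gr \<one>\<^bsub>G\<^esub>" if "z \<in> center_e G A gr" for z
    using that by (auto simp: center_e_def alg_center_def)
  show comm: "z \<otimes>\<^bsub>A\<^esub> x = x \<otimes>\<^bsub>A\<^esub> z" if "z \<in> center_e G A gr" "x \<in> carrier A" for z x
    using that by (auto simp: center_e_def alg_center_def)
  have I: "z \<in> center_e G A gr"
    if "z \<in> gr \<one>\<^bsub>G\<^esub>" "\<And>x. x \<in> carrier A \<Longrightarrow> z \<otimes>\<^bsub>A\<^esub> x = x \<otimes>\<^bsub>A\<^esub> z" for z
    using that gr_carrier[of "\<one>\<^bsub>G\<^esub>" z] by (auto simp: center_e_def alg_center_def)
  show "\<zero>\<^bsub>A\<^esub> \<in> center_e G A gr" by (rule I) (simp_all add: gr_zero mult_zero_left mult_zero_right)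
  show "z \<oplus>\<^bsub>A\<^esub> y \<in> center_e G A gr" if "z \<in> center_e G A gr" "y \<in> center_e G A gr" for z y
    by (rule I) (use that * comm in \<open>simp_all add: gr_add mult_distrib_left mult_distrib_right\<close>)
  show "\<ominus>\<^bsub>A\<^esub> z \<in> center_e G A gr" if z: "z \<in> center_e G A gr" for z
  proof (rule I)
    show "\<ominus>\<^bsub>A\<^esub> z \<otimes>\<^bsub>A\<^esub> x = x \<otimes>\<^bsub>A\<^esub> \<ominus>\<^bsub>A\<^esub> z" if x: "x \<in> carrier A" for x
      using additive_minus[OF additive_left[OF x] *(1)[OF z]] additive_minus[OF additive_right[OF x] *(1)[OF z]]
        comm[OF z x] by simp
  qed (use *(2)[OF z] gr_minus in simp)
  show "z \<otimes>\<^bsub>A\<^esub> y \<in> center_e G A gr" if z: "z \<in> center_e G A gr" and y: "y \<in> center_e G A gr" for z y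
  proof (rule I)
    show "z \<otimes>\<^bsub>A\<^esub> y \<in> gr \<one>\<^bsub>G\<^esub>" using gr_mult[of "\<one>\<^bsub>G\<^esub>" "\<one>\<^bsub>G\<^esub>" z y] *(2) z y by simp
    fix x assume x: "x \<in> carrier A"
    have "(z \<otimes>\<^bsub>A\<^esub> y) \<otimes>\<^bsub>A\<^esub> x = z \<otimes>\<^bsub>A\<^esub> (x \<otimes>\<^bsub>A\<^esub> y)" using * z y x comm[OF y x] by (simp add: mult_assoc)
    also have "\<dots> = (x \<otimes>\<^bsub>A\<^esub> z) \<otimes>\<^bsub>A\<^esub> y" using * z y x comm[OF z x] by (simp flip: mult_assoc)
    finally show "(z \<otimes>\<^bsub>A\<^esub> y) \<otimes>\<^bsub>A\<^esub> x = x \<otimes>\<^bsub>A\<^esub> (z \<otimes>\<^bsub>A\<^esub> y)" using * z y x by (simp add: mult_assoc)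
  qed
  show "c \<odot>\<^bsub>A\<^esub> z \<in> center_e G A gr" if c: "c \<in> carrier F" and z: "z \<in> center_e G A gr" for c z
    by (rule I) (use c * [OF z] comm[OF z] gr_smult in \<open>simp_all add: smult_mult_left smult_mult_right\<close>)
qed

text \<open>As s has degree e, it also annihilates the components of x; as s is central, s A
  annihilates them too, and primeness for homogeneous elements applies.\<close>

lemma center_e_cancel:
  assumes s: "s \<in> center_e G A gr" "s \<noteq> \<zero>\<^bsub>A\<^esub>" and x: "x \<in> carrier A" "s \<otimes>\<^bsub>A\<^esub> x = \<zero>\<^bsub>A\<^esub>"
  shows "x = \<zero>\<^bsub>A\<^esub>"
proof (rule comp_zero_imp_zero[OF x(1)])
  fix g assume g: "g \<in> carrier G"
  have sA: "s \<in> carrier A" "s \<in> gr \<one>\<^bsub>G\<^esub>" using s by (auto intro: center_e_carrier center_e_gr)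
  have c: "comp g x \<in> gr g" "comp g x \<in> carrier A" using comp_gr[OF x(1) g] comp_carrier[OF x(1) g] by blast+
  have sc: "s \<otimes>\<^bsub>A\<^esub> comp g x = \<zero>\<^bsub>A\<^esub>"
    using comp_mult_left[OF x(1) _ sA(2) g] x(2) additive_zero[OF additive_comp_g[OF g]] g by simp
  have "s = \<zero>\<^bsub>A\<^esub> \<or> comp g x = \<zero>\<^bsub>A\<^esub>"
  proof (rule prime_elements[OF _ sA(2) g c(1)])
    fix k z assume "k \<in> carrier G" "z \<in> gr k"
    then have z: "z \<in> carrier A" using gr_carrier by blast
    have "(s \<otimes>\<^bsub>A\<^esub> z) \<otimes>\<^bsub>A\<^esub> comp g x = z \<otimes>\<^bsub>A\<^esub> (s \<otimes>\<^bsub>A\<^esub> comp g x)"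
      using center_e_commute[OF s(1) z] z sA c by (simp add: mult_assoc)
    then show "(s \<otimes>\<^bsub>A\<^esub> z) \<otimes>\<^bsub>A\<^esub> comp g x = \<zero>\<^bsub>A\<^esub>" using sc z by (simp add: mult_zero_right)
  qed simp
  then show "comp g x = \<zero>\<^bsub>A\<^esub>" using s(2) by blast
qed

end

section \<open>Central localization\<close>

locale central_localization = assoc_algebra F A
  for F :: "('f, 'n) ring_scheme" and A :: "('f, 'a, 'm) module_scheme" +
  fixes S :: "'a set"
  assumes S_center: "S \<subseteq> alg_center A"
    and S_mult: "s \<in> S \<Longrightarrow> t \<in> S \<Longrightarrow> s \<otimes>\<^bsub>A\<^esub> t \<in> S"
    and S_nonempty: "S \<noteq> {}"
    and S_cancel: "s \<in> S \<Longrightarrow> x \<in> carrier A \<Longrightarrow> s \<otimes>\<^bsub>A\<^esub> x = \<zero>\<^bsub>A\<^esub> \<Longrightarrow> x = \<zero>\<^bsub>A\<^esub>"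
begin

lemma S_carrier [simp]: "s \<in> S \<Longrightarrow> s \<in> carrier A"
  using S_center by (auto simp: alg_center_def)

lemma S_commute: "s \<in> S \<Longrightarrow> x \<in> carrier A \<Longrightarrow> x \<otimes>\<^bsub>A\<^esub> s = s \<otimes>\<^bsub>A\<^esub> x"
  using S_center by (auto simp: alg_center_def)

text \<open>Multiplication by a denominator is given a name, so that denominators can be moved to the
  front by rewriting; for the product of \<open>A\<close> itself these rules would loop.\<close>

definition sm :: "'a \<Rightarrow> 'a \<Rightarrow> 'a" where "sm s x = s \<otimes>\<^bsub>A\<^esub> x"

lemma sm_closed [simp]: "s \<in> S \<Longrightarrow> x \<in> carrier A \<Longrightarrow> sm s x \<in> carrier A"
  by (simp add: sm_def mult_closed)

lemma sm_S [simp]: "s \<in> S \<Longrightarrow> t \<in> S \<Longrightarrow> sm s t \<in> S"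
  by (simp add: sm_def S_mult)

lemma sm_zero: "s \<in> S \<Longrightarrow> sm s \<zero>\<^bsub>A\<^esub> = \<zero>\<^bsub>A\<^esub>"
  by (simp add: sm_def mult_zero_right)

lemma sm_left_commute: "s \<in> S \<Longrightarrow> t \<in> S \<Longrightarrow> x \<in> carrier A \<Longrightarrow> sm s (sm t x) = sm t (sm s x)"
  by (simp add: sm_def S_commute[of t s] flip: mult_assoc)

lemma sm_commute: "s \<in> S \<Longrightarrow> t \<in> S \<Longrightarrow> sm s t = sm t s"
  by (simp add: sm_def S_commute)

lemma sm_sm: "s \<in> S \<Longrightarrow> t \<in> S \<Longrightarrow> x \<in> carrier A \<Longrightarrow> sm (sm s t) x = sm s (sm t x)"
  by (simp add: sm_def mult_assoc)

lemma sm_add: "s \<in> S \<Longrightarrow> x \<in> carrier A \<Longrightarrow> y \<in> carrier A \<Longrightarrow> sm s (x \<oplus>\<^bsub>A\<^esub> y) = sm s x \<oplus>\<^bsub>A\<^esub> sm s y"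
  by (simp add: sm_def mult_distrib_left)

lemma sm_minus: "s \<in> S \<Longrightarrow> x \<in> carrier A \<Longrightarrow> sm s (\<ominus>\<^bsub>A\<^esub> x) = \<ominus>\<^bsub>A\<^esub> sm s x"
  unfolding sm_def by (rule additive_minus[OF additive_left]) simp_all

lemma sm_mult_left: "s \<in> S \<Longrightarrow> x \<in> carrier A \<Longrightarrow> y \<in> carrier A \<Longrightarrow> sm s x \<otimes>\<^bsub>A\<^esub> y = sm s (x \<otimes>\<^bsub>A\<^esub> y)"
  by (simp add: sm_def mult_assoc)

lemma sm_mult_right:
  assumes "s \<in> S" "x \<in> carrier A" "y \<in> carrier A" shows "x \<otimes>\<^bsub>A\<^esub> sm s y = sm s (x \<otimes>\<^bsub>A\<^esub> y)"
proof -
  have "x \<otimes>\<^bsub>A\<^esub> (s \<otimes>\<^bsub>A\<^esub> y) = (s \<otimes>\<^bsub>A\<^esub> x) \<otimes>\<^bsub>A\<^esub> y"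
    using assms S_commute[of s x] by (simp flip: mult_assoc)
  then show ?thesis using assms by (simp add: sm_def mult_assoc)
qed

lemma sm_smult: "s \<in> S \<Longrightarrow> c \<in> carrier F \<Longrightarrow> x \<in> carrier A \<Longrightarrow> sm s (c \<odot>\<^bsub>A\<^esub> x) = c \<odot>\<^bsub>A\<^esub> sm s x"
  by (simp add: sm_def smult_mult_right)

lemma sm_cancel:
  assumes "s \<in> S" "x \<in> carrier A" "y \<in> carrier A" shows "sm s x = sm s y \<longleftrightarrow> x = y"
proof
  assume "sm s x = sm s y"
  then have "s \<otimes>\<^bsub>A\<^esub> (x \<ominus>\<^bsub>A\<^esub> y) = \<zero>\<^bsub>A\<^esub>"
    using additive_diff[OF additive_left[of s] assms(2,3)] assms by (simp add: sm_def diff_zero_iff mult_closed)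
  then show "x = y" using S_cancel[of s "x \<ominus>\<^bsub>A\<^esub> y"] assms by (simp add: diff_zero_iff)
qed simp

lemmas sm_simps = sm_zero sm_left_commute sm_commute sm_sm sm_add sm_minus sm_mult_left sm_mult_right sm_smult

text \<open>Elements of S can be cancelled, so the auxiliary factor u in the definition of the
  relation disappears.\<close>

lemma frac_rel_iff:
  "((a, s), (b, t)) \<in> frac_rel A S \<longleftrightarrow> a \<in> carrier A \<and> s \<in> S \<and> b \<in> carrier A \<and> t \<in> S \<and> sm t a = sm s b"
  using S_nonempty by (auto simp: frac_rel_def sm_cancel simp flip: sm_def)

lemma equiv_frac_rel: "equiv (carrier A \<times> S) (frac_rel A S)"
proof (rule equivI)
  show "trans (frac_rel A S)"
  proof (rule transI, clarify)
    fix a s b t c u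
    assume "((a, s), (b, t)) \<in> frac_rel A S" "((b, t), (c, u)) \<in> frac_rel A S"
    then have h: "a \<in> carrier A" "s \<in> S" "b \<in> carrier A" "t \<in> S" "c \<in> carrier A" "u \<in> S"
      "sm t a = sm s b" "sm u b = sm t c" by (simp_all add: frac_rel_iff)
    have "sm t (sm u a) = sm u (sm t a)" using h by (intro sm_left_commute) auto
    also have "\<dots> = sm s (sm u b)" unfolding h(7) using h by (intro sm_left_commute) auto
    also have "\<dots> = sm t (sm s c)" unfolding h(8) using h by (intro sm_left_commute) auto
    finally have "sm u a = sm s c" using h by (simp add: sm_cancel)
    then show "((a, s), (c, u)) \<in> frac_rel A S" using h by (simp add: frac_rel_iff)
  qed
qed (auto simp: refl_on_def sym_def frac_rel_iff)

definition fr :: "'a \<Rightarrow> 'a \<Rightarrow> ('a \<times> 'a) set" where "fr a s = frac_rel A S `` {(a, s)}"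

lemma fr_eq_iff:
  "a \<in> carrier A \<Longrightarrow> s \<in> S \<Longrightarrow> b \<in> carrier A \<Longrightarrow> t \<in> S \<Longrightarrow> fr a s = fr b t \<longleftrightarrow> sm t a = sm s b"
  unfolding fr_def using eq_equiv_class_iff[OF equiv_frac_rel, of "(a, s)" "(b, t)"] by (simp add: frac_rel_iff)

lemma fr_cancel: "a \<in> carrier A \<Longrightarrow> s \<in> S \<Longrightarrow> t \<in> S \<Longrightarrow> fr (sm t a) (sm t s) = fr a s"
  by (simp add: fr_eq_iff sm_simps)

lemma mem_frD: "(b, t) \<in> fr a s \<Longrightarrow> b \<in> carrier A \<and> t \<in> S \<and> sm t a = sm s b \<and> fr b t = fr a s"
  unfolding fr_def using equiv_class_eq[OF equiv_frac_rel] by (auto simp: frac_rel_iff)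

lemma mem_fr: "a \<in> carrier A \<Longrightarrow> s \<in> S \<Longrightarrow> (a, s) \<in> fr a s"
  by (simp add: fr_def frac_rel_iff)

lemma frac_add_fr:
  assumes "a \<in> carrier A" "s \<in> S" "b \<in> carrier A" "t \<in> S"
  shows "frac_add A S (fr a s) (fr b t) = fr (sm t a \<oplus>\<^bsub>A\<^esub> sm s b) (sm s t)"
proof -
  have "fr (sm t' a' \<oplus>\<^bsub>A\<^esub> sm s' b') (sm s' t') = fr (sm t a \<oplus>\<^bsub>A\<^esub> sm s b) (sm s t)"
    if "(a', s') \<in> fr a s" "(b', t') \<in> fr b t" for a' s' b' t'
  proof -
    have 1: "a' \<in> carrier A" "s' \<in> S" "sm s' a = sm s a'" "b' \<in> carrier A" "t' \<in> S" "sm t' b = sm t b'"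
      using mem_frD[OF that(1)] mem_frD[OF that(2)] by simp_all
    have "sm (sm s t) (sm t' a') = sm t (sm t' (sm s a'))" "sm (sm s t) (sm s' b') = sm s (sm s' (sm t b'))"
      "sm (sm s' t') (sm t a) = sm t (sm t' (sm s' a))" "sm (sm s' t') (sm s b) = sm s (sm s' (sm t' b))"
      using assms 1(1,2,4,5) by (simp_all add: sm_simps)
    then show ?thesis using assms 1 by (simp add: fr_eq_iff sm_add)
  qed
  then show ?thesis using mem_fr[OF assms(1,2)] mem_fr[OF assms(3,4)]
    unfolding frac_add_def fr_def[symmetric] sm_def[symmetric] by fast
qed

text \<open>The first factor may be a nonempty part of a class: a scalar is a class of pairs with
  central numerators, hence only a part of the class of the same fraction over the whole
  algebra.\<close>

lemma frac_mult_fr: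
  assumes X: "X \<subseteq> fr a s" "X \<noteq> {}" and h: "a \<in> carrier A" "s \<in> S" "b \<in> carrier A" "t \<in> S"
  shows "frac_mult A S X (fr b t) = fr (a \<otimes>\<^bsub>A\<^esub> b) (sm s t)"
proof -
  have "fr (a' \<otimes>\<^bsub>A\<^esub> b') (sm s' t') = fr (a \<otimes>\<^bsub>A\<^esub> b) (sm s t)"
    if "(a', s') \<in> fr a s" "(b', t') \<in> fr b t" for a' s' b' t'
  proof -
    have 1: "a' \<in> carrier A" "s' \<in> S" "sm s' a = sm s a'" "b' \<in> carrier A" "t' \<in> S" "sm t' b = sm t b'"
      using mem_frD[OF that(1)] mem_frD[OF that(2)] by simp_all
    have "sm (sm s t) (a' \<otimes>\<^bsub>A\<^esub> b') = sm s a' \<otimes>\<^bsub>A\<^esub> sm t b'"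
      using h 1(1,2,4,5) by (simp add: sm_simps mult_closed)
    also have "\<dots> = sm (sm s' t') (a \<otimes>\<^bsub>A\<^esub> b)"
      using h 1(1,2,4,5) unfolding 1(3,6)[symmetric] by (simp add: sm_simps mult_closed)
    finally show ?thesis using h 1(1,2,4,5) by (simp add: fr_eq_iff mult_closed)
  qed
  moreover obtain a0 s0 where "(a0, s0) \<in> X" using X(2) by auto
  ultimately show ?thesis using X(1) mem_fr[OF h(3,4)]
    unfolding frac_mult_def fr_def[symmetric] sm_def[symmetric] by fast
qed

lemma Union_fr_eq:
  assumes "\<And>s. s \<in> S \<Longrightarrow> f s \<in> carrier A" "\<And>s t. s \<in> S \<Longrightarrow> t \<in> S \<Longrightarrow> sm t (f s) = sm s (f t)" "s \<in> S"
  shows "frac_rel A S `` {(f s, s) | s. s \<in> S} = fr (f s) s"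
proof -
  have "fr (f t) t = fr (f s) s" if "t \<in> S" for t using assms that by (simp add: fr_eq_iff)
  then show ?thesis using assms(3) unfolding fr_def by blast
qed

text \<open>The ring operations do not involve the scalar action, so their laws are shown once for
  both algebra structures.\<close>

context
  fixes sc :: "'c \<Rightarrow> ('a \<times> 'a) set \<Rightarrow> ('a \<times> 'a) set"
begin

abbreviation "L \<equiv> frac_algebra A S sc"

lemma L_sel:
  shows L_mult: "a \<in> carrier A \<Longrightarrow> s \<in> S \<Longrightarrow> b \<in> carrier A \<Longrightarrow> t \<in> S \<Longrightarrow>
      fr a s \<otimes>\<^bsub>L\<^esub> fr b t = fr (a \<otimes>\<^bsub>A\<^esub> b) (sm s t)"
    and L_add: "a \<in> carrier A \<Longrightarrow> s \<in> S \<Longrightarrow> b \<in> carrier A \<Longrightarrow> t \<in> S \<Longrightarrow>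
      fr a s \<oplus>\<^bsub>L\<^esub> fr b t = fr (sm t a \<oplus>\<^bsub>A\<^esub> sm s b) (sm s t)"
    and L_zero: "s \<in> S \<Longrightarrow> \<zero>\<^bsub>L\<^esub> = fr \<zero>\<^bsub>A\<^esub> s"
    and L_one: "s \<in> S \<Longrightarrow> \<one>\<^bsub>L\<^esub> = fr s s"
    and L_carrier: "carrier L = {fr a s | a s. a \<in> carrier A \<and> s \<in> S}"
  using frac_mult_fr[OF subset_refl, of a s b t] mem_fr[of a s] frac_add_fr[of a s b t]
    Union_fr_eq[of "\<lambda>_. \<zero>\<^bsub>A\<^esub>" s] Union_fr_eq[of "\<lambda>s. s" s]
  by (auto simp: frac_algebra_def sm_zero sm_commute fr_def quotient_def)

lemma L_closed [simp]: "a \<in> carrier A \<Longrightarrow> s \<in> S \<Longrightarrow> fr a s \<in> carrier L"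
  by (auto simp: L_carrier)

lemma L_cases:
  assumes "X \<in> carrier L" obtains a s where "a \<in> carrier A" "s \<in> S" "X = fr a s"
  using assms by (auto simp: L_carrier)

lemma L_add_same: "a \<in> carrier A \<Longrightarrow> b \<in> carrier A \<Longrightarrow> s \<in> S \<Longrightarrow> fr a s \<oplus>\<^bsub>L\<^esub> fr b s = fr (a \<oplus>\<^bsub>A\<^esub> b) s"
  by (simp add: L_add fr_eq_iff sm_simps)

lemma L_abelian_group: "abelian_group L"
proof (rule abelian_groupI)
  obtain s0 where s0: "s0 \<in> S" using S_nonempty by blast
  show "\<zero>\<^bsub>L\<^esub> \<in> carrier L" using s0 by (simp add: L_zero)
  fix X assume X: "X \<in> carrier L"
  then obtain a s where as: "a \<in> carrier A" "s \<in> S" "X = fr a s" by (rule L_cases)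
  show "\<zero>\<^bsub>L\<^esub> \<oplus>\<^bsub>L\<^esub> X = X" using as by (simp add: L_zero[OF as(2)] L_add_same)
  show "\<exists>Y\<in>carrier L. Y \<oplus>\<^bsub>L\<^esub> X = \<zero>\<^bsub>L\<^esub>"
    using as by (intro bexI[of _ "fr (\<ominus>\<^bsub>A\<^esub> a) s"]) (simp_all add: L_zero[OF as(2)] L_add_same M.l_neg)
  fix Y assume Y: "Y \<in> carrier L"
  then obtain b t where bt: "b \<in> carrier A" "t \<in> S" "Y = fr b t" by (rule L_cases)
  show "X \<oplus>\<^bsub>L\<^esub> Y \<in> carrier L" using as bt by (simp add: L_add)
  show "X \<oplus>\<^bsub>L\<^esub> Y = Y \<oplus>\<^bsub>L\<^esub> X" using as bt by (simp add: L_add sm_commute M.a_comm)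
  fix Z assume Z: "Z \<in> carrier L"
  then obtain c u where cu: "c \<in> carrier A" "u \<in> S" "Z = fr c u" by (rule L_cases)
  show "(X \<oplus>\<^bsub>L\<^esub> Y) \<oplus>\<^bsub>L\<^esub> Z = X \<oplus>\<^bsub>L\<^esub> (Y \<oplus>\<^bsub>L\<^esub> Z)"
    using as bt cu by (simp add: L_add sm_simps M.a_ac)
qed

lemma L_mult_laws:
  assumes "X \<in> carrier L" "Y \<in> carrier L" "Z \<in> carrier L"
  shows "X \<otimes>\<^bsub>L\<^esub> Y \<in> carrier L" "(X \<otimes>\<^bsub>L\<^esub> Y) \<otimes>\<^bsub>L\<^esub> Z = X \<otimes>\<^bsub>L\<^esub> (Y \<otimes>\<^bsub>L\<^esub> Z)"
    "(X \<oplus>\<^bsub>L\<^esub> Y) \<otimes>\<^bsub>L\<^esub> Z = X \<otimes>\<^bsub>L\<^esub> Z \<oplus>\<^bsub>L\<^esub> Y \<otimes>\<^bsub>L\<^esub> Z"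
    "Z \<otimes>\<^bsub>L\<^esub> (X \<oplus>\<^bsub>L\<^esub> Y) = Z \<otimes>\<^bsub>L\<^esub> X \<oplus>\<^bsub>L\<^esub> Z \<otimes>\<^bsub>L\<^esub> Y"
proof -
  obtain a s b t c u where "a \<in> carrier A" "s \<in> S" "X = fr a s" "b \<in> carrier A" "t \<in> S" "Y = fr b t"
    "c \<in> carrier A" "u \<in> S" "Z = fr c u"
    using assms by (elim L_cases)
  then show "X \<otimes>\<^bsub>L\<^esub> Y \<in> carrier L" "(X \<otimes>\<^bsub>L\<^esub> Y) \<otimes>\<^bsub>L\<^esub> Z = X \<otimes>\<^bsub>L\<^esub> (Y \<otimes>\<^bsub>L\<^esub> Z)"
    "(X \<oplus>\<^bsub>L\<^esub> Y) \<otimes>\<^bsub>L\<^esub> Z = X \<otimes>\<^bsub>L\<^esub> Z \<oplus>\<^bsub>L\<^esub> Y \<otimes>\<^bsub>L\<^esub> Z"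
    "Z \<otimes>\<^bsub>L\<^esub> (X \<oplus>\<^bsub>L\<^esub> Y) = Z \<otimes>\<^bsub>L\<^esub> X \<oplus>\<^bsub>L\<^esub> Z \<otimes>\<^bsub>L\<^esub> Y"
    by (simp_all add: L_mult L_add mult_closed sm_simps mult_assoc fr_eq_iff mult_distrib_left mult_distrib_right)
qed

lemma L_finsum:
  assumes s: "s \<in> S" and f: "f \<in> I \<rightarrow> carrier A"
  shows "(\<Oplus>\<^bsub>L\<^esub>i\<in>I. fr (f i) s) = fr (\<Oplus>\<^bsub>A\<^esub>i\<in>I. f i) s"
proof -
  interpret L: abelian_group L by (rule L_abelian_group)
  show ?thesis
    using f
  proof (induction I rule: infinite_finite_induct)
    case (insert i I)
    have "(\<Oplus>\<^bsub>L\<^esub>i\<in>insert i I. fr (f i) s) = fr (f i) s \<oplus>\<^bsub>L\<^esub> (\<Oplus>\<^bsub>L\<^esub>i\<in>I. fr (f i) s)"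
      using insert s by (intro L.finsum_insert) (auto simp: Pi_iff)
    moreover have "(\<Oplus>\<^bsub>A\<^esub>i\<in>insert i I. f i) = f i \<oplus>\<^bsub>A\<^esub> (\<Oplus>\<^bsub>A\<^esub>i\<in>I. f i)"
      using insert by (intro M.finsum_insert) auto
    moreover have "(\<Oplus>\<^bsub>A\<^esub>i\<in>I. f i) \<in> carrier A" using insert by (intro M.finsum_closed) auto
    ultimately show ?case using insert s by (simp add: L_add_same Pi_iff)
  qed (simp_all add: L_zero[OF s])
qed

end

text \<open>Formulated for sets U i stable under S, so that the numerators of homogeneous fractions
  stay in their components when denominators are enlarged.\<close>

lemma common_denominator:
  assumes "finite I" "\<And>i. i \<in> I \<Longrightarrow> \<exists>a\<in>U i. \<exists>s\<in>S. X i = fr a s"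
    and U: "\<And>i. i \<in> I \<Longrightarrow> U i \<subseteq> carrier A" "\<And>i a s. i \<in> I \<Longrightarrow> a \<in> U i \<Longrightarrow> s \<in> S \<Longrightarrow> sm s a \<in> U i"
  shows "\<exists>t\<in>S. \<exists>f\<in>(\<Pi> i\<in>I. U i). \<forall>i\<in>I. X i = fr (f i) t"
proof -
  have "\<exists>t\<in>S. \<forall>i\<in>I. \<exists>a\<in>U i. X i = fr a t"
    using assms
  proof (induction I rule: finite_induct)
    case empty
    then show ?case using S_nonempty by blast
  next
    case (insert i I)
    obtain t where t: "t \<in> S" "\<And>j. j \<in> I \<Longrightarrow> \<exists>a\<in>U j. X j = fr a t" using insert by (metis insertCI)
    obtain a s where a: "a \<in> U i" "s \<in> S" "X i = fr a s" using insert.prems(1) by blast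
    have "\<exists>a\<in>U j. X j = fr a (sm s t)" if j: "j \<in> I" for j
    proof -
      obtain b where b: "b \<in> U j" "X j = fr b t" using t(2)[OF j] by blast
      have "b \<in> carrier A" using b(1) insert.prems(2)[of j] j by blast
      then have "X j = fr (sm s b) (sm s t)" using b(2) a(2) t(1) by (simp add: fr_cancel)
      then show ?thesis using insert.prems(3)[of j b s] j b(1) a(2) by blast
    qed
    moreover have "\<exists>a\<in>U i. X i = fr a (sm s t)"
    proof -
      have "a \<in> carrier A" using a(1) insert.prems(2)[of i] by blast
      then have "X i = fr (sm t a) (sm s t)" using a t(1) fr_cancel[of a s t] by (simp add: sm_commute)
      then show ?thesis using insert.prems(3)[of i a t] a(1) t(1) by blast
    qed
    ultimately show ?case using a(2) t(1) by (intro bexI[of _ "sm s t"]) auto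
  qed
  then obtain t where t: "t \<in> S" "\<forall>i\<in>I. \<exists>a. a \<in> U i \<and> X i = fr a t" by blast
  from bchoice[OF t(2)] show ?thesis using t(1) by blast
qed

lemma localization_smult:
  assumes "c \<in> carrier F" "a \<in> carrier A" "s \<in> S"
  shows "c \<odot>\<^bsub>localization A S\<^esub> fr a s = fr (c \<odot>\<^bsub>A\<^esub> a) s"
proof -
  have "fr (c \<odot>\<^bsub>A\<^esub> a') s' = fr (c \<odot>\<^bsub>A\<^esub> a) s" if "(a', s') \<in> fr a s" for a' s'
    using mem_frD[OF that] assms by (simp add: fr_eq_iff sm_smult)
  then have "(\<lambda>(a', s'). fr (c \<odot>\<^bsub>A\<^esub> a') s') p = fr (c \<odot>\<^bsub>A\<^esub> a) s" if "p \<in> fr a s" for p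
    using that by (cases p) simp
  moreover have "c \<odot>\<^bsub>localization A S\<^esub> fr a s = (\<Union>p\<in>fr a s. (\<lambda>(a', s'). fr (c \<odot>\<^bsub>A\<^esub> a') s') p)"
    by (simp add: localization_def frac_algebra_def flip: fr_def)
  ultimately show ?thesis using mem_fr[OF assms(2,3)] by (simp only:) (rule UN_constant_eq; blast)
qed

lemma localization_map_eq: "a \<in> carrier A \<Longrightarrow> s \<in> S \<Longrightarrow> localization_map A S a = fr (sm s a) s"
  unfolding localization_map_def sm_def[symmetric] by (rule Union_fr_eq) (simp_all add: sm_simps)

lemma localization_assoc_algebra: "assoc_algebra F (localization A S)"
proof -
  let ?sm = "\<lambda>c X. \<Union>(a, s)\<in>X. frac_rel A S `` {(c \<odot>\<^bsub>A\<^esub> a, s)}"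
  have L: "localization A S = frac_algebra A S ?sm" by (simp add: localization_def)
  interpret L: abelian_group "localization A S" unfolding L by (rule L_abelian_group)
  note LL = L_mult[where sc = ?sm, folded L] L_closed[where sc = ?sm, folded L] localization_smult
  note L_add = L_add[where sc = ?sm, folded L] and L_add_same = L_add_same[where sc = ?sm, folded L]
    and cases = L_cases[where sc = ?sm, folded L]
  have "module F (localization A S)"
  proof (rule moduleI)
    show "cring F" by (rule R.cring_axioms)
    show "abelian_group (localization A S)" by (rule L.abelian_group_axioms)
    show "\<one>\<^bsub>F\<^esub> \<odot>\<^bsub>localization A S\<^esub> X = X" if "X \<in> carrier (localization A S)" for X
      using that by (auto elim!: cases simp: LL)
  next
    fix c X assume c: "c \<in> carrier F" and "X \<in> carrier (localization A S)"
    then obtain a s where a: "a \<in> carrier A" "s \<in> S" "X = fr a s" by (elim cases)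
    then show "c \<odot>\<^bsub>localization A S\<^esub> X \<in> carrier (localization A S)"
      using c by (simp_all add: LL)
    show "(c \<oplus>\<^bsub>F\<^esub> d) \<odot>\<^bsub>localization A S\<^esub> X =
        c \<odot>\<^bsub>localization A S\<^esub> X \<oplus>\<^bsub>localization A S\<^esub> d \<odot>\<^bsub>localization A S\<^esub> X"
      "(c \<otimes>\<^bsub>F\<^esub> d) \<odot>\<^bsub>localization A S\<^esub> X = c \<odot>\<^bsub>localization A S\<^esub> (d \<odot>\<^bsub>localization A S\<^esub> X)"
      if "d \<in> carrier F" for d
      using that c a by (simp_all add: LL L_add_same smult_l_distr smult_assoc1)
    fix Y assume "Y \<in> carrier (localization A S)"
    then obtain b t where "b \<in> carrier A" "t \<in> S" "Y = fr b t" by (elim cases)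
    then show "c \<odot>\<^bsub>localization A S\<^esub> (X \<oplus>\<^bsub>localization A S\<^esub> Y) =
        c \<odot>\<^bsub>localization A S\<^esub> X \<oplus>\<^bsub>localization A S\<^esub> c \<odot>\<^bsub>localization A S\<^esub> Y"
      using c a by (simp add: LL L_add smult_r_distr sm_simps)
  qed
  moreover have "(c \<odot>\<^bsub>localization A S\<^esub> X) \<otimes>\<^bsub>localization A S\<^esub> Y = c \<odot>\<^bsub>localization A S\<^esub> (X \<otimes>\<^bsub>localization A S\<^esub> Y)"
    "X \<otimes>\<^bsub>localization A S\<^esub> (c \<odot>\<^bsub>localization A S\<^esub> Y) = c \<odot>\<^bsub>localization A S\<^esub> (X \<otimes>\<^bsub>localization A S\<^esub> Y)"
    if "c \<in> carrier F" "X \<in> carrier (localization A S)" "Y \<in> carrier (localization A S)" for c X Y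
    using that by (auto elim!: cases simp: LL smult_mult_left smult_mult_right mult_closed)
  ultimately show ?thesis
    unfolding assoc_algebra_def assoc_algebra_axioms_def
    using L_mult_laws[where sc = ?sm, folded L] by (intro conjI allI impI) auto
qed

end

section \<open>The grading on the localization\<close>

locale graded_central_localization =
  finite_graded_algebra G F A gr + central_localization F A S
  for G :: "('g, 'l) monoid_scheme" and F :: "('f, 'n) ring_scheme" and A :: "('f, 'a, 'm) module_scheme"
    and gr :: "'g \<Rightarrow> 'a set" and S :: "'a set" +
  assumes S_gr: "S \<subseteq> gr \<one>\<^bsub>G\<^esub>"
begin

lemma localization_gr_eq: "localization_gr A S gr g = {fr a s | a s. a \<in> gr g \<and> s \<in> S}"
  by (auto simp: localization_gr_def quotient_def fr_def)

lemma sm_gr: "g \<in> carrier G \<Longrightarrow> s \<in> S \<Longrightarrow> a \<in> gr g \<Longrightarrow> sm s a \<in> gr g"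
  using gr_mult[of "\<one>\<^bsub>G\<^esub>" g s a] S_gr by (auto simp: sm_def)

lemma common_denominator_gr:
  assumes "f \<in> (\<Pi> g\<in>carrier G. localization_gr A S gr g)"
  shows "\<exists>t\<in>S. \<exists>a\<in>(\<Pi> g\<in>carrier G. gr g). \<forall>g\<in>carrier G. f g = fr (a g) t"
proof (rule common_denominator[OF fin_G])
  fix g assume "g \<in> carrier G"
  then have "f g \<in> localization_gr A S gr g" using assms by blast
  then show "\<exists>a\<in>gr g. \<exists>s\<in>S. f g = fr a s" by (auto simp: localization_gr_eq)
qed (use gr_subset sm_gr in auto)

lemma fr_decompose:
  assumes a: "a \<in> carrier A" and s: "s \<in> S"
  shows "fr a s = (\<Oplus>\<^bsub>frac_algebra A S sc\<^esub>g\<in>carrier G. fr (comp g a) s)"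
  using L_finsum[OF s, of "\<lambda>g. comp g a" "carrier G"] comp_carrier[OF a] comp_sum[OF a] by auto

text \<open>Denominators have degree e, so fractions inherit the components of their numerators. For
  uniqueness the two families get common denominators t and u, and cross-multiplication turns
  equality of the sums into an equation in A.\<close>

lemma frac_graded_algebra:
  assumes alg: "assoc_algebra R (frac_algebra A S sc)"
    and sc: "\<And>c g a s. c \<in> carrier R \<Longrightarrow> g \<in> carrier G \<Longrightarrow> a \<in> gr g \<Longrightarrow> s \<in> S \<Longrightarrow>
      c \<odot>\<^bsub>frac_algebra A S sc\<^esub> fr a s \<in> localization_gr A S gr g"
  shows "graded_algebra G R (frac_algebra A S sc) (localization_gr A S gr)"
proof -
  let ?L = "frac_algebra A S sc"
  interpret L: assoc_algebra R ?L by (rule alg)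
  obtain s0 where s0: "s0 \<in> S" using S_nonempty by blast
  have sub: "localization_gr A S gr g \<subseteq> carrier ?L" if "g \<in> carrier G" for g
    using gr_carrier[OF that] by (auto simp: localization_gr_eq)
  have submod: "submodule (localization_gr A S gr g) R ?L" if g: "g \<in> carrier G" for g
  proof (rule L.submoduleI)
    show "localization_gr A S gr g \<subseteq> carrier ?L" by (rule sub[OF g])
    show "\<zero>\<^bsub>?L\<^esub> \<in> localization_gr A S gr g"
      using s0 gr_zero[OF g] L_zero[OF s0, of sc] by (auto simp: localization_gr_eq)
    show "X \<oplus>\<^bsub>?L\<^esub> Y \<in> localization_gr A S gr g"
      if X: "X \<in> localization_gr A S gr g" and Y: "Y \<in> localization_gr A S gr g" for X Y
    proof -
      obtain a s b t where ab: "a \<in> gr g" "s \<in> S" "X = fr a s" "b \<in> gr g" "t \<in> S" "Y = fr b t"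
        using X Y by (auto simp: localization_gr_eq)
      then have "X \<oplus>\<^bsub>?L\<^esub> Y = fr (sm t a \<oplus>\<^bsub>A\<^esub> sm s b) (sm s t)" using gr_carrier[OF g] by (simp add: L_add)
      moreover have "sm t a \<oplus>\<^bsub>A\<^esub> sm s b \<in> gr g" using ab sm_gr[OF g] gr_add[OF g] by blast
      ultimately show ?thesis unfolding localization_gr_eq using ab sm_S by blast
    qed
    show smult: "c \<odot>\<^bsub>?L\<^esub> X \<in> localization_gr A S gr g" if "c \<in> carrier R" "X \<in> localization_gr A S gr g" for c X
      using that sc g by (auto simp: localization_gr_eq)
    show "\<ominus>\<^bsub>?L\<^esub> X \<in> localization_gr A S gr g" if "X \<in> localization_gr A S gr g" for X
      using smult[of "\<ominus>\<^bsub>R\<^esub> \<one>\<^bsub>R\<^esub>" X] that sub[OF g] L.smult_l_minus[of "\<one>\<^bsub>R\<^esub>" X] by auto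
  qed
  have "direct_sum_of ?L (carrier G) (localization_gr A S gr) (carrier ?L)"
  proof (rule L.M.direct_sum_ofI[OF fin_G sub subset_refl])
    fix X assume "X \<in> carrier ?L"
    then obtain a s where as: "a \<in> carrier A" "s \<in> S" "X = fr a s" by (rule L_cases)
    then have "(\<lambda>g. fr (comp g a) s) \<in> (\<Pi> g\<in>carrier G. localization_gr A S gr g)"
      using comp_gr by (auto simp: localization_gr_eq)
    then show "\<exists>f\<in>(\<Pi> g\<in>carrier G. localization_gr A S gr g). X = (\<Oplus>\<^bsub>?L\<^esub>g\<in>carrier G. f g)"
      using fr_decompose[OF as(1,2)] as(3) by blast
  next
    fix f h g
    assume f: "f \<in> (\<Pi> g\<in>carrier G. localization_gr A S gr g)" and h: "h \<in> (\<Pi> g\<in>carrier G. localization_gr A S gr g)"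
      and eq: "(\<Oplus>\<^bsub>?L\<^esub>g\<in>carrier G. f g) = (\<Oplus>\<^bsub>?L\<^esub>g\<in>carrier G. h g)" and g: "g \<in> carrier G"
    obtain t a where a: "t \<in> S" "\<And>g. g \<in> carrier G \<Longrightarrow> a g \<in> gr g" "\<And>g. g \<in> carrier G \<Longrightarrow> f g = fr (a g) t"
      using common_denominator_gr[OF f] by blast
    obtain u b where b: "u \<in> S" "\<And>g. g \<in> carrier G \<Longrightarrow> b g \<in> gr g" "\<And>g. g \<in> carrier G \<Longrightarrow> h g = fr (b g) u"
      using common_denominator_gr[OF h] by blast
    have ab: "a g \<in> carrier A" "b g \<in> carrier A" if "g \<in> carrier G" for g
      using a(2) b(2) gr_carrier that by blast+
    have "(\<Oplus>\<^bsub>?L\<^esub>g\<in>carrier G. f g) = (\<Oplus>\<^bsub>?L\<^esub>g\<in>carrier G. fr (a g) t)"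
      by (rule L.M.add.finprod_cong') (use a ab in auto)
    also have "\<dots> = fr (\<Oplus>\<^bsub>A\<^esub>g\<in>carrier G. a g) t" by (rule L_finsum[OF a(1)]) (use ab in blast)
    finally have fa: "(\<Oplus>\<^bsub>?L\<^esub>g\<in>carrier G. f g) = fr (\<Oplus>\<^bsub>A\<^esub>g\<in>carrier G. a g) t" .
    have "(\<Oplus>\<^bsub>?L\<^esub>g\<in>carrier G. h g) = (\<Oplus>\<^bsub>?L\<^esub>g\<in>carrier G. fr (b g) u)"
      by (rule L.M.add.finprod_cong') (use b ab in auto)
    also have "\<dots> = fr (\<Oplus>\<^bsub>A\<^esub>g\<in>carrier G. b g) u" by (rule L_finsum[OF b(1)]) (use ab in blast)
    finally have "fr (\<Oplus>\<^bsub>A\<^esub>g\<in>carrier G. a g) t = fr (\<Oplus>\<^bsub>A\<^esub>g\<in>carrier G. b g) u" using eq fa by simp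
    then have "sm u (\<Oplus>\<^bsub>A\<^esub>g\<in>carrier G. a g) = sm t (\<Oplus>\<^bsub>A\<^esub>g\<in>carrier G. b g)"
      using a(1) b(1) ab by (subst (asm) fr_eq_iff) (auto intro!: M.finsum_closed)
    moreover have "sm s (\<Oplus>\<^bsub>A\<^esub>g\<in>carrier G. f g) = (\<Oplus>\<^bsub>A\<^esub>g\<in>carrier G. sm s (f g))"
      if "s \<in> S" "f \<in> carrier G \<rightarrow> carrier A" for s f
      using additive_finsum[OF additive_left[OF S_carrier[OF that(1)]] that(2)] by (simp add: sm_def)
    ultimately have "(\<Oplus>\<^bsub>A\<^esub>g\<in>carrier G. sm u (a g)) = (\<Oplus>\<^bsub>A\<^esub>g\<in>carrier G. sm t (b g))"
      using a(1) b(1) ab by simp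
    then have "sm u (a g) = sm t (b g)"
      by (intro gr_unique[of "\<lambda>g. sm u (a g)" "\<lambda>g. sm t (b g)"]) (use a b sm_gr g in auto)
    then show "f g = h g" using a(1,3) b(1,3) ab g by (simp add: fr_eq_iff)
  qed
  moreover have "X \<otimes>\<^bsub>?L\<^esub> Y \<in> localization_gr A S gr (g \<otimes>\<^bsub>G\<^esub> h)"
    if g: "g \<in> carrier G" "h \<in> carrier G" and X: "X \<in> localization_gr A S gr g" "Y \<in> localization_gr A S gr h" for g h X Y
  proof -
    obtain a s b t where ab: "a \<in> gr g" "s \<in> S" "X = fr a s" "b \<in> gr h" "t \<in> S" "Y = fr b t"
      using X by (auto simp: localization_gr_eq)
    then have "X \<otimes>\<^bsub>?L\<^esub> Y = fr (a \<otimes>\<^bsub>A\<^esub> b) (sm s t)"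
      using gr_carrier[OF g(1)] gr_carrier[OF g(2)] by (simp add: L_mult)
    moreover have "a \<otimes>\<^bsub>A\<^esub> b \<in> gr (g \<otimes>\<^bsub>G\<^esub> h)" using ab gr_mult[OF g] by blast
    ultimately show ?thesis unfolding localization_gr_eq using ab sm_S by blast
  qed
  ultimately show ?thesis using submod
    by (intro graded_algebra.intro graded_algebra_axioms.intro alg G.group_axioms) auto
qed

lemma localization_graded_algebra: "graded_algebra G F (localization A S) (localization_gr A S gr)"
proof -
  have "fr (c \<odot>\<^bsub>A\<^esub> a) s \<in> localization_gr A S gr g" if "c \<in> carrier F" "g \<in> carrier G" "a \<in> gr g" "s \<in> S" for c g a s
    using gr_smult that unfolding localization_gr_eq by blast
  then have "c \<odot>\<^bsub>localization A S\<^esub> fr a s \<in> localization_gr A S gr g"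
    if "c \<in> carrier F" "g \<in> carrier G" "a \<in> gr g" "s \<in> S" for c g a s
    using that gr_carrier[of g a] by (simp add: localization_smult)
  then show ?thesis
    using frac_graded_algebra[OF localization_assoc_algebra[unfolded localization_def]] unfolding localization_def by blast
qed

lemma localization_map_laws:
  fixes sc :: "'c \<Rightarrow> ('a \<times> 'a) set \<Rightarrow> ('a \<times> 'a) set"
  assumes "a \<in> carrier A" "b \<in> carrier A"
  shows localization_map_add: "localization_map A S (a \<oplus>\<^bsub>A\<^esub> b) =
      localization_map A S a \<oplus>\<^bsub>frac_algebra A S sc\<^esub> localization_map A S b"
    and localization_map_mult: "localization_map A S (a \<otimes>\<^bsub>A\<^esub> b) =
      localization_map A S a \<otimes>\<^bsub>frac_algebra A S sc\<^esub> localization_map A S b"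
    and localization_map_eq_iff: "localization_map A S a = localization_map A S b \<longleftrightarrow> a = b"
    and localization_map_closed: "localization_map A S a \<in> carrier (frac_algebra A S sc)"
proof -
  obtain s where s: "s \<in> S" using S_nonempty by blast
  note eq = localization_map_eq[OF _ s]
  show "localization_map A S (a \<oplus>\<^bsub>A\<^esub> b) =
      localization_map A S a \<oplus>\<^bsub>frac_algebra A S sc\<^esub> localization_map A S b"
    using assms s by (simp add: eq L_add_same sm_add)
  show "localization_map A S (a \<otimes>\<^bsub>A\<^esub> b) =
      localization_map A S a \<otimes>\<^bsub>frac_algebra A S sc\<^esub> localization_map A S b"
    using assms s by (simp add: eq mult_closed L_mult fr_eq_iff sm_simps)
  show "localization_map A S a = localization_map A S b \<longleftrightarrow> a = b"
    using assms s by (simp add: eq fr_eq_iff sm_cancel)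
  show "localization_map A S a \<in> carrier (frac_algebra A S sc)" using assms s by (simp add: eq)
qed

lemma localization_map_graded_embedding:
  "graded_embedding G F A gr (localization A S) (localization_gr A S gr) (localization_map A S)"
proof -
  obtain s where s: "s \<in> S" using S_nonempty by blast
  note eq = localization_map_eq[OF _ s]
  have "localization_map A S (c \<odot>\<^bsub>A\<^esub> x) = c \<odot>\<^bsub>localization A S\<^esub> localization_map A S x"
    if "c \<in> carrier F" "x \<in> carrier A" for c x
    using that s by (simp add: eq localization_smult sm_smult)
  moreover have "localization_map A S ` gr g \<subseteq> localization_gr A S gr g" if g: "g \<in> carrier G" for g
    unfolding localization_gr_eq using sm_gr[OF g s] gr_carrier[OF g] s eq by blast
  ultimately show ?thesis
    unfolding graded_embedding_def
    by (auto simp: inj_on_def localization_map_eq_iff localization_def localization_map_closed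
        localization_map_add[symmetric] localization_map_mult[symmetric])
qed

end

context prime_graded_PI_algebra
begin

definition S :: "'a set" where "S = center_e G A gr - {\<zero>\<^bsub>A\<^esub>}"

lemma S_iff: "s \<in> S \<longleftrightarrow> s \<in> center_e G A gr \<and> s \<noteq> \<zero>\<^bsub>A\<^esub>"
  by (simp add: S_def)

lemma S_Z [simp]: "s \<in> S \<Longrightarrow> s \<in> center_e G A gr"
  by (simp add: S_def)

end

sublocale prime_graded_PI_algebra \<subseteq> graded_central_localization G F A gr S
proof unfold_locales
  show "S \<subseteq> alg_center A" "S \<subseteq> gr \<one>\<^bsub>G\<^esub>"
    by (auto simp: S_iff center_e_def)
  show "s \<otimes>\<^bsub>A\<^esub> t \<in> S" if "s \<in> S" "t \<in> S" for s t
    using that center_e_mult center_e_cancel center_e_carrier unfolding S_iff by blast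
  \<comment> \<open>This is where the existence of a nonzero central element of degree e enters the
    localization.\<close>
  show "S \<noteq> {}" using finite_over_center_e unfolding S_def by blast
  show "x = \<zero>\<^bsub>A\<^esub>" if "s \<in> S" "x \<in> carrier A" "s \<otimes>\<^bsub>A\<^esub> x = \<zero>\<^bsub>A\<^esub>" for s x
    using that center_e_cancel unfolding S_iff by blast
qed

section \<open>The field of central fractions and the localization as an algebra over it\<close>

context prime_graded_PI_algebra
begin

abbreviation "Z \<equiv> center_e G A gr"
abbreviation "K \<equiv> localization (A\<lparr>carrier := Z\<rparr>) S"
abbreviation "A1 \<equiv> localization_central A S"
abbreviation "gr1 \<equiv> localization_gr A S gr"
abbreviation "\<phi> \<equiv> localization_map A S"

lemma not_zero_divisor: "s \<in> S \<Longrightarrow> \<not> zero_divisor A s"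
  using S_cancel[of s] S_commute[of s] unfolding zero_divisor_def by metis

lemma center_assoc_algebra: "assoc_algebra F (A\<lparr>carrier := Z\<rparr>)"
proof -
  have "submodule Z F A"
    using center_e_carrier center_e_zero center_e_minus center_e_add center_e_smult
    by (intro submoduleI) auto
  then have "module F (A\<lparr>carrier := Z\<rparr>)" using submodule.submodule_is_module module_axioms by blast
  then show ?thesis
    unfolding assoc_algebra_def assoc_algebra_axioms_def
    using center_e_carrier center_e_mult
    by (auto simp: mult_assoc mult_distrib_left mult_distrib_right smult_mult_left smult_mult_right)
qed

end

text \<open>Fractions over the center are classes of a different relation than fractions over A,
  hence a second instance of the theory; \<open>Z_fr_subset\<close> links the two.\<close>

sublocale prime_graded_PI_algebra \<subseteq> Z: central_localization F "A\<lparr>carrier := center_e G A gr\<rparr>" S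
proof (intro central_localization.intro central_localization_axioms.intro center_assoc_algebra)
  show "S \<subseteq> alg_center (A\<lparr>carrier := Z\<rparr>)"
    using center_e_carrier center_e_commute by (auto simp: alg_center_def S_iff)
  show "s \<otimes>\<^bsub>A\<lparr>carrier := Z\<rparr>\<^esub> t \<in> S" if "s \<in> S" "t \<in> S" for s t
    using S_mult[OF that] by simp
  show "x = \<zero>\<^bsub>A\<lparr>carrier := Z\<rparr>\<^esub>"
    if "s \<in> S" "x \<in> carrier (A\<lparr>carrier := Z\<rparr>)" "s \<otimes>\<^bsub>A\<lparr>carrier := Z\<rparr>\<^esub> x = \<zero>\<^bsub>A\<lparr>carrier := Z\<rparr>\<^esub>" for s x
    using S_cancel[OF that(1), of x] that(2,3) center_e_carrier[of x] by simp
qed (rule S_nonempty)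

context prime_graded_PI_algebra
begin

lemma Z_sm [simp]: "Z.sm = sm"
  by (simp add: fun_eq_iff Z.sm_def sm_def)

lemma Z_fr_subset: "Z.fr z s \<subseteq> fr z s" if "z \<in> Z" "s \<in> S"
  using center_e_carrier by (auto simp: Z.fr_def fr_def Z.frac_rel_iff frac_rel_iff)

lemma K_eq: "K = frac_algebra (A\<lparr>carrier := Z\<rparr>) S
    (\<lambda>c X. \<Union>(a, s)\<in>X. frac_rel (A\<lparr>carrier := Z\<rparr>) S `` {(c \<odot>\<^bsub>A\<^esub> a, s)})"
  by (simp add: localization_def)

lemma K_sel:
  assumes z: "z \<in> Z" "s \<in> S"
  shows K_closed: "Z.fr z s \<in> carrier K"
    and K_mult: "y \<in> Z \<Longrightarrow> t \<in> S \<Longrightarrow> Z.fr z s \<otimes>\<^bsub>K\<^esub> Z.fr y t = Z.fr (z \<otimes>\<^bsub>A\<^esub> y) (sm s t)"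
    and K_add: "y \<in> Z \<Longrightarrow> t \<in> S \<Longrightarrow> Z.fr z s \<oplus>\<^bsub>K\<^esub> Z.fr y t = Z.fr (sm t z \<oplus>\<^bsub>A\<^esub> sm s y) (sm s t)"
    and K_zero: "\<zero>\<^bsub>K\<^esub> = Z.fr \<zero>\<^bsub>A\<^esub> s"
    and K_one: "\<one>\<^bsub>K\<^esub> = Z.fr s s"
  using assms unfolding K_eq
  by (simp_all add: Z.L_closed Z.L_mult Z.L_add Z.L_zero[of s] Z.L_one[of s])

lemma K_cases:
  assumes "X \<in> carrier K" obtains z s where "z \<in> Z" "s \<in> S" "X = Z.fr z s"
  by (rule Z.L_cases[OF assms[unfolded K_eq]]) (use that in auto)

text \<open>The numerator x of a nonzero fraction x/t is in S, because S contains every nonzero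
  element of the ring of numerators; the inverse is t/x.\<close>

lemma field_K: "field K"
proof -
  interpret K: assoc_algebra F K by (rule Z.localization_assoc_algebra)
  obtain s where s: "s \<in> S" using S_nonempty by blast
  then have sZ: "s \<in> Z" by simp
  have comm: "X \<otimes>\<^bsub>K\<^esub> Y = Y \<otimes>\<^bsub>K\<^esub> X" if XY: "X \<in> carrier K" "Y \<in> carrier K" for X Y
  proof -
    obtain x t y u where "x \<in> Z" "t \<in> S" "X = Z.fr x t" "y \<in> Z" "u \<in> S" "Y = Z.fr y u"
      using XY by (elim K_cases)
    then show ?thesis using center_e_commute[of x y] center_e_carrier[of y] by (simp add: K_mult sm_commute)
  qed
  have one: "\<one>\<^bsub>K\<^esub> \<otimes>\<^bsub>K\<^esub> X = X" if X: "X \<in> carrier K" for X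
  proof -
    obtain x t where x: "x \<in> Z" "t \<in> S" "X = Z.fr x t" using X by (elim K_cases)
    then have "\<one>\<^bsub>K\<^esub> \<otimes>\<^bsub>K\<^esub> X = Z.fr (sm s x) (sm s t)"
      using s sZ by (simp add: K_one[OF sZ s] K_mult flip: sm_def)
    then show ?thesis using x s Z.fr_cancel[of x t s] by simp
  qed
  have "cring K"
  proof (rule cringI)
    show "abelian_group K" by (rule K.M.abelian_group_axioms)
    show "Group.comm_monoid K"
    proof (rule Group.comm_monoidI)
      show "\<one>\<^bsub>K\<^esub> \<in> carrier K" using K_one[OF sZ s] K_closed[OF sZ s] by simp
    qed (use K.mult_closed K.mult_assoc comm one in auto)
  qed (rule K.mult_distrib_right)
  then interpret cring K .
  show ?thesis
  proof (rule cring_fieldI2)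
    show "\<zero>\<^bsub>K\<^esub> \<noteq> \<one>\<^bsub>K\<^esub>"
      using s sZ center_e_zero sm_cancel[of s "\<zero>\<^bsub>A\<^esub>" s] by (auto simp: K_zero[OF sZ s] K_one[OF sZ s] Z.fr_eq_iff S_iff)
    fix X assume X: "X \<in> carrier K" "X \<noteq> \<zero>\<^bsub>K\<^esub>"
    then obtain x t where x: "x \<in> Z" "t \<in> S" "X = Z.fr x t" by (elim K_cases)
    then have xS: "x \<in> S" and tZ: "t \<in> Z" using X(2) K_zero[OF x(1,2)] by (auto simp: S_iff)
    have "X \<otimes>\<^bsub>K\<^esub> Z.fr t x = Z.fr (sm x t) (sm x t)"
      using x xS tZ by (simp add: K_mult sm_commute flip: sm_def)
    also have "\<dots> = \<one>\<^bsub>K\<^esub>" using K_one[of "sm x t" "sm x t"] sm_S[OF xS x(2)] by simp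
    finally show "\<exists>Y\<in>carrier K. X \<otimes>\<^bsub>K\<^esub> Y = \<one>\<^bsub>K\<^esub>" using K_closed[OF tZ xS] by blast
  qed
qed

lemma A1_smult:
  assumes "z \<in> Z" "s \<in> S" "a \<in> carrier A" "t \<in> S"
  shows "Z.fr z s \<odot>\<^bsub>A1\<^esub> fr a t = fr (z \<otimes>\<^bsub>A\<^esub> a) (sm s t)"
proof -
  have "Z.fr z s \<noteq> {}" using Z.mem_fr[of z s] assms by auto
  then have "frac_mult A S (Z.fr z s) (fr a t) = fr (z \<otimes>\<^bsub>A\<^esub> a) (sm s t)"
    using assms center_e_carrier by (intro frac_mult_fr Z_fr_subset) auto
  then show ?thesis by (simp add: localization_central_def frac_algebra_def)
qed

lemmas A1_sel = L_closed[where sc = "frac_mult A S", folded localization_central_def]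
  L_mult[where sc = "frac_mult A S", folded localization_central_def]
  A1_smult

lemma A1_graded_algebra: "graded_algebra G K A1 gr1"
proof -
  interpret K: field K by (rule field_K)
  note A1 = localization_central_def[of A S]
  note laws = L_mult_laws[where sc = "frac_mult A S", folded A1]
    and add = L_add[where sc = "frac_mult A S", folded A1]
    and add_same = L_add_same[where sc = "frac_mult A S", folded A1]
    and cases = L_cases[where sc = "frac_mult A S", folded A1]
  have "module K A1"
  proof (rule moduleI)
    show "cring K" by (rule K.cring_axioms)
    show "abelian_group A1" unfolding A1 by (rule L_abelian_group)
  next
    fix X assume "X \<in> carrier A1"
    then obtain a s where a: "a \<in> carrier A" "s \<in> S" "X = fr a s" by (elim cases)
    then have "\<one>\<^bsub>K\<^esub> \<odot>\<^bsub>A1\<^esub> X = fr (sm s a) (sm s s)" by (simp add: K_one[of s s] A1_smult flip: sm_def)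
    then show "\<one>\<^bsub>K\<^esub> \<odot>\<^bsub>A1\<^esub> X = X" using a by (simp add: fr_cancel)
  next
    fix c X assume c: "c \<in> carrier K" and X: "X \<in> carrier A1"
    obtain z u where z: "z \<in> Z" "u \<in> S" "c = Z.fr z u" using c by (elim K_cases)
    obtain a s where a: "a \<in> carrier A" "s \<in> S" "X = fr a s" using X by (elim cases)
    note zA = center_e_carrier[OF z(1)]
    show "c \<odot>\<^bsub>A1\<^esub> X \<in> carrier A1" using z a zA mult_closed by (simp add: A1_sel)
    show "(c \<oplus>\<^bsub>K\<^esub> d) \<odot>\<^bsub>A1\<^esub> X = c \<odot>\<^bsub>A1\<^esub> X \<oplus>\<^bsub>A1\<^esub> d \<odot>\<^bsub>A1\<^esub> X"
      "(c \<otimes>\<^bsub>K\<^esub> d) \<odot>\<^bsub>A1\<^esub> X = c \<odot>\<^bsub>A1\<^esub> (d \<odot>\<^bsub>A1\<^esub> X)" if "d \<in> carrier K" for d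
    proof -
      obtain y v where y: "y \<in> Z" "v \<in> S" "d = Z.fr y v" using \<open>d \<in> carrier K\<close> by (elim K_cases)
      note yA = center_e_carrier[OF y(1)]
      have uv: "sm v z \<in> Z" "sm u y \<in> Z" using y z center_e_mult by (auto simp: sm_def)
      show "(c \<oplus>\<^bsub>K\<^esub> d) \<odot>\<^bsub>A1\<^esub> X = c \<odot>\<^bsub>A1\<^esub> X \<oplus>\<^bsub>A1\<^esub> d \<odot>\<^bsub>A1\<^esub> X"
        using z y a zA yA center_e_add[OF uv]
        by (simp add: K_add A1_sel add mult_closed fr_eq_iff sm_simps mult_distrib_right)
      show "(c \<otimes>\<^bsub>K\<^esub> d) \<odot>\<^bsub>A1\<^esub> X = c \<odot>\<^bsub>A1\<^esub> (d \<odot>\<^bsub>A1\<^esub> X)"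
        using z y a zA yA center_e_mult[OF z(1) y(1)]
        by (simp add: K_mult A1_sel mult_closed sm_simps mult_assoc)
    qed
    fix Y assume "Y \<in> carrier A1"
    then obtain b t where b: "b \<in> carrier A" "t \<in> S" "Y = fr b t" by (elim cases)
    show "c \<odot>\<^bsub>A1\<^esub> (X \<oplus>\<^bsub>A1\<^esub> Y) = c \<odot>\<^bsub>A1\<^esub> X \<oplus>\<^bsub>A1\<^esub> c \<odot>\<^bsub>A1\<^esub> Y"
      using z a b zA by (simp add: A1_sel add mult_closed fr_eq_iff sm_simps mult_distrib_left)
  qed
  moreover have "(c \<odot>\<^bsub>A1\<^esub> X) \<otimes>\<^bsub>A1\<^esub> Y = c \<odot>\<^bsub>A1\<^esub> (X \<otimes>\<^bsub>A1\<^esub> Y)"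
    "X \<otimes>\<^bsub>A1\<^esub> (c \<odot>\<^bsub>A1\<^esub> Y) = c \<odot>\<^bsub>A1\<^esub> (X \<otimes>\<^bsub>A1\<^esub> Y)"
    if cXY: "c \<in> carrier K" "X \<in> carrier A1" "Y \<in> carrier A1" for c X Y
  proof -
    obtain z u where z: "z \<in> Z" "u \<in> S" "c = Z.fr z u" using cXY(1) by (elim K_cases)
    obtain a s b t where a: "a \<in> carrier A" "s \<in> S" "X = fr a s" and b: "b \<in> carrier A" "t \<in> S" "Y = fr b t"
      using cXY(2,3) by (elim cases)
    note zA = center_e_carrier[OF z(1)]
    show "(c \<odot>\<^bsub>A1\<^esub> X) \<otimes>\<^bsub>A1\<^esub> Y = c \<odot>\<^bsub>A1\<^esub> (X \<otimes>\<^bsub>A1\<^esub> Y)"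
      using z a b zA by (simp add: A1_sel mult_closed sm_simps mult_assoc)
    have "a \<otimes>\<^bsub>A\<^esub> (z \<otimes>\<^bsub>A\<^esub> b) = z \<otimes>\<^bsub>A\<^esub> (a \<otimes>\<^bsub>A\<^esub> b)"
      using center_e_commute[OF z(1) a(1)] a(1) b(1) zA by (simp flip: mult_assoc)
    then show "X \<otimes>\<^bsub>A1\<^esub> (c \<odot>\<^bsub>A1\<^esub> Y) = c \<odot>\<^bsub>A1\<^esub> (X \<otimes>\<^bsub>A1\<^esub> Y)"
      using z a b zA by (simp add: A1_sel mult_closed sm_simps)
  qed
  ultimately have alg: "assoc_algebra K A1"
    unfolding assoc_algebra_def assoc_algebra_axioms_def
    using laws by (intro conjI allI impI) auto
  have "c \<odot>\<^bsub>A1\<^esub> fr a s \<in> gr1 g" if c: "c \<in> carrier K" and a: "g \<in> carrier G" "a \<in> gr g" "s \<in> S" for c g a s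
  proof -
    obtain z u where z: "z \<in> Z" "u \<in> S" "c = Z.fr z u" using c by (elim K_cases)
    have "z \<otimes>\<^bsub>A\<^esub> a \<in> gr g" using gr_mult[OF _ a(1) center_e_gr[OF z(1)] a(2)] a(1) by simp
    then show ?thesis unfolding localization_gr_eq z(3) using A1_smult[OF z(1,2) gr_carrier[OF a(1,2)] a(3)] sm_S[OF z(2) a(3)] by blast
  qed
  then show ?thesis using frac_graded_algebra[of K "frac_mult A S", folded A1, OF alg] by blast
qed

text \<open>If s a is a combination of B with central coefficients \<zeta> b, then a/t is the
  combination of the images of the b with coefficients \<zeta> b divided by s t; s and B are the
  same for all a.\<close>

lemma A1_finite_dimensional: "finite_dimensional K A1"
proof -
  interpret A1: graded_algebra G K A1 gr1 by (rule A1_graded_algebra)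
  obtain s B where s: "s \<in> Z" "s \<noteq> \<zero>\<^bsub>A\<^esub>" and B: "finite B" "B \<subseteq> carrier A"
    and gen: "\<And>a. a \<in> carrier A \<Longrightarrow> \<exists>\<zeta>\<in>B \<rightarrow> Z. s \<otimes>\<^bsub>A\<^esub> a = (\<Oplus>\<^bsub>A\<^esub>b\<in>B. \<zeta> b \<otimes>\<^bsub>A\<^esub> b)"
    using finite_over_center_e by blast
  from s have s: "s \<in> S" by (simp add: S_iff)
  have BA: "b \<in> carrier A" if "b \<in> B" for b using B(2) that by blast
  have inj: "inj_on \<phi> B" using localization_map_eq_iff BA by (auto simp: inj_on_def)
  have \<phi>: "\<phi> b \<in> carrier A1" if "b \<in> carrier A" for b
    unfolding localization_central_def by (rule localization_map_closed[OF that that])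
  have "\<exists>c\<in>\<phi> ` B \<rightarrow> carrier K. X = (\<Oplus>\<^bsub>A1\<^esub>b\<in>\<phi> ` B. c b \<odot>\<^bsub>A1\<^esub> b)" if X: "X \<in> carrier A1" for X
  proof -
    obtain a t where a: "a \<in> carrier A" "t \<in> S" "X = fr a t"
      using X unfolding localization_central_def by (elim L_cases)
    obtain \<zeta> where \<zeta>: "\<zeta> \<in> B \<rightarrow> Z" "sm s a = (\<Oplus>\<^bsub>A\<^esub>b\<in>B. \<zeta> b \<otimes>\<^bsub>A\<^esub> b)"
      using gen[OF a(1)] unfolding sm_def by blast
    have \<zeta>Z: "\<zeta> b \<in> Z" "\<zeta> b \<in> carrier A" if "b \<in> B" for b using \<zeta>(1) that center_e_carrier by blast+
    define c where "c X = Z.fr (\<zeta> (inv_into B \<phi> X)) (sm s t)" for X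
    have c: "c (\<phi> b) = Z.fr (\<zeta> b) (sm s t)" if "b \<in> B" for b using inj that by (simp add: c_def)
    have st: "sm s t \<in> S" using s a(2) by simp
    have cK: "c (\<phi> b) \<in> carrier K" if "b \<in> B" for b using K_closed[OF \<zeta>Z(1)[OF that] st] c[OF that] by simp
    have "X = fr (sm s a) (sm s t)" using fr_cancel[OF a(1,2) s] a(3) by simp
    also have "\<dots> = (\<Oplus>\<^bsub>A1\<^esub>b\<in>B. fr (\<zeta> b \<otimes>\<^bsub>A\<^esub> b) (sm s t))"
      unfolding \<zeta>(2) localization_central_def
      by (rule L_finsum[OF st, symmetric]) (use \<zeta>Z BA mult_closed in auto)
    also have "\<dots> = (\<Oplus>\<^bsub>A1\<^esub>b\<in>B. c (\<phi> b) \<odot>\<^bsub>A1\<^esub> \<phi> b)"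
    proof (rule A1.M.add.finprod_cong'[OF refl])
      show "(\<lambda>b. c (\<phi> b) \<odot>\<^bsub>A1\<^esub> \<phi> b) \<in> B \<rightarrow> carrier A1"
        using A1.smult_closed[OF cK \<phi>[OF BA]] by simp
      fix b assume b: "b \<in> B"
      have "c (\<phi> b) \<odot>\<^bsub>A1\<^esub> \<phi> b = Z.fr (\<zeta> b) (sm s t) \<odot>\<^bsub>A1\<^esub> fr (sm s b) s"
        using c[OF b] localization_map_eq[OF BA[OF b] s] by simp
      also have "\<dots> = fr (\<zeta> b \<otimes>\<^bsub>A\<^esub> sm s b) (sm (sm s t) s)"
        using \<zeta>Z[OF b] BA[OF b] s st by (intro A1_smult) auto
      also have "\<dots> = fr (\<zeta> b \<otimes>\<^bsub>A\<^esub> b) (sm s t)"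
        using \<zeta>Z[OF b] BA[OF b] s a(2) mult_closed by (simp add: fr_eq_iff sm_simps)
      finally show "fr (\<zeta> b \<otimes>\<^bsub>A\<^esub> b) (sm s t) = c (\<phi> b) \<odot>\<^bsub>A1\<^esub> \<phi> b" by simp
    qed
    also have "\<dots> = (\<Oplus>\<^bsub>A1\<^esub>X\<in>\<phi> ` B. c X \<odot>\<^bsub>A1\<^esub> X)"
      by (rule A1.M.finsum_reindex[symmetric]) (use A1.smult_closed[OF cK \<phi>[OF BA]] inj in auto)
    finally show ?thesis using cK by (intro bexI[of _ c]) auto
  qed
  then show ?thesis unfolding finite_dimensional_def using B(1) \<phi>[OF BA] by (intro exI[of _ "\<phi> ` B"]) auto
qed

text \<open>An ideal I is compared with its preimage J in A. If J is zero, clearing denominators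
  shows that I is zero; otherwise J contains an element of S, whose image is invertible.\<close>

lemma A1_graded_simple: "graded_simple G K A1 gr1"
proof -
  interpret A1: finite_graded_algebra G K A1 gr1
    using A1_graded_algebra fin_G by (simp add: finite_graded_algebra_def finite_graded_algebra_axioms_def)
  note A1_def = localization_central_def[of A S]
  note \<phi>_add = localization_map_add[where sc = "frac_mult A S", folded A1_def]
    and \<phi>_mult = localization_map_mult[where sc = "frac_mult A S", folded A1_def]
    and \<phi>_closed = localization_map_closed[where sc = "frac_mult A S", folded A1_def]
    and cases = L_cases[where sc = "frac_mult A S", folded A1_def]
    and finsum = L_finsum[where sc = "frac_mult A S", folded A1_def]
    and zero = L_zero[where sc = "frac_mult A S", folded A1_def]
  obtain s where s: "s \<in> S" using S_nonempty by blast
  have \<phi>: "\<phi> a = fr (sm s a) s" if "a \<in> carrier A" for a by (rule localization_map_eq[OF that s])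
  have \<phi>_zero: "\<phi> a = \<zero>\<^bsub>A1\<^esub> \<longleftrightarrow> a = \<zero>\<^bsub>A\<^esub>" if "a \<in> carrier A" for a
    using that s sm_cancel[of s a "\<zero>\<^bsub>A\<^esub>"] sm_cancel[of s "sm s a" "\<zero>\<^bsub>A\<^esub>"] by (simp add: \<phi> zero[OF s] fr_eq_iff sm_zero sm_cancel)
  have "ideal_prod A1 (carrier A1) (carrier A1) \<noteq> {\<zero>\<^bsub>A1\<^esub>}"
  proof
    assume eq: "ideal_prod A1 (carrier A1) (carrier A1) = {\<zero>\<^bsub>A1\<^esub>}"
    have "\<phi> s \<otimes>\<^bsub>A1\<^esub> \<phi> s \<in> ideal_prod A1 (carrier A1) (carrier A1)"
      using \<phi>_closed[OF S_carrier[OF s] S_carrier[OF s]] by (intro ideal_prod.prod)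
    then have "\<phi> (s \<otimes>\<^bsub>A\<^esub> s) = \<zero>\<^bsub>A1\<^esub>" using eq \<phi>_mult[of s s] s by simp
    then show False using \<phi>_zero[OF S_carrier[OF S_mult[OF s s]]] S_mult[OF s s, unfolded S_iff] by blast
  qed
  moreover have "I = {\<zero>\<^bsub>A1\<^esub>} \<or> I = carrier A1" if I: "graded_ideal G K A1 gr1 I" for I
  proof -
    note D = A1.graded_idealD[OF I]
    define J where "J = {a \<in> carrier A. \<phi> a \<in> I}"
    have J: "graded_ideal G F A gr J"
    proof (rule graded_idealI)
      show "\<zero>\<^bsub>A\<^esub> \<in> J" using \<phi>_zero[of "\<zero>\<^bsub>A\<^esub>"] D(2) by (simp add: J_def)
      show "x \<oplus>\<^bsub>A\<^esub> y \<in> J" if "x \<in> J" "y \<in> J" for x y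
        using that D(3) \<phi>_add[of x y] by (auto simp: J_def)
      \<comment> \<open>I is stable under scalars from K; a scalar c from F acts like the central
        fraction with numerator c s and denominator s.\<close>
      show "c \<odot>\<^bsub>A\<^esub> x \<in> J" if c: "c \<in> carrier F" and x: "x \<in> J" for c x
      proof -
        have xA: "x \<in> carrier A" and xI: "\<phi> x \<in> I" using x by (auto simp: J_def)
        have cs: "c \<odot>\<^bsub>A\<^esub> s \<in> Z" "s \<in> Z" using c s center_e_smult by auto
        have "Z.fr (c \<odot>\<^bsub>A\<^esub> s) s \<odot>\<^bsub>A1\<^esub> \<phi> x = fr ((c \<odot>\<^bsub>A\<^esub> s) \<otimes>\<^bsub>A\<^esub> sm s x) (sm s s)"
          unfolding \<phi>[OF xA] using cs(1) s xA by (intro A1_smult) auto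
        also have "(c \<odot>\<^bsub>A\<^esub> s) \<otimes>\<^bsub>A\<^esub> sm s x = sm s (sm s (c \<odot>\<^bsub>A\<^esub> x))"
          using c s xA by (simp add: smult_mult_left sm_smult sm_def[of s "sm s x", symmetric])
        also have "fr \<dots> (sm s s) = \<phi> (c \<odot>\<^bsub>A\<^esub> x)" using c s xA by (simp add: \<phi> fr_cancel)
        finally have "\<phi> (c \<odot>\<^bsub>A\<^esub> x) \<in> I" using D(5)[OF K_closed[OF cs(1) s] xI] by simp
        then show ?thesis using c xA by (simp add: J_def)
      qed
      show "x \<otimes>\<^bsub>A\<^esub> y \<in> J" "y \<otimes>\<^bsub>A\<^esub> x \<in> J" if "x \<in> carrier A" "y \<in> J" for x y
        using that D(6,7)[of "\<phi> x" "\<phi> y"] \<phi>_mult[of x y] \<phi>_mult[of y x] \<phi>_closed[of x x] mult_closed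
        by (auto simp: J_def)
      show "comp g x \<in> J" if x: "x \<in> J" and g: "g \<in> carrier G" for x g
      proof -
        have xA: "x \<in> carrier A" and xI: "\<phi> x \<in> I" using x by (auto simp: J_def)
        have "A1.comp g (\<phi> x) = \<phi> (comp g x)"
        proof (rule A1.comp_unique[OF _ _ _ g])
          show "\<phi> (comp h x) \<in> gr1 h" if h: "h \<in> carrier G" for h
            unfolding localization_gr_eq
            using \<phi>[OF comp_carrier[OF xA h]] sm_gr[OF h s comp_gr[OF xA h]] s by blast
          have "(\<Oplus>\<^bsub>A1\<^esub>h\<in>carrier G. \<phi> (comp h x)) = (\<Oplus>\<^bsub>A1\<^esub>h\<in>carrier G. fr (sm s (comp h x)) s)"
            by (rule A1.M.add.finprod_cong')
              (use \<phi> comp_carrier[OF xA] s L_closed[where sc = "frac_mult A S", folded A1_def] in auto)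
          also have "\<dots> = fr (\<Oplus>\<^bsub>A\<^esub>h\<in>carrier G. sm s (comp h x)) s"
            using comp_carrier[OF xA] s by (intro finsum) auto
          also have "(\<Oplus>\<^bsub>A\<^esub>h\<in>carrier G. sm s (comp h x)) = sm s x"
            using additive_finsum[OF additive_left[OF S_carrier[OF s]], of "\<lambda>h. comp h x" "carrier G"]
              comp_carrier[OF xA] comp_sum[OF xA] by (auto simp: sm_def)
          finally show "(\<Oplus>\<^bsub>A1\<^esub>h\<in>carrier G. \<phi> (comp h x)) = \<phi> x" using \<phi>[OF xA] by simp
          show "\<phi> x \<in> carrier A1" by (rule \<phi>_closed[OF xA xA])
        qed
        then show ?thesis using D(8)[OF xI g] comp_carrier[OF xA g] by (simp add: J_def)
      qed
    qed (auto simp: J_def)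
    show ?thesis
    proof (cases "J = {\<zero>\<^bsub>A\<^esub>}")
      case True
      have "X = \<zero>\<^bsub>A1\<^esub>" if X: "X \<in> I" for X
      proof -
        have "X \<in> carrier A1" using X D(1) by blast
        then obtain a t where a: "a \<in> carrier A" "t \<in> S" "X = fr a t" by (elim cases)
        have st: "sm s t \<in> Z" using sm_S[OF s a(2)] by simp
        have "Z.fr (sm s t) s \<odot>\<^bsub>A1\<^esub> X = fr (sm s t \<otimes>\<^bsub>A\<^esub> a) (sm s t)"
          unfolding a(3) using st s a by (intro A1_smult) auto
        also have "\<dots> = \<phi> a" using a s by (simp add: \<phi> fr_eq_iff sm_def[of "sm s t" a, symmetric] sm_simps)
        finally have "a \<in> J" using D(5)[OF K_closed[OF st s] X] a(1) by (simp add: J_def)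
        then have "a = \<zero>\<^bsub>A\<^esub>" using True by blast
        then show ?thesis using a by (simp add: zero)
      qed
      then show ?thesis using D(2) by blast
    next
      case False
      then obtain z where z: "z \<in> J" "z \<in> S" using central_in_graded_ideal[OF J] unfolding S_iff by blast
      have "X \<in> I" if X: "X \<in> carrier A1" for X
      proof -
        obtain a t where a: "a \<in> carrier A" "t \<in> S" "X = fr a t" using X by (elim cases)
        \<comment> \<open>An arbitrary fraction a/t is recovered as z times a/(t z), so it lies in
          the ideal.\<close>
        have "\<phi> z \<otimes>\<^bsub>A1\<^esub> fr a (sm t z) = fr (sm s z \<otimes>\<^bsub>A\<^esub> a) (sm s (sm t z))"
          using a z(2) s by (simp add: \<phi> A1_sel)
        also have "\<dots> = X" using a z(2) s by (simp add: fr_eq_iff sm_mult_left sm_def[of z a, symmetric] sm_left_commute sm_sm sm_commute)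
        finally show ?thesis using D(7)[of "fr a (sm t z)" "\<phi> z"] z a A1_sel(1)[of a "sm t z"] by (simp add: J_def)
      qed
      then show ?thesis using D(1) by blast
    qed
  qed
  ultimately show ?thesis unfolding graded_simple_def by blast
qed

end

theorem corollary4p7:
  fixes G :: "('g, 'l) monoid_scheme" and F :: "('f, 'n) ring_scheme"
    and A :: "('f, 'a, 'm) module_scheme" and gr :: "'g \<Rightarrow> 'a set"
  assumes "group G" and "finite (carrier G)"
    and "field F" and "char_zero F"
    and "graded_algebra G F A gr"
    and "carrier A \<noteq> {\<zero>\<^bsub>A\<^esub>}"
    and "graded_prime G F A gr"
    and "satisfies_PI F A"
  shows "let
      S = center_e G A gr - {\<zero>\<^bsub>A\<^esub>};
      K = localization (A\<lparr>carrier := center_e G A gr\<rparr>) S;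
      A1 = localization_central A S;
      gr1 = localization_gr A S gr
    in
      (\<forall>s\<in>S. \<not> zero_divisor A s) \<and>
      graded_algebra G F (localization A S) gr1 \<and>
      graded_embedding G F A gr (localization A S) gr1 (localization_map A S) \<and>
      field K \<and>
      graded_algebra G K A1 gr1 \<and>
      finite_dimensional K A1 \<and>
      graded_simple G K A1 gr1"
proof -
  interpret prime_graded_PI_algebra G F A gr
    using assms by (intro prime_graded_PI_algebra.intro finite_graded_algebra.intro
        finite_graded_algebra_axioms.intro prime_graded_PI_algebra_axioms.intro)
  show ?thesis
    unfolding Let_def S_def[symmetric]
    using not_zero_divisor localization_graded_algebra localization_map_graded_embedding field_K
      A1_graded_algebra A1_finite_dimensional A1_graded_simple by blast
qed

end
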